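(* Let $n\ge1$, $\alpha>-1$, $0<p\le1$ and $\Phi\in\mathscr L_p$. Then the Hankel operator $h_b$ extends into a bounded operator from $\mathcal A_\alpha^{\Phi}(\mathbb B^n)$ into $\mathcal A_\alpha^{1}(\mathbb B^n)$ if and only if the symbol $b$ belongs to $L\Gamma_{\alpha,\rho}(\mathbb B^n)$, where $\rho(t)=\frac{1}{t\Phi^{-1}(1/t)}$.
   Context: $\mathbb B^n$ is the unit ball of $\mathbb C^n$, $d\nu$ is Lebesgue measure on it, and $d\nu_\alpha(z)=c_\alpha(1-|z|^2)^\alpha d\nu(z)$ with $\nu_\alpha(\mathbb B^n)=1$. A growth function is a continuous non-decreasing function from $[0,\infty)$ onto itself. $\mathscr L_p$ ($0<p\le1$): growth functions $\Phi$ of lower type $p$ ($\Phi(st)\le Ct^p\Phi(s)$ for all $s>0$, $0<t\le1$, some $C>0$) with $\Phi(t)/t$ non-increasing. Equivalent growth functions ($c\Phi_1(ct)\le\Phi_2(t)\le c^{-1}\Phi_1(c^{-1}t)$ for some $c>0$) define the same spaces; by convention members of $\mathscr L_p$ are supposed concave and $C^1$ with $\Phi'(t)\simeq\Phi(t)/t$. $\mathcal A_\alpha^\Phi(\mathbb B^n)$ is the space of holomorphic $f$ on $\mathbb B^n$ with $\int_{\mathbb B^n}\Phi(|f|)\,d\nu_\alpha<\infty$, with (quasi-)norm $\|f\|^{lux}_{\alpha,\Phi}=\inf\{\lambda>0:\int\Phi(|f|/\lambda)\,d\nu_\alpha\le1\}$. $\mathcal A^s_\alpha$ is the case $\Phi(t)=t^s$;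 $\|f\|_{1,\alpha}=\int|f|\,d\nu_\alpha$. $P_\alpha f(z)=\int_{\mathbb B^n}\frac{f(\xi)}{(1-\langle z,\xi\rangle)^{n+1+\alpha}}d\nu_\alpha(\xi)$ is the Bergman projection. For a symbol $b\in\mathcal A_\alpha^2(\mathbb B^n)$ the small Hankel operator is defined on bounded holomorphic $f$ by $h_b(f)=P_\alpha(b\overline f)$. "$h_b$ extends into a bounded operator from $\mathcal A_\alpha^{\Phi}$ into $\mathcal A_\alpha^{1}$" means there is $C$ with $\|h_b(f)\|_{1,\alpha}\le C\|f\|^{lux}_{\alpha,\Phi}$ for all bounded holomorphic $f$. $Rf(z)=\sum_{j}z_j\frac{\partial f}{\partial z_j}(z)$. A positive function $\rho$ is of upper type $\gamma$ on $[0,1]$ if $\rho(st)\le Cs^\gamma\rho(t)$ for $s>1$, $st\le1$; the $\rho$ above is of upper type $\gamma=\frac1p-1$. For $\rho$ of upper type $\gamma$, $L\Gamma_{\alpha,\rho}(\mathbb B^n)$ is the space of holomorphic $f$ on $\mathbb B^n$ such that for some integer $k>\gamma(n+1+\alpha)$ and some $C>0$, $$|R^kf(z)|\le C(1-|z|^2)^{-k}\rho\big((1-|z|^2)^{n+1+\alpha}\big)\Big(\log\frac1{1-|z|^2}\Big)^{-1},\quad z\in\mathbb B^n$$ (the condition being vacuous at $z=0$); it does not depend on the choice of such $k$. *)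

theory Defs
  imports "HOL-Analysis.Analysis"
begin

text \<open>
  The ball \<open>ball 0 1 :: (complex ^ 'n) set\<close> is the unit ball of \<open>n\<close>-dimensional complex space with
  \<open>n = CARD('n)\<close>. Functions on it are total functions on the ambient type whose values outside
  the ball are irrelevant: the measures below live on \<open>restrict_space lborel (ball 0 1)\<close>, so that
  measurability is only demanded on the ball.
\<close>

section \<open>Growth functions\<close>

definition growth_function :: "(real \<Rightarrow> real) \<Rightarrow> bool" where
  "growth_function \<Phi> \<longleftrightarrow>
     continuous_on {0..} \<Phi> \<and> mono_on {0..} \<Phi> \<and> \<Phi> ` {0..} = {0..}"

definition lower_type :: "real \<Rightarrow> (real \<Rightarrow> real) \<Rightarrow> bool" where
  "lower_type p \<Phi> \<longleftrightarrow>
     (\<exists>C>0. \<forall>s>0. \<forall>t. 0 < t \<and> t \<le> 1 \<longrightarrow> \<Phi> (s * t) \<le> C * t powr p * \<Phi> s)"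

text \<open>
  The last four conjuncts are the standing normalisation of the class: every growth function of
  lower type \<open>p\<close> with \<open>\<Phi> t / t\<close> non-increasing is replaced by an equivalent one that is concave
  and continuously differentiable with \<open>\<Phi>'(t)\<close> comparable to \<open>\<Phi> t / t\<close>. Differentiability is
  asked on the open half-line only, since \<open>t powr p\<close> with \<open>p < 1\<close> must be a member.
\<close>

definition growth_class :: "real \<Rightarrow> (real \<Rightarrow> real) set" where
  "growth_class p = {\<Phi>.
     growth_function \<Phi> \<and> lower_type p \<Phi> \<and> antimono_on {0<..} (\<lambda>t. \<Phi> t / t) \<and>
     concave_on {0..} \<Phi> \<and>
     \<Phi> differentiable_on {0<..} \<and> continuous_on {0<..} (deriv \<Phi>) \<and>
     (\<exists>c>0. \<forall>t>0. c * (\<Phi> t / t) \<le> deriv \<Phi> t \<and> deriv \<Phi> t \<le> inverse c * (\<Phi> t / t))}"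

text \<open>The inverse is that of \<open>\<Phi>\<close> as a (by concavity, bijective) map of \<open>{0..}\<close> onto itself.\<close>

definition growth_rho :: "(real \<Rightarrow> real) \<Rightarrow> real \<Rightarrow> real" where
  "growth_rho \<Phi> t = 1 / (t * inv_into {0..} \<Phi> (1 / t))"


section \<open>Holomorphic functions of several variables\<close>

definition holomorphic_vec :: "(complex ^ 'n \<Rightarrow> complex) \<Rightarrow> (complex ^ 'n) set \<Rightarrow> bool" where
  "holomorphic_vec f S \<longleftrightarrow>
     (\<forall>z\<in>S. \<exists>D. (f has_derivative D) (at z) \<and> (\<forall>c v. D (c *s v) = c * D v))"

definition partial_deriv :: "'n \<Rightarrow> (complex ^ 'n \<Rightarrow> complex) \<Rightarrow> complex ^ 'n \<Rightarrow> complex" where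
  "partial_deriv j f z = deriv (\<lambda>w. f (\<chi> i. if i = j then w else z $ i)) (z $ j)"

definition radial_deriv :: "(complex ^ 'n \<Rightarrow> complex) \<Rightarrow> complex ^ 'n \<Rightarrow> complex" where
  "radial_deriv f z = (\<Sum>j\<in>UNIV. z $ j * partial_deriv j f z)"

definition cinner_vec :: "complex ^ 'n \<Rightarrow> complex ^ 'n \<Rightarrow> complex" where
  "cinner_vec z w = (\<Sum>j\<in>UNIV. z $ j * cnj (w $ j))"


section \<open>Weighted Bergman and Bergman--Orlicz spaces\<close>

definition bergman_measure :: "real \<Rightarrow> (complex ^ 'n) measure" where
  "bergman_measure \<alpha> =
     (let M = restrict_space lborel (ball 0 1); w = (\<lambda>z. (1 - (norm z)\<^sup>2) powr \<alpha>)
      in density M (\<lambda>z. ennreal (w z / (\<integral>u. w u \<partial>M))))"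

definition bergman_orlicz :: "real \<Rightarrow> (real \<Rightarrow> real) \<Rightarrow> (complex ^ 'n \<Rightarrow> complex) set" where
  "bergman_orlicz \<alpha> \<Phi> = {f. holomorphic_vec f (ball 0 1) \<and>
     (\<integral>\<^sup>+z. ennreal (\<Phi> (norm (f z))) \<partial>bergman_measure \<alpha>) < \<infinity>}"

definition bergman_space :: "real \<Rightarrow> real \<Rightarrow> (complex ^ 'n \<Rightarrow> complex) set" where
  "bergman_space \<alpha> s = bergman_orlicz \<alpha> (\<lambda>t. t powr s)"

definition lux_norm :: "real \<Rightarrow> (real \<Rightarrow> real) \<Rightarrow> (complex ^ 'n \<Rightarrow> complex) \<Rightarrow> real" where
  "lux_norm \<alpha> \<Phi> f =
     Inf {l. 0 < l \<and> (\<integral>\<^sup>+z. ennreal (\<Phi> (norm (f z) / l)) \<partial>bergman_measure \<alpha>) \<le> 1}"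

definition L1_norm :: "real \<Rightarrow> (complex ^ 'n \<Rightarrow> complex) \<Rightarrow> ennreal" where
  "L1_norm \<alpha> f = (\<integral>\<^sup>+z. ennreal (norm (f z)) \<partial>bergman_measure \<alpha>)"


section \<open>The small Hankel operator\<close>

text \<open>
  For \<open>z\<close>, \<open>w\<close> in the ball, \<open>1 - cinner_vec z w\<close> has positive real part, so the principal
  branch used by \<open>powr\<close> is holomorphic in \<open>z\<close>.
\<close>

definition bergman_proj ::
    "real \<Rightarrow> (complex ^ 'n \<Rightarrow> complex) \<Rightarrow> complex ^ 'n \<Rightarrow> complex" where
  "bergman_proj \<alpha> f z =
     (\<integral>w. f w / (1 - cinner_vec z w) powr of_real (real CARD('n) + 1 + \<alpha>) \<partial>bergman_measure \<alpha>)"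

definition small_hankel ::
    "real \<Rightarrow> (complex ^ 'n \<Rightarrow> complex) \<Rightarrow> (complex ^ 'n \<Rightarrow> complex) \<Rightarrow> complex ^ 'n \<Rightarrow> complex" where
  "small_hankel \<alpha> b f = bergman_proj \<alpha> (\<lambda>w. b w * cnj (f w))"

text \<open>
  Since \<open>L1_norm\<close> takes values in \<open>ennreal\<close>, the estimate includes finiteness of the left side.
\<close>

definition hankel_extends_bounded ::
    "real \<Rightarrow> (real \<Rightarrow> real) \<Rightarrow> (complex ^ 'n \<Rightarrow> complex) \<Rightarrow> bool" where
  "hankel_extends_bounded \<alpha> \<Phi> b \<longleftrightarrow>
     (\<exists>C::real. \<forall>f. holomorphic_vec f (ball 0 1) \<and> bounded (f ` ball 0 1) \<longrightarrow>
        L1_norm \<alpha> (small_hankel \<alpha> b f) \<le> ennreal (C * lux_norm \<alpha> \<Phi> f))"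


section \<open>The logarithmic Lipschitz-type space\<close>

definition LGamma :: "real \<Rightarrow> real \<Rightarrow> (real \<Rightarrow> real) \<Rightarrow> (complex ^ 'n \<Rightarrow> complex) set" where
  "LGamma \<alpha> \<gamma> \<rho> = {f. holomorphic_vec f (ball 0 1) \<and>
     (\<exists>k::nat. real k > \<gamma> * (real CARD('n) + 1 + \<alpha>) \<and>
       (\<exists>C>0. \<forall>z\<in>ball 0 1 - {0}.
          norm ((radial_deriv ^^ k) f z)
            \<le> C * inverse ((1 - (norm z)\<^sup>2) ^ k)
                * \<rho> ((1 - (norm z)\<^sup>2) powr (real CARD('n) + 1 + \<alpha>))
                * inverse (ln (1 / (1 - (norm z)\<^sup>2)))))}"

end

(* The kernel of P_\<alpha> reproduces: rotating the complement of a unit vector e reduces an integral of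
   f(w) \<kappa>(<z,w>), with z = t e, to the slice of f through e, rotating everything keeps only the diagonal
   terms of the two power series, and the moments of |<w,e>|^2 (obtained from a Gaussian integral)
   supply their coefficients. This yields R^k b as the integral of b against R^k of the kernel, and the
   Forelli-Rudin estimates as statements about explicit series.

   Necessity: pair h_b f_a, where f_a is a multiple of R^k of the kernel at a, normalised in the Orlicz
   space, with log (1 / (1 - <w,a>)), which is the projection of a function bounded uniformly in a.
   Sufficiency: rewrite h_b f in terms of R^k b; since the L^1 norm of the kernel at w is at most
   logarithmic in 1 / (1 - |w|^2), the logarithm in the hypothesis on R^k b is absorbed, and the pointwise
   growth of f turns |f| \<rho> into \<Phi>(|f|). *)

theory Submission
  imports Defs "HOL-Complex_Analysis.Complex_Analysis"
begin

section \<open>Invariance of Lebesgue measure\<close>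

text \<open>Sufficiency has to bring in R^k b. In degree m, 1 = m^k * (integral over x > 0 of exp (-
  m x) x^(k-1) / (k-1)!) does this at the price of an integral over dilations. The factor exp (- m
  x) is shared equally between the two functions of the pairing, each dilated by exp (- x / 2), so
  that one substitution undoes both dilations and turns the x-integral into the weight (1 -
  |v|^2)^k. Near the origin this breaks down: the substitution has no bounded weight and the
  hypothesis on R^k b says next to nothing. What helps is that R^k b vanishes at 0, which supplies
  decay in x. For necessity, multiplying f_a by log (1 / (1 - <w,a>)) would spoil its normalisation.
  Subtracting the constant log (1 / (1 - |a|^2)) leaves the logarithm of a quotient bounded by 2, at
  the cost of an arbitrarily small power of it; the strict inequality k > (1/p - 1) N, with N = n +
  1 + \<alpha>, leaves room for that. Both directions are organised around \<open>peak\<close>, the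
  inverse of \<Phi> at (1 - |w|^2)^(-N): it bounds normalised functions pointwise, scales the test
  functions and encodes \<rho>.\<close>

lemma nn_integral_lborel_translate:
  fixes f :: "'a::euclidean_space \<Rightarrow> ennreal"
  assumes [measurable]: "f \<in> borel_measurable borel"
  shows "(\<integral>\<^sup>+x. f (c + x) \<partial>lborel) = (\<integral>\<^sup>+x. f x \<partial>lborel)"
proof -
  have "(\<integral>\<^sup>+x. f (c + x) \<partial>lborel) = (\<integral>\<^sup>+x. f x \<partial>distr lborel borel ((+) c))"
    by (subst nn_integral_distr) auto
  then show ?thesis by (simp add: lborel_distr_plus)
qed

lemma nn_integral_lborel_scale:
  fixes f :: "'a::euclidean_space \<Rightarrow> ennreal"
  assumes [measurable]: "f \<in> borel_measurable borel" and "c > 0"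
  shows "(\<integral>\<^sup>+x. f x \<partial>lborel) = ennreal (c ^ DIM('a)) * (\<integral>\<^sup>+x. f (c *\<^sub>R x) \<partial>lborel)"
  using assms(2)
  by (subst lborel_affine[of c 0]) (simp_all add: nn_integral_density nn_integral_distr nn_integral_cmult)

(* Uniqueness of Haar measure: the image measure is translation invariant. *)
lemma nn_integral_lborel_isometry:
  fixes T :: "'a::euclidean_space \<Rightarrow> 'a" and f :: "'a \<Rightarrow> ennreal"
  assumes lin: "linear T" and iso: "\<And>x. norm (T x) = norm x"
    and [measurable]: "f \<in> borel_measurable borel"
  shows "(\<integral>\<^sup>+x. f (T x) \<partial>lborel) = (\<integral>\<^sup>+x. f x \<partial>lborel)"
proof -
  have cT: "continuous_on UNIV T"
    using lin by (simp add: linear_continuous_on linear_conv_bounded_linear)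
  then have [measurable]: "T \<in> borel_measurable borel"
    by (rule borel_measurable_continuous_onI)
  have "inj T"
  proof (rule injI)
    fix x y assume "T x = T y"
    then have "norm (T (x - y)) = 0" using lin by (simp add: linear_diff)
    then show "x = y" using iso by simp
  qed
  then have "surj T" using lin by (simp add: linear_injective_imp_surjective)
  then obtain S where S: "\<And>y. T (S y) = y" by (metis surjD)
  \<comment> \<open>Since T is onto, a translation after T is a translation before it; this is the
    translation invariance of the image measure.\<close>
  have transT: "(\<integral>\<^sup>+x. g (T x + y) \<partial>lborel) = (\<integral>\<^sup>+x. g (T x) \<partial>lborel)"
    if [measurable]: "g \<in> borel_measurable borel" for g :: "'a \<Rightarrow> ennreal" and y
  proof -
    have "T x + y = T (S y + x)" for x using lin S by (simp add: linear_add add.commute)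
    then show ?thesis
      using nn_integral_lborel_translate[of "\<lambda>x. g (T x)" "S y"] by simp
  qed
  let ?B = "ball 0 1 :: 'a set"
  have [measurable]: "(indicator ?B :: 'a \<Rightarrow> ennreal) \<in> borel_measurable borel"
    by (intro borel_measurable_indicator) simp
  \<comment> \<open>The indicator of the ball translated by T x is inserted and Fubini applied:
    integrating over y first gives the volume of the ball, integrating over x first gives the
    integral of f. As T preserves the ball, the remaining factor is its volume on both sides and
    cancels.\<close>
  have "(\<integral>\<^sup>+x. f (T x) \<partial>lborel) * emeasure lborel ?B
      = (\<integral>\<^sup>+x. f (T x) * (\<integral>\<^sup>+y. indicator ?B y \<partial>lborel) \<partial>lborel)"
    by (simp add: nn_integral_multc)
  also have "\<dots> = (\<integral>\<^sup>+x. f (T x) * (\<integral>\<^sup>+y. indicator ?B (- T x + y) \<partial>lborel) \<partial>lborel)"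
    by (subst nn_integral_lborel_translate) (auto intro!: borel_measurable_indicator)
  also have "\<dots> = (\<integral>\<^sup>+x. (\<integral>\<^sup>+y. f (T x) * indicator ?B (- T x + y) \<partial>lborel) \<partial>lborel)"
    by (subst nn_integral_cmult[symmetric]) auto
  also have "\<dots> = (\<integral>\<^sup>+y. (\<integral>\<^sup>+x. f (T x) * indicator ?B (- T x + y) \<partial>lborel) \<partial>lborel)"
    by (rule lborel_pair.Fubini') (simp add: case_prod_beta')
  also have "\<dots> = (\<integral>\<^sup>+y. (\<integral>\<^sup>+x. f (T x + y) * indicator ?B (- T x) \<partial>lborel) \<partial>lborel)"
  proof (rule nn_integral_cong)
    fix y
    have "(\<integral>\<^sup>+x. f (T x) * indicator ?B (- T x + y) \<partial>lborel)
        = (\<integral>\<^sup>+x. f (T x + y) * indicator ?B (- (T x + y) + y) \<partial>lborel)"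
      by (rule transT[symmetric]) auto
    then show "(\<integral>\<^sup>+x. f (T x) * indicator ?B (- T x + y) \<partial>lborel)
        = (\<integral>\<^sup>+x. f (T x + y) * indicator ?B (- T x) \<partial>lborel)" by simp
  qed
  also have "\<dots> = (\<integral>\<^sup>+x. (\<integral>\<^sup>+y. f (T x + y) * indicator ?B (- T x) \<partial>lborel) \<partial>lborel)"
    by (rule lborel_pair.Fubini'[symmetric]) (simp add: case_prod_beta')
  also have "\<dots> = (\<integral>\<^sup>+x. (\<integral>\<^sup>+y. f y \<partial>lborel) * indicator ?B (- T x) \<partial>lborel)"
    by (simp add: nn_integral_multc nn_integral_lborel_translate)
  also have "\<dots> = (\<integral>\<^sup>+y. f y \<partial>lborel) * (\<integral>\<^sup>+x. indicator ?B x \<partial>lborel)"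
  proof -
    have "indicator ?B (- T x) = (indicator ?B x :: ennreal)" for x
      using iso by (simp add: indicator_def)
    then show ?thesis by (simp add: nn_integral_cmult)
  qed
  finally have *: "(\<integral>\<^sup>+x. f (T x) \<partial>lborel) * emeasure lborel ?B = (\<integral>\<^sup>+x. f x \<partial>lborel) * emeasure lborel ?B"
    by simp
  have "emeasure lborel ?B \<noteq> 0"
    by (simp add: emeasure_ball less_imp_neq[OF unit_ball_vol_pos, symmetric])
  moreover have "emeasure lborel ?B \<noteq> \<infinity>"
    using emeasure_lborel_ball_finite[of "0::'a" 1] by simp
  ultimately show ?thesis using *
    by (metis ennreal_mult_cancel_left infinity_ennreal_def mult.commute)
qed

section \<open>The Hermitian inner product\<close>

lemma cinner_vec_add_left: "cinner_vec (x + y) z = cinner_vec x z + cinner_vec y z"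
  by (simp add: cinner_vec_def algebra_simps sum.distrib)

lemma cinner_vec_diff_left: "cinner_vec (x - y) z = cinner_vec x z - cinner_vec y z"
  by (simp add: cinner_vec_def algebra_simps sum_subtractf)

lemma cinner_vec_scale_left: "cinner_vec (c *s x) z = c * cinner_vec x z"
  by (simp add: cinner_vec_def sum_distrib_left mult_ac)

lemma cinner_vec_scale_right: "cinner_vec x (c *s z) = cnj c * cinner_vec x z"
  by (simp add: cinner_vec_def sum_distrib_left mult_ac)

lemma cinner_vec_commute: "cinner_vec x y = cnj (cinner_vec y x)"
  by (simp add: cinner_vec_def mult.commute)

lemma cinner_vec_zero [simp]: "cinner_vec 0 x = 0" "cinner_vec x 0 = 0"
  by (simp_all add: cinner_vec_def)

lemma Re_cinner_vec: "Re (cinner_vec x y) = x \<bullet> y"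
  by (simp add: cinner_vec_def inner_vec_def inner_complex_def)

lemma cinner_vec_self: "cinner_vec x x = of_real ((norm x)\<^sup>2)"
proof -
  have "Im (cinner_vec x x) = 0" by (simp add: cinner_vec_def)
  then show ?thesis
    by (simp add: complex_eq_iff Re_cinner_vec power2_norm_eq_inner)
qed

lemma scaleR_eq_scale: "c *\<^sub>R (x::complex^'n) = complex_of_real c *s x"
  by (simp add: vec_eq_iff scaleR_conv_of_real[of _ "_::complex"])

lemma norm_scale_vec: "norm (c *s (x::complex^'n)) = norm c * norm x"
proof -
  have "complex_of_real ((norm (c *s x))\<^sup>2) = (c * cnj c) * cinner_vec x x"
    unfolding cinner_vec_self[symmetric] cinner_vec_scale_left cinner_vec_scale_right by simp
  also have "\<dots> = of_real ((norm c * norm x)\<^sup>2)"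
    by (simp only: complex_norm_square[symmetric] cinner_vec_self of_real_mult power_mult_distrib)
  finally have "complex_of_real ((norm (c *s x))\<^sup>2) = of_real ((norm c * norm x)\<^sup>2)" .
  then show ?thesis unfolding of_real_eq_iff by (simp add: power2_eq_iff_nonneg)
qed

lemma norm_cinner_vec_le: "norm (cinner_vec x y) \<le> norm x * norm y"
proof (cases "cinner_vec x y = 0")
  case False
  \<comment> \<open>A unimodular factor makes the Hermitian product real and nonnegative, so that
    the Cauchy-Schwarz inequality of the real inner product applies.\<close>
  define u where "u = cnj (cinner_vec x y) / of_real (norm (cinner_vec x y))"
  have u: "norm u = 1" using False by (simp add: u_def norm_divide)
  have "u * cinner_vec x y = of_real (norm (cinner_vec x y))"
    using False
    by (simp add: u_def mult.commute complex_norm_square[symmetric] power2_eq_square)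
  then have "norm (cinner_vec x y) = Re (cinner_vec (u *s x) y)"
    by (simp add: cinner_vec_scale_left)
  also have "\<dots> \<le> norm (u *s x) * norm y"
    unfolding Re_cinner_vec by (rule norm_cauchy_schwarz)
  finally show ?thesis by (simp add: norm_scale_vec u)
qed simp

lemma norm_cinner_vec_less:
  assumes "norm x < 1" "norm y < 1"
  shows "norm (cinner_vec x y) < 1"
proof -
  have "norm x * norm y \<le> norm x" using assms by (simp add: mult_left_le)
  then show ?thesis using norm_cinner_vec_le[of x y] assms by linarith
qed

lemma continuous_on_cinner_vec [continuous_intros]:
  "continuous_on A f \<Longrightarrow> continuous_on A g \<Longrightarrow> continuous_on A (\<lambda>x. cinner_vec (f x) (g x))"
  unfolding cinner_vec_def by (intro continuous_intros)

lemma continuous_on_scale_vec [continuous_intros]: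
  fixes g :: "_ \<Rightarrow> complex^'n"
  shows "continuous_on A f \<Longrightarrow> continuous_on A g \<Longrightarrow> continuous_on A (\<lambda>x. f x *s g x)"
  unfolding vector_scalar_mult_def by (intro continuous_intros)

lemma measurable_cinner_vec [measurable (raw)]:
  assumes [measurable]: "f \<in> borel_measurable M" "g \<in> borel_measurable M"
  shows "(\<lambda>x. cinner_vec (f x) (g x)) \<in> borel_measurable M"
proof -
  have "(\<lambda>z. cinner_vec (fst z) (snd z)) \<in> borel_measurable (borel :: ((complex^'n) \<times> (complex^'n)) measure)"
    by (intro borel_measurable_continuous_onI continuous_intros)
  then have "(\<lambda>z. cinner_vec (fst z) (snd z :: complex^'n)) \<in> borel_measurable (borel \<Otimes>\<^sub>M borel)"
    by (simp add: borel_prod)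
  from measurable_compose[OF measurable_Pair[OF assms] this] show ?thesis by simp
qed

text \<open>The unitary map that multiplies the orthogonal complement of the unit vector \<open>e\<close> by \<open>u\<close>;
  the value \<open>e = 0\<close> gives scalar multiplication.\<close>

definition rot :: "complex^'n \<Rightarrow> complex \<Rightarrow> complex^'n \<Rightarrow> complex^'n" where
  "rot e u w = cinner_vec w e *s e + u *s (w - cinner_vec w e *s e)"

lemma rot_0: "rot 0 u w = u *s w"
  by (simp add: rot_def)

lemma norm_rot:
  assumes "norm e = 1 \<or> e = 0" "norm u = 1"
  shows "norm (rot e u w) = norm w"
proof -
  define a where "a = cinner_vec w e *s e"
  define b where "b = w - a"
  have "cinner_vec b a = 0" 
    using assms(1) unfolding a_def b_def
    by (auto simp: cinner_vec_diff_left cinner_vec_scale_left cinner_vec_scale_right cinner_vec_self)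
  then have "cinner_vec (v *s b) a = 0" for v by (simp add: cinner_vec_scale_left)
  then have "(v *s b) \<bullet> a = 0" for v by (metis Re_cinner_vec zero_complex.sel(1))
  then have pyth: "(norm (a + v *s b))\<^sup>2 = (norm a)\<^sup>2 + (norm v * norm b)\<^sup>2" for v
    by (simp add: norm_add_Pythagorean orthogonal_def inner_commute norm_scale_vec)
  have "(norm (rot e u w))\<^sup>2 = (norm (a + 1 *s b))\<^sup>2"
    unfolding pyth using pyth[of u] assms(2) by (simp add: rot_def a_def b_def)
  also have "a + 1 *s b = w" by (simp add: b_def)
  finally show ?thesis by (simp add: power2_eq_iff_nonneg)
qed

lemma linear_rot: "linear (rot e u)"
  by (rule linearI)
    (simp_all add: rot_def cinner_vec_add_left scaleR_eq_scale cinner_vec_scale_left vec_eq_iff algebra_simps)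

lemma cinner_vec_rot:
  assumes "norm e = 1"
  shows "cinner_vec (rot e u w) e = cinner_vec w e"
  using assms by (simp add: rot_def cinner_vec_add_left cinner_vec_diff_left cinner_vec_scale_left cinner_vec_self)

lemma continuous_on_rot [continuous_intros]:
  "continuous_on A f \<Longrightarrow> continuous_on A g \<Longrightarrow> continuous_on A (\<lambda>x. rot e (f x) (g x))"
  unfolding rot_def by (intro continuous_intros)

section \<open>Averages over the unit circle\<close>

text \<open>Normalised arc length. It lives on the circle as a subspace, so that
  \<open>norm u = 1\<close> is available for every point of its space and only continuity on the
  circle is needed for measurability.\<close>

definition circ :: "complex measure" where
  "circ = distr (restrict_space lborel {0..1}) (restrict_space borel (sphere 0 1)) (\<lambda>t. cis (2 * pi * t))"

lemma space_circ [simp]: "space circ = sphere 0 1"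
  by (simp add: circ_def space_restrict_space)

lemma sets_circ [measurable_cong]: "sets circ = sets (restrict_space borel (sphere 0 1))"
  by (simp add: circ_def)

lemma measurable_cis_circ:
  "(\<lambda>t. cis (2 * pi * t)) \<in> restrict_space lborel {0..1} \<rightarrow>\<^sub>M restrict_space borel (sphere 0 1)"
proof (rule measurable_restrict_space2)
  have "(\<lambda>t. cis (2 * pi * t)) \<in> borel_measurable borel"
    by (intro borel_measurable_continuous_onI continuous_intros)
  then show "(\<lambda>t. cis (2 * pi * t)) \<in> borel_measurable (restrict_space lborel {0..1})"
    by (intro measurable_restrict_space1) simp
qed simp

lemma emeasure_space_circ [simp]: "emeasure circ (sphere 0 1) = 1"
proof -
  have "(\<lambda>t. cis (2 * pi * t)) -` sphere 0 1 \<inter> space (restrict_space lborel {0..1}) = {0..1}"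
    by (auto simp: space_restrict_space)
  then show ?thesis
    unfolding circ_def
    by (subst emeasure_distr[OF measurable_cis_circ])
      (auto simp: sets_restrict_space emeasure_restrict_space)
qed

interpretation circ: finite_measure circ
  by (rule finite_measureI) simp

lemma measure_space_circ [simp]: "measure circ (sphere 0 1) = 1"
  by (simp add: measure_def)

lemma measurable_cnj [measurable (raw)]:
  "f \<in> borel_measurable M \<Longrightarrow> (\<lambda>x. cnj (f x)) \<in> borel_measurable M"
  by (rule measurable_compose[of _ _ borel])
    (auto intro!: borel_measurable_continuous_onI continuous_intros)

lemma continuous_on_measurable_circ:
  "continuous_on (sphere 0 1) f \<Longrightarrow> f \<in> borel_measurable circ"
  using borel_measurable_continuous_on_restrict[of "sphere 0 1" f] measurable_cong_sets[OF sets_circ refl]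
  by blast

lemma measurable_id_circ [measurable]: "(\<lambda>u. u) \<in> borel_measurable circ"
  by (intro continuous_on_measurable_circ continuous_intros)

text \<open>For m distinct from k the antiderivative of \<open>cis (2 * pi * j * t)\<close> takes
  equal values at 0 and 1, because j is a nonzero integer.\<close>

lemma integral_circ_monom:
  "(\<integral>u. u ^ m * cnj u ^ k \<partial>circ) = (if m = k then 1 else 0)"
proof -
  define j where "j = real m - real k"
  have cont: "continuous_on (sphere 0 1) (\<lambda>u. u ^ m * cnj u ^ k)" by (intro continuous_intros)
  have [measurable]: "(\<lambda>u. u ^ m * cnj u ^ k) \<in> borel_measurable (restrict_space borel (sphere 0 1))"
    by (rule borel_measurable_continuous_on_restrict[OF cont])
  have pw: "cis (2 * pi * t) ^ m * cnj (cis (2 * pi * t)) ^ k = cis (2 * pi * j * t)" for t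
  proof -
    have "cis (2 * pi * t) ^ m * cnj (cis (2 * pi * t)) ^ k
        = cis (real m * (2 * pi * t) + real k * - (2 * pi * t))"
      by (simp only: cis_cnj Complex.DeMoivre cis_mult)
    also have "real m * (2 * pi * t) + real k * - (2 * pi * t) = 2 * pi * j * t"
      by (simp add: j_def algebra_simps)
    finally show ?thesis .
  qed
  have "(\<integral>u. u ^ m * cnj u ^ k \<partial>circ) = (\<integral>t. indicator {0..1} t *\<^sub>R cis (2 * pi * j * t) \<partial>lborel)"
    unfolding circ_def
    by (subst integral_distr[OF measurable_cis_circ])
      (simp_all add: integral_restrict_space pw)
  also have "\<dots> = (if m = k then 1 else 0)"
  proof (cases "m = k")
    case True
    then show ?thesis by (simp add: j_def)
  next
    case False
    then have j: "j \<noteq> 0" by (simp add: j_def)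
    define F where "F = (\<lambda>t. cis (2 * pi * j * t) / (\<i> * of_real (2 * pi * j)))"
    have "has_bochner_integral lborel (\<lambda>t. indicator {0..1} t *\<^sub>R cis (2 * pi * j * t)) (F 1 - F 0)"
    proof (rule has_bochner_integral_FTC_Icc)
      fix t :: real
      have "((\<lambda>t. exp (\<i> * of_real (2 * pi * j) * of_real t) / (\<i> * of_real (2 * pi * j))) has_vector_derivative
           exp (\<i> * of_real (2 * pi * j) * of_real t)) (at t within {0..1})"
        using j
        by (auto intro!: derivative_eq_intros has_vector_derivative_real_field)
      then show "(F has_vector_derivative cis (2 * pi * j * t)) (at t within {0..1})"
        by (simp add: F_def cis_conv_exp mult_ac)
    qed (auto intro!: continuous_intros)
    moreover have "cis (2 * pi * j) = 1"
    proof -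
      have "cis (2 * pi * j) = cis (2 * pi * real m) * cnj (cis (2 * pi * real k))"
        by (simp add: cis_cnj cis_mult j_def algebra_simps)
      also have "\<dots> = 1" using cis_multiple_2pi[of "real m"] cis_multiple_2pi[of "real k"] by (simp del: cis_cnj)
      finally show ?thesis .
    qed
    ultimately show ?thesis using False by (simp add: has_bochner_integral_iff F_def)
  qed
  finally show ?thesis .
qed

lemma sums_integral_bounded:
  fixes f :: "nat \<Rightarrow> 'a \<Rightarrow> complex"
  assumes "finite_measure M" and [measurable]: "\<And>m. f m \<in> borel_measurable M"
    and bd: "\<And>m x. x \<in> space M \<Longrightarrow> norm (f m x) \<le> c m" and sm: "summable c"
  shows "(\<lambda>m. \<integral>x. f m x \<partial>M) sums (\<integral>x. (\<Sum>m. f m x) \<partial>M)"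
proof -
  interpret finite_measure M by fact
  have int: "integrable M (f m)" for m
    by (rule integrable_const_bound[where B="c m"]) (auto simp: bd)
  show ?thesis
  proof (rule sums_integral[OF int])
    show "AE x in M. summable (\<lambda>m. norm (f m x))"
      using sm bd by (auto intro!: AE_I2 summable_comparison_test'[where g=c and N=0])
    show "summable (\<lambda>m. \<integral>x. norm (f m x) \<partial>M)"
    proof (rule summable_comparison_test'[where g="\<lambda>m. measure M (space M) * c m" and N=0])
      fix m
      have "(\<integral>x. norm (f m x) \<partial>M) \<le> (\<integral>x. c m \<partial>M)"
        using int bd by (intro integral_mono) auto
      then show "norm (\<integral>x. norm (f m x) \<partial>M) \<le> measure M (space M) * c m" by simp
    qed (use sm in \<open>simp add: summable_mult\<close>)
  qed
qed

text \<open>Two termwise integrations against the orthonormal monomials: over the second series,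
  which computes the Fourier coefficients of B, and then over the first. Absolute summability of the
  coefficients dominates both on the circle itself.\<close>

lemma circ_parseval:
  assumes a: "summable (\<lambda>m. norm (a m))" and b: "summable (\<lambda>m. norm (b m))"
  shows "(\<lambda>m. a m * cnj (b m)) sums (\<integral>u. (\<Sum>m. a m * u ^ m) * cnj (\<Sum>m. b m * u ^ m) \<partial>circ)"
proof -
  have sa: "summable (\<lambda>m. c m * u ^ m)" if "summable (\<lambda>m. norm (c m :: complex))" "norm u = 1" for c u
    using that by (intro summable_norm_cancel[of "\<lambda>m. c m * u ^ m"]) (simp add: norm_mult norm_power)
  define B where "B = (\<lambda>u. \<Sum>m. b m * u ^ m)"
  have Bb: "norm (B u) \<le> (\<Sum>m. norm (b m))" if "norm u = 1" for u
    unfolding B_def using that b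
    by (intro order.trans[OF summable_norm]) (simp_all add: norm_mult norm_power)
  have [measurable]: "B \<in> borel_measurable circ"
    unfolding B_def by (rule borel_measurable_suminf) measurable
  have coeff: "(\<integral>u. u ^ m * cnj (B u) \<partial>circ) = cnj (b m)" for m
  proof -
    have "(\<lambda>k. \<integral>u. u ^ m * cnj (b k * u ^ k) \<partial>circ) sums (\<integral>u. (\<Sum>k. u ^ m * cnj (b k * u ^ k)) \<partial>circ)"
      by (rule sums_integral_bounded[OF circ.finite_measure_axioms _ _ b])
        (auto simp: norm_mult norm_power)
    moreover have "(\<integral>u. u ^ m * cnj (b k * u ^ k) \<partial>circ) = (if k = m then cnj (b m) else 0)" for k
    proof -
      have "(\<integral>u. u ^ m * cnj (b k * u ^ k) \<partial>circ) = (\<integral>u. cnj (b k) * (u ^ m * cnj u ^ k) \<partial>circ)"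
        by (simp add: mult_ac)
      then show ?thesis by (simp add: integral_circ_monom)
    qed
    moreover have "(\<lambda>k. if k = m then cnj (b m) else 0) sums cnj (b m)"
      using sums_single[of m "\<lambda>_. cnj (b m)"] by simp
    ultimately have "(\<integral>u. (\<Sum>k. u ^ m * cnj (b k * u ^ k)) \<partial>circ) = cnj (b m)"
      by (simp add: sums_unique2)
    moreover have "(\<integral>u. (\<Sum>k. u ^ m * cnj (b k * u ^ k)) \<partial>circ) = (\<integral>u. u ^ m * cnj (B u) \<partial>circ)"
    proof (rule Bochner_Integration.integral_cong[OF refl])
      fix u assume "u \<in> space circ"
      then have s: "(\<lambda>k. b k * u ^ k) sums B u"
        unfolding B_def using sa[OF b] by (simp add: summable_sums)
      show "(\<Sum>k. u ^ m * cnj (b k * u ^ k)) = u ^ m * cnj (B u)"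
        using sums_mult[OF sums_cnj[THEN iffD2, OF s]] by (rule sums_unique[symmetric])
    qed
    ultimately show ?thesis by simp
  qed
  have "(\<lambda>m. \<integral>u. a m * u ^ m * cnj (B u) \<partial>circ) sums (\<integral>u. (\<Sum>m. a m * u ^ m * cnj (B u)) \<partial>circ)"
  proof (rule sums_integral_bounded[OF circ.finite_measure_axioms])
    show "summable (\<lambda>m. norm (a m) * (\<Sum>m. norm (b m)))" using a by (rule summable_mult2)
    show "norm (a m * u ^ m * cnj (B u)) \<le> norm (a m) * (\<Sum>m. norm (b m))" if "u \<in> space circ" for m u
      using Bb[of u] that by (simp add: norm_mult norm_power mult_left_mono)
  qed measurable
  moreover have "(\<integral>u. a m * u ^ m * cnj (B u) \<partial>circ) = a m * cnj (b m)" for m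
    using coeff[of m] by (simp add: mult.assoc)
  moreover have "(\<integral>u. (\<Sum>m. a m * u ^ m * cnj (B u)) \<partial>circ) = (\<integral>u. (\<Sum>m. a m * u ^ m) * cnj (B u) \<partial>circ)"
    using sa[OF a] by (intro Bochner_Integration.integral_cong refl suminf_mult2[symmetric]) auto
  ultimately show ?thesis by (simp add: B_def)
qed

text \<open>The constant 1 is a series with one coefficient, so this is Parseval against it.\<close>

lemma circ_mean_value:
  assumes a: "summable (\<lambda>m. norm (a m))"
  shows "(\<integral>u. (\<Sum>m. a m * u ^ m) \<partial>circ) = a 0"
proof -
  define b where "b = (\<lambda>m::nat. if m = 0 then 1 else 0 :: complex)"
  have b: "summable (\<lambda>m. norm (b m))"
    unfolding b_def by (rule summable_finite[of "{0}"]) auto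
  have "(\<Sum>m. b m * u ^ m) = 1" for u
    using suminf_finite[of "{0}" "\<lambda>m. b m * u ^ m"] by (simp add: b_def)
  moreover have "(\<lambda>m. a m * cnj (b m)) sums a 0"
    using sums_single[of 0 a] by (simp add: b_def if_distrib cong: if_cong)
  ultimately show ?thesis using circ_parseval[OF a b] by (simp add: sums_unique2)
qed

text \<open>The difference of the two series vanishes on the half-line, whereas a power series with
  a nonzero coefficient has at most an isolated zero at 0. It serves to read moments off a
  generating function known only for nonnegative arguments.\<close>

lemma power_series_unique_nonneg:
  fixes a b :: "nat \<Rightarrow> real"
  assumes a: "\<And>x. 0 \<le> x \<Longrightarrow> (\<lambda>m. a m * x ^ m) sums f x" and b: "\<And>x. 0 \<le> x \<Longrightarrow> (\<lambda>m. b m * x ^ m) sums f x"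
  shows "a = b"
proof (rule ccontr)
  assume "a \<noteq> b"
  define c where "c = (\<lambda>m. a m - b m)"
  have c0: "(\<lambda>m. c m * x ^ m) sums 0" if "0 \<le> x" for x
    using sums_diff[OF a[OF that] b[OF that]] by (simp add: c_def algebra_simps)
  have "summable (\<lambda>m. c m * x ^ m)" if "norm x < 1" for x
    by (rule powser_inside[of _ 1]) (use that c0[of 1] in \<open>auto simp: sums_iff\<close>)
  then have sm: "(\<lambda>m. c m * (x - 0) ^ m) sums (\<Sum>m. c m * x ^ m)" if "norm (x - 0) < 1" for x
    using that by (simp add: summable_sums)
  have z: "(\<Sum>m. c m * x ^ m) = 0" if "0 \<le> x" for x using c0[OF that] by (simp add: sums_iff)
  obtain m where m: "c m \<noteq> 0" using \<open>a \<noteq> b\<close> by (auto simp: c_def)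
  have "c 0 = 0" using z[of 0] by simp
  then have "m > 0" using m by (cases m) auto
  obtain s where "0 < s" "\<And>x. x \<in> cball 0 s - {0} \<Longrightarrow> (\<Sum>m. c m * x ^ m) \<noteq> 0"
    using powser_0_nonzero[OF zero_less_one sm _ m \<open>m > 0\<close>] z[of 0] by auto
  then show False using z[of s] by auto
qed

lemma measurable_rot_circ:
  fixes e :: "complex^'n"
  assumes e: "norm e = 1 \<or> e = 0"
  shows "(\<lambda>(u, w). rot e u w) \<in> borel_measurable (circ \<Otimes>\<^sub>M borel)"
proof -
  have "(\<lambda>z. rot e (fst z) (snd z)) \<in> borel_measurable (borel :: (complex \<times> (complex^'n)) measure)"
    by (intro borel_measurable_continuous_onI continuous_intros)
  then have "(\<lambda>z. rot e (fst z) (snd z)) \<in> borel_measurable (borel \<Otimes>\<^sub>M borel)"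
    by (simp add: borel_prod)
  moreover have "(\<lambda>z. (fst z, snd z)) \<in> circ \<Otimes>\<^sub>M borel \<rightarrow>\<^sub>M borel \<Otimes>\<^sub>M (borel :: (complex^'n) measure)"
    by measurable
  ultimately have "(\<lambda>z. rot e (fst (fst z, snd z)) (snd (fst z, snd z))) \<in> borel_measurable (circ \<Otimes>\<^sub>M borel)"
    by (rule measurable_compose[rotated])
  then show ?thesis by (simp add: case_prod_beta')
qed

text \<open>Every rotation leaves the integral unchanged, hence so does their average, which Fubini
  moves inside. With e = 0 it extracts the diagonal terms of the Gaussian generating
  function.\<close>

lemma nn_integral_lborel_rot_average:
  fixes f :: "complex^'n \<Rightarrow> ennreal"
  assumes e: "norm e = 1 \<or> e = 0" and [measurable]: "f \<in> borel_measurable borel"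
  shows "(\<integral>\<^sup>+w. f w \<partial>lborel) = (\<integral>\<^sup>+w. (\<integral>\<^sup>+u. f (rot e u w) \<partial>circ) \<partial>lborel)"
proof -
  interpret pair_sigma_finite circ "lborel :: (complex^'n) measure" ..
  note measurable_rot_circ[OF e, measurable]
  have "(\<integral>\<^sup>+w. f w \<partial>lborel) = (\<integral>\<^sup>+u. (\<integral>\<^sup>+w. f w \<partial>lborel) \<partial>circ)"
    by simp
  also have "\<dots> = (\<integral>\<^sup>+u. (\<integral>\<^sup>+w. f (rot e u w) \<partial>lborel) \<partial>circ)"
    by (intro nn_integral_cong nn_integral_lborel_isometry[symmetric] linear_rot norm_rot e) auto
  also have "\<dots> = (\<integral>\<^sup>+w. (\<integral>\<^sup>+u. f (rot e u w) \<partial>circ) \<partial>lborel)"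
    by (intro Fubini'[symmetric]) (simp add: case_prod_beta')
  finally show ?thesis .
qed

section \<open>Moments of the weighted measures\<close>

lemma DIM_complex_vec: "DIM(complex ^ 'n) = 2 * CARD('n)"
  by simp

(* Both sides equal the integral of exp (- s) * H w * (s - |w|^2)^\<alpha> over all s > |w|^2. *)
lemma ball_moment_eq_gauss_moment:
  fixes H :: "complex ^ 'n \<Rightarrow> real"
  assumes [measurable]: "H \<in> borel_measurable borel" and H0: "\<And>w. H w \<ge> 0"
    and hom: "\<And>c w. c > 0 \<Longrightarrow> H (c *\<^sub>R w) = c ^ (2 * m) * H w"
    and \<alpha>: "\<alpha> > -1"
  shows "ennreal (Gamma (real CARD('n) + 1 + \<alpha> + real m)) *
      (\<integral>\<^sup>+w. ennreal (H w * (1 - (norm w)\<^sup>2) powr \<alpha>) * indicator (ball 0 1) w \<partial>lborel)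
    = ennreal (Gamma (\<alpha> + 1)) * (\<integral>\<^sup>+w. ennreal (H w * exp (- (norm w)\<^sup>2)) \<partial>lborel)"
proof -
  let ?n = "real CARD('n)"
  define K where "K = (\<lambda>(s::real) (w::complex^'n).
    if (norm w)\<^sup>2 < s then ennreal (exp (- s) * H w * (s - (norm w)\<^sup>2) powr \<alpha>) else 0)"
  define I where "I = (\<integral>\<^sup>+w. ennreal (H w * (1 - (norm w)\<^sup>2) powr \<alpha>) * indicator (ball 0 1) w \<partial>(lborel :: (complex^'n) measure))"
  have [measurable]: "ball (0::complex^'n) 1 \<in> sets borel" by simp
  have [measurable]: "(\<lambda>(s, w). K s w) \<in> borel_measurable (lborel \<Otimes>\<^sub>M lborel)"
    unfolding K_def by measurable
  have [measurable]: "K s \<in> borel_measurable borel" for s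
    unfolding K_def by measurable
  \<comment> \<open>The ball of radius sqrt s is scaled to the unit ball: the real dimension 2 n
    gives s^n, homogeneity s^m, the weight s^\<alpha>. The exponent is written with + 1 and - 1 to
    match the integrand of Gamma at n + 1 + \<alpha> + m.\<close>
  have L: "(\<integral>\<^sup>+w. K s w \<partial>lborel) = ennreal (indicator {0..} s * s powr (?n + 1 + \<alpha> + m - 1) / exp s) * I" for s
  proof (cases "s > 0")
    case True
    have Ks: "K s (sqrt s *\<^sub>R w) = ennreal (exp (- s) * s ^ m * s powr \<alpha>) *
        (ennreal (H w * (1 - (norm w)\<^sup>2) powr \<alpha>) * indicator (ball 0 1) w)" for w
    proof -
      have 1: "(norm (sqrt s *\<^sub>R w))\<^sup>2 = s * (norm w)\<^sup>2" using True by (simp add: power_mult_distrib)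
      have 2: "s * (norm w)\<^sup>2 < s \<longleftrightarrow> norm w < 1"
        using True by (simp add: mult_less_cancel_left1 power_less_one_iff abs_square_less_1)
      have 3: "(s - s * (norm w)\<^sup>2) powr \<alpha> = s powr \<alpha> * (1 - (norm w)\<^sup>2) powr \<alpha>" if "norm w < 1"
      proof -
        have "s - s * (norm w)\<^sup>2 = s * (1 - (norm w)\<^sup>2)" by (simp add: algebra_simps)
        then show ?thesis using True that by (simp add: powr_mult abs_square_le_1)
      qed
      have 4: "H (sqrt s *\<^sub>R w) = s ^ m * H w" using hom[of "sqrt s" w] True by (simp add: power_mult)
      show ?thesis
        unfolding K_def 1 2 4 using 3 True H0[of w]
        by (auto simp: indicator_def ennreal_mult'[symmetric] mult_ac)
    qed
    have "(\<integral>\<^sup>+w. K s w \<partial>lborel) = ennreal (sqrt s ^ DIM(complex^'n)) * (\<integral>\<^sup>+w. K s (sqrt s *\<^sub>R w) \<partial>lborel)"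
      using True by (intro nn_integral_lborel_scale) auto
    also have "sqrt s ^ DIM(complex^'n) = s powr ?n"
      using True unfolding DIM_complex_vec by (simp add: power_mult powr_realpow)
    also have "(\<integral>\<^sup>+w. K s (sqrt s *\<^sub>R w) \<partial>lborel)
        = ennreal (exp (- s) * s ^ m * s powr \<alpha>) * I"
      unfolding Ks I_def by (rule nn_integral_cmult) measurable
    also have "ennreal (s powr ?n) * (ennreal (exp (- s) * s ^ m * s powr \<alpha>) * I)
        = ennreal (s powr ?n * (exp (- s) * s ^ m * s powr \<alpha>)) * I"
      by (simp add: ennreal_mult' mult.assoc)
    also have "s powr ?n * (exp (- s) * s ^ m * s powr \<alpha>) = s powr (?n + 1 + \<alpha> + m - 1) / exp s"
      using True by (simp add: powr_add powr_realpow exp_minus field_simps)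
    finally show ?thesis using True by simp
  next
    case False
    then have "\<not> (norm w)\<^sup>2 < s" for w :: "complex^'n"
      using zero_le_power2[of "norm w"] by linarith
    then have "K s w = 0" for w unfolding K_def by simp
    then show ?thesis using False \<alpha> by (cases "s = 0") auto
  qed
  \<comment> \<open>Shifting s by |w|^2 splits off exp (- |w|^2) and leaves the integral of Gamma at
    \<alpha> + 1.\<close>
  have R: "(\<integral>\<^sup>+s. K s w \<partial>lborel) = ennreal (Gamma (\<alpha> + 1)) * ennreal (H w * exp (- (norm w)\<^sup>2))" for w
  proof -
    let ?q = "(norm w)\<^sup>2"
    have "(\<integral>\<^sup>+s. K s w \<partial>lborel) = (\<integral>\<^sup>+s. K (?q + s) w \<partial>lborel)"
      by (rule nn_integral_lborel_translate[symmetric]) (simp add: K_def)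
    also have "\<dots> = (\<integral>\<^sup>+s. ennreal (H w * exp (- ?q)) * ennreal (indicator {0..} s * s powr (\<alpha> + 1 - 1) / exp s) \<partial>lborel)"
      using H0[of w]
      by (intro nn_integral_cong)
        (auto simp: K_def indicator_def ennreal_mult'[symmetric] exp_add exp_diff exp_minus field_simps)
    also have "\<dots> = ennreal (H w * exp (- ?q)) * ennreal (Gamma (\<alpha> + 1))"
      using \<alpha> by (subst nn_integral_cmult) (auto simp: Gamma_conv_nn_integral_real)
    finally show ?thesis by (simp add: mult.commute)
  qed
  have "ennreal (Gamma (?n + 1 + \<alpha> + m)) * I = (\<integral>\<^sup>+s. (\<integral>\<^sup>+w. K s w \<partial>lborel) \<partial>lborel)"
    unfolding L using \<alpha> by (subst nn_integral_multc) (auto simp: Gamma_conv_nn_integral_real)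
  also have "\<dots> = (\<integral>\<^sup>+w. (\<integral>\<^sup>+s. K s w \<partial>lborel) \<partial>lborel)"
    by (rule lborel_pair.Fubini') measurable
  also have "\<dots> = ennreal (Gamma (\<alpha> + 1)) * (\<integral>\<^sup>+w. ennreal (H w * exp (- (norm w)\<^sup>2)) \<partial>lborel)"
    unfolding R by (rule nn_integral_cmult) measurable
  finally show ?thesis unfolding I_def .
qed

text \<open>This is pi^n, kept as an unevaluated constant because it cancels between the moments and
  the total mass.\<close>

definition gauss_mass :: "'n::finite itself \<Rightarrow> ennreal" where
  "gauss_mass _ = (\<integral>\<^sup>+w. ennreal (exp (- (norm w)\<^sup>2)) \<partial>(lborel :: (complex^'n) measure))"

text \<open>The moment identity with H = 1 and \<alpha> = 0 compares the Gaussian mass with the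
  volume of the ball, which is positive and finite.\<close>

lemma gauss_mass: "gauss_mass TYPE('n::finite) \<noteq> 0" "gauss_mass TYPE('n) < \<infinity>"
proof -
  let ?B = "ball 0 1 :: (complex^'n) set"
  have "(\<integral>\<^sup>+w. ennreal ((1 - (norm w)\<^sup>2) powr 0) * indicator ?B w \<partial>lborel) = (\<integral>\<^sup>+w. indicator ?B w \<partial>lborel)"
    by (intro nn_integral_cong) (auto simp: indicator_def power2_eq_1_iff, smt (verit) norm_ge_zero)
  then have "ennreal (Gamma (real CARD('n) + 1)) * emeasure lborel ?B = gauss_mass TYPE('n)"
    using ball_moment_eq_gauss_moment[of "\<lambda>_::complex^'n. 1" 0 0]
    by (simp add: gauss_mass_def)
  moreover have "Gamma (real CARD('n) + 1) > 0" by (intro Gamma_real_pos) simp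
  moreover have "emeasure lborel ?B \<noteq> 0" "emeasure lborel ?B < \<infinity>"
    using emeasure_lborel_ball_finite[of "0::complex^'n" 1]
    by (simp_all add: emeasure_ball less_imp_neq[OF unit_ball_vol_pos, symmetric])
  ultimately show "gauss_mass TYPE('n) \<noteq> 0" "gauss_mass TYPE('n) < \<infinity>"
    by (metis ennreal_eq_0_iff linorder_not_less mult_eq_0_iff, metis ennreal_mult_less_top ennreal_less_top infinity_ennreal_def)
qed

(* Completing the square evaluates the integral of |exp <w,z>|^2 exp (- |w|^2) for z = sqrt r e;
   averaging over the circle expands it into a power series in r. *)
lemma gauss_moment:
  fixes e :: "complex^'n"
  assumes e: "norm e = 1"
  shows "(\<integral>\<^sup>+w. ennreal (norm (cinner_vec w e) ^ (2 * m) * exp (- (norm w)\<^sup>2)) \<partial>lborel) = ennreal (fact m) * gauss_mass TYPE('n)"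
proof -
  define M where "M = (\<lambda>m. \<integral>\<^sup>+w. ennreal (norm (cinner_vec w e) ^ (2 * m) * exp (- (norm w)\<^sup>2)) \<partial>lborel)"
  obtain g where g: "gauss_mass TYPE('n) = ennreal g" "g \<ge> 0"
    using gauss_mass(2)[where 'n='n] by (cases "gauss_mass TYPE('n)" rule: ennreal_cases) auto
  have series: "(\<Sum>m. ennreal (r ^ m / (fact m)\<^sup>2) * M m) = ennreal (g * exp r)" if r: "r \<ge> 0" for r
  proof -
    define z where "z = sqrt r *\<^sub>R e"
    have z: "(norm z)\<^sup>2 = r" using r e by (simp add: z_def)
    let ?F = "\<lambda>w. ennreal (exp (2 * (w \<bullet> z) - (norm w)\<^sup>2))"
    have "(\<integral>\<^sup>+w. ?F w \<partial>lborel) = (\<integral>\<^sup>+w. ?F (z + w) \<partial>lborel)"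
      by (rule nn_integral_lborel_translate[symmetric]) measurable
    also have "\<dots> = (\<integral>\<^sup>+w. ennreal (exp r) * ennreal (exp (- (norm w)\<^sup>2)) \<partial>(lborel :: (complex^'n) measure))"
    proof (rule nn_integral_cong)
      fix w :: "complex^'n"
      have eq: "2 * ((z + w) \<bullet> z) - (norm (z + w))\<^sup>2 = r + - (norm w)\<^sup>2"
        unfolding z[symmetric] power2_norm_eq_inner by (simp add: inner_add inner_commute)
      show "?F (z + w) = ennreal (exp r) * ennreal (exp (- (norm w)\<^sup>2))"
        unfolding eq by (simp add: ennreal_mult'[symmetric] exp_diff exp_minus divide_inverse)
    qed
    also have "(\<integral>\<^sup>+w. ennreal (exp r) * ennreal (exp (- (norm w)\<^sup>2)) \<partial>(lborel :: (complex^'n) measure)) = ennreal (g * exp r)"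
      using g unfolding gauss_mass_def by (subst nn_integral_cmult) (auto simp: ennreal_mult'[symmetric] mult.commute)
    finally have 1: "(\<integral>\<^sup>+w. ?F w \<partial>lborel) = ennreal (g * exp r)" .
    have inner: "(\<integral>\<^sup>+u. ?F (rot 0 u w) \<partial>circ)
      = (\<Sum>m. ennreal (r ^ m / (fact m)\<^sup>2) * ennreal (norm (cinner_vec w e) ^ (2 * m) * exp (- (norm w)\<^sup>2)))" for w
    proof -
      \<comment> \<open>For fixed w, exp (u c) has the coefficients c^m / m! in u and the squared
        modulus exp (2 Re (u c)); Parseval on the circle gives the diagonal series.\<close>
      define c where "c = cinner_vec w z"
      have c: "norm c ^ 2 = r * norm (cinner_vec w e) ^ 2"
        using r by (simp add: c_def z_def scaleR_eq_scale cinner_vec_scale_right norm_mult power_mult_distrib)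
      define a where "a = (\<lambda>m. c ^ m / fact m)"
      have a: "summable (\<lambda>m. norm (a m))"
        using summable_norm_exp[of c] by (simp add: a_def divide_inverse scaleR_conv_of_real mult.commute norm_mult norm_power norm_inverse)
      have ex: "(\<Sum>m. a m * u ^ m) = exp (u * c)" for u
        unfolding exp_def a_def by (simp add: scaleR_conv_of_real power_mult_distrib field_simps)
      have "(\<lambda>m. a m * cnj (a m)) sums (\<integral>u. exp (u * c) * cnj (exp (u * c)) \<partial>circ)"
        using circ_parseval[OF a a] by (simp add: ex)
      moreover have "exp (u * c) * cnj (exp (u * c)) = of_real (exp (2 * (rot 0 u w \<bullet> z)))" for u
      proof -
        have "u * c = cinner_vec (rot 0 u w) z" by (simp add: rot_0 c_def cinner_vec_scale_left)
        then have "Re (u * c) = rot 0 u w \<bullet> z" by (simp add: Re_cinner_vec del: times_complex.sel)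
        then show ?thesis
          by (simp add: complex_norm_square[symmetric] norm_exp_eq_Re exp_double del: times_complex.sel)
      qed
      moreover have "a m * cnj (a m) = of_real ((norm c ^ 2) ^ m / (fact m)\<^sup>2)" for m
        unfolding complex_norm_square[symmetric]
        by (simp add: a_def norm_divide norm_power power_divide power_mult[symmetric] mult.commute)
      ultimately have "(\<lambda>m. complex_of_real ((norm c ^ 2) ^ m / (fact m)\<^sup>2)) sums
          of_real (\<integral>u. exp (2 * (rot 0 u w \<bullet> z)) \<partial>circ)"
        by (simp only: integral_complex_of_real)
      then have s: "(\<lambda>m. (norm c ^ 2) ^ m / (fact m)\<^sup>2) sums (\<integral>u. exp (2 * (rot 0 u w \<bullet> z)) \<partial>circ)"
        by (simp only: sums_of_real_iff)
      have cont: "continuous_on (sphere 0 1) (\<lambda>u. exp (2 * (rot 0 u w \<bullet> z)))"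
        by (intro continuous_intros)
      have "rot 0 u w \<bullet> z \<le> norm w * norm z" if "norm u = 1" for u
        using norm_cauchy_schwarz[of "rot 0 u w" z] that by (simp add: norm_rot)
      then have int: "integrable circ (\<lambda>u. exp (2 * (rot 0 u w \<bullet> z)))"
        by (intro circ.integrable_const_bound[where B="exp (2 * (norm w * norm z))"]
            continuous_on_measurable_circ[OF cont] AE_I2) simp
      have "(\<integral>\<^sup>+u. ?F (rot 0 u w) \<partial>circ) = (\<integral>\<^sup>+u. ennreal (exp (- (norm w)\<^sup>2)) * ennreal (exp (2 * (rot 0 u w \<bullet> z))) \<partial>circ)"
        by (intro nn_integral_cong) (simp add: norm_rot ennreal_mult'[symmetric] exp_diff exp_minus field_simps)
      also have "\<dots> = ennreal (exp (- (norm w)\<^sup>2)) * ennreal (\<integral>u. exp (2 * (rot 0 u w \<bullet> z)) \<partial>circ)"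
        using int by (subst nn_integral_cmult) (auto simp: nn_integral_eq_integral)
      also have "ennreal (\<integral>u. exp (2 * (rot 0 u w \<bullet> z)) \<partial>circ) = (\<Sum>m. ennreal ((norm c ^ 2) ^ m / (fact m)\<^sup>2))"
        using s by (intro suminf_ennreal_eq[symmetric]) auto
      also have "ennreal (exp (- (norm w)\<^sup>2)) * \<dots> = (\<Sum>m. ennreal (exp (- (norm w)\<^sup>2)) * ennreal ((norm c ^ 2) ^ m / (fact m)\<^sup>2))"
        by simp
      also have "\<dots> = (\<Sum>m. ennreal (r ^ m / (fact m)\<^sup>2) * ennreal (norm (cinner_vec w e) ^ (2 * m) * exp (- (norm w)\<^sup>2)))"
        using r unfolding c power_mult_distrib power_mult[of _ 2]
        by (simp add: ennreal_mult'[symmetric] mult_ac)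
      finally show ?thesis .
    qed
    have "(\<integral>\<^sup>+w. ?F w \<partial>lborel) = (\<integral>\<^sup>+w. (\<integral>\<^sup>+u. ?F (rot 0 u w) \<partial>circ) \<partial>lborel)"
      by (rule nn_integral_lborel_rot_average) auto
    also have "\<dots> = (\<Sum>m. ennreal (r ^ m / (fact m)\<^sup>2) * M m)"
      unfolding inner M_def
      by (subst nn_integral_suminf) (simp_all add: nn_integral_cmult)
    finally show ?thesis using 1 by simp
  qed
  \<comment> \<open>Each moment occurs with a positive factor in a series whose sum at r = 1 is
    finite.\<close>
  have fin: "M m < \<infinity>" for m
  proof -
    have "ennreal (1 / (fact m)\<^sup>2) * M m \<le> (\<Sum>m. ennreal (1 ^ m / (fact m)\<^sup>2) * M m)"
      using sum_le_suminf[of "\<lambda>m. ennreal (1 ^ m / (fact m)\<^sup>2) * M m" "{m}"] by simp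
    then have "ennreal (1 / (fact m)\<^sup>2) * M m < \<infinity>"
      using series[of 1] by (simp add: le_less_trans)
    then show ?thesis by (auto simp: ennreal_mult_less_top)
  qed
  define \<mu> where "\<mu> = (\<lambda>m. enn2real (M m))"
  have \<mu>: "M m = ennreal (\<mu> m)" "\<mu> m \<ge> 0" for m using fin[of m] by (auto simp: \<mu>_def)
  have "(\<lambda>m. \<mu> m / (fact m)\<^sup>2) = (\<lambda>m. g / fact m)"
  proof (rule power_series_unique_nonneg)
    fix r :: real assume r: "0 \<le> r"
    have eq: "ennreal (r ^ m / (fact m)\<^sup>2) * M m = ennreal (\<mu> m / (fact m)\<^sup>2 * r ^ m)" for m
      using r \<mu>[of m] by (simp add: ennreal_mult'[symmetric] mult_ac)
    have "(\<Sum>m. ennreal (\<mu> m / (fact m)\<^sup>2 * r ^ m)) = ennreal (g * exp r)"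
      using series[OF r] by (simp add: eq)
    then have "(\<lambda>m. ennreal (\<mu> m / (fact m)\<^sup>2 * r ^ m)) sums ennreal (g * exp r)"
      by (metis summable_sums summableI)
    then show "(\<lambda>m. \<mu> m / (fact m)\<^sup>2 * r ^ m) sums (g * exp r)"
      using r \<mu> g by (subst (asm) sums_ennreal) auto
    show "(\<lambda>m. g / fact m * r ^ m) sums (g * exp r)"
      using sums_mult[OF exp_converges[of r], of g] by (simp add: divide_inverse mult_ac)
  qed
  then have "\<mu> m / (fact m)\<^sup>2 = g / fact m" by (rule fun_cong)
  then have "\<mu> m = fact m * g" by (simp add: field_simps power2_eq_square)
  then show ?thesis using \<mu>[of m] g unfolding M_def by (simp add: ennreal_mult')
qed

section \<open>The weighted Bergman measure\<close>

lemma space_bergman [simp]: "space (bergman_measure \<alpha>) = ball 0 1"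
  by (simp add: bergman_measure_def Let_def space_restrict_space)

lemma sets_bergman [measurable_cong]: "sets (bergman_measure \<alpha>) = sets (restrict_space borel (ball 0 1))"
  by (simp add: bergman_measure_def Let_def sets_restrict_space)

lemma measurable_bergman_borel:
  "f \<in> borel_measurable borel \<Longrightarrow> f \<in> borel_measurable (bergman_measure \<alpha>)"
  by (simp add: measurable_cong_sets[OF sets_bergman refl] measurable_restrict_space1)

lemma continuous_on_measurable_bergman:
  "continuous_on (ball 0 1) f \<Longrightarrow> f \<in> borel_measurable (bergman_measure \<alpha>)"
  using borel_measurable_continuous_on_restrict[of "ball 0 1" f] measurable_cong_sets[OF sets_bergman refl]
  by blast

lemma measurable_id_bergman [measurable]: "(\<lambda>w. w) \<in> borel_measurable (bergman_measure \<alpha>)"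
  by (intro measurable_bergman_borel) simp

text \<open>Functions are controlled on the ball only; extension by zero makes the statements about
  Lebesgue measure on the whole space applicable.\<close>

lemma measurable_bergman_extend:
  assumes "f \<in> borel_measurable (bergman_measure \<alpha> :: (complex^'n) measure)"
  shows "(\<lambda>w. f w * indicator (ball 0 1) w :: ennreal) \<in> borel_measurable borel"
proof -
  have "f \<in> borel_measurable (restrict_space borel (ball 0 1))"
    using assms by (simp add: measurable_cong_sets[OF sets_bergman refl])
  then show ?thesis
    by (subst (asm) borel_measurable_restrict_space_iff_ennreal) auto
qed

abbreviation bergman_mass :: "'n::finite itself \<Rightarrow> real \<Rightarrow> real" where
  "bergman_mass _ \<alpha> \<equiv> (\<integral>u. (1 - (norm u)\<^sup>2) powr \<alpha> \<partial>restrict_space lborel (ball 0 1 :: (complex^'n) set))"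

text \<open>The normaliser in \<open>bergman_measure\<close> is a Bochner integral, whose default
  value 0 would make the density vanish. Comparison with the Gaussian mass (H = 1 in the moment
  identity) shows that it is positive and gives its value.\<close>

lemma nn_integral_ball_weight:
  assumes "\<alpha> > -1"
  shows "(\<integral>\<^sup>+w. ennreal ((1 - (norm w)\<^sup>2) powr \<alpha>) * indicator (ball 0 1 :: (complex^'n) set) w \<partial>lborel) = ennreal (bergman_mass TYPE('n) \<alpha>)"
    and "bergman_mass TYPE('n) \<alpha> > 0"
    and "ennreal (Gamma (real CARD('n) + 1 + \<alpha>)) * ennreal (bergman_mass TYPE('n) \<alpha>) = ennreal (Gamma (\<alpha> + 1)) * gauss_mass TYPE('n)"
proof -
  let ?I = "\<integral>\<^sup>+w. ennreal ((1 - (norm w)\<^sup>2) powr \<alpha>) * indicator (ball 0 1 :: (complex^'n) set) w \<partial>lborel"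
  have eq: "ennreal (Gamma (real CARD('n) + 1 + \<alpha>)) * ?I = ennreal (Gamma (\<alpha> + 1)) * gauss_mass TYPE('n)"
    using ball_moment_eq_gauss_moment[of "\<lambda>_::complex^'n. 1" 0 \<alpha>] assms by (simp add: gauss_mass_def)
  have G: "Gamma (real CARD('n) + 1 + \<alpha>) > 0" "Gamma (\<alpha> + 1) > 0"
    using assms by (auto intro!: Gamma_real_pos)
  have "ennreal (Gamma (\<alpha> + 1)) * gauss_mass TYPE('n) < \<infinity>"
    using gauss_mass[where 'n='n] by (simp add: ennreal_mult_less_top)
  then have "?I \<noteq> \<infinity>"
    using eq G by (auto simp: ennreal_mult_top)
  moreover have "?I \<noteq> 0"
    using eq gauss_mass[where 'n='n] G by auto
  ultimately obtain I where I: "?I = ennreal I" "I > 0"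
    by (cases ?I rule: ennreal_cases) (auto simp: less_le)
  have "(\<integral>\<^sup>+u. ennreal ((1 - (norm u)\<^sup>2) powr \<alpha>) \<partial>restrict_space lborel (ball 0 1 :: (complex^'n) set)) = ennreal I"
    using I by (subst nn_integral_restrict_space) auto
  then have "bergman_mass TYPE('n) \<alpha> = I"
    using I(2) by (intro integral_eq_nn_integral[THEN trans])
      (auto intro!: measurable_restrict_space1)
  then show "?I = ennreal (bergman_mass TYPE('n) \<alpha>)" "bergman_mass TYPE('n) \<alpha> > 0"
    "ennreal (Gamma (real CARD('n) + 1 + \<alpha>)) * ennreal (bergman_mass TYPE('n) \<alpha>) = ennreal (Gamma (\<alpha> + 1)) * gauss_mass TYPE('n)"
    using I eq by auto
qed

lemma nn_integral_bergman:
  fixes f :: "complex^'n \<Rightarrow> ennreal"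
  assumes \<alpha>: "\<alpha> > -1" and f: "f \<in> borel_measurable (bergman_measure \<alpha>)"
  shows "(\<integral>\<^sup>+w. f w \<partial>bergman_measure \<alpha>)
    = ennreal (1 / bergman_mass TYPE('n) \<alpha>) * (\<integral>\<^sup>+w. f w * ennreal ((1 - (norm w)\<^sup>2) powr \<alpha>) * indicator (ball 0 1) w \<partial>lborel)"
proof -
  let ?M = "restrict_space lborel (ball 0 1 :: (complex^'n) set)"
  let ?Z = "bergman_mass TYPE('n) \<alpha>"
  have Z: "?Z > 0" using nn_integral_ball_weight[OF \<alpha>] by simp
  have f': "f \<in> borel_measurable ?M"
    using f by (simp add: measurable_cong_sets[OF sets_bergman refl])
  have [measurable]: "(\<lambda>w. f w * indicator (ball 0 1) w) \<in> borel_measurable borel"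
    by (rule measurable_bergman_extend[OF f])
  have "(\<integral>\<^sup>+w. f w \<partial>bergman_measure \<alpha>) = (\<integral>\<^sup>+w. ennreal ((1 - (norm w)\<^sup>2) powr \<alpha> / ?Z) * f w \<partial>?M)"
    unfolding bergman_measure_def Let_def using f'
    by (subst nn_integral_density) (auto intro!: measurable_restrict_space1)
  also have "\<dots> = (\<integral>\<^sup>+w. ennreal ((1 - (norm w)\<^sup>2) powr \<alpha> / ?Z) * f w * indicator (ball 0 1) w \<partial>lborel)"
    by (subst nn_integral_restrict_space) auto
  also have "\<dots> = (\<integral>\<^sup>+w. ennreal (1 / ?Z) * (ennreal ((1 - (norm w)\<^sup>2) powr \<alpha>) * (f w * indicator (ball 0 1) w)) \<partial>lborel)"
    using Z by (intro nn_integral_cong) (simp add: ennreal_mult'[symmetric] mult.assoc[symmetric])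
  also have "\<dots> = ennreal (1 / ?Z) * (\<integral>\<^sup>+w. ennreal ((1 - (norm w)\<^sup>2) powr \<alpha>) * (f w * indicator (ball 0 1) w) \<partial>lborel)"
    by (rule nn_integral_cmult, rule borel_measurable_times_ennreal)
      (simp_all add: \<open>(\<lambda>w. f w * indicator (ball 0 1) w) \<in> borel_measurable borel\<close>)
  finally show ?thesis by (simp add: mult_ac)
qed

lemma emeasure_space_bergman:
  assumes "\<alpha> > -1"
  shows "emeasure (bergman_measure \<alpha>) (ball (0::complex^'n) 1) = 1"
proof -
  have "emeasure (bergman_measure \<alpha>) (ball (0::complex^'n) 1) = (\<integral>\<^sup>+w. 1 \<partial>(bergman_measure \<alpha> :: (complex^'n) measure))"
    by simp
  also have "\<dots> = 1"
    using nn_integral_ball_weight[OF assms, where 'n='n]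
    by (subst nn_integral_bergman[OF assms]) (auto simp: ennreal_mult'[symmetric])
  finally show ?thesis .
qed

lemma finite_measure_bergman:
  "\<alpha> > -1 \<Longrightarrow> finite_measure (bergman_measure \<alpha> :: (complex^'n) measure)"
  by (intro finite_measureI) (simp add: emeasure_space_bergman)

text \<open>The constant is the quotient of the two masses. The lemma serves to reproduce with a
  larger weight in \<open>peak_bound\<close> and to pass between \<alpha> and \<alpha> + 1 in the
  duality.\<close>

lemma bergman_measure_reweight:
  assumes "\<alpha> > -1" "\<beta> > -1"
  obtains c where "c > 0" "(bergman_measure \<beta> :: (complex^'n) measure)
     = density (bergman_measure \<alpha>) (\<lambda>w. ennreal (c * (1 - (norm w)\<^sup>2) powr (\<beta> - \<alpha>)))"
proof -
  let ?M = "restrict_space lborel (ball 0 1 :: (complex^'n) set)"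
  let ?a = "bergman_mass TYPE('n) \<alpha>" and ?b = "bergman_mass TYPE('n) \<beta>"
  have Z: "?a > 0" "?b > 0" using assms nn_integral_ball_weight by auto
  have "(bergman_measure \<beta> :: (complex^'n) measure)
     = density (bergman_measure \<alpha>) (\<lambda>w. ennreal (?a / ?b * (1 - (norm w)\<^sup>2) powr (\<beta> - \<alpha>)))"
    unfolding bergman_measure_def Let_def
  proof (subst density_density_eq)
    show "density ?M (\<lambda>w. ennreal ((1 - (norm w)\<^sup>2) powr \<beta> / ?b)) = density ?M
      (\<lambda>w. ennreal ((1 - (norm w)\<^sup>2) powr \<alpha> / ?a) * ennreal (?a / ?b * (1 - (norm w)\<^sup>2) powr (\<beta> - \<alpha>)))"
      using Z by (intro density_cong AE_I2)
        (auto intro!: measurable_restrict_space1 simp: ennreal_mult'[symmetric] powr_diff)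
  qed (auto intro!: measurable_restrict_space1)
  then show ?thesis using that[of "?a / ?b"] Z by simp
qed

text \<open>The moment identity for degree 2 m is divided by the one for degree 0: the Gaussian mass
  and Gamma (\<alpha> + 1) cancel, and the remaining Gamma quotient is a Pochhammer symbol.\<close>

lemma bergman_moment:
  fixes e :: "complex^'n"
  assumes \<alpha>: "\<alpha> > -1" and e: "norm e = 1"
  shows "(\<integral>\<^sup>+w. ennreal (norm (cinner_vec w e) ^ (2 * m)) \<partial>bergman_measure \<alpha>)
    = ennreal (fact m / pochhammer (real CARD('n) + 1 + \<alpha>) m)"
proof -
  let ?N = "real CARD('n) + 1 + \<alpha>" and ?Z = "bergman_mass TYPE('n) \<alpha>"
  let ?I = "\<integral>\<^sup>+w. ennreal (norm (cinner_vec w e) ^ (2 * m) * (1 - (norm w)\<^sup>2) powr \<alpha>) * indicator (ball 0 1) w \<partial>lborel"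
  have N: "?N > 0" using \<alpha> by simp
  have G: "Gamma (?N + m) > 0" "Gamma ?N > 0" "Gamma (\<alpha> + 1) > 0"
    using \<alpha> by (auto intro!: Gamma_real_pos)
  obtain g where g: "gauss_mass TYPE('n) = ennreal g" "g > 0"
    using gauss_mass[where 'n='n] by (cases "gauss_mass TYPE('n)" rule: ennreal_cases) (auto simp: less_le)
  have Z: "?Z > 0" "Gamma ?N * ?Z = Gamma (\<alpha> + 1) * g"
    using nn_integral_ball_weight(2,3)[OF \<alpha>, where 'n='n] g G
    by (auto simp: ennreal_mult'[symmetric])
  have "ennreal (Gamma (?N + real m)) * ?I
      = ennreal (Gamma (\<alpha> + 1)) * (\<integral>\<^sup>+w. ennreal (norm (cinner_vec w e) ^ (2 * m) * exp (- (norm w)\<^sup>2)) \<partial>lborel)"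
    by (rule ball_moment_eq_gauss_moment[OF _ _ _ \<alpha>])
      (auto simp: scaleR_eq_scale cinner_vec_scale_left norm_mult power_mult_distrib)
  also have "\<dots> = ennreal (Gamma (\<alpha> + 1) * fact m * g)"
    unfolding gauss_moment[OF e] g(1) using G g by (simp add: ennreal_mult'[symmetric] mult_ac)
  finally have I: "ennreal (Gamma (?N + real m)) * ?I = ennreal (Gamma (\<alpha> + 1) * fact m * g)" .
  have "?I \<noteq> \<infinity>" using I G by (auto simp: ennreal_mult_top)
  then obtain i where i: "?I = ennreal i" "i \<ge> 0" by (cases ?I rule: ennreal_cases) auto
  have "Gamma (?N + real m) * i = Gamma (\<alpha> + 1) * fact m * g"
    using I i G g by (auto simp: ennreal_mult'[symmetric])
  also have "\<dots> = fact m * (Gamma ?N * ?Z)" unfolding Z(2) by simp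
  finally have "i = fact m * (Gamma ?N * ?Z) / Gamma (?N + real m)" using G by (simp add: field_simps)
  moreover have "?N \<notin> \<int>\<^sub>\<le>\<^sub>0" using N by (auto elim: nonpos_Ints_cases)
  then have "pochhammer ?N m = Gamma (?N + m) / Gamma ?N" by (rule pochhammer_Gamma)
  moreover from this have "Gamma (?N + m) = Gamma ?N * pochhammer ?N m" using G by simp
  ultimately have "i = fact m * (Gamma ?N * ?Z) / (Gamma ?N * pochhammer ?N m)" by metis
  then have "1 / ?Z * i = fact m / pochhammer ?N m" using G Z(1) by simp
  moreover have "(\<integral>\<^sup>+w. ennreal (norm (cinner_vec w e) ^ (2 * m)) \<partial>bergman_measure \<alpha>) = ennreal (1 / ?Z) * ?I"
    by (subst nn_integral_bergman[OF \<alpha>]) (auto simp: ennreal_mult'[symmetric])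
  ultimately show ?thesis using i Z by (simp add: ennreal_mult'[symmetric])
qed

lemma measurable_rot_bergman:
  fixes e :: "complex^'n"
  assumes "norm e = 1 \<or> e = 0"
  shows "(\<lambda>(u, w). rot e u w) \<in> circ \<Otimes>\<^sub>M bergman_measure \<alpha> \<rightarrow>\<^sub>M bergman_measure \<alpha>"
proof -
  have "(\<lambda>z. (fst z, snd z)) \<in> circ \<Otimes>\<^sub>M bergman_measure \<alpha> \<rightarrow>\<^sub>M circ \<Otimes>\<^sub>M (borel :: (complex^'n) measure)"
    by measurable
  from measurable_compose[OF this measurable_rot_circ[OF assms]]
  have "(\<lambda>z. rot e (fst z) (snd z)) \<in> circ \<Otimes>\<^sub>M bergman_measure \<alpha> \<rightarrow>\<^sub>M restrict_space borel (ball 0 1)"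
    by (intro measurable_restrict_space2) (auto simp: space_pair_measure norm_rot[OF assms])
  then show ?thesis
    by (simp add: case_prod_beta' measurable_cong_sets[OF refl sets_bergman])
qed

lemma measurable_rot_bergman1:
  assumes "norm e = 1 \<or> e = 0" "norm u = 1"
  shows "rot e u \<in> bergman_measure \<alpha> \<rightarrow>\<^sub>M bergman_measure \<alpha>"
  using measurable_compose[OF measurable_Pair1'[of u circ] measurable_rot_bergman[OF assms(1)]] assms(2)
  by simp

lemma nn_integral_bergman_rot:
  fixes e :: "complex^'n"
  assumes \<alpha>: "\<alpha> > -1" and e: "norm e = 1 \<or> e = 0" and u: "norm u = 1"
    and f: "f \<in> borel_measurable (bergman_measure \<alpha>)"
  shows "(\<integral>\<^sup>+w. f (rot e u w) \<partial>bergman_measure \<alpha>) = (\<integral>\<^sup>+w. f w \<partial>bergman_measure \<alpha>)"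
proof -
  have f': "(\<lambda>w. f (rot e u w)) \<in> borel_measurable (bergman_measure \<alpha>)"
    using measurable_rot_bergman1[OF e u] f by (rule measurable_compose)
  have [measurable]: "(\<lambda>w. f w * indicator (ball 0 1) w) \<in> borel_measurable borel"
    by (rule measurable_bergman_extend[OF f])
  let ?F = "\<lambda>w. (f w * indicator (ball 0 1) w) * ennreal ((1 - (norm w)\<^sup>2) powr \<alpha>)"
  have "(\<integral>\<^sup>+w. ?F (rot e u w) \<partial>lborel) = (\<integral>\<^sup>+w. ?F w \<partial>lborel)"
    by (rule nn_integral_lborel_isometry[OF linear_rot norm_rot[OF e u]]) measurable
  moreover have "indicator (ball 0 1) (rot e u w) = (indicator (ball 0 1) w :: ennreal)" for w
    by (simp add: indicator_def norm_rot[OF e u])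
  ultimately show ?thesis
    unfolding nn_integral_bergman[OF \<alpha> f] nn_integral_bergman[OF \<alpha> f']
    by (simp add: norm_rot[OF e u] mult_ac)
qed

lemma integral_bergman_rot:
  fixes e :: "complex^'n" and f :: "complex^'n \<Rightarrow> complex"
  assumes \<alpha>: "\<alpha> > -1" and e: "norm e = 1 \<or> e = 0" and u: "norm u = 1"
    and f: "f \<in> borel_measurable (bergman_measure \<alpha>)"
  shows "(\<integral>w. f (rot e u w) \<partial>bergman_measure \<alpha>) = (\<integral>w. f w \<partial>bergman_measure \<alpha>)"
proof -
  let ?\<nu> = "bergman_measure \<alpha> :: (complex^'n) measure"
  note rm = measurable_rot_bergman1[OF e u, of \<alpha>]
  have "distr ?\<nu> ?\<nu> (rot e u) = ?\<nu>"
  proof (rule measure_eqI)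
    fix A assume "A \<in> sets (distr ?\<nu> ?\<nu> (rot e u))"
    then have A: "A \<in> sets ?\<nu>" by simp
    have "emeasure (distr ?\<nu> ?\<nu> (rot e u)) A = (\<integral>\<^sup>+w. indicator A w \<partial>distr ?\<nu> ?\<nu> (rot e u))"
      using A by simp
    also have "\<dots> = (\<integral>\<^sup>+w. indicator A (rot e u w) \<partial>?\<nu>)"
      using A by (intro nn_integral_distr[OF rm]) simp
    also have "\<dots> = (\<integral>\<^sup>+w. indicator A w \<partial>?\<nu>)"
      using A by (intro nn_integral_bergman_rot[OF \<alpha> e u]) simp
    finally show "emeasure (distr ?\<nu> ?\<nu> (rot e u)) A = emeasure ?\<nu> A" using A by simp
  qed simp
  then show ?thesis using integral_distr[OF rm f] by simp
qed

text \<open>Fubini is available because the integral over w of the norm of f (rot e u w) is the same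
  finite number for every u.\<close>

lemma integral_bergman_rot_average:
  fixes e :: "complex^'n" and f :: "complex^'n \<Rightarrow> complex"
  assumes \<alpha>: "\<alpha> > -1" and e: "norm e = 1 \<or> e = 0" and f: "integrable (bergman_measure \<alpha>) f"
  shows "(\<integral>w. f w \<partial>bergman_measure \<alpha>) = (\<integral>w. (\<integral>u. f (rot e u w) \<partial>circ) \<partial>bergman_measure \<alpha>)"
    and "integrable (bergman_measure \<alpha>) (\<lambda>w. \<integral>u. f (rot e u w) \<partial>circ)"
proof -
  let ?\<nu> = "bergman_measure \<alpha> :: (complex^'n) measure"
  interpret \<nu>: finite_measure ?\<nu> by (rule finite_measure_bergman[OF \<alpha>])
  interpret pair_sigma_finite circ ?\<nu> ..
  have [measurable]: "f \<in> borel_measurable ?\<nu>" using f by simp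
  have [measurable]: "(\<lambda>(u, w). f (rot e u w)) \<in> borel_measurable (circ \<Otimes>\<^sub>M ?\<nu>)"
    using measurable_compose[OF measurable_rot_bergman[OF e] \<open>f \<in> borel_measurable ?\<nu>\<close>]
    by (simp add: case_prod_beta')
  have int: "integrable (circ \<Otimes>\<^sub>M ?\<nu>) (\<lambda>(u, w). f (rot e u w))"
  proof (rule integrableI_bounded)
    have "(\<integral>\<^sup>+z. ennreal (norm (case z of (u, w) \<Rightarrow> f (rot e u w))) \<partial>(circ \<Otimes>\<^sub>M ?\<nu>))
      = (\<integral>\<^sup>+u. (\<integral>\<^sup>+w. ennreal (norm (f (rot e u w))) \<partial>?\<nu>) \<partial>circ)"
      by (subst \<nu>.nn_integral_fst[symmetric]) (auto simp: case_prod_beta')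
    also have "\<dots> = (\<integral>\<^sup>+u. (\<integral>\<^sup>+w. ennreal (norm (f w)) \<partial>?\<nu>) \<partial>circ)"
      by (intro nn_integral_cong nn_integral_bergman_rot[OF \<alpha> e, where f="\<lambda>w. ennreal (norm (f w))"]) auto
    also have "\<dots> < \<infinity>" using f by (simp add: integrable_iff_bounded)
    finally show "(\<integral>\<^sup>+z. ennreal (norm (case z of (u, w) \<Rightarrow> f (rot e u w))) \<partial>(circ \<Otimes>\<^sub>M ?\<nu>)) < \<infinity>" .
  qed simp
  have "(\<integral>w. f w \<partial>?\<nu>) = (\<integral>u. (\<integral>w. f w \<partial>?\<nu>) \<partial>circ)" by simp
  also have "\<dots> = (\<integral>u. (\<integral>w. f (rot e u w) \<partial>?\<nu>) \<partial>circ)"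
    by (intro Bochner_Integration.integral_cong integral_bergman_rot[OF \<alpha> e, symmetric]) auto
  also have "\<dots> = (\<integral>w. (\<integral>u. f (rot e u w) \<partial>circ) \<partial>?\<nu>)"
    using Fubini_integral[OF int] by simp
  finally show "(\<integral>w. f w \<partial>?\<nu>) = (\<integral>w. (\<integral>u. f (rot e u w) \<partial>circ) \<partial>?\<nu>)" .
  show "integrable ?\<nu> (\<lambda>w. \<integral>u. f (rot e u w) \<partial>circ)"
    using integrable_snd[OF int] by simp
qed

section \<open>Slices of holomorphic functions\<close>

lemma holomorphic_vec_slice:
  assumes "holomorphic_vec f S"
  shows "(\<lambda>\<mu>. f (a + \<mu> *s v)) holomorphic_on {\<mu>. a + \<mu> *s v \<in> S}"
proof (rule holomorphic_onI)
  fix \<mu> assume "\<mu> \<in> {\<mu>. a + \<mu> *s v \<in> S}"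
  then obtain D where D: "(f has_derivative D) (at (a + \<mu> *s v))" "\<And>c x. D (c *s x) = c * D x"
    using assms unfolding holomorphic_vec_def by blast
  have "((\<lambda>\<mu>. a + \<mu> *s v) has_derivative (\<lambda>h. h *s v)) (at \<mu>)"
  proof -
    have "bounded_linear (\<lambda>h::complex. h *s v)"
      by (intro linear_conv_bounded_linear[THEN iffD1] linearI)
        (simp_all add: vec_eq_iff algebra_simps)
    then show ?thesis
      by (auto intro!: derivative_eq_intros bounded_linear_imp_has_derivative)
  qed
  from has_derivative_compose[OF this D(1)]
  have "((\<lambda>\<mu>. f (a + \<mu> *s v)) has_derivative (\<lambda>h. D v * h)) (at \<mu>)"
    by (simp add: D(2) mult.commute)
  then show "(\<lambda>\<mu>. f (a + \<mu> *s v)) field_differentiable at \<mu> within {\<mu>. a + \<mu> *s v \<in> S}"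
    using field_differentiable_def has_field_derivative_def field_differentiable_at_within by metis
qed

lemma holomorphic_vec_continuous_on:
  "holomorphic_vec f S \<Longrightarrow> continuous_on S f"
  unfolding holomorphic_vec_def
  by (meson continuous_at_imp_continuous_on has_derivative_continuous)

lemma measurable_holomorphic_vec:
  "holomorphic_vec f (ball 0 1) \<Longrightarrow> f \<in> borel_measurable (bergman_measure \<alpha>)"
  by (intro continuous_on_measurable_bergman holomorphic_vec_continuous_on)

lemma power_series_abs_summable:
  fixes b :: "nat \<Rightarrow> complex"
  assumes "\<And>\<mu>. norm \<mu> < R \<Longrightarrow> summable (\<lambda>m. b m * \<mu> ^ m)" and "norm \<mu> < R"
  shows "summable (\<lambda>m. norm (b m * \<mu> ^ m))"
proof -
  define \<rho> where "\<rho> = (norm \<mu> + R) / 2"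
  have "norm \<mu> < \<rho>" "\<rho> < R" using assms(2) by (auto simp: \<rho>_def)
  moreover from this have "\<rho> > 0" using norm_ge_zero[of \<mu>] by linarith
  ultimately show ?thesis
    using powser_insidea[of b "of_real \<rho>" \<mu>] assms(1)[of "of_real \<rho>"] by simp
qed

lemma holomorphic_vec_slice_series:
  fixes e :: "complex^'n"
  assumes "holomorphic_vec f (ball 0 1)" "norm e = 1"
  obtains \<beta> where "\<And>\<mu>. norm \<mu> < 1 \<Longrightarrow> (\<lambda>m. \<beta> m * \<mu> ^ m) sums f (\<mu> *s e)"
proof -
  have "(\<lambda>\<mu>. f (0 + \<mu> *s e)) holomorphic_on {\<mu>. 0 + \<mu> *s e \<in> ball 0 1}"
    by (rule holomorphic_vec_slice[OF assms(1)])
  also have "{\<mu>. 0 + \<mu> *s e \<in> ball 0 1} = ball 0 1" using assms(2) by (auto simp: norm_scale_vec)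
  finally have "(\<lambda>\<mu>. f (\<mu> *s e)) holomorphic_on ball 0 1" by simp
  from holomorphic_power_series[OF this] show ?thesis
    by (intro that[of "\<lambda>m. (deriv ^^ m) (\<lambda>\<mu>. f (\<mu> *s e)) 0 / fact m"]) simp
qed

text \<open>As a function of u, \<open>rot e u w\<close> runs through a complex affine disc centred
  at the projection of w on e. The mean value property on this disc gives the value of f at the
  centre.\<close>

lemma rot_mean_value:
  fixes e w :: "complex^'n"
  assumes f: "holomorphic_vec f (ball 0 1)" and e: "norm e = 1" and w: "norm w < 1"
  shows "(\<integral>u. f (rot e u w) \<partial>circ) = f (cinner_vec w e *s e)"
proof -
  define a where "a = cinner_vec w e *s e"
  define v where "v = w - a"
  \<comment> \<open>Larger than 1 and with R |w| < 1: the disc of radius R still lies in the ball,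
    so the unit circle is inside the disc of convergence and the coefficients are absolutely
    summable.\<close>
  define R where "R = 2 / (1 + norm w)"
  have pos: "1 + norm w > 0" by (simp add: add_pos_nonneg)
  have R: "R > 1" and Rw: "R * norm w < 1" using w pos by (simp_all add: R_def field_simps)
  have in_ball: "a + \<mu> *s v \<in> ball 0 1" if "norm \<mu> < R" for \<mu>
  proof -
    have "cinner_vec v a = 0"
      using e unfolding a_def v_def
      by (simp add: cinner_vec_diff_left cinner_vec_scale_left cinner_vec_scale_right cinner_vec_self)
    then have "(c *s v) \<bullet> a = 0" for c
      by (metis Re_cinner_vec cinner_vec_scale_left mult_zero_right zero_complex.sel(1))
    then have pyth: "(norm (a + c *s v))\<^sup>2 = (norm a)\<^sup>2 + (norm c * norm v)\<^sup>2" for c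
      by (simp add: norm_add_Pythagorean orthogonal_def inner_commute norm_scale_vec)
    have w2: "(norm w)\<^sup>2 = (norm a)\<^sup>2 + (norm v)\<^sup>2" using pyth[of 1] by (simp add: v_def)
    have "norm a \<le> R * norm a" using R by (simp add: mult_le_cancel_right1)
    moreover have "norm \<mu> * norm v \<le> R * norm v" using that by (simp add: mult_right_mono)
    ultimately have "(norm (a + \<mu> *s v))\<^sup>2 \<le> (R * norm a)\<^sup>2 + (R * norm v)\<^sup>2"
      unfolding pyth by (intro add_mono power_mono) auto
    also have "\<dots> = (R * norm w)\<^sup>2" by (simp add: power_mult_distrib w2 distrib_left)
    finally have "norm (a + \<mu> *s v) \<le> R * norm w"
      by (rule power2_le_imp_le) (use R in simp)
    then show ?thesis using Rw by simp
  qed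
  have "(\<lambda>\<mu>. f (a + \<mu> *s v)) holomorphic_on ball 0 R"
    using in_ball by (intro holomorphic_on_subset[OF holomorphic_vec_slice[OF f]]) auto
  from holomorphic_power_series[OF this]
  have s: "(\<lambda>m. (deriv ^^ m) (\<lambda>\<mu>. f (a + \<mu> *s v)) 0 / fact m * \<mu> ^ m) sums f (a + \<mu> *s v)" (is "(\<lambda>m. ?b m * _) sums _")
    if "norm \<mu> < R" for \<mu> using that by simp
  have "summable (\<lambda>m. norm (?b m * 1 ^ m))"
    by (rule power_series_abs_summable[of R]) (use sums_summable[OF s] R in auto)
  then have mv: "(\<integral>u. (\<Sum>m. ?b m * u ^ m) \<partial>circ) = ?b 0" by (intro circ_mean_value) simp
  have "(\<integral>u. (\<Sum>m. ?b m * u ^ m) \<partial>circ) = (\<integral>u. f (rot e u w) \<partial>circ)"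
  proof (rule Bochner_Integration.integral_cong[OF refl])
    fix u assume "u \<in> space circ"
    then have "norm u < R" using R by simp
    from sums_unique[OF s[OF this], symmetric]
    show "(\<Sum>m. ?b m * u ^ m) = f (rot e u w)" by (simp only: rot_def a_def v_def)
  qed
  from trans[OF this[symmetric] mv] show ?thesis
    by (simp only: a_def funpow_0 fact_0 div_by_1 vector_smult_lzero add_0_right)
qed

section \<open>Integrals against kernels\<close>

lemma continuous_on_kernel:
  assumes "continuous_on (ball 0 1) \<kappa>" "norm (z :: complex^'n) < 1"
  shows "continuous_on (ball 0 1) (\<lambda>w. \<kappa> (cinner_vec z w))"
proof (rule continuous_on_compose2[OF assms(1)])
  show "continuous_on (ball 0 1) (\<lambda>w. cinner_vec z w)"
    by (intro continuous_on_cinner_vec continuous_on_const continuous_on_id)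
  show "(\<lambda>w. cinner_vec z w) ` ball 0 1 \<subseteq> ball 0 1"
    using norm_cinner_vec_less[OF assms(2)] by auto
qed

text \<open>For fixed z the products stay in the closed disc of radius |z|, a compact part of the
  unit disc.\<close>

lemma kernel_bounded:
  fixes \<kappa> :: "complex \<Rightarrow> complex" and z :: "complex^'n"
  assumes "continuous_on (ball 0 1) \<kappa>" "norm z < 1"
  obtains B where "\<And>w. norm w < 1 \<Longrightarrow> norm (\<kappa> (cinner_vec z w)) \<le> B"
proof -
  have "continuous_on (cball 0 (norm z)) \<kappa>"
    using assms by (intro continuous_on_subset[OF assms(1)]) auto
  then have "bounded (\<kappa> ` cball 0 (norm z))"
    by (intro compact_imp_bounded compact_continuous_image) auto
  then obtain B where "\<forall>y\<in>\<kappa> ` cball 0 (norm z). norm y \<le> B" unfolding bounded_iff by blast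
  then have B: "norm (\<kappa> x) \<le> B" if "norm x \<le> norm z" for x using that by simp
  have "norm (\<kappa> (cinner_vec z w)) \<le> B" if "norm w < 1" for w
  proof (rule B)
    have "norm z * norm w \<le> norm z" using that by (simp add: mult_left_le)
    then show "norm (cinner_vec z w) \<le> norm z" using norm_cinner_vec_le[of z w] by linarith
  qed
  then show ?thesis by (rule that)
qed

lemma integrable_bounded_mult:
  fixes f g :: "'a \<Rightarrow> complex"
  assumes "integrable M f" "g \<in> borel_measurable M" "\<And>w. w \<in> space M \<Longrightarrow> norm (g w) \<le> B"
  shows "integrable M (\<lambda>w. f w * g w)"
proof (rule Bochner_Integration.integrable_bound[of _ "\<lambda>w. f w * of_real B"])
  show "AE w in M. norm (f w * g w) \<le> norm (f w * complex_of_real B)"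
    using assms(3) by (auto intro!: AE_I2 mult_left_mono intro: order.trans[OF _ abs_ge_self] simp: norm_mult)
qed (use assms in auto)

lemma integrable_kernel:
  fixes \<kappa> :: "complex \<Rightarrow> complex" and f :: "complex^'n \<Rightarrow> complex"
  assumes "continuous_on (ball 0 1) \<kappa>" "norm (z :: complex^'n) < 1" "integrable (bergman_measure \<alpha>) f"
  shows "integrable (bergman_measure \<alpha>) (\<lambda>w. f w * \<kappa> (cinner_vec z w))"
  using kernel_bounded[OF assms(1,2)] continuous_on_measurable_bergman[OF continuous_on_kernel[OF assms(1,2)]]
  by (metis assms(3) dist_0_norm integrable_bounded_mult mem_ball space_bergman)

lemma power_series_continuous_on:
  assumes "\<And>x. norm x < 1 \<Longrightarrow> (\<lambda>m. c m * x ^ m) sums \<kappa> (x::complex)"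
  shows "continuous_on (ball 0 1) \<kappa>" "\<kappa> holomorphic_on ball 0 1"
proof -
  show "\<kappa> holomorphic_on ball 0 1"
    by (rule power_series_holomorphic[where a=c]) (use assms in auto)
  then show "continuous_on (ball 0 1) \<kappa>" by (rule holomorphic_on_imp_continuous_on)
qed

(* Rotating about e reduces f to the slice through e, and rotating everything isolates the diagonal
   terms of the two power series. *)
theorem integral_kernel_sums:
  fixes e :: "complex^'n" and \<beta> c :: "nat \<Rightarrow> complex"
  assumes \<alpha>: "\<alpha> > -1" and f: "holomorphic_vec f (ball 0 1)" and int: "integrable (bergman_measure \<alpha>) f"
    and e: "norm e = 1" and t: "0 \<le> t" "t < 1"
    and \<beta>: "\<And>\<mu>. norm \<mu> < 1 \<Longrightarrow> (\<lambda>m. \<beta> m * \<mu> ^ m) sums f (\<mu> *s e)"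
    and c: "\<And>x. norm x < 1 \<Longrightarrow> (\<lambda>m. c m * x ^ m) sums \<kappa> x"
  shows "(\<lambda>m. \<beta> m * of_real t ^ m * c m * of_real (fact m / pochhammer (real CARD('n) + 1 + \<alpha>) m)) sums
    (\<integral>w. f w * \<kappa> (cinner_vec (of_real t *s e) w) \<partial>bergman_measure \<alpha>)"
proof -
  let ?\<nu> = "bergman_measure \<alpha> :: (complex^'n) measure"
  interpret \<nu>: finite_measure ?\<nu> by (rule finite_measure_bergman[OF \<alpha>])
  define z where "z = of_real t *s e"
  have z: "norm z < 1" using e t by (simp add: z_def norm_scale_vec)
  note \<kappa> = power_series_continuous_on(1)[OF c]
  have zw: "cinner_vec z w = of_real t * cnj (cinner_vec w e)" for w
    by (subst cinner_vec_commute) (simp add: z_def cinner_vec_scale_right)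
  have we: "norm (cinner_vec w e) < 1" if "norm w < 1" for w
    using norm_cinner_vec_le[of w e] that e by simp
  define g where "g = (\<lambda>w. f w * \<kappa> (cinner_vec z w))"
  have g: "integrable ?\<nu> g" unfolding g_def by (rule integrable_kernel[OF \<kappa> z int])
  define h where "h = (\<lambda>w. f (cinner_vec w e *s e) * \<kappa> (cinner_vec z w))"
  \<comment> \<open>The rotations fix \<open>cinner_vec w e\<close>, hence also the kernel factor,
    so only f is averaged and becomes its value at the projection of w on e.\<close>
  have gh: "(\<integral>u. g (rot e u w) \<partial>circ) = h w" if "w \<in> space ?\<nu>" for w
  proof -
    have "(\<integral>u. g (rot e u w) \<partial>circ) = (\<integral>u. f (rot e u w) * \<kappa> (cinner_vec z w) \<partial>circ)"
      unfolding g_def zw by (simp add: cinner_vec_rot[OF e])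
    then show ?thesis using rot_mean_value[OF f e, of w] that by (simp add: h_def)
  qed
  have ee: "norm e = 1 \<or> e = 0" using e by simp
  have "integrable ?\<nu> (\<lambda>w. \<integral>u. g (rot e u w) \<partial>circ) \<longleftrightarrow> integrable ?\<nu> h"
    by (rule Bochner_Integration.integrable_cong[OF refl gh])
  then have hint: "integrable ?\<nu> h"
    using integral_bergman_rot_average(2)[OF \<alpha> ee g] by blast
  have "(\<integral>w. (\<integral>u. g (rot e u w) \<partial>circ) \<partial>?\<nu>) = (\<integral>w. h w \<partial>?\<nu>)"
    by (rule Bochner_Integration.integral_cong[OF refl gh])
  then have gh_int: "(\<integral>w. g w \<partial>?\<nu>) = (\<integral>w. h w \<partial>?\<nu>)"
    using integral_bergman_rot_average(1)[OF \<alpha> ee g] by simp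
  define d where "d = (\<lambda>m. \<beta> m * c m * of_real t ^ m)"
  have sm\<beta>: "summable (\<lambda>m. norm (\<beta> m * x ^ m))" and smc: "summable (\<lambda>m. norm (c m * x ^ m))" if "norm x < 1" for x
    using that \<beta> c by (auto intro!: power_series_abs_summable[of 1] simp: sums_iff)
  have h_avg: "(\<lambda>m. d m * of_real (norm (cinner_vec w e) ^ (2 * m))) sums (\<integral>u. h (rot 0 u w) \<partial>circ)"
    if "w \<in> space ?\<nu>" for w
  proof -
    define \<mu> where "\<mu> = cinner_vec w e"
    have \<mu>: "norm \<mu> < 1" using we[of w] that by (simp add: \<mu>_def)
    have t\<mu>: "norm (of_real t * \<mu>) < 1" using t \<mu> by (auto simp: norm_mult intro: order.strict_trans1[OF mult_left_le_one_le])
    \<comment> \<open>Scalar rotation of w by u multiplies \<mu> by u. The kernel factor is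
      antiholomorphic in w, so it is the conjugate of a power series in u with conjugated
      coefficients, the form Parseval asks for.\<close>
    define a where "a = (\<lambda>m. \<beta> m * \<mu> ^ m)"
    define b where "b = (\<lambda>m. cnj (c m) * (of_real t * \<mu>) ^ m)"
    have a: "summable (\<lambda>m. norm (a m))" unfolding a_def by (rule sm\<beta>[OF \<mu>])
    have b: "summable (\<lambda>m. norm (b m))" using smc[OF t\<mu>] by (simp add: b_def norm_mult)
    have "h (rot 0 u w) = (\<Sum>m. a m * u ^ m) * cnj (\<Sum>m. b m * u ^ m)" if u: "norm u = 1" for u
    proof -
      have "(\<lambda>m. \<beta> m * (u * \<mu>) ^ m) sums f ((u * \<mu>) *s e)"
        using u \<mu> by (intro \<beta>) (simp add: norm_mult)
      then have 1: "(\<Sum>m. a m * u ^ m) = f ((u * \<mu>) *s e)"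
        by (simp add: sums_iff a_def power_mult_distrib mult_ac)
      have "(\<lambda>m. c m * (of_real t * cnj (u * \<mu>)) ^ m) sums \<kappa> (of_real t * cnj (u * \<mu>))"
        using u t\<mu> by (intro c) (simp add: norm_mult)
      moreover have "c m * (of_real t * cnj (u * \<mu>)) ^ m = cnj (b m * u ^ m)" for m
        by (simp add: b_def power_mult_distrib mult_ac)
      ultimately have "(\<lambda>m. cnj (b m * u ^ m)) sums cnj (cnj (\<kappa> (of_real t * cnj (u * \<mu>))))" by simp
      then have "(\<lambda>m. b m * u ^ m) sums cnj (\<kappa> (of_real t * cnj (u * \<mu>)))" unfolding sums_cnj .
      then have 2: "cnj (\<Sum>m. b m * u ^ m) = \<kappa> (of_real t * cnj (u * \<mu>))" by (simp add: sums_iff)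
      show ?thesis
        unfolding 1 2 h_def zw rot_0 cinner_vec_scale_left \<mu>_def by simp
    qed
    then have "(\<integral>u. h (rot 0 u w) \<partial>circ) = (\<integral>u. (\<Sum>m. a m * u ^ m) * cnj (\<Sum>m. b m * u ^ m) \<partial>circ)"
      by (intro Bochner_Integration.integral_cong) auto
    moreover have "a m * cnj (b m) = d m * of_real (norm \<mu> ^ (2 * m))" for m
    proof -
      have "a m * cnj (b m) = d m * (\<mu> * cnj \<mu>) ^ m"
        by (simp add: a_def b_def d_def power_mult_distrib mult_ac)
      also have "\<mu> * cnj \<mu> = of_real (norm \<mu> ^ 2)" by (simp only: complex_norm_square)
      finally show ?thesis by (simp only: of_real_power[symmetric] power_mult)
    qed
    ultimately show ?thesis using circ_parseval[OF a b] by (simp only: \<mu>_def)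
  qed
  \<comment> \<open>Splitting t as sqrt t * sqrt t gives each of the two series an argument inside
    the disc: one is absolutely summable there, the other has bounded terms.\<close>
  have smd: "summable (\<lambda>m. norm (d m))"
  proof -
    have st: "norm (complex_of_real (sqrt t)) < 1" using t by simp
    have "Bseq (\<lambda>m. c m * of_real (sqrt t) ^ m)"
      by (intro convergent_imp_Bseq convergentI[OF summable_LIMSEQ_zero] summable_norm_cancel[OF smc[OF st]])
    then obtain K where K: "\<And>m. norm (c m * of_real (sqrt t) ^ m) \<le> K" unfolding Bseq_def by blast
    have eq: "norm (d m) = norm (\<beta> m * of_real (sqrt t) ^ m) * norm (c m * of_real (sqrt t) ^ m)" for m
    proof -
      have "t ^ m = sqrt t ^ m * sqrt t ^ m" using t by (simp add: power_mult_distrib[symmetric])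
      then have "norm (d m) = norm (\<beta> m) * norm (c m) * (sqrt t ^ m * sqrt t ^ m)"
        using t by (simp only: d_def norm_mult norm_power norm_of_real abs_of_nonneg)
      then show ?thesis using t by (simp only: norm_mult norm_power norm_of_real abs_of_nonneg real_sqrt_ge_zero) (simp only: mult_ac)
    qed
    show ?thesis
    proof (rule summable_comparison_test'[where N=0])
      show "summable (\<lambda>m. norm (\<beta> m * of_real (sqrt t) ^ m) * K)"
        by (intro summable_mult2 sm\<beta> st)
      have "norm (d m) \<le> norm (\<beta> m * of_real (sqrt t) ^ m) * K" for m
        unfolding eq by (rule mult_left_mono[OF K]) simp
      then show "norm (norm (d m)) \<le> norm (\<beta> m * of_real (sqrt t) ^ m) * K" for m
        by (simp only: real_norm_def abs_norm_cancel)
    qed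
  qed
  have "(\<lambda>m. \<integral>w. d m * of_real (norm (cinner_vec w e) ^ (2 * m)) \<partial>?\<nu>) sums
    (\<integral>w. (\<Sum>m. d m * of_real (norm (cinner_vec w e) ^ (2 * m))) \<partial>?\<nu>)"
  proof (rule sums_integral_bounded[OF \<nu>.finite_measure_axioms _ _ smd])
    show "norm (d m * of_real (norm (cinner_vec w e) ^ (2 * m))) \<le> norm (d m)" if "w \<in> space ?\<nu>" for m w
      using we[of w] that by (simp add: norm_mult norm_power mult_left_le power_le_one)
  qed measurable
  also have "(\<integral>w. (\<Sum>m. d m * of_real (norm (cinner_vec w e) ^ (2 * m))) \<partial>?\<nu>)
      = (\<integral>w. (\<integral>u. h (rot 0 u w) \<partial>circ) \<partial>?\<nu>)"
    using h_avg by (intro Bochner_Integration.integral_cong) (auto simp: sums_iff)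
  also have "\<dots> = (\<integral>w. g w \<partial>?\<nu>)"
    using integral_bergman_rot_average(1)[OF \<alpha> _ hint, of 0] gh_int by simp
  also have "(\<lambda>m. \<integral>w. d m * of_real (norm (cinner_vec w e) ^ (2 * m)) \<partial>?\<nu>)
    = (\<lambda>m. \<beta> m * of_real t ^ m * c m * of_real (fact m / pochhammer (real CARD('n) + 1 + \<alpha>) m))"
  proof
    fix m
    have "pochhammer (real CARD('n) + 1 + \<alpha>) m \<ge> 0"
      using \<alpha> by (intro pochhammer_nonneg) auto
    then have "(\<integral>w. norm (cinner_vec w e) ^ (2 * m) \<partial>?\<nu>) = fact m / pochhammer (real CARD('n) + 1 + \<alpha>) m"
      by (subst integral_eq_nn_integral) (auto simp: bergman_moment[OF \<alpha> e])
    moreover have "(\<integral>w. d m * of_real (norm (cinner_vec w e) ^ (2 * m)) \<partial>?\<nu>)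
       = d m * of_real (\<integral>w. norm (cinner_vec w e) ^ (2 * m) \<partial>?\<nu>)"
      unfolding integral_complex_of_real[symmetric] by (rule integral_mult_right_zero)
    ultimately show "(\<integral>w. d m * of_real (norm (cinner_vec w e) ^ (2 * m)) \<partial>?\<nu>)
      = \<beta> m * of_real t ^ m * c m * of_real (fact m / pochhammer (real CARD('n) + 1 + \<alpha>) m)"
      by (simp add: d_def)
  qed
  finally show ?thesis by (simp add: g_def z_def)
qed

section \<open>The Bergman kernel and its radial derivatives\<close>

text \<open>The one-variable profile of the Bergman kernel, to be evaluated at <z,w>. The exponent
  is free because the same function also provides square roots of kernels and the kernels of shifted
  weights.\<close>

definition bkern :: "real \<Rightarrow> complex \<Rightarrow> complex" where
  "bkern s x = (1 - x) powr (- of_real s)"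

lemma bkern_sums:
  assumes "norm x < 1"
  shows "(\<lambda>m. of_real (pochhammer s m / fact m) * x ^ m) sums bkern s x"
proof -
  have "(\<lambda>m. (- complex_of_real s gchoose m) * (- x) ^ m) sums (1 + (- x)) powr (- of_real s)"
    by (rule gen_binomial_complex) (use assms in simp)
  moreover have "(- complex_of_real s gchoose m) * (- x) ^ m = of_real (pochhammer s m / fact m) * x ^ m" for m
  proof -
    have "(- 1 :: complex) ^ m * (- x) ^ m = x ^ m" by (simp add: power_mult_distrib[symmetric])
    then show ?thesis
      by (simp add: gbinomial_pochhammer pochhammer_of_real mult_ac)
  qed
  ultimately show ?thesis by (simp add: bkern_def)
qed

lemma one_minus_nonzero: "norm x < 1 \<Longrightarrow> 1 - x \<noteq> (0::complex)"
  by auto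

lemma norm_bkern:
  assumes "norm x < 1"
  shows "norm (bkern s x) = norm (1 - x) powr (- s)"
  using one_minus_nonzero[OF assms] by (simp add: bkern_def powr_def norm_exp_eq_Re)

lemma bkern_cnj:
  assumes "norm x < 1"
  shows "bkern s (cnj x) = cnj (bkern s x)"
proof -
  have "(\<lambda>m. cnj (of_real (pochhammer s m / fact m) * x ^ m)) sums cnj (bkern s x)"
    using bkern_sums[OF assms] by (simp only: sums_cnj)
  moreover have "(\<lambda>m. of_real (pochhammer s m / fact m) * cnj x ^ m) sums bkern s (cnj x)"
    using assms by (intro bkern_sums) simp
  ultimately show ?thesis by (simp add: sums_unique2)
qed

lemma bkern_holomorphic: "bkern s holomorphic_on ball 0 1"
  using power_series_continuous_on(2)[OF bkern_sums] .

text \<open>Radial differentiation multiplies the coefficient of degree m by m, and m * (s)_m = s *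
  ((s+1)_m - (s)_m). Hence R^k of a kernel is a combination of kernels with exponents s, ..., s + k,
  which gives its size near the boundary.\<close>

lemma radial_coeff_combination:
  assumes s: "s > (0::real)"
  shows "\<exists>a. \<forall>m. real m ^ k * pochhammer s m = (\<Sum>j\<le>k. a j * pochhammer (s + real j) m)"
proof (induction k)
  case 0
  show ?case by (intro exI[of _ "\<lambda>_. 1"]) simp
next
  case (Suc k)
  then obtain a where a: "\<And>m. real m ^ k * pochhammer s m = (\<Sum>j\<le>k. a j * pochhammer (s + real j) m)" by blast
  define p where "p = (\<lambda>j m. pochhammer (s + real j) m)"
  have step: "real m * p j m = (s + j) * p (Suc j) m - (s + j) * p j m" for j m
  proof -
    have "(s + j) * p (Suc j) m = (s + j + m) * p j m"
    proof -
      have "pochhammer (s + j) (Suc m) = (s + j) * p (Suc j) m" by (simp add: pochhammer_rec p_def add_ac)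
      moreover have "pochhammer (s + j) (Suc m) = (s + j + m) * p j m" by (simp add: pochhammer_rec' p_def)
      ultimately show ?thesis by simp
    qed
    then show ?thesis by (simp add: algebra_simps)
  qed
  define a' where "a' = (\<lambda>j. (case j of 0 \<Rightarrow> 0 | Suc i \<Rightarrow> a i * (s + i)) - (if j \<le> k then a j * (s + j) else 0))"
  have "real m ^ Suc k * pochhammer s m = (\<Sum>j\<le>Suc k. a' j * p j m)" for m
  proof -
    have "real m ^ Suc k * pochhammer s m = (\<Sum>j\<le>k. a j * (real m * p j m))"
      using a[of m] by (simp add: p_def sum_distrib_left mult_ac)
    also have "\<dots> = (\<Sum>j\<le>k. a j * (s + j) * p (Suc j) m) - (\<Sum>j\<le>k. a j * (s + j) * p j m)"
      unfolding step by (simp add: sum_subtractf[symmetric] algebra_simps)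
    also have "(\<Sum>j\<le>k. a j * (s + j) * p (Suc j) m) = (\<Sum>j\<le>Suc k. (case j of 0 \<Rightarrow> 0 | Suc i \<Rightarrow> a i * (s + i)) * p j m)"
      by (subst sum.atMost_Suc_shift) simp
    also have "(\<Sum>j\<le>k. a j * (s + j) * p j m) = (\<Sum>j\<le>Suc k. (if j \<le> k then a j * (s + j) else 0) * p j m)"
      by simp
    finally show ?thesis unfolding a'_def left_diff_distrib sum_subtractf .
  qed
  then show ?case unfolding p_def by blast
qed

text \<open>The operator x d/dx applied k times to \<open>bkern s\<close>, that is, R^k of the
  kernel as a function of <z,w>. As 0^0 = 1, the case k = 0 keeps the constant term and is
  \<open>bkern s\<close> itself.\<close>

definition rkern :: "real \<Rightarrow> nat \<Rightarrow> complex \<Rightarrow> complex" where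
  "rkern s k x = (\<Sum>m. of_real (real m ^ k * pochhammer s m / fact m) * x ^ m)"

lemma rkern_sums_bound:
  assumes s: "s > 0"
  shows "norm x < 1 \<Longrightarrow> (\<lambda>m. of_real (real m ^ k * pochhammer s m / fact m) * x ^ m) sums rkern s k x"
    and "\<exists>C>0. \<forall>x. norm x < 1 \<longrightarrow> norm (rkern s k x) \<le> C * norm (1 - x) powr (- (s + k))"
proof -
  obtain a where a: "\<And>m. real m ^ k * pochhammer s m = (\<Sum>j\<le>k. a j * pochhammer (s + real j) m)"
    using radial_coeff_combination[OF s] by blast
  have sums: "(\<lambda>m. of_real (real m ^ k * pochhammer s m / fact m) * x ^ m) sums (\<Sum>j\<le>k. of_real (a j) * bkern (s + j) x)"
    if x: "norm x < 1" for x
  proof -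
    have "(\<lambda>m. \<Sum>j\<le>k. of_real (a j) * (of_real (pochhammer (s + j) m / fact m) * x ^ m)) sums (\<Sum>j\<le>k. of_real (a j) * bkern (s + j) x)"
      by (intro sums_sum sums_mult bkern_sums x)
    moreover have "(\<Sum>j\<le>k. of_real (a j) * (of_real (pochhammer (s + j) m / fact m) * x ^ m))
      = of_real (real m ^ k * pochhammer s m / fact m) * x ^ m" for m
      unfolding a by (simp add: sum_distrib_right sum_divide_distrib mult.assoc)
    ultimately show ?thesis by simp
  qed
  then have eq: "rkern s k x = (\<Sum>j\<le>k. of_real (a j) * bkern (s + j) x)" if "norm x < 1" for x
    unfolding rkern_def using that by (simp add: sums_iff)
  show "norm x < 1 \<Longrightarrow> (\<lambda>m. of_real (real m ^ k * pochhammer s m / fact m) * x ^ m) sums rkern s k x"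
    using sums eq by simp
  define C where "C = 1 + (\<Sum>j\<le>k. \<bar>a j\<bar> * 2 ^ k)"
  have "norm (rkern s k x) \<le> C * norm (1 - x) powr (- (s + k))" if x: "norm x < 1" for x
  proof -
    let ?y = "norm (1 - x)"
    have y: "?y > 0" using one_minus_nonzero[OF x] by simp
    have y2: "?y \<le> 2" using norm_triangle_ineq4[of 1 x] x by simp
    \<comment> \<open>The lower exponents are absorbed by the highest one because |1 - x| is at most
      2; this costs at most 2^k.\<close>
    have le: "?y powr (- (s + j)) \<le> 2 ^ k * ?y powr (- (s + k))" if "j \<le> k" for j
    proof -
      have "?y powr (- (s + j)) = ?y ^ (k - j) * ?y powr (- (s + k))"
      proof -
        have "- (s + real j) = real (k - j) + - (s + real k)" using that by (simp add: of_nat_diff)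
        then show ?thesis using y by (simp only: powr_add powr_realpow)
      qed
      also have "?y ^ (k - j) \<le> 2 ^ (k - j)" using y2 by (intro power_mono) auto
      also have "(2::real) ^ (k - j) \<le> 2 ^ k" by (intro power_increasing) auto
      finally show ?thesis by (simp add: mult_right_mono)
    qed
    have "norm (rkern s k x) \<le> (\<Sum>j\<le>k. norm (of_real (a j) * bkern (s + j) x))"
      unfolding eq[OF x] by (rule norm_sum)
    also have "\<dots> \<le> (\<Sum>j\<le>k. \<bar>a j\<bar> * (2 ^ k * ?y powr (- (s + k))))"
      using le by (intro sum_mono) (simp add: norm_mult norm_bkern[OF x] mult_left_mono)
    also have "\<dots> \<le> C * ?y powr (- (s + k))"
      by (simp add: C_def sum_distrib_right distrib_right mult.assoc)
    finally show ?thesis .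
  qed
  moreover have "C > 0" unfolding C_def by (intro add_pos_nonneg sum_nonneg) auto
  ultimately show "\<exists>C>0. \<forall>x. norm x < 1 \<longrightarrow> norm (rkern s k x) \<le> C * norm (1 - x) powr (- (s + k))" by blast
qed

lemma rkern_0: "norm x < 1 \<Longrightarrow> rkern s 0 x = bkern s x"
  using bkern_sums[of x s] by (simp add: rkern_def sums_iff)

lemma rkern_holomorphic: "s > 0 \<Longrightarrow> rkern s k holomorphic_on ball 0 1"
  using power_series_continuous_on(2)[OF rkern_sums_bound(1)] .

lemma rkern_cnj:
  assumes "norm x < 1" "s > 0"
  shows "rkern s k (cnj x) = cnj (rkern s k x)"
proof -
  have "(\<lambda>m. cnj (of_real (real m ^ k * pochhammer s m / fact m) * x ^ m)) sums cnj (rkern s k x)"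
    using rkern_sums_bound(1)[OF assms(2,1)] by (simp only: sums_cnj)
  moreover have "(\<lambda>m. of_real (real m ^ k * pochhammer s m / fact m) * cnj x ^ m) sums rkern s k (cnj x)"
    using assms by (intro rkern_sums_bound(1)) auto
  ultimately show ?thesis by (simp add: sums_unique2)
qed

lemma deriv_rkern:
  assumes s: "s > 0" and x: "norm x < 1"
  shows "x * deriv (rkern s k) x = rkern s (Suc k) x"
proof -
  define c where "c = (\<lambda>m. complex_of_real (real m ^ k * pochhammer s m / fact m))"
  have sm: "summable (\<lambda>m. c m * y ^ m)" if "norm y < 1" for y
    using rkern_sums_bound(1)[OF s that] by (auto simp: c_def sums_iff)
  have "((\<lambda>x. \<Sum>m. c m * x ^ m) has_field_derivative (\<Sum>m. diffs c m * x ^ m)) (at x)"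
    by (rule termdiffs_strong'[OF sm x])
  then have D: "deriv (rkern s k) x = (\<Sum>m. diffs c m * x ^ m)"
    unfolding rkern_def c_def by (rule DERIV_imp_deriv)
  have "summable (\<lambda>m. diffs c m * x ^ m)"
    by (rule termdiff_converges[OF x sm])
  then have "(\<lambda>m. of_nat m * c m * x ^ (m - Suc 0)) sums (\<Sum>m. diffs c m * x ^ m)"
    by (rule diffs_equiv)
  from sums_mult[OF this, of x]
  have "(\<lambda>m. x * (of_nat m * c m * x ^ (m - Suc 0))) sums (x * deriv (rkern s k) x)" by (simp add: D)
  moreover have "x * (of_nat m * c m * x ^ (m - Suc 0)) = of_real (real m ^ Suc k * pochhammer s m / fact m) * x ^ m" for m
    by (cases m) (simp_all add: c_def mult_ac del: of_nat_Suc fact_Suc)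
  ultimately show ?thesis
    using rkern_sums_bound(1)[OF s x, of "Suc k"] by (simp add: sums_unique2)
qed

text \<open>For k > 0 the function is x times a derivative that is bounded on the smaller disc. This
  is the source of the vanishing of R^k b at the origin.\<close>

lemma rkern_le_norm:
  assumes s: "s > 0" and k: "k > 0"
  obtains C where "C > 0" "\<And>x. norm x \<le> 1/2 \<Longrightarrow> norm (rkern s k x) \<le> C * norm x"
proof -
  obtain j where j: "k = Suc j" using k by (cases k) auto
  have "deriv (rkern s j) holomorphic_on ball 0 1"
    by (rule holomorphic_deriv[OF rkern_holomorphic[OF s]]) simp
  then have "continuous_on (cball 0 (1/2)) (deriv (rkern s j))"
    by (intro holomorphic_on_imp_continuous_on) (rule holomorphic_on_subset, auto)
  then have "bounded (deriv (rkern s j) ` cball 0 (1/2))"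
    by (intro compact_imp_bounded compact_continuous_image) auto
  then obtain C where "C > 0" and C: "\<forall>y\<in>deriv (rkern s j) ` cball 0 (1/2). norm y \<le> C"
    unfolding bounded_pos by blast
  have "norm (rkern s k x) \<le> C * norm x" if "norm x \<le> 1/2" for x
  proof -
    have "rkern s k x = x * deriv (rkern s j) x" using deriv_rkern[OF s, of x j] that j by simp
    moreover have "norm (deriv (rkern s j) x) \<le> C" using C that by simp
    ultimately show ?thesis
      using mult_right_mono[of "norm (deriv (rkern s j) x)" C "norm x"] by (simp add: norm_mult mult.commute)
  qed
  then show ?thesis using that \<open>C > 0\<close> by blast
qed

section \<open>Differentiation of kernel integrals\<close>

text \<open>Complex linearity of the total derivative turns the sum of z_j D e_j into D z, so radial
  derivatives can be computed without touching the coordinates.\<close>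

lemma radial_deriv_eq:
  fixes f :: "complex^'n \<Rightarrow> complex"
  assumes D: "(f has_derivative D) (at z)" and lin: "\<And>c v. D (c *s v) = c * D v"
  shows "radial_deriv f z = D z"
proof -
  have "partial_deriv j f z = D (axis j 1)" for j
  proof -
    have eq: "(\<chi> i. if i = j then w else z $ i) = z + (w - z $ j) *s axis j 1" for w
      by (simp add: vec_eq_iff axis_def)
    have "((\<lambda>w. z + (w - z $ j) *s axis j 1) has_derivative (\<lambda>h. h *s axis j 1)) (at (z $ j))"
    proof -
      have "bounded_linear (\<lambda>h::complex. h *s (axis j 1 :: complex^'n))"
        by (intro linear_conv_bounded_linear[THEN iffD1] linearI)
          (simp_all add: vec_eq_iff algebra_simps)
      moreover have "((\<lambda>w. w - z $ j) has_derivative (\<lambda>h. h)) (at (z $ j))"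
        by (auto intro!: derivative_eq_intros)
      ultimately have "((\<lambda>w. (w - z $ j) *s (axis j 1 :: complex^'n)) has_derivative (\<lambda>h. h *s axis j 1)) (at (z $ j))"
        by (rule bounded_linear.has_derivative)
      from has_derivative_add[OF has_derivative_const[of z] this] show ?thesis by (simp only: add_0)
    qed
    from has_derivative_compose[OF this, of f D]
    have "((\<lambda>w. f (z + (w - z $ j) *s axis j 1)) has_derivative (\<lambda>h. D (axis j 1) * h)) (at (z $ j))"
      using D by (simp add: lin mult.commute)
    then show ?thesis
      unfolding partial_deriv_def eq by (intro DERIV_imp_deriv) (simp add: has_field_derivative_def)
  qed
  then have "radial_deriv f z = (\<Sum>j\<in>UNIV. D (z $ j *s axis j 1))"
    by (simp add: radial_deriv_def lin)
  also have "\<dots> = D (\<Sum>j\<in>UNIV. z $ j *s axis j 1)"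
    using has_derivative_linear[OF D] by (simp add: linear_sum)
  finally show ?thesis by (simp add: basis_expansion)
qed

definition kern_int :: "real \<Rightarrow> (complex \<Rightarrow> complex) \<Rightarrow> (complex^'n \<Rightarrow> complex) \<Rightarrow> complex^'n \<Rightarrow> complex" where
  "kern_int \<alpha> \<kappa> g z = (\<integral>w. g w * \<kappa> (cinner_vec z w) \<partial>bergman_measure \<alpha>)"

text \<open>A Taylor remainder uniform on a disc strictly inside the unit disc; it is what permits
  differentiation under the integral sign.\<close>

lemma second_order_remainder:
  fixes \<kappa> :: "complex \<Rightarrow> complex"
  assumes \<kappa>: "\<kappa> holomorphic_on ball 0 1" and r: "r < 1"
  obtains K where "K \<ge> 0" "\<And>x y. norm x \<le> r \<Longrightarrow> norm y \<le> r \<Longrightarrow> norm (\<kappa> y - \<kappa> x - deriv \<kappa> x * (y - x)) \<le> K * norm (y - x) ^ 2"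
proof -
  have sub: "cball (0::complex) r \<subseteq> ball 0 1" using r by auto
  have h: "(deriv ^^ i) \<kappa> holomorphic_on ball 0 1" for i
    by (rule holomorphic_higher_deriv[OF \<kappa>]) simp
  have "continuous_on (cball 0 r) ((deriv ^^ 2) \<kappa>)"
    by (rule holomorphic_on_imp_continuous_on[OF holomorphic_on_subset[OF h sub]])
  then have "bounded ((deriv ^^ 2) \<kappa> ` cball 0 r)"
    by (intro compact_imp_bounded compact_continuous_image) auto
  then obtain K where "K > 0" and K: "\<forall>y\<in>(deriv ^^ 2) \<kappa> ` cball 0 r. norm y \<le> K"
    unfolding bounded_pos by blast
  have "norm (\<kappa> y - \<kappa> x - deriv \<kappa> x * (y - x)) \<le> K * norm (y - x) ^ 2" if "norm x \<le> r" "norm y \<le> r" for x y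
  proof -
    have "norm ((deriv ^^ 0) \<kappa> y - (\<Sum>i\<le>1. (deriv ^^ i) \<kappa> x * (y - x) ^ i / fact i)) \<le> K * norm (y - x) ^ Suc 1 / fact 1"
    proof (rule complex_Taylor[of "cball 0 r"])
      fix i and w :: complex assume "w \<in> cball 0 r"
      then have "w \<in> ball 0 1" using sub by auto
      then have "((deriv ^^ i) \<kappa> has_field_derivative deriv ((deriv ^^ i) \<kappa>) w) (at w)"
        by (intro holomorphic_derivI[OF h]) auto
      then show "((deriv ^^ i) \<kappa> has_field_derivative (deriv ^^ Suc i) \<kappa> w) (at w within cball 0 r)"
        by (simp add: has_field_derivative_at_within)
    next
      show "norm ((deriv ^^ Suc 1) \<kappa> w) \<le> K" if "w \<in> cball 0 r" for w
        using K that by (simp add: numeral_2_eq_2)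
    qed (use that in auto)
    then show ?thesis by (simp add: numeral_2_eq_2 diff_diff_eq)
  qed
  then show ?thesis using that[of K] \<open>K > 0\<close> by simp
qed

text \<open>Differentiation under the integral sign: since |<y - z, w>| is at most |y - z|, the
  remainders integrate to at most K |y - z|^2 times the L^1 norm of g.\<close>

lemma kern_int_has_derivative:
  fixes g :: "complex^'n \<Rightarrow> complex"
  assumes \<kappa>: "\<kappa> holomorphic_on ball 0 1" and g: "integrable (bergman_measure \<alpha>) g" and z: "norm z < 1"
  shows "(kern_int \<alpha> \<kappa> g has_derivative (\<lambda>v. \<integral>w. g w * (deriv \<kappa> (cinner_vec z w) * cinner_vec v w) \<partial>bergman_measure \<alpha>)) (at z)"
proof -
  let ?\<nu> = "bergman_measure \<alpha> :: (complex^'n) measure"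
  define D where "D = (\<lambda>v. \<integral>w. g w * (deriv \<kappa> (cinner_vec z w) * cinner_vec v w) \<partial>?\<nu>)"
  have c\<kappa>: "continuous_on (ball 0 1) \<kappa>" using \<kappa> by (rule holomorphic_on_imp_continuous_on)
  have c\<kappa>': "continuous_on (ball 0 1) (deriv \<kappa>)"
    by (intro holomorphic_on_imp_continuous_on holomorphic_deriv[OF \<kappa>]) simp
  have gk': "integrable ?\<nu> (\<lambda>w. g w * deriv \<kappa> (cinner_vec z w))"
    by (rule integrable_kernel[OF c\<kappa>' z g])
  have cv: "norm (cinner_vec v w) \<le> norm v" if "w \<in> space ?\<nu>" for v w :: "complex^'n"
    using norm_cinner_vec_le[of v w] that mult_left_le[of "norm w" "norm v"] by simp
  have intD: "integrable ?\<nu> (\<lambda>w. g w * (deriv \<kappa> (cinner_vec z w) * cinner_vec v w))" for v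
    unfolding mult.assoc[symmetric]
    by (rule integrable_bounded_mult[OF gk']) (use cv in auto)
  have "linear D"
  proof (rule linearI)
    show "D (v + w) = D v + D w" for v w
      unfolding D_def cinner_vec_add_left distrib_left
      by (rule Bochner_Integration.integral_add) (use intD in \<open>simp_all add: mult.assoc\<close>)
    show "D (r *\<^sub>R v) = r *\<^sub>R D v" for r v
      unfolding D_def scaleR_eq_scale cinner_vec_scale_left scaleR_conv_of_real
      by (subst integral_mult_right_zero[symmetric]) (simp add: mult_ac)
  qed
  then have blD: "bounded_linear D" by (simp add: linear_conv_bounded_linear)
  \<comment> \<open>For y near z all products <y,w> and <z,w> stay in the closed disc of radius r,
    where one constant K serves every w.\<close>
  define r where "r = (1 + norm z) / 2"
  have r: "norm z < r" "r < 1" using z by (auto simp: r_def)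
  obtain K where K: "K \<ge> 0" "\<And>x y. norm x \<le> r \<Longrightarrow> norm y \<le> r \<Longrightarrow> norm (\<kappa> y - \<kappa> x - deriv \<kappa> x * (y - x)) \<le> K * norm (y - x) ^ 2"
    using second_order_remainder[OF \<kappa> r(2)] by blast
  define G where "G = (\<integral>w. norm (g w) \<partial>?\<nu>)"
  have rem: "norm (kern_int \<alpha> \<kappa> g y - kern_int \<alpha> \<kappa> g z - D (y - z)) \<le> K * G * norm (y - z) ^ 2" if y: "norm y \<le> r" for y
  proof -
    have y1: "norm y < 1" using y r by simp
    have "kern_int \<alpha> \<kappa> g y - kern_int \<alpha> \<kappa> g z - D (y - z)
      = (\<integral>w. g w * \<kappa> (cinner_vec y w) - g w * \<kappa> (cinner_vec z w) - g w * (deriv \<kappa> (cinner_vec z w) * cinner_vec (y - z) w) \<partial>?\<nu>)"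
      unfolding kern_int_def D_def
      using integrable_kernel[OF c\<kappa> y1 g] integrable_kernel[OF c\<kappa> z g] intD by simp
    also have "norm \<dots> \<le> (\<integral>w. K * norm (y - z) ^ 2 * norm (g w) \<partial>?\<nu>)"
    proof (rule Bochner_Integration.integral_norm_bound_integral)
      fix w assume w: "w \<in> space ?\<nu>"
      let ?a = "cinner_vec y w" and ?b = "cinner_vec z w"
      have "norm (\<kappa> ?a - \<kappa> ?b - deriv \<kappa> ?b * (?a - ?b)) \<le> K * norm (?a - ?b) ^ 2"
        using cv[OF w, of y] cv[OF w, of z] y r by (intro K) auto
      also have "\<dots> \<le> K * norm (y - z) ^ 2"
        using cv[OF w, of "y - z"] K by (intro mult_left_mono power_mono) (auto simp: cinner_vec_diff_left)
      finally have "norm (g w) * norm (\<kappa> ?a - \<kappa> ?b - deriv \<kappa> ?b * (?a - ?b)) \<le> norm (g w) * (K * norm (y - z) ^ 2)"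
        by (rule mult_left_mono) simp
      then show "norm (g w * \<kappa> ?a - g w * \<kappa> ?b - g w * (deriv \<kappa> ?b * cinner_vec (y - z) w)) \<le> K * norm (y - z) ^ 2 * norm (g w)"
        by (simp add: norm_mult[symmetric] cinner_vec_diff_left right_diff_distrib[symmetric] mult.commute)
    qed (use g integrable_kernel[OF c\<kappa> y1 g] integrable_kernel[OF c\<kappa> z g] intD in auto)
    finally show ?thesis by (simp add: G_def mult_ac)
  qed
  have "(kern_int \<alpha> \<kappa> g has_derivative D) (at z)"
  proof (rule has_derivativeI_sandwich[where H="\<lambda>y. K * G * norm (y - z)" and e="r - norm z"])
    fix y assume "y \<noteq> z" "dist y z < r - norm z"
    then have "norm y \<le> r" using norm_triangle_ineq2[of y z] by (simp add: dist_norm)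
    from rem[OF this] \<open>y \<noteq> z\<close>
    show "norm (kern_int \<alpha> \<kappa> g y - kern_int \<alpha> \<kappa> g z - D (y - z)) / norm (y - z) \<le> K * G * norm (y - z)"
      by (simp add: field_simps power2_eq_square)
  next
    have "((\<lambda>y. K * G * norm (y - z)) \<longlongrightarrow> K * G * norm (z - z)) (at z)"
      by (intro tendsto_intros)
    then show "((\<lambda>y. K * G * norm (y - z)) \<longlongrightarrow> 0) (at z)" by simp
  qed (use r blD in auto)
  then show ?thesis by (simp add: D_def)
qed

text \<open>On a function of <z,w>, the operator R in z acts as x d/dx, which raises the index of
  \<open>rkern\<close> by one.\<close>

lemma kern_int_radial_deriv:
  fixes f g :: "complex^'n \<Rightarrow> complex"
  assumes s: "s > 0" and g: "integrable (bergman_measure \<alpha>) g" and z: "norm z < 1"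
    and eq: "\<And>y. norm y < 1 \<Longrightarrow> f y = kern_int \<alpha> (rkern s k) g y"
  shows "radial_deriv f z = kern_int \<alpha> (rkern s (Suc k)) g z"
proof -
  let ?D = "\<lambda>v. \<integral>w. g w * (deriv (rkern s k) (cinner_vec z w) * cinner_vec v w) \<partial>bergman_measure \<alpha>"
  have "(kern_int \<alpha> (rkern s k) g has_derivative ?D) (at z)"
    by (rule kern_int_has_derivative[OF rkern_holomorphic[OF s] g z])
  then have "(f has_derivative ?D) (at z)"
    by (rule has_derivative_transform_within_open[of _ _ _ _ "ball 0 1"]) (use z eq in auto)
  moreover have "?D (c *s v) = c * ?D v" for c v
    unfolding cinner_vec_scale_left by (subst integral_mult_right_zero[symmetric]) (simp add: mult_ac)
  ultimately have "radial_deriv f z = ?D z" by (rule radial_deriv_eq)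
  also have "?D z = kern_int \<alpha> (rkern s (Suc k)) g z"
    unfolding kern_int_def
  proof (rule Bochner_Integration.integral_cong[OF refl])
    fix w :: "complex^'n" assume "w \<in> space (bergman_measure \<alpha>)"
    then have "norm (cinner_vec z w) < 1" using z by (intro norm_cinner_vec_less) auto
    from deriv_rkern[OF s this, of k]
    show "g w * (deriv (rkern s k) (cinner_vec z w) * cinner_vec z w) = g w * rkern s (Suc k) (cinner_vec z w)"
      by (simp add: mult.commute)
  qed
  finally show ?thesis .
qed

lemma polar_vec:
  fixes z :: "complex^'n"
  obtains e where "norm e = 1" "z = of_real (norm z) *s e"
proof (cases "z = 0")
  case True
  obtain e :: "complex^'n" where "norm e = 1" using vector_choose_size[of 1] by auto
  then show ?thesis using True by (intro that[of e]) auto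
next
  case False
  show ?thesis
  proof (rule that[of "of_real (1 / norm z) *s z"])
    show "norm (of_real (1 / norm z) *s z) = 1" using False unfolding norm_scale_vec norm_of_real by simp
    show "z = of_real (norm z) *s (of_real (1 / norm z) *s z)" using False by (simp add: vec_eq_iff)
  qed
qed

text \<open>The Taylor coefficients of the kernel are the reciprocals of the moments, so the series
  of \<open>integral_kernel_sums\<close> collapses to the Taylor series of f on the slice through
  z.\<close>

theorem bergman_reproducing:
  fixes f :: "complex^'n \<Rightarrow> complex"
  assumes \<alpha>: "\<alpha> > -1" and f: "holomorphic_vec f (ball 0 1)" and int: "integrable (bergman_measure \<alpha>) f"
    and z: "norm z < 1"
  shows "f z = kern_int \<alpha> (bkern (real CARD('n) + 1 + \<alpha>)) f z"
proof -
  let ?N = "real CARD('n) + 1 + \<alpha>"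
  obtain e where e: "norm e = 1" and ze: "z = of_real (norm z) *s e" by (rule polar_vec)
  obtain \<beta> where \<beta>: "\<And>\<mu>. norm \<mu> < 1 \<Longrightarrow> (\<lambda>m. \<beta> m * \<mu> ^ m) sums f (\<mu> *s e)"
    using holomorphic_vec_slice_series[OF f e] by blast
  have "(\<lambda>m. \<beta> m * of_real (norm z) ^ m * of_real (pochhammer ?N m / fact m) * of_real (fact m / pochhammer ?N m)) sums
    (\<integral>w. f w * bkern ?N (cinner_vec (of_real (norm z) *s e) w) \<partial>bergman_measure \<alpha>)"
    by (rule integral_kernel_sums[OF \<alpha> f int e _ z \<beta> bkern_sums]) auto
  moreover have "\<beta> m * of_real (norm z) ^ m * of_real (pochhammer ?N m / fact m) * of_real (fact m / pochhammer ?N m)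
    = \<beta> m * of_real (norm z) ^ m" for m
  proof -
    have "pochhammer ?N m > 0" using \<alpha> by (intro pochhammer_pos) auto
    then have "pochhammer ?N m / fact m * (fact m / pochhammer ?N m) = 1" by simp
    then have "complex_of_real (pochhammer ?N m / fact m) * of_real (fact m / pochhammer ?N m) = 1"
      unfolding of_real_mult[symmetric] by (simp only: of_real_1)
    then show ?thesis by (simp only: mult.assoc mult_1_right)
  qed
  moreover have "(\<lambda>m. \<beta> m * of_real (norm z) ^ m) sums f (of_real (norm z) *s e)"
    using z by (intro \<beta>) simp
  ultimately show ?thesis
    unfolding kern_int_def ze[symmetric] by (simp add: sums_unique2)
qed

theorem iterated_radial_deriv:
  fixes f :: "complex^'n \<Rightarrow> complex"
  assumes \<alpha>: "\<alpha> > -1" and f: "holomorphic_vec f (ball 0 1)" and int: "integrable (bergman_measure \<alpha>) f"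
    and z: "norm z < 1"
  shows "(radial_deriv ^^ k) f z = kern_int \<alpha> (rkern (real CARD('n) + 1 + \<alpha>) k) f z"
  using z
proof (induction k arbitrary: z)
  case 0
  have "f z = kern_int \<alpha> (bkern (real CARD('n) + 1 + \<alpha>)) f z"
    by (rule bergman_reproducing[OF \<alpha> f int 0])
  also have "\<dots> = kern_int \<alpha> (rkern (real CARD('n) + 1 + \<alpha>) 0) f z"
    unfolding kern_int_def using 0
    by (intro Bochner_Integration.integral_cong refl) (simp add: rkern_0 norm_cinner_vec_less)
  finally show ?case by simp
next
  case (Suc k)
  show ?case
    unfolding funpow.simps comp_def
    by (rule kern_int_radial_deriv[OF _ int Suc.prems Suc.IH]) (use \<alpha> in auto)
qed

section \<open>Norms of the kernels\<close>

lemma holomorphic_vec_kernel: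
  fixes a :: "complex^'n"
  assumes \<kappa>: "\<kappa> holomorphic_on ball 0 1" and a: "norm a < 1"
  shows "holomorphic_vec (\<lambda>w. \<kappa> (cinner_vec w a)) (ball 0 1)"
  unfolding holomorphic_vec_def
proof (intro ballI exI conjI allI)
  fix w :: "complex^'n" assume "w \<in> ball 0 1"
  then have "norm (cinner_vec w a) < 1" using a by (intro norm_cinner_vec_less) auto
  then have "(\<kappa> has_field_derivative deriv \<kappa> (cinner_vec w a)) (at (cinner_vec w a))"
    by (intro holomorphic_derivI[OF \<kappa>]) auto
  then have "(\<kappa> has_derivative (\<lambda>h. deriv \<kappa> (cinner_vec w a) * h)) (at (cinner_vec w a))"
    by (simp add: has_field_derivative_def)
  moreover have "bounded_linear (\<lambda>w. cinner_vec w a)"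
    by (intro linear_conv_bounded_linear[THEN iffD1] linearI)
      (simp_all add: cinner_vec_add_left scaleR_eq_scale cinner_vec_scale_left scaleR_conv_of_real)
  then have "((\<lambda>w. cinner_vec w a) has_derivative (\<lambda>v. cinner_vec v a)) (at w)"
    by (rule bounded_linear_imp_has_derivative)
  ultimately show "((\<lambda>w. \<kappa> (cinner_vec w a)) has_derivative (\<lambda>v. deriv \<kappa> (cinner_vec w a) * cinner_vec v a)) (at w)"
    by (rule has_derivative_compose[rotated])
  show "deriv \<kappa> (cinner_vec w a) * cinner_vec (c *s v) a = c * (deriv \<kappa> (cinner_vec w a) * cinner_vec v a)" for c v
    by (simp add: cinner_vec_scale_left)
qed

section \<open>Lower bounds for |1 - <z,w>|, coefficient growth and Forelli-Rudin estimates\<close>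

lemma norm_one_minus_cinner_commute: "norm (1 - cinner_vec z w) = norm (1 - cinner_vec w z)"
proof -
  have "1 - cinner_vec z w = cnj (1 - cinner_vec w z)" by (subst cinner_vec_commute) simp
  then show ?thesis by (simp only: complex_mod_cnj)
qed

lemma one_minus_norm_le:
  assumes "norm z < 1" "norm w < 1"
  shows "(1 - (norm z)\<^sup>2) / 2 \<le> norm (1 - cinner_vec z w)" "(1 - (norm w)\<^sup>2) / 2 \<le> norm (1 - cinner_vec z w)"
proof -
  have *: "(1 - r\<^sup>2) / 2 \<le> 1 - r" for r :: real
    using zero_le_power2[of "1 - r"] unfolding power2_diff by simp
  have "norm (cinner_vec z w) \<le> norm z" "norm (cinner_vec z w) \<le> norm w"
    using norm_cinner_vec_le[of z w] mult_left_le[of "norm w" "norm z"] mult_left_le_one_le[of "norm w" "norm z"] assms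
    by auto
  moreover have "1 - norm (cinner_vec z w) \<le> norm (1 - cinner_vec z w)"
    using norm_triangle_ineq2[of 1 "cinner_vec z w"] by simp
  ultimately show "(1 - (norm z)\<^sup>2) / 2 \<le> norm (1 - cinner_vec z w)" "(1 - (norm w)\<^sup>2) / 2 \<le> norm (1 - cinner_vec z w)"
    using *[of "norm z"] *[of "norm w"] by linarith+
qed

lemma norm_one_minus_le2: "norm x < 1 \<Longrightarrow> norm (1 - x :: complex) \<le> 2"
  using norm_triangle_ineq4[of 1 x] by simp

text \<open>Factor by factor, ((p + q) / 2 + j)^2 exceeds (p + j) (q + j) by the constant ((p - q) /
  2)^2, a relative error of order 1 / j^2. The product of such factors converges.\<close>

lemma pochhammer_mean_square_le:
  fixes p q :: real
  assumes "p > 0" "q > 0"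
  obtains C where "C > 0" "\<And>m. (pochhammer ((p + q) / 2) m)\<^sup>2 \<le> C * (pochhammer p m * pochhammer q m)"
proof -
  \<comment> \<open>Chosen so that p + j and q + j are both at least \<mu> (1 + j), which bounds the
    relative error by K / (1 + j)^2 from j = 0 on.\<close>
  define \<mu> where "\<mu> = min 1 (min p q)"
  define d where "d = ((p - q) / 2)\<^sup>2"
  define K where "K = d / \<mu>\<^sup>2"
  have \<mu>: "0 < \<mu>" "\<mu> \<le> 1" "\<mu> \<le> p" "\<mu> \<le> q" using assms by (auto simp: \<mu>_def)
  have sm: "summable (\<lambda>j. K / (1 + real j)\<^sup>2)"
  proof -
    have "summable (\<lambda>j. inverse (real (Suc j) ^ 2))"
      using inverse_power_summable[of 2, where 'a=real] by (subst summable_Suc_iff) auto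
    from summable_mult[OF this, of K] show ?thesis by (simp add: divide_inverse add_ac)
  qed
  have step: "((p + q) / 2 + real j)\<^sup>2 \<le> exp (K / (1 + real j)\<^sup>2) * ((p + j) * (q + j))" for j
  proof -
    have "\<mu> * real j \<le> 1 * real j" using \<mu> by (intro mult_right_mono) auto
    then have "\<mu> * (1 + real j) \<le> p + j" "\<mu> * (1 + real j) \<le> q + j"
      using \<mu> by (auto simp: distrib_left)
    then have "(\<mu> * (1 + real j)) * (\<mu> * (1 + real j)) \<le> (p + j) * (q + j)"
      using \<mu> assms by (intro mult_mono) auto
    then have "\<mu>\<^sup>2 * (1 + real j)\<^sup>2 \<le> (p + j) * (q + j)" by (simp add: power2_eq_square mult_ac)
    moreover have "\<mu>\<^sup>2 * (1 + real j)\<^sup>2 > 0" using \<mu> by (intro mult_pos_pos zero_less_power) auto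
    ultimately have "K / (1 + real j)\<^sup>2 * (\<mu>\<^sup>2 * (1 + real j)\<^sup>2) \<le> K / (1 + real j)\<^sup>2 * ((p + j) * (q + j))"
      by (intro mult_left_mono) (auto simp: K_def d_def)
    moreover have "K / (1 + real j)\<^sup>2 * (\<mu>\<^sup>2 * (1 + real j)\<^sup>2) = d" using \<mu> by (simp add: K_def add_nonneg_eq_0_iff)
    ultimately have "d \<le> K / (1 + real j)\<^sup>2 * ((p + j) * (q + j))" by simp
    moreover have "((p + q) / 2 + real j)\<^sup>2 = (p + j) * (q + j) + d"
      by (simp add: d_def power2_eq_square field_simps)
    ultimately have "((p + q) / 2 + real j)\<^sup>2 \<le> (1 + K / (1 + real j)\<^sup>2) * ((p + j) * (q + j))"
      by (simp add: distrib_right)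
    also have "\<dots> \<le> exp (K / (1 + real j)\<^sup>2) * ((p + j) * (q + j))"
      using assms by (intro mult_right_mono exp_ge_add_one_self) auto
    finally show ?thesis .
  qed
  have part: "(pochhammer ((p + q) / 2) m)\<^sup>2 \<le> exp (\<Sum>j<m. K / (1 + real j)\<^sup>2) * (pochhammer p m * pochhammer q m)" for m
  proof (induction m)
    case (Suc m)
    have "(pochhammer ((p + q) / 2) (Suc m))\<^sup>2 = (pochhammer ((p + q) / 2) m)\<^sup>2 * ((p + q) / 2 + real m)\<^sup>2"
      by (simp add: pochhammer_Suc power_mult_distrib)
    also have "\<dots> \<le> (exp (\<Sum>j<m. K / (1 + real j)\<^sup>2) * (pochhammer p m * pochhammer q m)) *
        (exp (K / (1 + real m)\<^sup>2) * ((p + m) * (q + m)))"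
      using assms by (intro mult_mono Suc.IH step mult_nonneg_nonneg pochhammer_nonneg) auto
    also have "\<dots> = exp (\<Sum>j<Suc m. K / (1 + real j)\<^sup>2) * (pochhammer p (Suc m) * pochhammer q (Suc m))"
      by (simp add: pochhammer_Suc exp_add mult_ac)
    finally show ?case .
  qed simp
  show ?thesis
  proof (rule that[of "exp (\<Sum>j. K / (1 + real j)\<^sup>2)"])
    fix m
    have "(\<Sum>j<m. K / (1 + real j)\<^sup>2) \<le> (\<Sum>j. K / (1 + real j)\<^sup>2)"
      by (rule sum_le_suminf[OF sm]) (auto simp: K_def d_def)
    then have "exp (\<Sum>j<m. K / (1 + real j)\<^sup>2) * (pochhammer p m * pochhammer q m) \<le>
       exp (\<Sum>j. K / (1 + real j)\<^sup>2) * (pochhammer p m * pochhammer q m)"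
      using assms by (intro mult_right_mono mult_nonneg_nonneg pochhammer_nonneg) auto
    with part[of m]
    show "(pochhammer ((p + q) / 2) m)\<^sup>2 \<le> exp (\<Sum>j. K / (1 + real j)\<^sup>2) * (pochhammer p m * pochhammer q m)"
      by linarith
  qed simp
qed

text \<open>The integrand is the squared modulus of f = \<open>bkern (s / 2)\<close> at <w,a>, that
  is, f times the kernel profile at <a,w>. So \<open>integral_kernel_sums\<close> evaluates the
  integral exactly, and the Forelli-Rudin estimates reduce to comparing coefficients.\<close>

lemma kernel_norm_sums:
  fixes a :: "complex^'n"
  assumes \<alpha>: "\<alpha> > -1" and a: "norm a < 1"
  shows "(\<lambda>m. (pochhammer (s / 2) m)\<^sup>2 / (fact m * pochhammer (real CARD('n) + 1 + \<alpha>) m) * ((norm a)\<^sup>2) ^ m)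
      sums (\<integral>w. norm (1 - cinner_vec w a) powr (- s) \<partial>bergman_measure \<alpha>)"
    and "integrable (bergman_measure \<alpha>) (\<lambda>w. norm (1 - cinner_vec w a) powr (- s))"
proof -
  let ?\<nu> = "bergman_measure \<alpha> :: (complex^'n) measure"
  let ?N = "real CARD('n) + 1 + \<alpha>"
  interpret \<nu>: finite_measure ?\<nu> by (rule finite_measure_bergman[OF \<alpha>])
  obtain e where e: "norm e = 1" and ae: "a = of_real (norm a) *s e" by (rule polar_vec)
  define t where "t = norm a"
  define f where "f = (\<lambda>w. bkern (s / 2) (cinner_vec w a))"
  have f: "holomorphic_vec f (ball 0 1)"
    unfolding f_def by (rule holomorphic_vec_kernel[OF bkern_holomorphic a])
  have f_eq: "f w = cnj (bkern (s / 2) (cinner_vec a w))" if "w \<in> space ?\<nu>" for w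
    using that a unfolding f_def by (subst cinner_vec_commute) (intro bkern_cnj norm_cinner_vec_less, auto)
  obtain B where B: "\<And>w. norm w < 1 \<Longrightarrow> norm (bkern (s / 2) (cinner_vec a w)) \<le> B"
    using kernel_bounded[OF holomorphic_on_imp_continuous_on[OF bkern_holomorphic] a] by blast
  have int: "integrable ?\<nu> f"
    by (rule \<nu>.integrable_const_bound[where B=B]) (use B f_eq measurable_holomorphic_vec[OF f] in auto)
  have prod: "f w * bkern (s / 2) (cinner_vec a w) = of_real (norm (1 - cinner_vec w a) powr (- s))" if "w \<in> space ?\<nu>" for w
  proof -
    have x: "norm (cinner_vec w a) < 1" using that a by (intro norm_cinner_vec_less) auto
    have "f w * bkern (s / 2) (cinner_vec a w) = f w * cnj (f w)" using f_eq[OF that] by simp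
    also have "\<dots> = of_real ((norm (f w))\<^sup>2)" by (simp only: complex_norm_square)
    also have "(norm (f w))\<^sup>2 = norm (1 - cinner_vec w a) powr (- s)"
      unfolding f_def norm_bkern[OF x] by (simp add: power2_eq_square powr_add[symmetric])
    finally show ?thesis .
  qed
  have "integrable ?\<nu> (\<lambda>w. f w * bkern (s / 2) (cinner_vec a w))"
    by (rule integrable_kernel[OF holomorphic_on_imp_continuous_on[OF bkern_holomorphic] a int])
  moreover have "integrable ?\<nu> (\<lambda>w. f w * bkern (s / 2) (cinner_vec a w))
      \<longleftrightarrow> integrable ?\<nu> (\<lambda>w. complex_of_real (norm (1 - cinner_vec w a) powr (- s)))"
    by (rule Bochner_Integration.integrable_cong[OF refl prod])
  ultimately have "integrable ?\<nu> (\<lambda>w. complex_of_real (norm (1 - cinner_vec w a) powr (- s)))"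
    by blast
  then show "integrable ?\<nu> (\<lambda>w. norm (1 - cinner_vec w a) powr (- s))"
    unfolding complex_of_real_integrable_eq .
  define c where "c = (\<lambda>m. pochhammer (s / 2) m / fact m)"
  have "(\<lambda>m. (of_real (c m) * of_real t ^ m) * of_real t ^ m * of_real (c m) * of_real (fact m / pochhammer ?N m)) sums
    (\<integral>w. f w * bkern (s / 2) (cinner_vec (of_real t *s e) w) \<partial>?\<nu>)"
  proof (rule integral_kernel_sums[OF \<alpha> f int e])
    fix \<mu> :: complex assume \<mu>: "norm \<mu> < 1"
    have "norm (of_real t * \<mu>) \<le> norm \<mu>"
      using a by (simp add: norm_mult t_def mult_left_le_one_le)
    then have "(\<lambda>m. of_real (c m) * (of_real t * \<mu>) ^ m) sums bkern (s / 2) (of_real t * \<mu>)"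
      unfolding c_def using \<mu> by (intro bkern_sums) simp
    moreover have "f (\<mu> *s e) = bkern (s / 2) (of_real t * \<mu>)"
      using e by (simp add: f_def, subst ae)
        (simp add: cinner_vec_scale_left cinner_vec_scale_right cinner_vec_self t_def mult.commute)
    ultimately show "(\<lambda>m. of_real (c m) * of_real t ^ m * \<mu> ^ m) sums f (\<mu> *s e)"
      by (simp add: power_mult_distrib mult.assoc)
  next
    show "(\<lambda>m. of_real (c m) * x ^ m) sums bkern (s / 2) x" if "norm x < 1" for x
      unfolding c_def by (rule bkern_sums[OF that])
  qed (use a in \<open>auto simp: t_def\<close>)
  moreover have "(of_real (c m) * of_real t ^ m) * of_real t ^ m * of_real (c m) * of_real (fact m / pochhammer ?N m)
      = complex_of_real ((pochhammer (s / 2) m)\<^sup>2 / (fact m * pochhammer ?N m) * ((norm a)\<^sup>2) ^ m)" for m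
  proof -
    have "(c m * t ^ m) * t ^ m * c m * (fact m / pochhammer ?N m) = (pochhammer (s / 2) m)\<^sup>2 / (fact m * pochhammer ?N m) * ((norm a)\<^sup>2) ^ m"
      by (simp add: c_def t_def power2_eq_square power_mult_distrib)
    then show ?thesis by (simp only: of_real_mult[symmetric] of_real_power[symmetric])
  qed
  moreover have "(\<integral>w. f w * bkern (s / 2) (cinner_vec (of_real t *s e) w) \<partial>?\<nu>)
      = of_real (\<integral>w. norm (1 - cinner_vec w a) powr (- s) \<partial>?\<nu>)"
    unfolding t_def ae[symmetric] integral_complex_of_real[symmetric]
    by (rule Bochner_Integration.integral_cong[OF refl prod])
  ultimately show "(\<lambda>m. (pochhammer (s / 2) m)\<^sup>2 / (fact m * pochhammer ?N m) * ((norm a)\<^sup>2) ^ m)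
      sums (\<integral>w. norm (1 - cinner_vec w a) powr (- s) \<partial>?\<nu>)"
    by (simp only: sums_of_real_iff)
qed

lemma nn_kernel_norm:
  fixes a :: "complex^'n"
  assumes "\<alpha> > -1" "norm a < 1"
  shows "(\<integral>\<^sup>+w. ennreal (norm (1 - cinner_vec w a) powr (- s)) \<partial>bergman_measure \<alpha>)
    = ennreal (\<integral>w. norm (1 - cinner_vec w a) powr (- s) \<partial>bergman_measure \<alpha>)"
  by (rule nn_integral_eq_integral[OF kernel_norm_sums(2)[OF assms]]) simp

text \<open>Since (N + d) / 2 is the mean of N and d, the coefficients are at most C (d)_m / m!,
  those of (1 - x)^(-d).\<close>

theorem forelli_rudin_power:
  assumes \<alpha>: "\<alpha> > -1" and d: "d > 0"
  obtains C where "C > 0" "\<And>a :: complex^'n. norm a < 1 \<Longrightarrow>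
    (\<integral>\<^sup>+w. ennreal (norm (1 - cinner_vec w a) powr (- (real CARD('n) + 1 + \<alpha> + d))) \<partial>bergman_measure \<alpha>)
      \<le> ennreal (C * (1 - (norm a)\<^sup>2) powr (- d))"
proof -
  let ?N = "real CARD('n) + 1 + \<alpha>"
  have N: "?N > 0" using \<alpha> by simp
  obtain C where C: "C > 0" "\<And>m. (pochhammer ((?N + d) / 2) m)\<^sup>2 \<le> C * (pochhammer ?N m * pochhammer d m)"
    using pochhammer_mean_square_le[OF N d] by blast
  show ?thesis
  proof (rule that[OF C(1)])
    fix a :: "complex^'n" assume a: "norm a < 1"
    let ?x = "(norm a)\<^sup>2"
    have x: "0 \<le> ?x" "?x < 1" using a by (auto simp: abs_square_less_1)
    have "(\<lambda>m. (- d gchoose m) * (- ?x) ^ m) sums (1 + (- ?x)) powr (- d)"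
      by (rule gen_binomial_real) (use x in simp)
    moreover have "(- d gchoose m) * (- ?x) ^ m = pochhammer d m / fact m * ?x ^ m" for m
    proof -
      have "(- 1 :: real) ^ m * (- ?x) ^ m = ?x ^ m" by (simp only: power_mult_distrib[symmetric]) simp
      then show ?thesis by (simp add: gbinomial_pochhammer mult_ac)
    qed
    ultimately have "(\<lambda>m. C * (pochhammer d m / fact m * ?x ^ m)) sums (C * (1 - ?x) powr (- d))"
      by (intro sums_mult) simp
    moreover have "(pochhammer ((?N + d) / 2) m)\<^sup>2 / (fact m * pochhammer ?N m) * ?x ^ m \<le> C * (pochhammer d m / fact m * ?x ^ m)" for m
    proof -
      have p: "pochhammer ?N m > 0" using N by (rule pochhammer_pos)
      have "(pochhammer ((?N + d) / 2) m)\<^sup>2 / (fact m * pochhammer ?N m) \<le> C * (pochhammer ?N m * pochhammer d m) / (fact m * pochhammer ?N m)"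
        using p by (intro divide_right_mono C(2)) auto
      also have "\<dots> = C * (pochhammer d m / fact m)" using p by simp
      finally show ?thesis using x by (simp only: mult.assoc[symmetric]) (intro mult_right_mono, auto)
    qed
    ultimately have "(\<integral>w. norm (1 - cinner_vec w a) powr (- (?N + d)) \<partial>bergman_measure \<alpha>) \<le> C * (1 - ?x) powr (- d)"
      by (intro sums_le[OF _ kernel_norm_sums(1)[OF \<alpha> a]]) auto
    then show "(\<integral>\<^sup>+w. ennreal (norm (1 - cinner_vec w a) powr (- (?N + d))) \<partial>bergman_measure \<alpha>) \<le> ennreal (C * (1 - ?x) powr (- d))"
      unfolding nn_kernel_norm[OF \<alpha> a] by (rule ennreal_leI)
  qed
qed

text \<open>At the critical exponent the second parameter d would be 0, with vanishing Pochhammer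
  symbols. One factor is therefore split off from (N/2)_m and from (N)_m; then N / 2 + 1 is the mean
  of 1 and N + 1.\<close>

lemma critical_coeff_le:
  assumes N: "(N::real) > 0"
  obtains C where "C > 0" "\<And>m. m > 0 \<Longrightarrow> (pochhammer (N / 2) m)\<^sup>2 / (fact m * pochhammer N m) \<le> C / real m"
proof -
  obtain C where C: "C > 0" "\<And>m. (pochhammer ((1 + (N + 1)) / 2) m)\<^sup>2 \<le> C * (pochhammer 1 m * pochhammer (N + 1) m)"
    using pochhammer_mean_square_le[of 1 "N + 1"] N by auto
  show ?thesis
  proof (rule that[of "C * N / 4"])
    fix m :: nat assume "m > 0"
    then obtain k where m: "m = Suc k" by (cases m) auto
    have p: "pochhammer (N + 1) k > 0" using N by (intro pochhammer_pos) auto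
    have "(pochhammer (N / 2) m)\<^sup>2 / (fact m * pochhammer N m)
        = (N / 2)\<^sup>2 * (pochhammer ((1 + (N + 1)) / 2) k)\<^sup>2 / (fact m * (N * pochhammer (N + 1) k))"
    proof -
      have e: "(1 + (N + 1)) / 2 = N / 2 + 1" by simp
      show ?thesis unfolding m e pochhammer_rec[of "N / 2"] pochhammer_rec[of N] power_mult_distrib ..
    qed
    also have "\<dots> \<le> (N / 2)\<^sup>2 * (C * (pochhammer 1 k * pochhammer (N + 1) k)) / (fact m * (N * pochhammer (N + 1) k))"
      using N p by (intro divide_right_mono mult_left_mono C(2)) auto
    also have "\<dots> = C * N / 4 / real m"
      using N p unfolding m by (simp add: pochhammer_fact[symmetric] power2_eq_square)
    finally show "(pochhammer (N / 2) m)\<^sup>2 / (fact m * pochhammer N m) \<le> C * N / 4 / real m" .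
  qed (use C N in simp)
qed

text \<open>Coefficients of size C / m sum to a logarithm; the term of degree 0 contributes the
  1.\<close>

theorem forelli_rudin_log:
  assumes \<alpha>: "\<alpha> > -1"
  obtains C where "C > 0" "\<And>a :: complex^'n. norm a < 1 \<Longrightarrow>
    (\<integral>\<^sup>+w. ennreal (norm (1 - cinner_vec w a) powr (- (real CARD('n) + 1 + \<alpha>))) \<partial>bergman_measure \<alpha>)
      \<le> ennreal (1 + C * ln (1 / (1 - (norm a)\<^sup>2)))"
proof -
  let ?N = "real CARD('n) + 1 + \<alpha>"
  have N: "?N > 0" using \<alpha> by simp
  obtain C where C: "C > 0" "\<And>m. m > 0 \<Longrightarrow> (pochhammer (?N / 2) m)\<^sup>2 / (fact m * pochhammer ?N m) \<le> C / real m"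
    using critical_coeff_le[OF N] by blast
  show ?thesis
  proof (rule that[OF C(1)])
    fix a :: "complex^'n" assume a: "norm a < 1"
    let ?x = "(norm a)\<^sup>2"
    have x: "0 \<le> ?x" "?x < 1" using a by (auto simp: abs_square_less_1)
    have "(\<lambda>m. - ((- (- ?x)) ^ m) / of_nat m) sums ln (1 + (- ?x))"
      by (rule ln_series') (use x in simp)
    then have "(\<lambda>m. - (?x ^ m / real m)) sums ln (1 - ?x)" by simp
    from sums_minus[OF this] have "(\<lambda>m. ?x ^ m / real m) sums ln (1 / (1 - ?x))" using x by (simp add: ln_div)
    from sums_add[OF sums_single[of 0 "\<lambda>_. 1"] sums_mult[OF this, of C]]
    have "(\<lambda>m. (if m = 0 then 1 else 0) + C * (?x ^ m / real m)) sums (1 + C * ln (1 / (1 - ?x)))"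
      by (simp add: eq_commute cong: if_cong)
    moreover have "(pochhammer (?N / 2) m)\<^sup>2 / (fact m * pochhammer ?N m) * ?x ^ m \<le> (if m = 0 then 1 else 0) + C * (?x ^ m / real m)" for m
    proof (cases "m = 0")
      case False
      then have "(pochhammer (?N / 2) m)\<^sup>2 / (fact m * pochhammer ?N m) * ?x ^ m \<le> C / real m * ?x ^ m"
        using C(2)[of m] x by (intro mult_right_mono) auto
      then show ?thesis using False by simp
    qed simp
    ultimately have "(\<integral>w. norm (1 - cinner_vec w a) powr (- ?N) \<partial>bergman_measure \<alpha>) \<le> 1 + C * ln (1 / (1 - ?x))"
      by (intro sums_le[OF _ kernel_norm_sums(1)[OF \<alpha> a]]) auto
    then show "(\<integral>\<^sup>+w. ennreal (norm (1 - cinner_vec w a) powr (- ?N)) \<partial>bergman_measure \<alpha>) \<le> ennreal (1 + C * ln (1 / (1 - ?x)))"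
      unfolding nn_kernel_norm[OF \<alpha> a] by (rule ennreal_leI)
  qed
qed

text \<open>The factor 1 - |w|^2 raises the weight to \<alpha> + 1, for which the exponent N is one
  below the critical value. The coefficients gain N / (N + m), become O(1 / m^2) and sum uniformly
  in a.\<close>

theorem forelli_rudin_bounded:
  assumes \<alpha>: "\<alpha> > -1"
  obtains C where "C > 0" "\<And>a :: complex^'n. norm a < 1 \<Longrightarrow>
    (\<integral>\<^sup>+w. ennreal ((1 - (norm w)\<^sup>2) * norm (1 - cinner_vec w a) powr (- (real CARD('n) + 1 + \<alpha>))) \<partial>bergman_measure \<alpha>)
      \<le> ennreal C"
proof -
  let ?N = "real CARD('n) + 1 + \<alpha>"
  have N: "?N > 0" using \<alpha> by simp
  obtain C where C: "C > 0" "\<And>m. m > 0 \<Longrightarrow> (pochhammer (?N / 2) m)\<^sup>2 / (fact m * pochhammer ?N m) \<le> C / real m"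
    using critical_coeff_le[OF N] by blast
  have \<alpha>1: "\<alpha> + 1 > -1" using \<alpha> by simp
  obtain c where c: "c > 0" "(bergman_measure (\<alpha> + 1) :: (complex^'n) measure)
     = density (bergman_measure \<alpha>) (\<lambda>w. ennreal (c * (1 - (norm w)\<^sup>2) powr (\<alpha> + 1 - \<alpha>)))"
    using bergman_measure_reweight[OF \<alpha> \<alpha>1] by blast
  define A where "A = (\<lambda>m. if m = 0 then 1 else C * ?N / real m ^ 2)"
  have "summable (\<lambda>m. C * ?N * inverse (real m ^ 2))"
    using inverse_power_summable[of 2, where 'a=real] by (intro summable_mult) auto
  then have smA: "summable A"
    by (subst summable_cong[of _ "\<lambda>m. C * ?N * inverse (real m ^ 2)"])
      (auto simp: A_def divide_inverse intro!: eventually_sequentiallyI[of 1])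
  have A0: "A m \<ge> 0" for m using C N by (simp add: A_def)
  have coeff: "(pochhammer (?N / 2) m)\<^sup>2 / (fact m * pochhammer (?N + 1) m) \<le> A m" for m
  proof (cases "m = 0")
    case False
    have p: "pochhammer ?N m > 0" "pochhammer (?N + 1) m > 0" using N by (auto intro!: pochhammer_pos)
    have "?N * pochhammer (?N + 1) m = (?N + m) * pochhammer ?N m"
      using pochhammer_rec[of ?N m] pochhammer_rec'[of ?N m] by simp
    then have eq: "pochhammer (?N + 1) m = pochhammer ?N m * ((?N + m) / ?N)" using N by (simp add: field_simps)
    have "(pochhammer (?N / 2) m)\<^sup>2 / (fact m * pochhammer (?N + 1) m)
        = (pochhammer (?N / 2) m)\<^sup>2 / (fact m * pochhammer ?N m) * (?N / (?N + m))"
      unfolding eq by simp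
    also have "\<dots> \<le> C / real m * (?N / (?N + m))"
      using False N C(2)[of m] by (intro mult_right_mono) auto
    also have "\<dots> \<le> C / real m * (?N / m)"
      using False N C by (intro mult_left_mono divide_left_mono) auto
    also have "\<dots> = A m" using False by (simp add: A_def power2_eq_square)
    finally show ?thesis .
  qed (simp add: A_def)
  show ?thesis
  proof (rule that[of "suminf A / c + 1"])
    show "suminf A / c + 1 > 0" using suminf_nonneg[OF smA A0] c by (simp add: add_nonneg_pos)
    fix a :: "complex^'n" assume a: "norm a < 1"
    let ?x = "(norm a)\<^sup>2"
    have x: "0 \<le> ?x" "?x < 1" using a by (auto simp: abs_square_less_1)
    let ?I = "\<integral>\<^sup>+w. ennreal ((1 - (norm w)\<^sup>2) * norm (1 - cinner_vec w a) powr (- ?N)) \<partial>bergman_measure \<alpha>"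
    have "(pochhammer (?N / 2) m)\<^sup>2 / (fact m * pochhammer (real CARD('n) + 1 + (\<alpha> + 1)) m) * ?x ^ m \<le> A m" for m
    proof -
      have "(pochhammer (?N / 2) m)\<^sup>2 / (fact m * pochhammer (?N + 1) m) * ?x ^ m \<le> A m * 1"
        by (intro mult_mono coeff power_le_one A0 zero_le_power x less_imp_le[OF x(2)])
      then show ?thesis by (simp add: add_ac)
    qed
    then have le: "(\<integral>w. norm (1 - cinner_vec w a) powr (- ?N) \<partial>bergman_measure (\<alpha> + 1)) \<le> suminf A"
      by (rule sums_le[OF _ kernel_norm_sums(1)[OF \<alpha>1 a] summable_sums[OF smA]])
    have "ennreal c * ?I = (\<integral>\<^sup>+w. ennreal (c * (1 - (norm w)\<^sup>2) powr (\<alpha> + 1 - \<alpha>)) * ennreal (norm (1 - cinner_vec w a) powr (- ?N)) \<partial>bergman_measure \<alpha>)"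
      using c by (subst nn_integral_cmult[symmetric])
        (auto intro!: nn_integral_cong simp: ennreal_mult'[symmetric] abs_square_le_1 mult.assoc)
    also have "\<dots> = (\<integral>\<^sup>+w. ennreal (norm (1 - cinner_vec w a) powr (- ?N)) \<partial>bergman_measure (\<alpha> + 1))"
      unfolding c(2) by (subst nn_integral_density) auto
    also have "\<dots> \<le> ennreal (suminf A)"
      unfolding nn_kernel_norm[OF \<alpha>1 a] by (rule ennreal_leI[OF le])
    finally have "ennreal c * ?I \<le> ennreal (suminf A)" .
    then have "ennreal (1 / c) * (ennreal c * ?I) \<le> ennreal (1 / c) * ennreal (suminf A)" by (rule mult_left_mono) simp
    moreover have "ennreal (1 / c) * (ennreal c * ?I) = ?I"
      using c by (simp add: mult.assoc[symmetric] ennreal_mult'[symmetric])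
    moreover have "ennreal (1 / c) * ennreal (suminf A) \<le> ennreal (suminf A / c + 1)"
      using c suminf_nonneg[OF smA A0] by (simp add: ennreal_mult'[symmetric] ennreal_leI)
    ultimately show "?I \<le> ennreal (suminf A / c + 1)" by simp
  qed
qed

section \<open>Growth functions\<close>

lemma growth_class_basic:
  assumes "\<Phi> \<in> growth_class p"
  shows growth_mono: "0 \<le> s \<Longrightarrow> s \<le> t \<Longrightarrow> \<Phi> s \<le> \<Phi> t"
    and growth_nonneg: "0 \<le> t \<Longrightarrow> 0 \<le> \<Phi> t"
    and growth_zero: "\<Phi> 0 = 0"
    and growth_pos: "0 < t \<Longrightarrow> 0 < \<Phi> t"
    and growth_ratio: "0 < s \<Longrightarrow> s \<le> t \<Longrightarrow> \<Phi> t / t \<le> \<Phi> s / s"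
proof -
  have im: "\<Phi> ` {0..} = {0..}" and mono: "mono_on {0..} \<Phi>" and anti: "antimono_on {0<..} (\<lambda>t. \<Phi> t / t)"
    using assms by (auto simp: growth_class_def growth_function_def)
  have m: "\<Phi> s \<le> \<Phi> t" if "0 \<le> s" "s \<le> t" for s t
    using mono that by (auto simp: mono_on_def)
  have nn: "0 \<le> \<Phi> t" if "0 \<le> t" for t
    using im that by (metis atLeast_iff imageI)
  have r: "\<Phi> t / t \<le> \<Phi> s / s" if "0 < s" "s \<le> t" for s t
    using anti that by (auto simp: monotone_on_def)
  have surj: "\<exists>t\<ge>0. \<Phi> t = y" if "y \<ge> 0" for y
    using im that by (metis (no_types, lifting) atLeast_iff image_iff)
  show "\<Phi> 0 = 0" using surj[of 0] m[of 0] nn[of 0] by fastforce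
  show "0 < \<Phi> t" if "0 < t"
  proof (rule ccontr)
    \<comment> \<open>As \<Phi> t / t does not increase, a zero at t > 0 would persist to the right
      of t, whereas \<Phi> takes the value 1 there.\<close>
    assume "\<not> 0 < \<Phi> t"
    then have t0: "\<Phi> t = 0" using nn[of t] that by simp
    obtain u where u: "u \<ge> 0" "\<Phi> u = 1" using surj[of 1] by auto
    have "t \<le> u" using m[of u t] u t0 by (cases "t \<le> u") auto
    from r[OF that this] have "1 / u \<le> 0" using u t0 by simp
    then show False using u that \<open>t \<le> u\<close> by (simp add: divide_le_0_iff)
  qed
  show "0 \<le> s \<Longrightarrow> s \<le> t \<Longrightarrow> \<Phi> s \<le> \<Phi> t" "0 \<le> t \<Longrightarrow> 0 \<le> \<Phi> t"
    "0 < s \<Longrightarrow> s \<le> t \<Longrightarrow> \<Phi> t / t \<le> \<Phi> s / s" by (rule m nn r; assumption)+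
qed

lemma growth_lower_type:
  assumes "\<Phi> \<in> growth_class p"
  obtains C where "C > 0" "\<And>s t. 0 < s \<Longrightarrow> 0 < t \<Longrightarrow> t \<le> 1 \<Longrightarrow> \<Phi> (s * t) \<le> C * t powr p * \<Phi> s"
  using assms by (auto simp: growth_class_def lower_type_def)

lemma growth_scale:
  assumes G: "\<Phi> \<in> growth_class p" and "c \<ge> 1" "t \<ge> 0"
  shows "\<Phi> (c * t) \<le> c * \<Phi> t"
proof (cases "t = 0")
  case False
  then have "t > 0" using assms by simp
  then have "\<Phi> (c * t) / (c * t) \<le> \<Phi> t / t" using assms by (intro growth_ratio[OF G]) auto
  then show ?thesis using \<open>t > 0\<close> assms(2) by (simp add: field_simps)
qed (simp add: growth_zero[OF G])

lemma measurable_growth: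
  assumes "\<Phi> \<in> growth_class p" and [measurable]: "f \<in> borel_measurable M"
    and "\<And>x. x \<in> space M \<Longrightarrow> 0 \<le> f x"
  shows "(\<lambda>x. \<Phi> (f x)) \<in> borel_measurable M"
proof -
  have "continuous_on {0..} \<Phi>" using assms(1) by (simp add: growth_class_def growth_function_def)
  \<comment> \<open>\<Phi> is arbitrary on the negative reals, so it is composed with a truncation
    that changes nothing on the range of f.\<close>
  then have "continuous_on UNIV (\<lambda>x. \<Phi> (max 0 x))"
    by (rule continuous_on_compose2) (auto intro!: continuous_intros)
  then have [measurable]: "(\<lambda>x. \<Phi> (max 0 x)) \<in> borel_measurable borel"
    by (rule borel_measurable_continuous_onI)
  have "(\<lambda>x. \<Phi> (max 0 (f x))) \<in> borel_measurable M" by measurable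
  then show ?thesis by (rule measurable_cong[THEN iffD1, rotated]) (use assms(3) in simp)
qed

definition ginv :: "(real \<Rightarrow> real) \<Rightarrow> real \<Rightarrow> real" where
  "ginv \<Phi> y = inv_into {0..} \<Phi> y"

lemma ginv:
  assumes G: "\<Phi> \<in> growth_class p" and "y > 0"
  shows growth_ginv: "\<Phi> (ginv \<Phi> y) = y" and ginv_pos: "ginv \<Phi> y > 0"
proof -
  have "y \<in> \<Phi> ` {0..}" using assms by (auto simp: growth_class_def growth_function_def)
  then show *: "\<Phi> (ginv \<Phi> y) = y" unfolding ginv_def by (rule f_inv_into_f)
  have "ginv \<Phi> y \<ge> 0" using inv_into_into[OF \<open>y \<in> \<Phi> ` {0..}\<close>] by (simp add: ginv_def)
  moreover have "ginv \<Phi> y \<noteq> 0" using * \<open>y > 0\<close> growth_zero[OF G] by auto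
  ultimately show "ginv \<Phi> y > 0" by simp
qed

lemma ginv_mono:
  assumes G: "\<Phi> \<in> growth_class p" and "0 < x" "x \<le> y"
  shows "ginv \<Phi> x \<le> ginv \<Phi> y"
proof (rule ccontr)
  assume *: "\<not> ginv \<Phi> x \<le> ginv \<Phi> y"
  have y: "y > 0" using assms by simp
  have "\<Phi> (ginv \<Phi> y) \<le> \<Phi> (ginv \<Phi> x)"
    using * ginv_pos[OF G y] by (intro growth_mono[OF G]) auto
  then have "x = y" using growth_ginv[OF G] assms y by simp
  then show False using * by simp
qed

lemma ginv_ratio:
  assumes G: "\<Phi> \<in> growth_class p" and "0 < x" "x \<le> y"
  shows "ginv \<Phi> x / x \<le> ginv \<Phi> y / y"
proof -
  have y: "y > 0" using assms by simp
  note p = ginv_pos[OF G assms(2)] ginv_pos[OF G y]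
  have "\<Phi> (ginv \<Phi> y) / ginv \<Phi> y \<le> \<Phi> (ginv \<Phi> x) / ginv \<Phi> x"
    using p by (intro growth_ratio[OF G] ginv_mono[OF G assms(2,3)]) auto
  then show ?thesis
    unfolding growth_ginv[OF G assms(2)] growth_ginv[OF G y] using p y assms(2) by (simp add: field_simps)
qed

text \<open>Lower type p of \<Phi> is upper type 1 / p of its inverse; this is where the exponent
  \<gamma> = 1/p - 1 of \<rho> comes from.\<close>

lemma ginv_upper:
  assumes G: "\<Phi> \<in> growth_class p" and p: "p > 0"
  obtains C where "C > 0" "\<And>x y. 0 < x \<Longrightarrow> x \<le> y \<Longrightarrow> ginv \<Phi> y \<le> C * (y / x) powr (1 / p) * ginv \<Phi> x"
proof -
  obtain C where C: "C > 0" "\<And>s t. 0 < s \<Longrightarrow> 0 < t \<Longrightarrow> t \<le> 1 \<Longrightarrow> \<Phi> (s * t) \<le> C * t powr p * \<Phi> s"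
    using growth_lower_type[OF G] by blast
  show ?thesis
  proof (rule that[of "C powr (1 / p)"])
    fix x y :: real assume x: "0 < x" and xy: "x \<le> y"
    have y: "y > 0" using x xy by simp
    define a b where "a = ginv \<Phi> x" "b = ginv \<Phi> y"
    have ab: "a > 0" "b > 0" "a \<le> b" using ginv_pos[OF G] ginv_mono[OF G x xy] x y by (auto simp: a_b_def)
    have "\<Phi> (b * (a / b)) \<le> C * (a / b) powr p * \<Phi> b" using ab by (intro C) auto
    then have "x \<le> C * (a / b) powr p * y"
      using ab growth_ginv[OF G x] growth_ginv[OF G y] by (simp add: a_b_def)
    then have "(b / a) powr p \<le> C * (y / x)"
      using ab x y by (simp add: powr_divide field_simps)
    then have "((b / a) powr p) powr (1 / p) \<le> (C * (y / x)) powr (1 / p)"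
      using p by (intro powr_mono2) auto
    moreover have "((b / a) powr p) powr (1 / p) = b / a" using ab p by (simp add: powr_powr)
    moreover have "(C * (y / x)) powr (1 / p) = C powr (1 / p) * (y / x) powr (1 / p)"
      by (rule powr_mult; use C x y in simp)
    ultimately have "b / a \<le> C powr (1 / p) * (y / x) powr (1 / p)" by simp
    then show "ginv \<Phi> y \<le> C powr (1 / p) * (y / x) powr (1 / p) * ginv \<Phi> x"
      using ab by (simp add: a_b_def[symmetric] field_simps)
  qed (use C in simp)
qed

section \<open>Pointwise growth in the Bergman--Orlicz space\<close>

text \<open>Up to a constant, the bound at w for a bounded holomorphic function with normalised
  Orlicz integral; the test functions of the necessity part are scaled by it.\<close>

definition peak :: "(real \<Rightarrow> real) \<Rightarrow> real \<Rightarrow> complex^'n \<Rightarrow> real" where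
  "peak \<Phi> \<alpha> w = ginv \<Phi> ((1 - (norm w)\<^sup>2) powr (- (real CARD('n) + 1 + \<alpha>)))"

lemma one_minus_norm_square_pos: "norm w < 1 \<Longrightarrow> 1 - (norm w)\<^sup>2 > 0"
  by (simp add: abs_square_less_1)

lemma peak_pos:
  assumes "\<Phi> \<in> growth_class p" "norm w < 1"
  shows "peak \<Phi> \<alpha> w > 0"
  unfolding peak_def using one_minus_norm_square_pos[OF assms(2)] by (intro ginv_pos[OF assms(1)]) simp

lemma growth_peak:
  fixes w :: "complex^'n"
  assumes "\<Phi> \<in> growth_class p" "norm w < 1"
  shows "\<Phi> (peak \<Phi> \<alpha> w) = (1 - (norm w)\<^sup>2) powr (- (real CARD('n) + 1 + \<alpha>))"
  unfolding peak_def using one_minus_norm_square_pos[OF assms(2)] by (intro growth_ginv[OF assms(1)]) simp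

text \<open>The kernel estimate behind \<open>peak_bound\<close>. If w is at least as close to the
  boundary as u, the monotone ratio of the inverse of \<Phi> compares the two peaks; otherwise its
  upper type 1 / p does. The leftover powers are absorbed because |1 - <w,u>| is at least half of 1
  - |u|^2 and half of 1 - |w|^2.\<close>

lemma peak_kernel_le:
  assumes G: "\<Phi> \<in> growth_class p" and p: "0 < p" "p \<le> 1" and \<alpha>: "\<alpha> > -1"
  obtains C where "C > 0" "\<And>u w :: complex^'n. norm u < 1 \<Longrightarrow> norm w < 1 \<Longrightarrow>
    peak \<Phi> \<alpha> u * (1 - (norm u)\<^sup>2) powr ((real CARD('n) + 1 + \<alpha>) / p) * norm (1 - cinner_vec w u) powr (- ((real CARD('n) + 1 + \<alpha>) / p))
      \<le> C * peak \<Phi> \<alpha> w"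
proof -
  let ?N = "real CARD('n) + 1 + \<alpha>"
  have N: "?N > 0" using \<alpha> by simp
  obtain C where C: "C > 0" "\<And>x y. 0 < x \<Longrightarrow> x \<le> y \<Longrightarrow> ginv \<Phi> y \<le> C * (y / x) powr (1 / p) * ginv \<Phi> x"
    using ginv_upper[OF G p(1)] by blast
  define L where "L = max 1 C * 2 powr (?N / p)"
  show ?thesis
  proof (rule that[of L])
    show "L > 0" by (simp add: L_def)
    fix u w :: "complex^'n" assume uw: "norm u < 1" "norm w < 1"
    define a b y where "a = 1 - (norm u)\<^sup>2" and "b = 1 - (norm w)\<^sup>2" and "y = norm (1 - cinner_vec w u)"
    have ab: "a > 0" "b > 0" using uw one_minus_norm_square_pos by (auto simp: a_def b_def)
    have y: "b / 2 \<le> y" "a / 2 \<le> y" using one_minus_norm_le[OF uw(2,1)] by (auto simp: a_def b_def y_def)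
    have y0: "y > 0" using y ab by linarith
    define S where "S = peak \<Phi> \<alpha> u"
    define R where "R = peak \<Phi> \<alpha> w"
    have SR: "S > 0" "R > 0" using peak_pos[OF G] uw by (auto simp: S_def R_def)
    have Se: "S = ginv \<Phi> (a powr (- ?N))" and Re: "R = ginv \<Phi> (b powr (- ?N))"
      by (auto simp: S_def R_def peak_def a_def b_def)
    have Np: "?N / p = ?N + ?N * (1 / p - 1)" using p by (simp add: field_simps)
    have j: "?N * (1 / p - 1) \<ge> 0" using p N by (intro mult_nonneg_nonneg) (auto simp: field_simps)
    have inv: "y powr (- s) \<le> 2 powr s * c powr (- s)" if "c > 0" "c / 2 \<le> y" "s \<ge> 0" for c s
    proof -
      have "y powr (- s) \<le> (c / 2) powr (- s)" using that by (intro powr_mono2') auto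
      also have "\<dots> = 2 powr s * c powr (- s)" using that by (simp add: powr_divide powr_minus field_simps)
      finally show ?thesis .
    qed
    have "S * a powr (?N / p) * y powr (- (?N / p)) \<le> L * R"
    proof (cases "b \<le> a")
      case True
      have "a powr (- ?N) \<le> b powr (- ?N)" using True ab N by (intro powr_mono2') auto
      then have "S / a powr (- ?N) \<le> R / b powr (- ?N)"
        unfolding Se Re using ab by (intro ginv_ratio[OF G]) auto
      then have 1: "S * a powr ?N \<le> R * b powr ?N" by (simp only: powr_minus divide_inverse inverse_inverse_eq)
      let ?j = "?N * (1 / p - 1)"
      have "S * a powr (?N / p) * y powr (- (?N / p)) = (S * a powr ?N) * (a powr ?j * y powr (- ?j)) * y powr (- ?N)"
        unfolding Np minus_add_distrib powr_add by simp
      also have "\<dots> \<le> (R * b powr ?N) * (a powr ?j * (2 powr ?j * a powr (- ?j))) * (2 powr ?N * b powr (- ?N))"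
      proof (rule mult_mono[OF mult_mono[OF 1]])
        show "a powr ?j * y powr (- ?j) \<le> a powr ?j * (2 powr ?j * a powr (- ?j))"
          by (rule mult_left_mono[OF inv[OF ab(1) y(2) j]]) simp
        show "y powr (- ?N) \<le> 2 powr ?N * b powr (- ?N)" by (rule inv[OF ab(2) y(1)]) (use N in simp)
      qed (use SR in auto)
      also have "\<dots> = R * (b powr ?N * b powr (- ?N)) * (a powr ?j * a powr (- ?j)) * (2 powr ?j * 2 powr ?N)"
        by (simp only: mult_ac)
      also have "\<dots> = R * 2 powr (?N / p)"
        using ab unfolding powr_add[symmetric] Np by (simp add: add.commute)
      also have "\<dots> \<le> L * R" using SR by (simp add: L_def mult_ac mult_left_mono)
      finally show ?thesis .
    next
      case False
      have "b powr (- ?N) \<le> a powr (- ?N)" using False ab N by (intro powr_mono2') auto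
      then have "S \<le> C * (a powr (- ?N) / b powr (- ?N)) powr (1 / p) * R"
        unfolding Se Re using ab by (intro C) auto
      also have "(a powr (- ?N) / b powr (- ?N)) powr (1 / p) = a powr (- (?N / p)) * b powr (?N / p)"
      proof -
        have "(a powr (- s) / b powr (- s)) powr (1 / p) = a powr (- (s / p)) * b powr (s / p)" for s
        proof -
          have "a powr (- s) / b powr (- s) = a powr (- s) * b powr s"
            unfolding powr_minus[of b s] by (simp only: divide_inverse inverse_inverse_eq)
          then show ?thesis by (simp add: powr_mult powr_powr)
        qed
        then show ?thesis .
      qed
      finally have "S * a powr (?N / p) * y powr (- (?N / p))
        \<le> (C * (a powr (- (?N / p)) * b powr (?N / p)) * R) * a powr (?N / p) * (2 powr (?N / p) * b powr (- (?N / p)))"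
        using SR ab y p N C by (intro mult_mono inv mult_nonneg_nonneg) auto
      also have "\<dots> = C * R * (a powr (- (?N / p)) * a powr (?N / p)) * (b powr (?N / p) * b powr (- (?N / p))) * 2 powr (?N / p)"
        by (simp only: mult_ac)
      also have "\<dots> = C * R * 2 powr (?N / p)"
        using ab unfolding powr_add[symmetric] by simp
      also have "\<dots> \<le> L * R" using SR by (simp add: L_def mult_ac mult_left_mono)
      finally show ?thesis .
    qed
    then show "peak \<Phi> \<alpha> u * (1 - (norm u)\<^sup>2) powr (?N / p) * norm (1 - cinner_vec w u) powr (- (?N / p)) \<le> L * peak \<Phi> \<alpha> w"
      by (simp only: S_def R_def a_def y_def)
  qed
qed

(* Reproduce f with the weight \<alpha> + N (1/p - 1); lower type p turns the a priori bound M = sup |f| / peak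
   into M \<le> K * M^(1-p). *)
theorem peak_bound:
  assumes G: "\<Phi> \<in> growth_class p" and p: "0 < p" "p \<le> 1" and \<alpha>: "\<alpha> > -1"
  obtains C where "C > 0" "\<And>f w. holomorphic_vec f (ball (0 :: complex^'n) 1) \<Longrightarrow> bounded (f ` ball 0 1) \<Longrightarrow>
    (\<integral>\<^sup>+z. ennreal (\<Phi> (norm (f z))) \<partial>bergman_measure \<alpha>) \<le> 1 \<Longrightarrow> norm w < 1 \<Longrightarrow> norm (f w) \<le> C * peak \<Phi> \<alpha> w"
proof -
  let ?N = "real CARD('n) + 1 + \<alpha>"
  let ?\<nu> = "bergman_measure \<alpha> :: (complex^'n) measure"
  have N: "?N > 0" using \<alpha> by simp
  \<comment> \<open>With the weight \<alpha> + j the reproducing exponent becomes N / p, the one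
    treated in \<open>peak_kernel_le\<close>.\<close>
  define j where "j = ?N * (1 / p - 1)"
  have j: "j \<ge> 0" using p N unfolding j_def by (intro mult_nonneg_nonneg) (auto simp: field_simps)
  have Nj: "real CARD('n) + 1 + (\<alpha> + j) = ?N / p" using p by (simp add: j_def field_simps)
  have \<beta>: "\<alpha> + j > -1" using \<alpha> j by simp
  obtain c where c: "c > 0" "(bergman_measure (\<alpha> + j) :: (complex^'n) measure)
     = density ?\<nu> (\<lambda>w. ennreal (c * (1 - (norm w)\<^sup>2) powr (\<alpha> + j - \<alpha>)))"
    using bergman_measure_reweight[OF \<alpha> \<beta>] by blast
  interpret \<beta>: finite_measure "bergman_measure (\<alpha> + j) :: (complex^'n) measure" by (rule finite_measure_bergman[OF \<beta>])
  obtain C1 where C1: "C1 > 0" "\<And>s t. 0 < s \<Longrightarrow> 0 < t \<Longrightarrow> t \<le> 1 \<Longrightarrow> \<Phi> (s * t) \<le> C1 * t powr p * \<Phi> s"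
    using growth_lower_type[OF G] by blast
  obtain C2 where C2: "C2 > 0" "\<And>u w :: complex^'n. norm u < 1 \<Longrightarrow> norm w < 1 \<Longrightarrow>
    peak \<Phi> \<alpha> u * (1 - (norm u)\<^sup>2) powr (?N / p) * norm (1 - cinner_vec w u) powr (- (?N / p)) \<le> C2 * peak \<Phi> \<alpha> w"
    using peak_kernel_le[OF G p \<alpha>] by blast
  define K where "K = c * C1 * C2"
  have K: "K > 0" using c C1 C2 by (simp add: K_def)
  show ?thesis
  proof (rule that[of "max 1 (K powr (1 / p))"])
    fix f :: "complex^'n \<Rightarrow> complex" and w :: "complex^'n"
    assume f: "holomorphic_vec f (ball 0 1)" and bd: "bounded (f ` ball 0 1)"
      and I: "(\<integral>\<^sup>+z. ennreal (\<Phi> (norm (f z))) \<partial>?\<nu>) \<le> 1" and w: "norm w < 1"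
    define Q where "Q = (\<lambda>u. norm (f u) / peak \<Phi> \<alpha> u)"
    obtain B where "\<forall>y\<in>f ` ball 0 1. norm y \<le> B" using bd unfolding bounded_iff by blast
    then have B: "norm (f u) \<le> B" if "norm u < 1" for u using that by simp
    \<comment> \<open>f is bounded and \<open>peak\<close> is at least the inverse of \<Phi> at 1,
      so the supremum to be estimated is finite beforehand; without that the final division would be
      meaningless.\<close>
    have bdd: "bdd_above (Q ` ball 0 1)"
    proof (rule bdd_aboveI2)
      fix u :: "complex^'n" assume "u \<in> ball 0 1"
      then have u: "norm u < 1" by simp
      have "1 powr (- ?N) \<le> (1 - (norm u)\<^sup>2) powr (- ?N)"
        using N one_minus_norm_square_pos[OF u] by (intro powr_mono2') auto
      then have le: "ginv \<Phi> 1 \<le> peak \<Phi> \<alpha> u" unfolding peak_def by (intro ginv_mono[OF G]) auto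
      have "B \<ge> 0" using B[of 0] norm_ge_zero[of "f 0"] by (simp del: norm_ge_zero)
      then show "Q u \<le> B / ginv \<Phi> 1"
        unfolding Q_def using B[OF u] le ginv_pos[OF G zero_less_one] by (intro frac_le) auto
    qed
    \<comment> \<open>M being at least 1 lets the lower type be applied with the factor 1 /
      M.\<close>
    define M where "M = max 1 (Sup (Q ` ball 0 1))"
    have M: "M \<ge> 1" by (simp add: M_def)
    have fM: "norm (f u) \<le> M * peak \<Phi> \<alpha> u" if "norm u < 1" for u
    proof -
      have "Q u \<le> Sup (Q ` ball 0 1)" using that by (intro cSUP_upper bdd) auto
      then have "Q u \<le> M" by (simp add: M_def)
      then show ?thesis using peak_pos[OF G that, of \<alpha>] by (simp add: Q_def field_simps)
    qed
    \<comment> \<open>The quotient t / \<Phi> t does not decrease, so at t = |f u| it is at most its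
      value at M * peak. Lower type with factor 1 / M then bounds \<Phi> peak by C1 M^(-p) \<Phi> (M
      * peak), and this gain M^(-p) closes the argument.\<close>
    have f\<Phi>: "norm (f u) \<le> C1 * M powr (1 - p) * \<Phi> (norm (f u)) * peak \<Phi> \<alpha> u * (1 - (norm u)\<^sup>2) powr ?N"
      if u: "norm u < 1" for u
    proof (cases "f u = 0")
      case False
      let ?S = "peak \<Phi> \<alpha> u" and ?t = "norm (f u)"
      have S: "?S > 0" by (rule peak_pos[OF G u])
      have t: "?t > 0" using False by simp
      have MS: "M * ?S > 0" using M S by simp
      note pos = growth_pos[OF G MS] growth_pos[OF G S] growth_pos[OF G t]
      have "\<Phi> (M * ?S * (1 / M)) \<le> C1 * (1 / M) powr p * \<Phi> (M * ?S)"
        using M by (intro C1(2)[OF MS]) auto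
      moreover have "M * ?S * (1 / M) = ?S" "(1 / M) powr p = M powr (- p)"
        using M powr_divide[of 1 M p] by (simp_all add: powr_minus_divide)
      ultimately have a: "\<Phi> ?S \<le> C1 * M powr (- p) * \<Phi> (M * ?S)" by (simp only:)
      have "\<Phi> (M * ?S) / (M * ?S) \<le> \<Phi> ?t / ?t"
        by (rule growth_ratio[OF G t fM[OF u]])
      then have "?t * \<Phi> (M * ?S) \<le> \<Phi> ?t * (M * ?S)" using MS t by (simp add: field_simps)
      then have "C1 * M powr (- p) * (?t * \<Phi> (M * ?S)) \<le> C1 * M powr (- p) * (\<Phi> ?t * (M * ?S))"
        using C1(1) by (intro mult_left_mono) auto
      moreover have "?t * \<Phi> ?S \<le> ?t * (C1 * M powr (- p) * \<Phi> (M * ?S))"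
        using a t by (intro mult_left_mono) auto
      ultimately have "?t * \<Phi> ?S \<le> C1 * (M powr (- p) * M) * \<Phi> ?t * ?S" by (simp add: mult_ac)
      also have "M powr (- p) * M = M powr (1 - p)"
        using M powr_add[of M "- p" 1] by simp
      finally have "?t * (1 - (norm u)\<^sup>2) powr (- ?N) \<le> C1 * M powr (1 - p) * \<Phi> ?t * ?S"
        unfolding growth_peak[OF G u] .
      from mult_right_mono[OF this, of "(1 - (norm u)\<^sup>2) powr ?N"]
      have "?t * ((1 - (norm u)\<^sup>2) powr (- ?N) * (1 - (norm u)\<^sup>2) powr ?N) \<le> C1 * M powr (1 - p) * \<Phi> ?t * ?S * (1 - (norm u)\<^sup>2) powr ?N"
        by (simp add: mult.assoc)
      then show ?thesis
        using one_minus_norm_square_pos[OF u] unfolding powr_add[symmetric] by simp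
    qed (simp add: growth_zero[OF G])
    have main: "norm (f z) \<le> K * M powr (1 - p) * peak \<Phi> \<alpha> z" if z: "norm z < 1" for z
    proof -
      have fm: "f \<in> borel_measurable (bergman_measure \<beta>)" for \<beta> by (rule measurable_holomorphic_vec[OF f])
      have int: "integrable (bergman_measure (\<alpha> + j)) f"
        by (rule \<beta>.integrable_const_bound[where B=B]) (use B fm in auto)
      have "f z = kern_int (\<alpha> + j) (bkern (?N / p)) f z"
        using bergman_reproducing[OF \<beta> f int z] unfolding Nj .
      then have "ennreal (norm (f z)) \<le> (\<integral>\<^sup>+u. ennreal (norm (f u * bkern (?N / p) (cinner_vec z u))) \<partial>bergman_measure (\<alpha> + j))"
        unfolding kern_int_def
        by (metis integral_norm_bound_ennreal integrable_kernel[OF holomorphic_on_imp_continuous_on[OF bkern_holomorphic] z int])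
      also have "\<dots> = (\<integral>\<^sup>+u. ennreal (c * (1 - (norm u)\<^sup>2) powr (\<alpha> + j - \<alpha>)) * ennreal (norm (f u * bkern (?N / p) (cinner_vec z u))) \<partial>?\<nu>)"
        unfolding c(2)
        using fm[of \<alpha>] continuous_on_measurable_bergman[OF continuous_on_kernel[OF holomorphic_on_imp_continuous_on[OF bkern_holomorphic] z], of "?N / p" \<alpha>]
        by (subst nn_integral_density) auto
      also have "\<dots> \<le> (\<integral>\<^sup>+u. ennreal (K * M powr (1 - p) * peak \<Phi> \<alpha> z) * ennreal (\<Phi> (norm (f u))) \<partial>?\<nu>)"
      proof (rule nn_integral_mono)
        fix u assume "u \<in> space ?\<nu>"
        then have u: "norm u < 1" by simp
        let ?a = "1 - (norm u)\<^sup>2" and ?y = "norm (1 - cinner_vec z u) powr (- (?N / p))"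
        have x: "norm (cinner_vec z u) < 1" by (rule norm_cinner_vec_less[OF z u])
        have "c * ?a powr j * (norm (f u) * ?y)
          \<le> c * ?a powr j * ((C1 * M powr (1 - p) * \<Phi> (norm (f u)) * peak \<Phi> \<alpha> u * ?a powr ?N) * ?y)"
          using c f\<Phi>[OF u] by (intro mult_left_mono mult_right_mono) auto
        also have "\<dots> = c * C1 * M powr (1 - p) * \<Phi> (norm (f u)) * (peak \<Phi> \<alpha> u * (?a powr j * ?a powr ?N) * ?y)"
          by (simp only: mult_ac)
        also have "?a powr j * ?a powr ?N = ?a powr (?N / p)"
          unfolding powr_add[symmetric] Nj[symmetric] by (simp add: add_ac)
        also have "c * C1 * M powr (1 - p) * \<Phi> (norm (f u)) * (peak \<Phi> \<alpha> u * ?a powr (?N / p) * ?y)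
          \<le> c * C1 * M powr (1 - p) * \<Phi> (norm (f u)) * (C2 * peak \<Phi> \<alpha> z)"
          using c C1 growth_nonneg[OF G, of "norm (f u)"] by (intro mult_left_mono C2(2)[OF u z]) auto
        also have "\<dots> = K * M powr (1 - p) * peak \<Phi> \<alpha> z * \<Phi> (norm (f u))" by (simp add: K_def mult_ac)
        finally have "c * ?a powr j * (norm (f u) * ?y) \<le> K * M powr (1 - p) * peak \<Phi> \<alpha> z * \<Phi> (norm (f u))" .
        then show "ennreal (c * ?a powr (\<alpha> + j - \<alpha>)) * ennreal (norm (f u * bkern (?N / p) (cinner_vec z u)))
          \<le> ennreal (K * M powr (1 - p) * peak \<Phi> \<alpha> z) * ennreal (\<Phi> (norm (f u)))"
          using c K peak_pos[OF G z, of \<alpha>] growth_nonneg[OF G, of "norm (f u)"]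
          by (simp add: ennreal_mult'[symmetric] norm_mult norm_bkern[OF x] ennreal_leI)
      qed
      also have "\<dots> = ennreal (K * M powr (1 - p) * peak \<Phi> \<alpha> z) * (\<integral>\<^sup>+u. ennreal (\<Phi> (norm (f u))) \<partial>?\<nu>)"
        using measurable_growth[OF G, of "\<lambda>u. norm (f u)" ?\<nu>] fm[of \<alpha>] by (intro nn_integral_cmult) auto
      also have "\<dots> \<le> ennreal (K * M powr (1 - p) * peak \<Phi> \<alpha> z) * 1" by (intro mult_left_mono I) simp
      finally have "ennreal (norm (f z)) \<le> ennreal (K * M powr (1 - p) * peak \<Phi> \<alpha> z)" by simp
      moreover have "0 \<le> K * M powr (1 - p) * peak \<Phi> \<alpha> z" using K peak_pos[OF G z, of \<alpha>] by simp
      ultimately show ?thesis by (simp only: ennreal_le_iff)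
    qed
    have "Sup (Q ` ball 0 1) \<le> K * M powr (1 - p)"
    proof (rule cSUP_least)
      fix z :: "complex^'n" assume "z \<in> ball 0 1"
      then show "Q z \<le> K * M powr (1 - p)"
        using main[of z] peak_pos[OF G, of z \<alpha>] by (simp add: Q_def divide_le_eq)
    qed simp
    \<comment> \<open>If M exceeds 1 it is the supremum itself, and dividing M <= K M^(1-p) by
      M^(1-p) leaves M^p <= K.\<close>
    have "M \<le> max 1 (K powr (1 / p))"
    proof (cases "M = 1")
      case False
      then have "M \<le> K * M powr (1 - p)" using \<open>Sup (Q ` ball 0 1) \<le> K * M powr (1 - p)\<close> by (simp add: M_def max_def split: if_splits)
      then have "M * M powr (p - 1) \<le> K * M powr (1 - p) * M powr (p - 1)" by (rule mult_right_mono) simp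
      also have "M * M powr (p - 1) = M powr p" using M powr_add[of M 1 "p - 1"] by simp
      also have "K * M powr (1 - p) * M powr (p - 1) = K" using M by (simp add: mult.assoc powr_add[symmetric])
      finally have "(M powr p) powr (1 / p) \<le> K powr (1 / p)" using p by (intro powr_mono2) auto
      then show ?thesis using M p by (simp add: powr_powr)
    qed simp
    then have "M * peak \<Phi> \<alpha> w \<le> max 1 (K powr (1 / p)) * peak \<Phi> \<alpha> w"
      using peak_pos[OF G w, of \<alpha>] by (intro mult_right_mono) auto
    then show "norm (f w) \<le> max 1 (K powr (1 / p)) * peak \<Phi> \<alpha> w" using fM[OF w] by linarith
  qed simp
qed

section \<open>Integral representation through radial derivatives\<close>

lemma holomorphic_vec_transform:
  assumes "holomorphic_vec g S" "open S" "\<And>z. z \<in> S \<Longrightarrow> f z = g z"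
  shows "holomorphic_vec f S"
  unfolding holomorphic_vec_def
proof
  fix z assume z: "z \<in> S"
  then obtain D where D: "(g has_derivative D) (at z)" "\<forall>c v. D (c *s v) = c * D v"
    using assms(1) unfolding holomorphic_vec_def by blast
  have "(f has_derivative D) (at z)"
    by (rule has_derivative_transform_within_open[OF D(1) assms(2) z]) (simp add: assms(3))
  with D(2) show "\<exists>D. (f has_derivative D) (at z) \<and> (\<forall>c v. D (c *s v) = c * D v)" by blast
qed

lemma holomorphic_vec_mult:
  assumes "holomorphic_vec f S" "holomorphic_vec g S"
  shows "holomorphic_vec (\<lambda>z. f z * g z) S"
  unfolding holomorphic_vec_def
proof
  fix z assume z: "z \<in> S"
  then obtain D where D: "(f has_derivative D) (at z)" "\<forall>c v. D (c *s v) = c * D v"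
    using assms(1) unfolding holomorphic_vec_def by blast
  obtain E where E: "(g has_derivative E) (at z)" "\<forall>c v. E (c *s v) = c * E v"
    using assms(2) z unfolding holomorphic_vec_def by blast
  show "\<exists>D. ((\<lambda>z. f z * g z) has_derivative D) (at z) \<and> (\<forall>c v. D (c *s v) = c * D v)"
    using has_derivative_mult[OF D(1) E(1)] D(2) E(2)
    by (intro exI[of _ "\<lambda>h. f z * E h + D h * g z"]) (simp add: algebra_simps)
qed

lemma holomorphic_vec_const: "holomorphic_vec (\<lambda>z. c) S"
  unfolding holomorphic_vec_def by (auto intro!: exI[of _ "\<lambda>_. 0"])

lemma holomorphic_vec_kern_int:
  assumes \<kappa>: "\<kappa> holomorphic_on ball 0 1" and g: "integrable (bergman_measure \<alpha> :: (complex^'n) measure) g"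
  shows "holomorphic_vec (kern_int \<alpha> \<kappa> g) (ball 0 1)"
  unfolding holomorphic_vec_def
proof
  fix z :: "complex^'n" assume "z \<in> ball 0 1"
  then have "norm z < 1" by simp
  note D = kern_int_has_derivative[OF \<kappa> g this]
  show "\<exists>D. (kern_int \<alpha> \<kappa> g has_derivative D) (at z) \<and> (\<forall>c v. D (c *s v) = c * D v)"
  proof (intro exI conjI allI, rule D)
    fix c and v :: "complex^'n"
    show "(\<integral>w. g w * (deriv \<kappa> (cinner_vec z w) * cinner_vec (c *s v) w) \<partial>bergman_measure \<alpha>)
      = c * (\<integral>w. g w * (deriv \<kappa> (cinner_vec z w) * cinner_vec v w) \<partial>bergman_measure \<alpha>)"
      unfolding cinner_vec_scale_left by (subst integral_mult_right_zero[symmetric]) (simp add: mult_ac)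
  qed
qed

section \<open>Homogeneous expansion of R^k f and its inversion by dilations\<close>

lemma holomorphic_vec_radial:
  assumes \<alpha>: "\<alpha> > -1" and f: "holomorphic_vec f (ball (0::complex^'n) 1)" "integrable (bergman_measure \<alpha>) f"
  shows "holomorphic_vec ((radial_deriv ^^ k) f) (ball 0 1)"
proof (rule holomorphic_vec_transform)
  show "holomorphic_vec (kern_int \<alpha> (rkern (real CARD('n) + 1 + \<alpha>) k) f) (ball 0 1)"
    using \<alpha> by (intro holomorphic_vec_kern_int rkern_holomorphic f) simp
qed (use iterated_radial_deriv[OF \<alpha> f] in auto)

text \<open>The homogeneous Taylor polynomial of degree m at 0, written as the degree-m term of the
  reproducing kernel under the integral; no multi-indices are involved.\<close>

definition hom_part :: "real \<Rightarrow> (complex^'n \<Rightarrow> complex) \<Rightarrow> nat \<Rightarrow> complex^'n \<Rightarrow> complex" where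
  "hom_part \<alpha> f m z = of_real (pochhammer (real CARD('n) + 1 + \<alpha>) m / fact m) * (\<integral>w. f w * cinner_vec z w ^ m \<partial>bergman_measure \<alpha>)"

lemma hom_part_scale: "hom_part \<alpha> f m (c *s z) = c ^ m * hom_part \<alpha> f m z"
proof -
  have "(\<integral>w. f w * cinner_vec (c *s z) w ^ m \<partial>bergman_measure \<alpha>) = (\<integral>w. c ^ m * (f w * cinner_vec z w ^ m) \<partial>bergman_measure \<alpha>)"
    by (simp add: cinner_vec_scale_left power_mult_distrib mult_ac)
  also have "\<dots> = c ^ m * (\<integral>w. f w * cinner_vec z w ^ m \<partial>bergman_measure \<alpha>)" by (rule integral_mult_right_zero)
  finally show ?thesis by (simp add: hom_part_def)
qed

text \<open>\<open>rkern\<close> is expanded under the integral that represents R^k f; |<z,w>| is at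
  most |z| < 1, so the interchange is absolutely convergent. The second part retains the summability
  required for Parseval on circles.\<close>

lemma radial_deriv_sums:
  fixes f :: "complex^'n \<Rightarrow> complex"
  assumes \<alpha>: "\<alpha> > -1" and f: "holomorphic_vec f (ball 0 1)" and int: "integrable (bergman_measure \<alpha>) f"
    and z: "norm z < 1"
  shows "(\<lambda>m. of_nat m ^ k * hom_part \<alpha> f m z) sums (radial_deriv ^^ k) f z"
    and "summable (\<lambda>m. norm (of_nat m ^ k * hom_part \<alpha> f m z))"
proof -
  let ?N = "real CARD('n) + 1 + \<alpha>"
  let ?\<nu> = "bergman_measure \<alpha> :: (complex^'n) measure"
  have N: "?N > 0" using \<alpha> by simp
  define c where "c = (\<lambda>m. complex_of_real (real m ^ k * pochhammer ?N m / fact m))"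
  have cs: "(\<lambda>m. c m * x ^ m) sums rkern ?N k x" if "norm x < 1" for x
    unfolding c_def by (rule rkern_sums_bound(1)[OF N that])
  define G where "G = (\<integral>w. norm (f w) \<partial>?\<nu>)"
  have zw: "norm (cinner_vec z w) \<le> norm z" if "w \<in> space ?\<nu>" for w
    using norm_cinner_vec_le[of z w] that mult_left_le[of "norm w" "norm z"] by simp
  have pw: "norm (cinner_vec z w ^ m) \<le> norm z ^ m" if "w \<in> space ?\<nu>" for w m
    using zw[OF that] by (simp add: norm_power power_mono)
  have smz: "summable (\<lambda>m. norm (c m * of_real (norm z) ^ m))"
    by (rule power_series_abs_summable[of 1]) (use cs z in \<open>auto simp: sums_iff\<close>)
  have ci: "integrable ?\<nu> (\<lambda>w. f w * cinner_vec z w ^ m)" for m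
    by (rule integrable_bounded_mult[OF int]) (use pw in auto)
  have int_m: "integrable ?\<nu> (\<lambda>w. c m * (f w * cinner_vec z w ^ m))" for m
    using ci by simp
  have coeff: "(\<integral>w. c m * (f w * cinner_vec z w ^ m) \<partial>?\<nu>) = of_nat m ^ k * hom_part \<alpha> f m z" for m
    by (simp add: c_def hom_part_def)
  have bound: "(\<integral>w. norm (c m * (f w * cinner_vec z w ^ m)) \<partial>?\<nu>) \<le> norm (c m * of_real (norm z) ^ m) * G" for m
  proof -
    have "(\<integral>w. norm (c m * (f w * cinner_vec z w ^ m)) \<partial>?\<nu>) \<le> (\<integral>w. norm (c m * of_real (norm z) ^ m) * norm (f w) \<partial>?\<nu>)"
    proof (rule integral_mono)
      fix w assume "w \<in> space ?\<nu>"
      from mult_left_mono[OF pw[OF this, of m], of "norm (c m) * norm (f w)"]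
      show "norm (c m * (f w * cinner_vec z w ^ m)) \<le> norm (c m * of_real (norm z) ^ m) * norm (f w)"
        by (simp add: norm_mult norm_power mult_ac)
    qed (use int int_m in auto)
    then show ?thesis by (simp add: G_def)
  qed
  have sum_int: "summable (\<lambda>m. \<integral>w. norm (c m * (f w * cinner_vec z w ^ m)) \<partial>?\<nu>)"
    by (rule summable_comparison_test'[OF summable_mult2[OF smz, of G], of 0]) (use bound in simp)
  have ae: "AE w in ?\<nu>. summable (\<lambda>m. norm (c m * (f w * cinner_vec z w ^ m)))"
  proof (rule AE_I2)
    fix w assume w: "w \<in> space ?\<nu>"
    have "norm (norm (c m * (f w * cinner_vec z w ^ m))) \<le> norm (c m * of_real (norm z) ^ m) * norm (f w)" for m
      using mult_left_mono[OF pw[OF w, of m], of "norm (c m) * norm (f w)"]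
      by (simp add: norm_mult norm_power mult_ac)
    then show "summable (\<lambda>m. norm (c m * (f w * cinner_vec z w ^ m)))"
      by (intro summable_comparison_test'[OF summable_mult2[OF smz, of "norm (f w)"], of 0])
  qed
  have "(\<lambda>m. \<integral>w. c m * (f w * cinner_vec z w ^ m) \<partial>?\<nu>) sums (\<integral>w. (\<Sum>m. c m * (f w * cinner_vec z w ^ m)) \<partial>?\<nu>)"
    by (rule sums_integral[OF int_m ae sum_int])
  also have "(\<integral>w. (\<Sum>m. c m * (f w * cinner_vec z w ^ m)) \<partial>?\<nu>) = kern_int \<alpha> (rkern ?N k) f z"
    unfolding kern_int_def
  proof (rule Bochner_Integration.integral_cong[OF refl])
    fix w assume "w \<in> space ?\<nu>"
    then have "norm (cinner_vec z w) < 1" using zw[of w] z by simp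
    from sums_mult[OF cs[OF this], of "f w"]
    show "(\<Sum>m. c m * (f w * cinner_vec z w ^ m)) = f w * rkern ?N k (cinner_vec z w)"
      by (simp add: sums_iff mult.left_commute)
  qed
  finally show "(\<lambda>m. of_nat m ^ k * hom_part \<alpha> f m z) sums (radial_deriv ^^ k) f z"
    unfolding coeff iterated_radial_deriv[OF \<alpha> f int z] .
  show "summable (\<lambda>m. norm (of_nat m ^ k * hom_part \<alpha> f m z))"
  proof (rule summable_comparison_test'[OF sum_int, of 0])
    show "norm (norm (of_nat m ^ k * hom_part \<alpha> f m z)) \<le> (\<integral>w. norm (c m * (f w * cinner_vec z w ^ m)) \<partial>?\<nu>)" for m
      unfolding coeff[symmetric] real_norm_def abs_norm_cancel by (rule integral_norm_bound)
  qed
qed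

text \<open>R^k falls on f alone but the dilation on both functions, so degree m carries s^(2 m).
  With s^2 = exp (- x) this is the factor exp (- m x) to be integrated out.\<close>

lemma radial_deriv_circ_parseval:
  fixes f h :: "complex^'n \<Rightarrow> complex"
  assumes \<alpha>: "\<alpha> > -1" and f: "holomorphic_vec f (ball 0 1)" "integrable (bergman_measure \<alpha>) f"
    and h: "holomorphic_vec h (ball 0 1)" "integrable (bergman_measure \<alpha>) h"
    and w: "norm w < 1" and s: "0 \<le> s" "s \<le> 1"
  shows "(\<lambda>m. of_nat m ^ k * of_real (s\<^sup>2) ^ m * (hom_part \<alpha> f m w * cnj (hom_part \<alpha> h m w))) sums
    (\<integral>u. (radial_deriv ^^ k) f (of_real s *s (u *s w)) * cnj (h (of_real s *s (u *s w))) \<partial>circ)"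
proof -
  define z where "z = complex_of_real s *s w"
  have z: "norm z < 1"
  proof -
    have "s * norm w \<le> norm w" using s by (simp add: mult_left_le_one_le)
    then show ?thesis using w s unfolding z_def norm_scale_vec by simp
  qed
  define a where "a = (\<lambda>m. of_nat m ^ k * hom_part \<alpha> f m z)"
  define b where "b = (\<lambda>m. hom_part \<alpha> h m z)"
  have a: "summable (\<lambda>m. norm (a m))" unfolding a_def by (rule radial_deriv_sums(2)[OF \<alpha> f z])
  have b: "summable (\<lambda>m. norm (b m))" using radial_deriv_sums(2)[OF \<alpha> h z, of 0] by (simp add: b_def)
  have eq: "(radial_deriv ^^ k) f (of_real s *s (u *s w)) = (\<Sum>m. a m * u ^ m)"
    "h (of_real s *s (u *s w)) = (\<Sum>m. b m * u ^ m)" if u: "norm u = 1" for u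
  proof -
    have uz: "of_real s *s (u *s w) = u *s z" by (simp add: z_def vec_eq_iff)
    have "norm (u *s z) < 1" using z u by (simp add: norm_scale_vec)
    note s1 = radial_deriv_sums(1)[OF \<alpha> f this, of k] and s2 = radial_deriv_sums(1)[OF \<alpha> h this, of 0]
    show "(radial_deriv ^^ k) f (of_real s *s (u *s w)) = (\<Sum>m. a m * u ^ m)"
      using s1 unfolding uz by (simp add: sums_iff a_def hom_part_scale mult_ac)
    show "h (of_real s *s (u *s w)) = (\<Sum>m. b m * u ^ m)"
      using s2 unfolding uz by (simp add: sums_iff b_def hom_part_scale mult_ac)
  qed
  have "(\<lambda>m. a m * cnj (b m)) sums (\<integral>u. (\<Sum>m. a m * u ^ m) * cnj (\<Sum>m. b m * u ^ m) \<partial>circ)"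
    by (rule circ_parseval[OF a b])
  also have "(\<integral>u. (\<Sum>m. a m * u ^ m) * cnj (\<Sum>m. b m * u ^ m) \<partial>circ)
      = (\<integral>u. (radial_deriv ^^ k) f (of_real s *s (u *s w)) * cnj (h (of_real s *s (u *s w))) \<partial>circ)"
  proof (rule Bochner_Integration.integral_cong[OF refl])
    fix u assume "u \<in> space circ"
    then have u: "norm u = 1" by simp
    show "(\<Sum>m. a m * u ^ m) * cnj (\<Sum>m. b m * u ^ m)
      = (radial_deriv ^^ k) f (of_real s *s (u *s w)) * cnj (h (of_real s *s (u *s w)))"
      unfolding eq[OF u] ..
  qed
  also have "(\<lambda>m. a m * cnj (b m)) = (\<lambda>m. of_nat m ^ k * of_real (s\<^sup>2) ^ m * (hom_part \<alpha> f m w * cnj (hom_part \<alpha> h m w)))"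
    by (simp add: fun_eq_iff a_def b_def z_def hom_part_scale power2_eq_square power_mult_distrib)
  finally show ?thesis .
qed

text \<open>The density x^j / j! on the half-line, with Laplace transform c^(-(j+1)); it therefore
  inverts the derivative of order \<open>Suc j\<close>.\<close>

definition gamma_weight :: "nat \<Rightarrow> real \<Rightarrow> real" where
  "gamma_weight j x = indicator {0..} x * x powr real j / fact j"

lemma gamma_weight_nonneg: "gamma_weight j x \<ge> 0"
  by (simp add: gamma_weight_def)

lemma measurable_gamma_weight [measurable]: "gamma_weight j \<in> borel_measurable borel"
  unfolding gamma_weight_def by measurable

lemma nn_integral_gamma_weight:
  assumes "c > 0"
  shows "(\<integral>\<^sup>+x. ennreal (exp (- (c * x)) * gamma_weight j x) \<partial>lborel) = ennreal (1 / c ^ Suc j)"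
proof -
  let ?f = "\<lambda>t::real. ennreal (indicator {0..} t * t powr (real (Suc j) - 1) / exp t)"
  have "ennreal (fact j) = (\<integral>\<^sup>+t. ?f t \<partial>lborel)"
    using Gamma_conv_nn_integral_real[of "real (Suc j)"] Gamma_fact[of j, where 'a=real] by (simp add: add_ac)
  also have "\<dots> = ennreal \<bar>c\<bar> * (\<integral>\<^sup>+x. ?f (0 + c * x) \<partial>lborel)"
    using assms by (intro nn_integral_real_affine) auto
  also have "(\<integral>\<^sup>+x. ?f (0 + c * x) \<partial>lborel) = (\<integral>\<^sup>+x. ennreal (c ^ j * fact j) * ennreal (exp (- (c * x)) * gamma_weight j x) \<partial>lborel)"
    using assms
    by (intro nn_integral_cong)
      (auto simp: ennreal_mult'[symmetric] gamma_weight_def indicator_def powr_mult powr_realpow exp_minus field_simps zero_le_mult_iff)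
  also have "\<dots> = ennreal (c ^ j * fact j) * (\<integral>\<^sup>+x. ennreal (exp (- (c * x)) * gamma_weight j x) \<partial>lborel)"
    by (rule nn_integral_cmult) measurable
  finally have "ennreal (fact j) = ennreal (c ^ Suc j * fact j) * (\<integral>\<^sup>+x. ennreal (exp (- (c * x)) * gamma_weight j x) \<partial>lborel)"
    using assms by (simp add: mult.assoc[symmetric] ennreal_mult'[symmetric])
  then have "ennreal (1 / (c ^ Suc j * fact j)) * ennreal (fact j) = ennreal (1 / (c ^ Suc j * fact j)) * (ennreal (c ^ Suc j * fact j) * (\<integral>\<^sup>+x. ennreal (exp (- (c * x)) * gamma_weight j x) \<partial>lborel))"
    by simp
  also have "\<dots> = (\<integral>\<^sup>+x. ennreal (exp (- (c * x)) * gamma_weight j x) \<partial>lborel)"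
    using assms by (simp add: mult.assoc[symmetric] ennreal_mult'[symmetric])
  finally show ?thesis using assms by (simp add: ennreal_mult'[symmetric])
qed

(* The truncation keeps the dilation inside the ball for every real x; only x \<ge> 0 carries weight. *)
definition shrink :: "real \<Rightarrow> real" where
  "shrink x = exp (- (max 0 x / 2))"

lemma shrink: "0 < shrink x" "shrink x \<le> 1"
  by (simp_all add: shrink_def)

lemma shrink_square: "0 \<le> x \<Longrightarrow> (shrink x)\<^sup>2 = exp (- x)"
  by (simp add: shrink_def exp_double[symmetric])

(* m^k * (integral of exp (- m x) x^(k-1) / (k-1)!) = 1 recovers each homogeneous term of f from R^k f. *)
lemma circ_average_le_radial:
  fixes f h :: "complex^'n \<Rightarrow> complex"
  assumes \<alpha>: "\<alpha> > -1" and f: "holomorphic_vec f (ball 0 1)" "integrable (bergman_measure \<alpha>) f"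
    and h: "holomorphic_vec h (ball 0 1)" "integrable (bergman_measure \<alpha>) h" and w: "norm w < 1"
  shows "ennreal (norm (\<integral>u. f (u *s w) * cnj (h (u *s w)) \<partial>circ)) \<le> ennreal (norm (f 0) * norm (h 0)) +
    (\<integral>\<^sup>+x. ennreal (gamma_weight j x) * (\<integral>\<^sup>+u. ennreal (norm ((radial_deriv ^^ Suc j) f (of_real (shrink x) *s (u *s w)) * cnj (h (of_real (shrink x) *s (u *s w))))) \<partial>circ) \<partial>lborel)"
proof -
  let ?k = "Suc j"
  define c where "c = (\<lambda>m. hom_part \<alpha> f m w * cnj (hom_part \<alpha> h m w))"
  define R where "R = (\<lambda>x. \<integral>u. (radial_deriv ^^ ?k) f (of_real (shrink x) *s (u *s w)) * cnj (h (of_real (shrink x) *s (u *s w))) \<partial>circ)"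
  have avg: "c sums (\<integral>u. f (u *s w) * cnj (h (u *s w)) \<partial>circ)"
    using radial_deriv_circ_parseval[OF \<alpha> f h w, of 1 0] by (simp add: c_def)
  have Rs: "(\<lambda>m. of_nat m ^ ?k * of_real (exp (- x)) ^ m * c m) sums R x" if "0 \<le> x" for x
    using radial_deriv_circ_parseval[OF \<alpha> f h w less_imp_le[OF shrink(1)] shrink(2), of ?k x]
    unfolding shrink_square[OF that] R_def c_def .
  have smc: "summable (\<lambda>m. norm (c m))"
  proof -
    have sf: "summable (\<lambda>m. norm (hom_part \<alpha> f m w))" and sh: "summable (\<lambda>m. norm (hom_part \<alpha> h m w))"
      using radial_deriv_sums(2)[OF \<alpha> f w, of 0] radial_deriv_sums(2)[OF \<alpha> h w, of 0] by simp_all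
    obtain K where K: "\<And>m. norm (norm (hom_part \<alpha> h m w)) \<le> K"
      using convergent_imp_Bseq[OF convergentI[OF summable_LIMSEQ_zero[OF sh]]] unfolding Bseq_def by blast
    show ?thesis
      by (rule summable_comparison_test'[OF summable_mult2[OF sf, of K], of 0])
        (use K in \<open>auto simp: c_def norm_mult intro!: mult_left_mono\<close>)
  qed
  \<comment> \<open>At the point 0 only degree 0 of the expansion survives, because 0^0 = 1.\<close>
  have hom0: "hom_part \<alpha> g 0 w = g 0" if g: "holomorphic_vec g (ball 0 1)" "integrable (bergman_measure \<alpha>) g" for g :: "complex^'n \<Rightarrow> complex"
  proof -
    have "(\<lambda>m. of_nat m ^ 0 * hom_part \<alpha> g m (0 *s w)) sums g 0"
      using radial_deriv_sums(1)[OF \<alpha> g, of 0 0] by simp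
    moreover have "(\<lambda>m. of_nat m ^ 0 * hom_part \<alpha> g m (0 *s w)) = (\<lambda>m. if m = 0 then hom_part \<alpha> g 0 w else 0)"
      unfolding hom_part_scale by (auto simp: fun_eq_iff)
    moreover have "(\<lambda>m. if m = 0 then hom_part \<alpha> g 0 w else 0) sums hom_part \<alpha> g 0 w"
      by (rule sums_single)
    ultimately show ?thesis by (metis sums_unique2)
  qed
  define F where "F = (\<lambda>m x. complex_of_real (real m ^ ?k * (exp (- (real m * x)) * gamma_weight j x)) * c m)"
  \<comment> \<open>For m > 0 the weight integrates to m^(-k), so F m integrates to c m. Degree 0 is
    killed by m^k and has to be added separately as f 0 * cnj (h 0).\<close>
  have F_int: "integrable lborel (F m) \<and> (\<integral>x. F m x \<partial>lborel) = (if m = 0 then 0 else c m) \<and> (\<integral>x. norm (F m x) \<partial>lborel) \<le> norm (c m)" for m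
  proof (cases "m = 0")
    case False
    define g where "g = (\<lambda>x. real m ^ ?k * (exp (- (real m * x)) * gamma_weight j x))"
    have g0: "g x \<ge> 0" for x by (simp add: g_def gamma_weight_nonneg)
    have [measurable]: "g \<in> borel_measurable borel" unfolding g_def by measurable
    have "(\<integral>\<^sup>+x. ennreal (g x) \<partial>lborel) = ennreal (real m ^ ?k) * (\<integral>\<^sup>+x. ennreal (exp (- (real m * x)) * gamma_weight j x) \<partial>lborel)"
      unfolding g_def by (subst nn_integral_cmult[symmetric]) (auto simp: ennreal_mult')
    also have "\<dots> = ennreal 1"
      using False by (subst nn_integral_gamma_weight) (auto simp: ennreal_mult'[symmetric])
    finally have nn: "(\<integral>\<^sup>+x. ennreal (g x) \<partial>lborel) = ennreal 1" .
    have gi: "integrable lborel g"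
      by (rule integrableI_nonneg) (use g0 nn in auto)
    have g1: "(\<integral>x. g x \<partial>lborel) = 1"
      using nn g0 by (subst integral_eq_nn_integral) auto
    have Fg: "F m = (\<lambda>x. complex_of_real (g x) * c m)" by (simp add: F_def g_def)
    have "integrable lborel (\<lambda>x. complex_of_real (g x))" using gi by simp
    moreover have "(\<integral>x. complex_of_real (g x) \<partial>lborel) = 1" unfolding integral_complex_of_real g1 by simp
    moreover have "(\<integral>x. norm (complex_of_real (g x) * c m) \<partial>lborel) = norm (c m)"
      using g0 g1 by (simp add: norm_mult)
    ultimately show ?thesis unfolding Fg using False by simp
  qed (simp add: F_def)
  have "(\<lambda>m. \<integral>x. F m x \<partial>lborel) sums (\<integral>x. (\<Sum>m. F m x) \<partial>lborel)"
    and intF: "integrable lborel (\<lambda>x. \<Sum>m. F m x)"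
  proof -
    have 1: "AE x in lborel. summable (\<lambda>m. norm (F m x))"
    proof (rule AE_I2)
      fix x :: real
      show "summable (\<lambda>m. norm (F m x))"
      proof (cases "x > 0")
        case True
        \<comment> \<open>The factor exp (- m x) moves into the argument of the degree-m part of f,
          which yields the absolutely convergent series of R^k f at a dilated point; the parts of h
          are bounded.\<close>
        have "exp (- x) * norm w \<le> norm w" using True by (simp add: mult_left_le_one_le)
        then have "norm (complex_of_real (exp (- x)) *s w) < 1" using w unfolding norm_scale_vec by simp
        then have S1: "summable (\<lambda>m. norm (of_nat m ^ ?k * hom_part \<alpha> f m (of_real (exp (- x)) *s w)))"
          by (rule radial_deriv_sums(2)[OF \<alpha> f])
        have "summable (\<lambda>m. norm (hom_part \<alpha> h m w))"
          using radial_deriv_sums(2)[OF \<alpha> h w, of 0] by simp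
        from convergent_imp_Bseq[OF convergentI[OF summable_LIMSEQ_zero[OF this]]]
        obtain K where "\<forall>m. norm (norm (hom_part \<alpha> h m w)) \<le> K" unfolding Bseq_def by blast
        then have K: "norm (hom_part \<alpha> h m w) \<le> K" for m by simp
        show ?thesis
        proof (rule summable_comparison_test'[OF summable_mult2[OF S1, of "K * gamma_weight j x"], of 0])
          fix m
          have "norm (F m x) = norm (of_nat m ^ ?k * hom_part \<alpha> f m (of_real (exp (- x)) *s w)) * (norm (hom_part \<alpha> h m w) * gamma_weight j x)"
            unfolding F_def c_def hom_part_scale norm_mult norm_power norm_of_real complex_mod_cnj norm_of_nat
            using gamma_weight_nonneg[of j x] by (simp add: abs_mult exp_of_nat_mult[symmetric] mult_ac)
          also have "\<dots> \<le> norm (of_nat m ^ ?k * hom_part \<alpha> f m (of_real (exp (- x)) *s w)) * (K * gamma_weight j x)"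
            by (intro mult_left_mono mult_right_mono K gamma_weight_nonneg norm_ge_zero)
          finally show "norm (norm (F m x)) \<le> norm (of_nat m ^ ?k * hom_part \<alpha> f m (of_real (exp (- x)) *s w)) * (K * gamma_weight j x)"
            by simp
        qed
      next
        case False
        \<comment> \<open>At x = 0 the weight vanishes for j = 0 as well, since
          \<open>0 powr 0 = 0\<close>.\<close>
        then have "gamma_weight j x = 0" by (cases "x = 0") (auto simp: gamma_weight_def)
        then show ?thesis by (simp add: F_def)
      qed
    qed
    have 2: "summable (\<lambda>m. \<integral>x. norm (F m x) \<partial>lborel)"
      by (rule summable_comparison_test'[OF smc, of 0]) (use F_int in auto)
    show "(\<lambda>m. \<integral>x. F m x \<partial>lborel) sums (\<integral>x. (\<Sum>m. F m x) \<partial>lborel)"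
      by (rule sums_integral[OF _ 1 2]) (use F_int in blast)
    show "integrable lborel (\<lambda>x. \<Sum>m. F m x)"
      by (rule integrable_suminf[OF _ 1 2]) (use F_int in blast)
  qed
  moreover have "(\<lambda>m. if m = 0 then 0 else c m) sums ((\<integral>u. f (u *s w) * cnj (h (u *s w)) \<partial>circ) - f 0 * cnj (h 0))"
  proof -
    have "(\<lambda>m. c m - (if m = 0 then c 0 else 0)) sums ((\<integral>u. f (u *s w) * cnj (h (u *s w)) \<partial>circ) - c 0)"
      using sums_diff[OF avg sums_single[of 0 "\<lambda>_. c 0"]] by (simp add: eq_commute cong: if_cong)
    moreover have "c 0 = f 0 * cnj (h 0)" by (simp add: c_def hom0 f h)
    moreover have "(\<lambda>m. c m - (if m = 0 then c 0 else 0)) = (\<lambda>m. if m = 0 then 0 else c m)" by auto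
    ultimately show ?thesis by simp
  qed
  ultimately have eq: "(\<integral>u. f (u *s w) * cnj (h (u *s w)) \<partial>circ) - f 0 * cnj (h 0) = (\<integral>x. (\<Sum>m. F m x) \<partial>lborel)"
    using F_int by (simp add: sums_iff)
  have sumF: "(\<Sum>m. F m x) = of_real (gamma_weight j x) * R x" for x
  proof (cases "0 \<le> x")
    case True
    have "(\<lambda>m. of_real (gamma_weight j x) * (of_nat m ^ ?k * of_real (exp (- x)) ^ m * c m)) sums (of_real (gamma_weight j x) * R x)"
      by (rule sums_mult[OF Rs[OF True]])
    moreover have "of_real (gamma_weight j x) * (of_nat m ^ ?k * of_real (exp (- x)) ^ m * c m) = F m x" for m
    proof -
      have "exp (- (real m * x)) = exp (- x) ^ m" by (simp add: exp_of_nat_mult[symmetric])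
      then show ?thesis by (simp add: F_def mult_ac del: power_Suc)
    qed
    ultimately show ?thesis by (simp add: sums_iff)
  qed (simp add: F_def gamma_weight_def)
  have "ennreal (norm (\<integral>x. (\<Sum>m. F m x) \<partial>lborel)) \<le> (\<integral>\<^sup>+x. ennreal (norm (\<Sum>m. F m x)) \<partial>lborel)"
    by (rule integral_norm_bound_ennreal[OF intF])
  also have "\<dots> \<le> (\<integral>\<^sup>+x. ennreal (gamma_weight j x) * (\<integral>\<^sup>+u. ennreal (norm ((radial_deriv ^^ ?k) f (of_real (shrink x) *s (u *s w)) * cnj (h (of_real (shrink x) *s (u *s w))))) \<partial>circ) \<partial>lborel)"
  proof (rule nn_integral_mono)
    fix x :: real
    have "ennreal (norm (R x)) \<le> (\<integral>\<^sup>+u. ennreal (norm ((radial_deriv ^^ ?k) f (of_real (shrink x) *s (u *s w)) * cnj (h (of_real (shrink x) *s (u *s w))))) \<partial>circ)"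
    \<comment> \<open>If the integrand is not integrable, R x is 0 by the convention for Bochner
      integrals and the bound is trivial.\<close>
    proof (cases "integrable circ (\<lambda>u. (radial_deriv ^^ ?k) f (of_real (shrink x) *s (u *s w)) * cnj (h (of_real (shrink x) *s (u *s w))))")
      case True
      then show ?thesis unfolding R_def by (rule integral_norm_bound_ennreal)
    qed (simp add: R_def not_integrable_integral_eq)
    then show "ennreal (norm (\<Sum>m. F m x)) \<le> ennreal (gamma_weight j x) * (\<integral>\<^sup>+u. ennreal (norm ((radial_deriv ^^ ?k) f (of_real (shrink x) *s (u *s w)) * cnj (h (of_real (shrink x) *s (u *s w))))) \<partial>circ)"
      unfolding sumF norm_mult norm_of_real using gamma_weight_nonneg[of j x]
      by (simp add: ennreal_mult' mult_left_mono del: funpow.simps)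
  qed
  finally have le: "ennreal (norm ((\<integral>u. f (u *s w) * cnj (h (u *s w)) \<partial>circ) - f 0 * cnj (h 0))) \<le> (\<integral>\<^sup>+x. ennreal (gamma_weight j x) * (\<integral>\<^sup>+u. ennreal (norm ((radial_deriv ^^ ?k) f (of_real (shrink x) *s (u *s w)) * cnj (h (of_real (shrink x) *s (u *s w))))) \<partial>circ) \<partial>lborel)"
    unfolding eq .
  have "norm (\<integral>u. f (u *s w) * cnj (h (u *s w)) \<partial>circ) \<le> norm (f 0) * norm (h 0) + norm ((\<integral>u. f (u *s w) * cnj (h (u *s w)) \<partial>circ) - f 0 * cnj (h 0))"
    using norm_triangle_sub[of "\<integral>u. f (u *s w) * cnj (h (u *s w)) \<partial>circ" "f 0 * cnj (h 0)"] by (simp add: norm_mult)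
  then have "ennreal (norm (\<integral>u. f (u *s w) * cnj (h (u *s w)) \<partial>circ)) \<le> ennreal (norm (f 0) * norm (h 0)) + ennreal (norm ((\<integral>u. f (u *s w) * cnj (h (u *s w)) \<partial>circ) - f 0 * cnj (h 0)))"
    by (simp add: ennreal_plus[symmetric] ennreal_leI del: ennreal_plus)
  then show ?thesis using le by (meson add_left_mono order.trans)
qed

section \<open>Measurability of dilations and the L^1 estimate of h_b f\<close>

lemma measurable_scale_vec [measurable (raw)]:
  fixes g :: "_ \<Rightarrow> complex^'n"
  assumes [measurable]: "f \<in> borel_measurable M" "g \<in> borel_measurable M"
  shows "(\<lambda>x. f x *s g x) \<in> borel_measurable M"
proof -
  have "(\<lambda>z. fst z *s snd z) \<in> borel_measurable (borel :: (complex \<times> (complex^'n)) measure)"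
    by (intro borel_measurable_continuous_onI continuous_intros)
  then have "(\<lambda>z. fst z *s (snd z :: complex^'n)) \<in> borel_measurable (borel \<Otimes>\<^sub>M borel)"
    by (simp add: borel_prod)
  from measurable_compose[OF measurable_Pair[OF assms] this] show ?thesis by simp
qed

lemma measurable_shrink [measurable]: "shrink \<in> borel_measurable borel"
  unfolding shrink_def by measurable

lemma norm_shrink_less:
  assumes "norm (w :: complex^'n) < 1" "norm u \<le> 1"
  shows "norm (complex_of_real (shrink x) *s (u *s w)) < 1"
proof -
  have "shrink x * (norm u * norm w) \<le> 1 * (1 * norm w)"
    using assms shrink[of x] by (intro mult_mono) (auto intro: mult_left_le_one_le)
  then show ?thesis
    using assms(1) unfolding norm_scale_vec norm_of_real abs_of_pos[OF shrink(1)] by linarith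
qed

lemma measurable_shrink_scale:
  "(\<lambda>(x, w). complex_of_real (shrink x) *s w) \<in> lborel \<Otimes>\<^sub>M bergman_measure \<alpha> \<rightarrow>\<^sub>M (bergman_measure \<alpha> :: (complex^'n) measure)"
proof -
  have "(\<lambda>z. complex_of_real (shrink (fst z)) *s snd z) \<in> lborel \<Otimes>\<^sub>M bergman_measure \<alpha> \<rightarrow>\<^sub>M (borel :: (complex^'n) measure)"
    by measurable
  then have "(\<lambda>z. complex_of_real (shrink (fst z)) *s snd z) \<in> lborel \<Otimes>\<^sub>M bergman_measure \<alpha> \<rightarrow>\<^sub>M restrict_space (borel :: (complex^'n) measure) (ball 0 1)"
    using norm_shrink_less[of _ 1]
    by (intro measurable_restrict_space2) (auto simp: space_pair_measure)
  then show ?thesis by (simp add: case_prod_beta' measurable_cong_sets[OF refl sets_bergman])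
qed

lemma measurable_shrink_rot:
  "(\<lambda>((x, w), u). complex_of_real (shrink x) *s (u *s w)) \<in> (lborel \<Otimes>\<^sub>M bergman_measure \<alpha>) \<Otimes>\<^sub>M circ \<rightarrow>\<^sub>M (bergman_measure \<alpha> :: (complex^'n) measure)"
proof -
  have "(\<lambda>z. complex_of_real (shrink (fst (fst z))) *s (snd z *s snd (fst z))) \<in> (lborel \<Otimes>\<^sub>M bergman_measure \<alpha>) \<Otimes>\<^sub>M circ \<rightarrow>\<^sub>M (borel :: (complex^'n) measure)"
    by measurable
  then have "(\<lambda>z. complex_of_real (shrink (fst (fst z))) *s (snd z *s snd (fst z))) \<in> (lborel \<Otimes>\<^sub>M bergman_measure \<alpha>) \<Otimes>\<^sub>M circ \<rightarrow>\<^sub>M restrict_space (borel :: (complex^'n) measure) (ball 0 1)"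
  proof (rule measurable_restrict_space2[rotated])
    show "(\<lambda>z. complex_of_real (shrink (fst (fst z))) *s (snd z *s snd (fst z))) \<in> space ((lborel \<Otimes>\<^sub>M bergman_measure \<alpha>) \<Otimes>\<^sub>M circ) \<rightarrow> ball (0 :: complex^'n) 1"
    proof
      fix z :: "(real \<times> (complex^'n)) \<times> complex"
      assume "z \<in> space ((lborel \<Otimes>\<^sub>M bergman_measure \<alpha>) \<Otimes>\<^sub>M circ)"
      then have "norm (snd (fst z)) < 1" "norm (snd z) \<le> 1" by (auto simp: space_pair_measure)
      from norm_shrink_less[OF this] show "complex_of_real (shrink (fst (fst z))) *s (snd z *s snd (fst z)) \<in> ball 0 1"
        unfolding mem_ball dist_0_norm .
    qed
  qed
  then show ?thesis by (simp add: case_prod_beta' measurable_cong_sets[OF refl sets_bergman])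
qed

lemma nn_integral_bergman_circ_average:
  fixes g :: "complex^'n \<Rightarrow> ennreal"
  assumes \<alpha>: "\<alpha> > -1" and [measurable]: "(\<lambda>(w, u). g (u *s w)) \<in> borel_measurable (bergman_measure \<alpha> \<Otimes>\<^sub>M circ)"
    "g \<in> borel_measurable (bergman_measure \<alpha>)"
  shows "(\<integral>\<^sup>+w. (\<integral>\<^sup>+u. g (u *s w) \<partial>circ) \<partial>bergman_measure \<alpha>) = (\<integral>\<^sup>+w. g w \<partial>bergman_measure \<alpha>)"
proof -
  let ?\<nu> = "bergman_measure \<alpha> :: (complex^'n) measure"
  interpret \<nu>: finite_measure ?\<nu> by (rule finite_measure_bergman[OF \<alpha>])
  interpret pair_sigma_finite ?\<nu> circ ..
  have "(\<integral>\<^sup>+w. (\<integral>\<^sup>+u. g (u *s w) \<partial>circ) \<partial>?\<nu>) = (\<integral>\<^sup>+u. (\<integral>\<^sup>+w. g (u *s w) \<partial>?\<nu>) \<partial>circ)"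
    by (rule Fubini'[symmetric]) measurable
  also have "\<dots> = (\<integral>\<^sup>+u. (\<integral>\<^sup>+w. g w \<partial>?\<nu>) \<partial>circ)"
  proof (rule nn_integral_cong)
    fix u assume "u \<in> space circ"
    then have "norm u = 1" by simp
    from nn_integral_bergman_rot[OF \<alpha> _ this, of 0 g] assms(3)
    show "(\<integral>\<^sup>+w. g (u *s w) \<partial>?\<nu>) = (\<integral>\<^sup>+w. g w \<partial>?\<nu>)" by (simp only: rot_0 simp_thms)
  qed
  finally show ?thesis by simp
qed

text \<open>The estimate on circles is integrated over the ball: rotation invariance removes the
  average over u, and Tonelli moves the integral over dilations outside.\<close>

lemma pairing_le_radial:
  fixes f h :: "complex^'n \<Rightarrow> complex"
  assumes \<alpha>: "\<alpha> > -1" and f: "holomorphic_vec f (ball 0 1)" "integrable (bergman_measure \<alpha>) f"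
    and h: "holomorphic_vec h (ball 0 1)" "integrable (bergman_measure \<alpha>) h"
    and fh: "integrable (bergman_measure \<alpha>) (\<lambda>w. f w * cnj (h w))"
  shows "ennreal (norm (\<integral>w. f w * cnj (h w) \<partial>bergman_measure \<alpha>)) \<le> ennreal (norm (f 0) * norm (h 0)) +
    (\<integral>\<^sup>+x. ennreal (gamma_weight j x) * (\<integral>\<^sup>+w. ennreal (norm ((radial_deriv ^^ Suc j) f (of_real (shrink x) *s w)) * norm (h (of_real (shrink x) *s w))) \<partial>bergman_measure \<alpha>) \<partial>lborel)"
proof -
  let ?\<nu> = "bergman_measure \<alpha> :: (complex^'n) measure"
  interpret \<nu>: finite_measure ?\<nu> by (rule finite_measure_bergman[OF \<alpha>])
  interpret pair_sigma_finite lborel ?\<nu> ..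
  define g where "g = (\<lambda>v. ennreal (norm ((radial_deriv ^^ Suc j) f v * cnj (h v))))"
  have g [measurable]: "g \<in> borel_measurable ?\<nu>"
    unfolding g_def
    using measurable_holomorphic_vec[OF holomorphic_vec_radial[OF \<alpha> f, of "Suc j"], of \<alpha>] measurable_holomorphic_vec[OF h(1), of \<alpha>]
    by measurable
  define T where "T = (\<lambda>x w. \<integral>\<^sup>+u. g (of_real (shrink x) *s (u *s w)) \<partial>circ)"
  have gm: "(\<lambda>z. g (of_real (shrink (fst (fst z))) *s (snd z *s snd (fst z)))) \<in> borel_measurable ((lborel \<Otimes>\<^sub>M ?\<nu>) \<Otimes>\<^sub>M circ)"
    using measurable_compose[OF measurable_shrink_rot g] by (simp add: case_prod_beta')
  then have T [measurable]: "(\<lambda>z. T (fst z) (snd z)) \<in> borel_measurable (lborel \<Otimes>\<^sub>M ?\<nu>)"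
    unfolding T_def by (intro circ.borel_measurable_nn_integral) (simp add: case_prod_beta')
  have gx [measurable]: "(\<lambda>w. g (of_real (shrink x) *s w)) \<in> borel_measurable ?\<nu>" for x
    using measurable_compose[OF measurable_Pair1'[of x lborel] measurable_compose[OF measurable_shrink_scale g]] by simp
  have Tx: "(\<integral>\<^sup>+w. T x w \<partial>?\<nu>) = (\<integral>\<^sup>+w. g (of_real (shrink x) *s w) \<partial>?\<nu>)" for x
    unfolding T_def
  proof (rule nn_integral_bergman_circ_average[OF \<alpha> _ gx])
    have "(\<lambda>z. ((x, fst z), snd z)) \<in> ?\<nu> \<Otimes>\<^sub>M circ \<rightarrow>\<^sub>M (lborel \<Otimes>\<^sub>M ?\<nu>) \<Otimes>\<^sub>M circ" by measurable
    from measurable_compose[OF this gm]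
    show "(\<lambda>(w, u). g (of_real (shrink x) *s (u *s w))) \<in> borel_measurable (?\<nu> \<Otimes>\<^sub>M circ)"
      by (simp add: case_prod_beta')
  qed
  note avg = integral_bergman_rot_average[OF \<alpha> disjI2[OF refl] fh, unfolded rot_0]
  have "ennreal (norm (\<integral>w. f w * cnj (h w) \<partial>?\<nu>)) \<le> (\<integral>\<^sup>+w. ennreal (norm (\<integral>u. f (u *s w) * cnj (h (u *s w)) \<partial>circ)) \<partial>?\<nu>)"
    unfolding avg(1) by (rule integral_norm_bound_ennreal[OF avg(2)])
  also have "\<dots> \<le> (\<integral>\<^sup>+w. ennreal (norm (f 0) * norm (h 0)) + (\<integral>\<^sup>+x. ennreal (gamma_weight j x) * T x w \<partial>lborel) \<partial>?\<nu>)"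
    unfolding T_def g_def
    by (rule nn_integral_mono, rule circ_average_le_radial[OF \<alpha> f h]) simp
  also have "\<dots> = ennreal (norm (f 0) * norm (h 0)) + (\<integral>\<^sup>+w. (\<integral>\<^sup>+x. ennreal (gamma_weight j x) * T x w \<partial>lborel) \<partial>?\<nu>)"
  proof (subst nn_integral_add)
    have "(\<lambda>z. T (snd z) (fst z)) \<in> borel_measurable (?\<nu> \<Otimes>\<^sub>M lborel)"
      using measurable_compose[OF measurable_pair_swap' T] by (simp add: case_prod_beta')
    then have "(\<lambda>z. ennreal (gamma_weight j (snd z)) * T (snd z) (fst z)) \<in> borel_measurable (?\<nu> \<Otimes>\<^sub>M lborel)"
      by (rule borel_measurable_times_ennreal[rotated]) measurable
    then show "(\<lambda>w. \<integral>\<^sup>+x. ennreal (gamma_weight j x) * T x w \<partial>lborel) \<in> borel_measurable ?\<nu>"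
      by (intro lborel.borel_measurable_nn_integral) (simp add: case_prod_beta')
  qed (simp_all add: emeasure_space_bergman[OF \<alpha>])
  also have "(\<integral>\<^sup>+w. (\<integral>\<^sup>+x. ennreal (gamma_weight j x) * T x w \<partial>lborel) \<partial>?\<nu>) = (\<integral>\<^sup>+x. (\<integral>\<^sup>+w. ennreal (gamma_weight j x) * T x w \<partial>?\<nu>) \<partial>lborel)"
    using T by (intro Fubini') (simp add: case_prod_beta')
  also have "\<dots> = (\<integral>\<^sup>+x. ennreal (gamma_weight j x) * (\<integral>\<^sup>+w. g (of_real (shrink x) *s w) \<partial>?\<nu>) \<partial>lborel)"
  proof (rule nn_integral_cong)
    fix x
    have "T x \<in> borel_measurable ?\<nu>"
      using measurable_compose[OF measurable_Pair1'[of x lborel] T] by simp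
    then show "(\<integral>\<^sup>+w. ennreal (gamma_weight j x) * T x w \<partial>?\<nu>) = ennreal (gamma_weight j x) * (\<integral>\<^sup>+w. g (of_real (shrink x) *s w) \<partial>?\<nu>)"
      by (simp add: nn_integral_cmult Tx)
  qed
  finally show ?thesis by (simp only: g_def norm_mult complex_mod_cnj)
qed

lemma small_hankel_eq:
  "small_hankel \<alpha> b f z = (\<integral>w. b w * cnj (f w) * bkern (real CARD('n) + 1 + \<alpha>) (cinner_vec z (w :: complex^'n)) \<partial>bergman_measure \<alpha>)"
  unfolding small_hankel_def bergman_proj_def bkern_def powr_minus divide_inverse ..

text \<open>For fixed z, h_b f (z) is the pairing of b with f times the kernel at z, to which
  \<open>pairing_le_radial\<close> applies. Tonelli in z then leaves the L^1 norm of the kernel at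
  the dilated point.\<close>

lemma L1_small_hankel_le:
  fixes b f :: "complex^'n \<Rightarrow> complex"
  assumes \<alpha>: "\<alpha> > -1" and b: "holomorphic_vec b (ball 0 1)" "integrable (bergman_measure \<alpha>) b"
    and f: "holomorphic_vec f (ball 0 1)" "bounded (f ` ball 0 1)"
  shows "L1_norm \<alpha> (small_hankel \<alpha> b f) \<le> ennreal (norm (b 0) * norm (f 0)) +
    (\<integral>\<^sup>+x. ennreal (gamma_weight j x) * (\<integral>\<^sup>+w.
      ennreal (norm ((radial_deriv ^^ Suc j) b (of_real (shrink x) *s w)) * norm (f (of_real (shrink x) *s w))) *
      (\<integral>\<^sup>+z. ennreal (norm (1 - cinner_vec z (of_real (shrink x) *s w)) powr (- (real CARD('n) + 1 + \<alpha>))) \<partial>bergman_measure \<alpha>) \<partial>bergman_measure \<alpha>) \<partial>lborel)"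
proof -
  let ?\<nu> = "bergman_measure \<alpha> :: (complex^'n) measure"
  let ?N = "real CARD('n) + 1 + \<alpha>"
  interpret \<nu>: finite_measure ?\<nu> by (rule finite_measure_bergman[OF \<alpha>])
  interpret l\<nu>: pair_sigma_finite lborel ?\<nu> ..
  interpret \<nu>\<nu>: pair_sigma_finite ?\<nu> ?\<nu> ..
  obtain B where "\<forall>y\<in>f ` ball 0 1. norm y \<le> B" using f(2) unfolding bounded_iff by blast
  then have B: "norm (f w) \<le> B" if "norm w < 1" for w using that by simp
  define S where "S = (\<lambda>x (w::complex^'n). complex_of_real (shrink x) *s w)"
  define g where "g = (\<lambda>v. ennreal (norm ((radial_deriv ^^ Suc j) b v) * norm (f v)))"
  define k where "k = (\<lambda>v z :: complex^'n. ennreal (norm (1 - cinner_vec z v) powr (- ?N)))"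
  have g [measurable]: "g \<in> borel_measurable ?\<nu>"
    unfolding g_def
    using measurable_holomorphic_vec[OF holomorphic_vec_radial[OF \<alpha> b, of "Suc j"], of \<alpha>] measurable_holomorphic_vec[OF f(1), of \<alpha>]
    by measurable
  have gS: "(\<lambda>z. g (S (fst z) (snd z))) \<in> borel_measurable (lborel \<Otimes>\<^sub>M ?\<nu>)"
    using measurable_compose[OF measurable_shrink_scale g] by (simp add: S_def case_prod_beta')
  have gSx [measurable]: "(\<lambda>w. g (S x w)) \<in> borel_measurable ?\<nu>" for x
    using measurable_compose[OF measurable_Pair1'[of x lborel] gS] by simp
  have kS: "(\<lambda>z. k (S (fst (fst z)) (snd z)) (snd (fst z))) \<in> borel_measurable ((lborel \<Otimes>\<^sub>M ?\<nu>) \<Otimes>\<^sub>M ?\<nu>)"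
    unfolding k_def S_def by measurable
  have kSx [measurable]: "(\<lambda>z. k (S x (snd z)) (fst z)) \<in> borel_measurable (?\<nu> \<Otimes>\<^sub>M ?\<nu>)" for x
    unfolding k_def S_def by measurable
  have gk: "(\<lambda>z. g (S (fst (fst z)) (snd z)) * k (S (fst (fst z)) (snd z)) (snd (fst z))) \<in> borel_measurable ((lborel \<Otimes>\<^sub>M ?\<nu>) \<Otimes>\<^sub>M ?\<nu>)"
  proof (rule borel_measurable_times_ennreal[OF _ kS])
    have "(\<lambda>z. (fst (fst z), snd z)) \<in> (lborel \<Otimes>\<^sub>M ?\<nu>) \<Otimes>\<^sub>M ?\<nu> \<rightarrow>\<^sub>M lborel \<Otimes>\<^sub>M ?\<nu>" by measurable
    from measurable_compose[OF this gS]
    show "(\<lambda>z. g (S (fst (fst z)) (snd z))) \<in> borel_measurable ((lborel \<Otimes>\<^sub>M ?\<nu>) \<Otimes>\<^sub>M ?\<nu>)" by simp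
  qed
  define T where "T = (\<lambda>x z. \<integral>\<^sup>+w. g (S x w) * k (S x w) z \<partial>?\<nu>)"
  have T: "(\<lambda>z. T (fst z) (snd z)) \<in> borel_measurable (lborel \<Otimes>\<^sub>M ?\<nu>)"
    unfolding T_def using gk by (intro \<nu>.borel_measurable_nn_integral) (simp add: case_prod_beta')
  have Tsw: "(\<lambda>z. ennreal (gamma_weight j (snd z)) * T (snd z) (fst z)) \<in> borel_measurable (?\<nu> \<Otimes>\<^sub>M lborel)"
  proof (rule borel_measurable_times_ennreal)
    show "(\<lambda>z. T (snd z) (fst z)) \<in> borel_measurable (?\<nu> \<Otimes>\<^sub>M lborel)"
      using measurable_compose[OF measurable_pair_swap' T] by (simp add: case_prod_beta')
  qed measurable
  have point: "ennreal (norm (small_hankel \<alpha> b f z)) \<le> ennreal (norm (b 0) * norm (f 0)) + (\<integral>\<^sup>+x. ennreal (gamma_weight j x) * T x z \<partial>lborel)"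
    if z: "z \<in> space ?\<nu>" for z
  proof -
    have z1: "norm z < 1" using z by simp
    \<comment> \<open>The conjugate of the kernel is joined to f, so that h is holomorphic and its
      conjugate carries the kernel of P_\<alpha>.\<close>
    define h where "h = (\<lambda>w. f w * bkern ?N (cinner_vec w z))"
    have hh: "holomorphic_vec h (ball 0 1)"
      unfolding h_def by (intro holomorphic_vec_mult f holomorphic_vec_kernel bkern_holomorphic z1)
    have hc: "cnj (h w) = cnj (f w) * bkern ?N (cinner_vec z w)" if "w \<in> space ?\<nu>" for w
    proof -
      have "norm (cinner_vec w z) < 1" using that z1 by (intro norm_cinner_vec_less) auto
      from bkern_cnj[OF this, of ?N] show ?thesis
        unfolding h_def by (simp add: cinner_vec_commute[of z w])
    qed
    obtain K where K: "\<And>w. norm w < 1 \<Longrightarrow> norm (bkern ?N (cinner_vec z w)) \<le> K"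
      using kernel_bounded[OF holomorphic_on_imp_continuous_on[OF bkern_holomorphic] z1] by blast
    have hB: "norm (h w) \<le> B * K" if "w \<in> space ?\<nu>" for w
    proof -
      have "norm (h w) = norm (f w) * norm (bkern ?N (cinner_vec z w))"
        using hc[OF that] by (metis complex_mod_cnj norm_mult)
      also have "\<dots> \<le> B * K"
        using B[of w] K[of w] that order.trans[OF norm_ge_zero B[of w]] by (intro mult_mono) auto
      finally show ?thesis .
    qed
    have hm: "h \<in> borel_measurable ?\<nu>" by (rule measurable_holomorphic_vec[OF hh])
    have hi: "integrable ?\<nu> h" by (rule \<nu>.integrable_const_bound[where B="B * K"]) (use hB hm in auto)
    have bh: "integrable ?\<nu> (\<lambda>w. b w * cnj (h w))"
      by (rule integrable_bounded_mult[OF b(2), where B="B * K"]) (use hB hm in auto)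
    have "small_hankel \<alpha> b f z = (\<integral>w. b w * cnj (h w) \<partial>?\<nu>)"
      unfolding small_hankel_eq by (rule Bochner_Integration.integral_cong) (simp_all add: hc mult.assoc)
    moreover have TE: "(\<integral>\<^sup>+w. ennreal (norm ((radial_deriv ^^ Suc j) b (of_real (shrink x) *s w)) * norm (h (of_real (shrink x) *s w))) \<partial>?\<nu>) = T x z" for x
      unfolding T_def
    proof (rule nn_integral_cong)
      fix w assume "w \<in> space ?\<nu>"
      then have w: "norm (S x w) < 1" using norm_shrink_less[of w 1 x] by (simp add: S_def)
      have "norm (h (S x w)) = norm (f (S x w)) * norm (1 - cinner_vec z (S x w)) powr (- ?N)"
        unfolding h_def norm_mult norm_bkern[OF norm_cinner_vec_less[OF w z1]]
        by (simp only: norm_one_minus_cinner_commute)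
      then show "ennreal (norm ((radial_deriv ^^ Suc j) b (of_real (shrink x) *s w)) * norm (h (of_real (shrink x) *s w))) = g (S x w) * k (S x w) z"
        unfolding g_def k_def by (simp add: S_def ennreal_mult'[symmetric] mult.assoc del: funpow.simps)
    qed
    have "norm (h 0) = norm (f 0)" by (simp add: h_def bkern_def)
    ultimately show ?thesis
      using pairing_le_radial[OF \<alpha> b hh hi bh, of j] unfolding TE by (simp only:)
  qed
  have "L1_norm \<alpha> (small_hankel \<alpha> b f) \<le> (\<integral>\<^sup>+z. ennreal (norm (b 0) * norm (f 0)) + (\<integral>\<^sup>+x. ennreal (gamma_weight j x) * T x z \<partial>lborel) \<partial>?\<nu>)"
    unfolding L1_norm_def by (rule nn_integral_mono[OF point])
  also have "\<dots> = ennreal (norm (b 0) * norm (f 0)) + (\<integral>\<^sup>+z. (\<integral>\<^sup>+x. ennreal (gamma_weight j x) * T x z \<partial>lborel) \<partial>?\<nu>)"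
  proof (subst nn_integral_add)
    show "(\<lambda>z. \<integral>\<^sup>+x. ennreal (gamma_weight j x) * T x z \<partial>lborel) \<in> borel_measurable ?\<nu>"
      using Tsw by (intro lborel.borel_measurable_nn_integral) (simp add: case_prod_beta')
  qed (simp_all add: emeasure_space_bergman[OF \<alpha>])
  also have "(\<integral>\<^sup>+z. (\<integral>\<^sup>+x. ennreal (gamma_weight j x) * T x z \<partial>lborel) \<partial>?\<nu>) = (\<integral>\<^sup>+x. (\<integral>\<^sup>+z. ennreal (gamma_weight j x) * T x z \<partial>?\<nu>) \<partial>lborel)"
    using T by (intro l\<nu>.Fubini') (simp add: case_prod_beta')
  also have "\<dots> = (\<integral>\<^sup>+x. ennreal (gamma_weight j x) * (\<integral>\<^sup>+w. g (S x w) * (\<integral>\<^sup>+z. k (S x w) z \<partial>?\<nu>) \<partial>?\<nu>) \<partial>lborel)"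
  proof (rule nn_integral_cong)
    fix x
    have Tx: "T x \<in> borel_measurable ?\<nu>"
      using measurable_compose[OF measurable_Pair1'[of x lborel] T] by simp
    have "(\<integral>\<^sup>+z. T x z \<partial>?\<nu>) = (\<integral>\<^sup>+w. (\<integral>\<^sup>+z. g (S x w) * k (S x w) z \<partial>?\<nu>) \<partial>?\<nu>)"
      unfolding T_def
    proof (rule \<nu>\<nu>.Fubini'[symmetric])
      have "(\<lambda>z. g (S x (snd z)) * k (S x (snd z)) (fst z)) \<in> borel_measurable (?\<nu> \<Otimes>\<^sub>M ?\<nu>)"
        by (rule borel_measurable_times_ennreal[OF measurable_compose[OF measurable_snd gSx] kSx])
      then show "(\<lambda>(z, w). g (S x w) * k (S x w) z) \<in> borel_measurable (?\<nu> \<Otimes>\<^sub>M ?\<nu>)" by (simp add: case_prod_beta')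
    qed
    also have "\<dots> = (\<integral>\<^sup>+w. g (S x w) * (\<integral>\<^sup>+z. k (S x w) z \<partial>?\<nu>) \<partial>?\<nu>)"
      by (intro nn_integral_cong nn_integral_cmult) (simp add: k_def)
    finally show "(\<integral>\<^sup>+z. ennreal (gamma_weight j x) * T x z \<partial>?\<nu>) = ennreal (gamma_weight j x) * (\<integral>\<^sup>+w. g (S x w) * (\<integral>\<^sup>+z. k (S x w) z \<partial>?\<nu>) \<partial>?\<nu>)"
      using Tx by (simp add: nn_integral_cmult)
  qed
  finally show ?thesis by (simp only: g_def k_def S_def)
qed

section \<open>Integrating over dilations\<close>

text \<open>Here q stands for |v|^2, and x runs up to ln (1 / q). For q at least 1/4 this forces x
  <= 4 (1 - q) and exp x <= 4: the density contributes (1 - q)^j, while exp x * (1 - q exp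
  x)^\<alpha> has an elementary antiderivative and contributes (1 - q)^(\<alpha> + 1).\<close>

lemma dilation_weight_le:
  fixes n :: real
  assumes \<alpha>: "\<alpha> > -1" and n: "n \<ge> 1"
  obtains C where "C > 0" "\<And>q. 1/4 \<le> q \<Longrightarrow> q < 1 \<Longrightarrow>
    (\<integral>\<^sup>+x. ennreal (gamma_weight j x * exp (n * x) * (if exp x * q < 1 then (1 - exp x * q) powr \<alpha> else 0)) \<partial>lborel)
      \<le> ennreal (C * (1 - q) powr (\<alpha> + real (Suc j)))"
proof -
  define K where "K = 4 ^ j * 4 powr (n - 1) / fact j"
  have K: "K > 0" by (simp add: K_def)
  show ?thesis
  proof (rule that[of "K * (4 / (\<alpha> + 1))"])
    show "K * (4 / (\<alpha> + 1)) > 0" using K \<alpha> by simp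
    fix q :: real assume q: "1/4 \<le> q" "q < 1"
    define X where "X = ln (1 / q)"
    have X: "X > 0" "exp X = 1 / q" using q by (auto simp: X_def)
    have lt: "exp x * q < 1 \<longleftrightarrow> x < X" for x
    proof -
      have "exp x * q < 1 \<longleftrightarrow> exp x < exp X" using q by (simp add: X(2) field_simps)
      then show ?thesis by simp
    qed
    define F where "F = (\<lambda>x. - ((1 - exp x * q) powr (\<alpha> + 1)) / (q * (\<alpha> + 1)))"
    define \<phi> where "\<phi> = (\<lambda>x. exp x * (1 - exp x * q) powr \<alpha>)"
    \<comment> \<open>For \<alpha> < 0 the integrand is unbounded at X, but F is continuous up to X
      because \<alpha> + 1 > 0; hence the version of the theorem with derivatives in the interior
      only.\<close>
    have "(\<phi> has_integral (F X - F 0)) {0..X}"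
    proof (rule fundamental_theorem_of_calculus_interior)
      show "0 \<le> X" using X by simp
      show "continuous_on {0..X} F"
      proof -
        have "exp x * q \<le> 1" if "x \<le> X" for x
        proof -
          have "exp x \<le> exp X" using that by simp
          then show ?thesis using q by (simp add: X(2) field_simps)
        qed
        then have "\<forall>x\<in>{0..X}. 0 \<le> 1 - exp x * q \<and> (1 - exp x * q = 0 \<longrightarrow> 0 < \<alpha> + 1)"
          using \<alpha> by auto
        then have "continuous_on {0..X} (\<lambda>x. (1 - exp x * q) powr (\<alpha> + 1))"
          by (intro continuous_on_powr' continuous_on_diff continuous_on_mult continuous_on_exp
              continuous_on_const continuous_on_id)
        then show ?thesis
          unfolding F_def using \<alpha> q
          by (intro continuous_on_divide continuous_on_minus continuous_on_const) auto
      qed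
      fix x assume x: "x \<in> {0<..<X}"
      then have pos: "1 - exp x * q > 0" using lt[of x] by simp
      have "((\<lambda>x. 1 - exp x * q) has_real_derivative - (exp x * q)) (at x)"
        by (auto intro!: derivative_eq_intros)
      from DERIV_chain2[OF has_real_derivative_powr[OF pos] this]
      have "((\<lambda>x. (1 - exp x * q) powr (\<alpha> + 1)) has_real_derivative
          (\<alpha> + 1) * (1 - exp x * q) powr (\<alpha> + 1 - 1) * - (exp x * q)) (at x)" .
      from DERIV_cdivide[OF DERIV_minus[OF this], of "q * (\<alpha> + 1)"]
      have "(F has_real_derivative - ((\<alpha> + 1) * (1 - exp x * q) powr (\<alpha> + 1 - 1) * - (exp x * q)) / (q * (\<alpha> + 1))) (at x)"
        unfolding F_def .
      moreover have "\<alpha> + 1 \<noteq> 0" "q \<noteq> 0" using \<alpha> q by auto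
      ultimately have "(F has_real_derivative \<phi> x) (at x)"
        by (simp add: \<phi>_def mult_ac)
      then show "(F has_vector_derivative \<phi> x) (at x)"
        by (simp add: has_real_derivative_iff_has_vector_derivative)
    qed
    moreover have "F X - F 0 = (1 - q) powr (\<alpha> + 1) / (q * (\<alpha> + 1))" using q by (simp add: F_def X(2))
    ultimately have "(\<phi> has_integral (1 - q) powr (\<alpha> + 1) / (q * (\<alpha> + 1))) {0..X}" by simp
    then have "((\<lambda>x. if x \<in> {0..X} then \<phi> x else 0) has_integral (1 - q) powr (\<alpha> + 1) / (q * (\<alpha> + 1))) UNIV"
      by (simp only: has_integral_restrict_UNIV)
    moreover have "(\<lambda>x. if x \<in> {0..X} then \<phi> x else 0) = (\<lambda>x. indicator {0..X} x * \<phi> x)"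
      by (auto simp: fun_eq_iff indicator_def)
    ultimately have "((\<lambda>x. indicator {0..X} x * \<phi> x) has_integral (1 - q) powr (\<alpha> + 1) / (q * (\<alpha> + 1))) UNIV"
      by simp
    then have FTC: "(\<integral>\<^sup>+x. ennreal (indicator {0..X} x * \<phi> x) \<partial>lborel) = ennreal ((1 - q) powr (\<alpha> + 1) / (q * (\<alpha> + 1)))"
      by (intro nn_integral_has_integral_lborel) (auto simp: \<phi>_def)
    have point: "gamma_weight j x * exp (n * x) * (if exp x * q < 1 then (1 - exp x * q) powr \<alpha> else 0)
      \<le> K * (1 - q) ^ j * (indicator {0..X} x * \<phi> x)" for x
    proof (cases "0 \<le> x \<and> x < X")
      case True
      then have ex: "exp x < 1 / q" using X(2) by (metis exp_less_mono)
      also have "1 / q \<le> 4" using q by (simp add: field_simps)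
      finally have ex4: "exp x \<le> 4" by simp
      \<comment> \<open>In the range of integration exp x < 1 / q, so x < (1 - q) / q <= 4 (1 -
        q).\<close>
      have "x \<le> exp x - 1" using exp_ge_add_one_self[of x] by linarith
      also have "\<dots> \<le> (1 - q) / q" using ex q by (simp add: field_simps)
      also have "\<dots> = (1 - q) * (1 / q)" by simp
      also have "\<dots> \<le> (1 - q) * 4" using q by (intro mult_left_mono) (auto simp: field_simps)
      also have "\<dots> = 4 * (1 - q)" by simp
      finally have x4: "x \<le> 4 * (1 - q)" .
      have "x powr real j \<le> (4 * (1 - q)) ^ j"
      proof (cases "x = 0")
        case False
        then show ?thesis using True x4 by (simp add: powr_realpow power_mono)
      qed (use q in auto)
      also have "\<dots> = 4 ^ j * (1 - q) ^ j" by (rule power_mult_distrib)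
      finally have 1: "gamma_weight j x \<le> 4 ^ j * (1 - q) ^ j / fact j"
        using True by (simp add: gamma_weight_def divide_right_mono)
      have "exp (n * x) = exp x * exp x powr (n - 1)" by (simp add: powr_def exp_add[symmetric] algebra_simps)
      also have "\<dots> \<le> exp x * 4 powr (n - 1)" using ex4 n by (intro mult_left_mono powr_mono2) auto
      finally have 2: "exp (n * x) \<le> exp x * 4 powr (n - 1)" .
      have "gamma_weight j x * exp (n * x) * (1 - exp x * q) powr \<alpha> \<le> (4 ^ j * (1 - q) ^ j / fact j) * (exp x * 4 powr (n - 1)) * (1 - exp x * q) powr \<alpha>"
        using q by (intro mult_right_mono mult_mono 1 2) (auto simp: gamma_weight_nonneg)
      also have "\<dots> = K * (1 - q) ^ j * \<phi> x" by (simp add: K_def \<phi>_def)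
      finally show ?thesis using True lt[of x] by simp
    next
      case False
      then have "gamma_weight j x * (if exp x * q < 1 then (1 - exp x * q) powr \<alpha> else 0) = 0"
        using lt[of x] by (auto simp: gamma_weight_def)
      then have "gamma_weight j x * exp (n * x) * (if exp x * q < 1 then (1 - exp x * q) powr \<alpha> else 0) = 0" by auto
      moreover have "0 \<le> K * (1 - q) ^ j * (indicator {0..X} x * \<phi> x)"
        using K q by (simp add: \<phi>_def)
      ultimately show ?thesis by linarith
    qed
    have Kq: "K * (1 - q) ^ j \<ge> 0" using K q by simp
    have "(\<integral>\<^sup>+x. ennreal (gamma_weight j x * exp (n * x) * (if exp x * q < 1 then (1 - exp x * q) powr \<alpha> else 0)) \<partial>lborel)
      \<le> (\<integral>\<^sup>+x. ennreal (K * (1 - q) ^ j) * ennreal (indicator {0..X} x * \<phi> x) \<partial>lborel)"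
      using point Kq by (intro nn_integral_mono) (simp add: ennreal_mult'[symmetric] ennreal_leI)
    also have "\<dots> = ennreal (K * (1 - q) ^ j) * ennreal ((1 - q) powr (\<alpha> + 1) / (q * (\<alpha> + 1)))"
      unfolding FTC[symmetric] by (rule nn_integral_cmult) (simp add: \<phi>_def)
    also have "\<dots> = ennreal (K * (1 - q) ^ j * ((1 - q) powr (\<alpha> + 1) / (q * (\<alpha> + 1))))"
      by (rule ennreal_mult'[OF Kq, symmetric])
    also have "\<dots> \<le> ennreal (K * (4 / (\<alpha> + 1)) * (1 - q) powr (\<alpha> + real (Suc j)))"
    proof (rule ennreal_leI)
      have "(1 - q) powr (\<alpha> + 1) / (q * (\<alpha> + 1)) \<le> (1 - q) powr (\<alpha> + 1) / ((1/4) * (\<alpha> + 1))"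
        using q \<alpha> by (intro divide_left_mono mult_right_mono mult_pos_pos) auto
      then have "K * (1 - q) ^ j * ((1 - q) powr (\<alpha> + 1) / (q * (\<alpha> + 1))) \<le> K * (1 - q) ^ j * ((1 - q) powr (\<alpha> + 1) / ((1/4) * (\<alpha> + 1)))"
        using Kq by (rule mult_left_mono)
      also have "\<dots> = K * (4 / (\<alpha> + 1)) * ((1 - q) ^ j * (1 - q) powr (\<alpha> + 1))" by simp
      also have "(1 - q) ^ j * (1 - q) powr (\<alpha> + 1) = (1 - q) powr (\<alpha> + real (Suc j))"
        using q by (simp add: powr_realpow[symmetric] powr_add[symmetric] add_ac)
      finally show "K * (1 - q) ^ j * ((1 - q) powr (\<alpha> + 1) / (q * (\<alpha> + 1))) \<le> K * (4 / (\<alpha> + 1)) * (1 - q) powr (\<alpha> + real (Suc j))" .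
    qed
    finally show "(\<integral>\<^sup>+x. ennreal (gamma_weight j x * exp (n * x) * (if exp x * q < 1 then (1 - exp x * q) powr \<alpha> else 0)) \<partial>lborel)
      \<le> ennreal (K * (4 / (\<alpha> + 1)) * (1 - q) powr (\<alpha> + real (Suc j)))" .
  qed
qed

(* Undo the dilation by the substitution w = exp (x/2) v and integrate over x first. *)
lemma nn_integral_dilations_le:
  assumes \<alpha>: "\<alpha> > -1"
  obtains C where "C > 0" "\<And>g :: complex^'n \<Rightarrow> ennreal. g \<in> borel_measurable (bergman_measure \<alpha>) \<Longrightarrow>
    (\<And>v. norm v < 1/2 \<Longrightarrow> g v = 0) \<Longrightarrow>
    (\<integral>\<^sup>+x. ennreal (gamma_weight j x) * (\<integral>\<^sup>+w. g (of_real (shrink x) *s w) \<partial>bergman_measure \<alpha>) \<partial>lborel)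
      \<le> ennreal C * (\<integral>\<^sup>+v. g v * ennreal ((1 - (norm v)\<^sup>2) ^ Suc j) \<partial>bergman_measure \<alpha>)"
proof -
  let ?\<nu> = "bergman_measure \<alpha> :: (complex^'n) measure"
  let ?n = "real CARD('n)"
  let ?iZ = "ennreal (1 / bergman_mass TYPE('n) \<alpha>)"
  have n: "?n \<ge> 1" using zero_less_card_finite[where 'a='n] by linarith
  obtain C where C: "C > 0" "\<And>q. 1/4 \<le> q \<Longrightarrow> q < 1 \<Longrightarrow>
    (\<integral>\<^sup>+x. ennreal (gamma_weight j x * exp (?n * x) * (if exp x * q < 1 then (1 - exp x * q) powr \<alpha> else 0)) \<partial>lborel)
      \<le> ennreal (C * (1 - q) powr (\<alpha> + real (Suc j)))"
    using dilation_weight_le[OF \<alpha> n] by blast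
  show ?thesis
  proof (rule that[OF C(1)])
    fix g :: "complex^'n \<Rightarrow> ennreal"
    assume g: "g \<in> borel_measurable ?\<nu>" and g0: "\<And>v. norm v < 1/2 \<Longrightarrow> g v = 0"
    have [measurable]: "ball (0::complex^'n) 1 \<in> sets borel" by simp
    define G where "G = (\<lambda>v. g v * indicator (ball 0 1) v)"
    have G [measurable]: "G \<in> borel_measurable borel" unfolding G_def by (rule measurable_bergman_extend[OF g])
    define E where "E = (\<lambda>x (v::complex^'n). ennreal (gamma_weight j x * exp (?n * x) * (if exp x * (norm v)\<^sup>2 < 1 then (1 - exp x * (norm v)\<^sup>2) powr \<alpha> else 0)))"
    have E: "(\<lambda>(x, v). E x v) \<in> borel_measurable (lborel \<Otimes>\<^sub>M lborel)" unfolding E_def by measurable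
    have inner: "ennreal (gamma_weight j x) * (\<integral>\<^sup>+w. g (of_real (shrink x) *s w) \<partial>?\<nu>) = ?iZ * (\<integral>\<^sup>+v. G v * E x v \<partial>lborel)" for x
    proof (cases "0 \<le> x")
      case True
      \<comment> \<open>The factor that undoes \<open>shrink x\<close>; in real dimension 2 n its
        Jacobian is exp (n x).\<close>
      define c where "c = exp (x / 2)"
      have c: "c > 0" "shrink x * c = 1" "c\<^sup>2 = exp x"
        using True by (simp_all add: c_def shrink_def exp_minus exp_double[symmetric])
      have gm: "(\<lambda>w. g (of_real (shrink x) *s w)) \<in> borel_measurable ?\<nu>"
        using measurable_compose[OF measurable_Pair1'[of x lborel] measurable_compose[OF measurable_shrink_scale g]] by simp
      define F where "F = (\<lambda>w. G (of_real (shrink x) *s w) * ennreal ((1 - (norm w)\<^sup>2) powr \<alpha>) * indicator (ball 0 1) w)"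
      have F: "F \<in> borel_measurable borel"
      proof -
        have "(\<lambda>w::complex^'n. complex_of_real (shrink x) *s w) \<in> borel_measurable borel"
          by (intro borel_measurable_continuous_onI continuous_on_scale_vec continuous_on_const continuous_on_id)
        then have 1: "(\<lambda>w. G (of_real (shrink x) *s w)) \<in> borel_measurable borel"
          by (rule measurable_compose[OF _ G])
        have 2: "(\<lambda>w::complex^'n. ennreal ((1 - (norm w)\<^sup>2) powr \<alpha>)) \<in> borel_measurable borel"
          by measurable
        have 3: "(indicator (ball 0 1) :: complex^'n \<Rightarrow> ennreal) \<in> borel_measurable borel"
          by (intro borel_measurable_indicator) simp
        show ?thesis
          unfolding F_def by (rule borel_measurable_times_ennreal[OF borel_measurable_times_ennreal[OF 1 2] 3])
      qed
      have "(\<lambda>v::complex^'n. c *\<^sub>R v) \<in> borel_measurable borel"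
        by (intro borel_measurable_continuous_onI continuous_intros)
      from measurable_compose[OF this F] have Fc: "(\<lambda>v. F (c *\<^sub>R v)) \<in> borel_measurable lborel" by simp
      have "(\<integral>\<^sup>+w. g (of_real (shrink x) *s w) \<partial>?\<nu>) = ?iZ * (\<integral>\<^sup>+w. F w \<partial>lborel)"
        unfolding nn_integral_bergman[OF \<alpha> gm] F_def
      proof (intro arg_cong[where f="\<lambda>y. ?iZ * y"] nn_integral_cong)
        fix w :: "complex^'n"
        show "g (of_real (shrink x) *s w) * ennreal ((1 - (norm w)\<^sup>2) powr \<alpha>) * indicator (ball 0 1) w
          = G (of_real (shrink x) *s w) * ennreal ((1 - (norm w)\<^sup>2) powr \<alpha>) * indicator (ball 0 1) w"
        proof (cases "norm w < 1")
          case True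
          from norm_shrink_less[OF this, of 1 x] have "norm (complex_of_real (shrink x) *s w) < 1" by simp
          then show ?thesis by (simp add: G_def)
        qed simp
      qed
      also have "(\<integral>\<^sup>+w. F w \<partial>lborel) = ennreal (c ^ DIM(complex^'n)) * (\<integral>\<^sup>+v. F (c *\<^sub>R v) \<partial>lborel)"
        by (rule nn_integral_lborel_scale[OF F c(1)])
      also have "\<dots> = (\<integral>\<^sup>+v. ennreal (c ^ DIM(complex^'n)) * F (c *\<^sub>R v) \<partial>lborel)"
        by (rule nn_integral_cmult[OF Fc, symmetric])
      finally have "ennreal (gamma_weight j x) * (\<integral>\<^sup>+w. g (of_real (shrink x) *s w) \<partial>?\<nu>)
        = ?iZ * (ennreal (gamma_weight j x) * (\<integral>\<^sup>+v. ennreal (c ^ DIM(complex^'n)) * F (c *\<^sub>R v) \<partial>lborel))"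
        by (simp only: mult.left_commute)
      also have "ennreal (gamma_weight j x) * (\<integral>\<^sup>+v. ennreal (c ^ DIM(complex^'n)) * F (c *\<^sub>R v) \<partial>lborel)
        = (\<integral>\<^sup>+v. ennreal (gamma_weight j x) * (ennreal (c ^ DIM(complex^'n)) * F (c *\<^sub>R v)) \<partial>lborel)"
        by (rule nn_integral_cmult[symmetric]) (rule borel_measurable_times_ennreal[OF borel_measurable_const Fc])
      also have "\<dots> = (\<integral>\<^sup>+v. G v * E x v \<partial>lborel)"
      proof (rule nn_integral_cong)
        fix v :: "complex^'n"
        have 1: "complex_of_real (shrink x) *s (c *\<^sub>R v) = v"
        proof -
          have "complex_of_real (shrink x) *s (c *\<^sub>R v) = (shrink x * c) *\<^sub>R v"
            unfolding scaleR_eq_scale by (simp add: vec_eq_iff mult.assoc)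
          then show ?thesis using c by simp
        qed
        have 2: "(norm (c *\<^sub>R v))\<^sup>2 = exp x * (norm v)\<^sup>2" by (simp add: power_mult_distrib c(3))
        have 3: "(indicator (ball 0 1) (c *\<^sub>R v) :: ennreal) = (if exp x * (norm v)\<^sup>2 < 1 then 1 else 0)"
          unfolding 2[symmetric] by (simp add: indicator_def abs_square_less_1)
        have 4: "c ^ DIM(complex^'n) = exp (?n * x)"
        proof -
          have "c ^ DIM(complex^'n) = (c\<^sup>2) ^ CARD('n)" unfolding DIM_complex_vec by (rule power_mult)
          also have "\<dots> = exp (?n * x)" unfolding c(3) by (rule exp_of_nat_mult[symmetric])
          finally show ?thesis .
        qed
        show "ennreal (gamma_weight j x) * (ennreal (c ^ DIM(complex^'n)) * F (c *\<^sub>R v)) = G v * E x v"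
          unfolding F_def 1 2 3 4 E_def
          by (simp add: ennreal_mult' gamma_weight_nonneg mult_ac)
      qed
      finally show ?thesis .
    qed (simp add: E_def gamma_weight_def)
    have "(\<integral>\<^sup>+x. ennreal (gamma_weight j x) * (\<integral>\<^sup>+w. g (of_real (shrink x) *s w) \<partial>?\<nu>) \<partial>lborel)
      = ?iZ * (\<integral>\<^sup>+x. (\<integral>\<^sup>+v. G v * E x v \<partial>lborel) \<partial>lborel)"
      unfolding inner
    proof (rule nn_integral_cmult)
      have "(\<lambda>(x, v). G v * E x v) \<in> borel_measurable (lborel \<Otimes>\<^sub>M lborel)" using E by measurable
      then show "(\<lambda>x. \<integral>\<^sup>+v. G v * E x v \<partial>lborel) \<in> borel_measurable lborel"
        by (rule lborel.borel_measurable_nn_integral)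
    qed
    also have "(\<integral>\<^sup>+x. (\<integral>\<^sup>+v. G v * E x v \<partial>lborel) \<partial>lborel) = (\<integral>\<^sup>+v. (\<integral>\<^sup>+x. G v * E x v \<partial>lborel) \<partial>lborel)"
      using E by (intro lborel_pair.Fubini'[symmetric]) (simp add: case_prod_beta')
    also have "\<dots> \<le> (\<integral>\<^sup>+v. ennreal C * (g v * ennreal ((1 - (norm v)\<^sup>2) ^ Suc j) * ennreal ((1 - (norm v)\<^sup>2) powr \<alpha>) * indicator (ball 0 1) v) \<partial>lborel)"
    proof (rule nn_integral_mono)
      fix v :: "complex^'n"
      have Ex: "(\<lambda>x. E x v) \<in> borel_measurable lborel" unfolding E_def by measurable
      show "(\<integral>\<^sup>+x. G v * E x v \<partial>lborel) \<le> ennreal C * (g v * ennreal ((1 - (norm v)\<^sup>2) ^ Suc j) * ennreal ((1 - (norm v)\<^sup>2) powr \<alpha>) * indicator (ball 0 1) v)"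
      \<comment> \<open>Only the annulus counts, because g vanishes on the inner ball; there |v|^2
        is at least 1/4, as \<open>dilation_weight_le\<close> demands.\<close>
      proof (cases "1/2 \<le> norm v \<and> norm v < 1")
        case True
        define q where "q = (norm v)\<^sup>2"
        have "(1/2)\<^sup>2 \<le> q" using True unfolding q_def by (intro power_mono) auto
        then have "1/4 \<le> q" by (simp add: power2_eq_square)
        moreover have "q < 1" using True by (simp add: q_def abs_square_less_1)
        ultimately have q: "1/4 \<le> q" "q < 1" by auto
        have "(\<integral>\<^sup>+x. G v * E x v \<partial>lborel) = g v * (\<integral>\<^sup>+x. E x v \<partial>lborel)"
          using True Ex by (simp add: G_def nn_integral_cmult)
        also have "\<dots> \<le> g v * ennreal (C * (1 - q) powr (\<alpha> + real (Suc j)))"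
          unfolding E_def q_def[symmetric] by (rule mult_left_mono[OF C(2)[OF q]]) simp
        also have "(1 - q) powr (\<alpha> + real (Suc j)) = (1 - q) ^ Suc j * (1 - q) powr \<alpha>"
          using q by (simp only: powr_add powr_realpow mult.commute)
        also have "g v * ennreal (C * ((1 - q) ^ Suc j * (1 - q) powr \<alpha>)) = ennreal C * (g v * ennreal ((1 - q) ^ Suc j) * ennreal ((1 - q) powr \<alpha>) * indicator (ball 0 1) v)"
          using True C(1) q by (simp add: ennreal_mult' mult_ac del: power_Suc)
        finally show ?thesis by (simp only: q_def)
      next
        case False
        then have "G v = 0" using g0[of v] by (auto simp: G_def)
        then show ?thesis by simp
      qed
    qed
    also have "\<dots> = ennreal C * (\<integral>\<^sup>+v. g v * ennreal ((1 - (norm v)\<^sup>2) ^ Suc j) * ennreal ((1 - (norm v)\<^sup>2) powr \<alpha>) * indicator (ball 0 1) v \<partial>lborel)"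
    proof (rule nn_integral_cmult)
      have "G \<in> borel_measurable lborel" using G by simp
      moreover have "(\<lambda>v::complex^'n. ennreal ((1 - (norm v)\<^sup>2) ^ Suc j) * ennreal ((1 - (norm v)\<^sup>2) powr \<alpha>)) \<in> borel_measurable lborel"
        by simp
      ultimately have "(\<lambda>v. G v * (ennreal ((1 - (norm v)\<^sup>2) ^ Suc j) * ennreal ((1 - (norm v)\<^sup>2) powr \<alpha>))) \<in> borel_measurable lborel"
        by (rule borel_measurable_times_ennreal)
      then show "(\<lambda>v. g v * ennreal ((1 - (norm v)\<^sup>2) ^ Suc j) * ennreal ((1 - (norm v)\<^sup>2) powr \<alpha>) * indicator (ball 0 1) v) \<in> borel_measurable lborel"
        by (simp only: G_def mult_ac)
    qed
    also have "?iZ * (ennreal C * (\<integral>\<^sup>+v. g v * ennreal ((1 - (norm v)\<^sup>2) ^ Suc j) * ennreal ((1 - (norm v)\<^sup>2) powr \<alpha>) * indicator (ball 0 1) v \<partial>lborel))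
      = ennreal C * (\<integral>\<^sup>+v. g v * ennreal ((1 - (norm v)\<^sup>2) ^ Suc j) \<partial>?\<nu>)"
    proof -
      have "(\<lambda>v. g v * ennreal ((1 - (norm v)\<^sup>2) ^ Suc j)) \<in> borel_measurable ?\<nu>"
        by (rule borel_measurable_times_ennreal[OF g]) measurable
      then show ?thesis by (simp only: nn_integral_bergman[OF \<alpha>] mult.left_commute)
    qed
    finally show "(\<integral>\<^sup>+x. ennreal (gamma_weight j x) * (\<integral>\<^sup>+w. g (of_real (shrink x) *s w) \<partial>?\<nu>) \<partial>lborel)
      \<le> ennreal C * (\<integral>\<^sup>+v. g v * ennreal ((1 - (norm v)\<^sup>2) ^ Suc j) \<partial>?\<nu>)"
      by (simp add: mult_left_mono)
  qed
qed

section \<open>Sufficiency\<close>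

lemma bergman_space_2D:
  fixes b :: "complex^'n \<Rightarrow> complex"
  assumes \<alpha>: "\<alpha> > -1" and b: "b \<in> bergman_space \<alpha> 2"
  shows "holomorphic_vec b (ball 0 1)" "integrable (bergman_measure \<alpha>) b"
proof -
  let ?\<nu> = "bergman_measure \<alpha> :: (complex^'n) measure"
  interpret \<nu>: finite_measure ?\<nu> by (rule finite_measure_bergman[OF \<alpha>])
  show h: "holomorphic_vec b (ball 0 1)" using b by (simp add: bergman_space_def bergman_orlicz_def)
  have fin: "(\<integral>\<^sup>+z. ennreal (norm (b z) powr 2) \<partial>?\<nu>) < \<infinity>" using b by (simp add: bergman_space_def bergman_orlicz_def)
  note bm [measurable] = measurable_holomorphic_vec[OF h, of \<alpha>]
  show "integrable ?\<nu> b"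
  proof (rule integrableI_bounded[OF bm])
    have "(\<integral>\<^sup>+z. ennreal (norm (b z)) \<partial>?\<nu>) \<le> (\<integral>\<^sup>+z. 1 + ennreal (norm (b z) powr 2) \<partial>?\<nu>)"
    proof (rule nn_integral_mono)
      fix z
      have "norm (b z) \<le> 1 + norm (b z) powr 2"
      proof (cases "norm (b z) \<le> 1")
        case False
        then have "norm (b z) powr 1 \<le> norm (b z) powr 2" by (intro powr_mono) auto
        then show ?thesis by simp
      qed (simp add: add_increasing2)
      then have "ennreal (norm (b z)) \<le> ennreal (1 + norm (b z) powr 2)" by (rule ennreal_leI)
      then show "ennreal (norm (b z)) \<le> 1 + ennreal (norm (b z) powr 2)" by simp
    qed
    also have "\<dots> = 1 + (\<integral>\<^sup>+z. ennreal (norm (b z) powr 2) \<partial>?\<nu>)"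
      by (subst nn_integral_add) (simp_all add: emeasure_space_bergman[OF \<alpha>])
    also have "\<dots> < \<infinity>" using fin by simp
    finally show "(\<integral>\<^sup>+z. ennreal (norm (b z)) \<partial>?\<nu>) < \<infinity>" .
  qed
qed

text \<open>Since \<Phi> (peak) = (1 - |z|^2)^(-N), this rewrites \<rho> as \<Phi> (peak) / peak, so
  that inequalities for \<rho> become inequalities for the ratio \<Phi> t / t.\<close>

lemma growth_rho_peak:
  fixes z :: "complex^'n"
  assumes "norm z < 1"
  shows "growth_rho \<Phi> ((1 - (norm z)\<^sup>2) powr (real CARD('n) + 1 + \<alpha>))
    = (1 - (norm z)\<^sup>2) powr (- (real CARD('n) + 1 + \<alpha>)) / peak \<Phi> \<alpha> z"
proof -
  have "(1 - (norm z)\<^sup>2) powr (- s) = 1 / (1 - (norm z)\<^sup>2) powr s" for s by (rule powr_minus_divide)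
  then show ?thesis by (simp only: growth_rho_def peak_def ginv_def divide_divide_eq_left)
qed

lemma peak_le_peak:
  fixes z w :: "complex^'n"
  assumes G: "\<Phi> \<in> growth_class p" and \<alpha>: "\<alpha> > -1" and "norm w < 1" "norm z \<le> norm w"
  shows "peak \<Phi> \<alpha> z \<le> peak \<Phi> \<alpha> w"
  unfolding peak_def
proof (rule ginv_mono[OF G])
  have "(norm z)\<^sup>2 \<le> (norm w)\<^sup>2" using assms by (intro power_mono) auto
  then show "(1 - (norm z)\<^sup>2) powr (- (real CARD('n) + 1 + \<alpha>)) \<le> (1 - (norm w)\<^sup>2) powr (- (real CARD('n) + 1 + \<alpha>))"
    using one_minus_norm_square_pos[OF assms(3)] \<alpha> by (intro powr_mono2') auto
  show "(1 - (norm z)\<^sup>2) powr (- (real CARD('n) + 1 + \<alpha>)) > 0"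
    using one_minus_norm_square_pos[of z] assms by simp
qed

text \<open>The ratio \<Phi> t / t does not increase, so at t it is at least its value at C * peak,
  which monotonicity of \<Phi> bounds below by \<Phi> (peak) / (C * peak).\<close>

lemma peak_growth_le:
  fixes w :: "complex^'n"
  assumes G: "\<Phi> \<in> growth_class p" and w: "norm w < 1" and t: "0 \<le> t" "t \<le> C * peak \<Phi> \<alpha> w" and C: "C \<ge> 1"
  shows "t * ((1 - (norm w)\<^sup>2) powr (- (real CARD('n) + 1 + \<alpha>)) / peak \<Phi> \<alpha> w) \<le> C * \<Phi> t"
proof (cases "t = 0")
  case False
  let ?S = "peak \<Phi> \<alpha> w"
  have S: "?S > 0" by (rule peak_pos[OF G w])
  have t0: "t > 0" using t False by simp
  have CS: "C * ?S > 0" using C S by simp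
  have "?S \<le> C * ?S" using C S by simp
  then have "\<Phi> ?S \<le> \<Phi> (C * ?S)" using S by (intro growth_mono[OF G]) auto
  then have "\<Phi> ?S / (C * ?S) \<le> \<Phi> (C * ?S) / (C * ?S)" using CS by (intro divide_right_mono) auto
  also have "\<dots> \<le> \<Phi> t / t" by (rule growth_ratio[OF G t0 t(2)])
  finally have "t * (\<Phi> ?S / ?S) \<le> C * \<Phi> t" using C S t0 by (simp add: field_simps)
  then show ?thesis unfolding growth_peak[OF G w] .
qed (simp add: growth_zero[OF G])

text \<open>The integrand of \<open>L1_small_hankel_le\<close> is split at |v| = 1/2. Inside, R^k b
  is O(|v|) and all other factors are bounded, which leaves a decaying factor
  \<open>shrink x\<close>. Outside, the logarithms cancel and
  \<open>nn_integral_dilations_le\<close> supplies the power (1 - |v|^2)^k that compensates the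
  hypothesis on R^k b.\<close>

lemma hankel_bound_normalized:
  fixes b :: "complex^'n \<Rightarrow> complex"
  assumes \<alpha>: "\<alpha> > -1" and p: "0 < p" "p \<le> 1" and G: "\<Phi> \<in> growth_class p"
    and b: "holomorphic_vec b (ball 0 1)" "integrable (bergman_measure \<alpha>) b"
    and R: "\<And>z. norm z < 1 \<Longrightarrow> z \<noteq> 0 \<Longrightarrow> norm ((radial_deriv ^^ Suc j) b z)
      \<le> A * inverse ((1 - (norm z)\<^sup>2) ^ Suc j) * growth_rho \<Phi> ((1 - (norm z)\<^sup>2) powr (real CARD('n) + 1 + \<alpha>)) * inverse (ln (1 / (1 - (norm z)\<^sup>2)))"
    and A: "A > 0"
  obtains C where "C \<ge> 0" "\<And>f. holomorphic_vec f (ball 0 1) \<Longrightarrow> bounded (f ` ball 0 1) \<Longrightarrow>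
    (\<integral>\<^sup>+z. ennreal (\<Phi> (norm (f z))) \<partial>bergman_measure \<alpha>) \<le> 1 \<Longrightarrow> L1_norm \<alpha> (small_hankel \<alpha> b f) \<le> ennreal C"
proof -
  let ?\<nu> = "bergman_measure \<alpha> :: (complex^'n) measure"
  let ?N = "real CARD('n) + 1 + \<alpha>"
  let ?k = "Suc j"
  have N: "?N > 0" using \<alpha> by simp
  obtain Cp where Cp: "Cp > 0" "\<And>f w. holomorphic_vec f (ball (0 :: complex^'n) 1) \<Longrightarrow> bounded (f ` ball 0 1) \<Longrightarrow>
    (\<integral>\<^sup>+z. ennreal (\<Phi> (norm (f z))) \<partial>?\<nu>) \<le> 1 \<Longrightarrow> norm w < 1 \<Longrightarrow> norm (f w) \<le> Cp * peak \<Phi> \<alpha> w"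
    using peak_bound[OF G p \<alpha>] by blast
  define P where "P = max 1 Cp"
  obtain Cl where Cl: "Cl > 0" "\<And>a :: complex^'n. norm a < 1 \<Longrightarrow>
    (\<integral>\<^sup>+w. ennreal (norm (1 - cinner_vec w a) powr (- ?N)) \<partial>?\<nu>) \<le> ennreal (1 + Cl * ln (1 / (1 - (norm a)\<^sup>2)))"
    using forelli_rudin_log[OF \<alpha>] by blast
  obtain Cr where Cr: "Cr > 0" "\<And>x. norm x \<le> 1/2 \<Longrightarrow> norm (rkern ?N ?k x) \<le> Cr * norm x"
    using rkern_le_norm[OF N, of ?k] by auto
  obtain Cd where Cd: "Cd > 0" "\<And>g :: complex^'n \<Rightarrow> ennreal. g \<in> borel_measurable ?\<nu> \<Longrightarrow>
    (\<And>v. norm v < 1/2 \<Longrightarrow> g v = 0) \<Longrightarrow>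
    (\<integral>\<^sup>+x. ennreal (gamma_weight j x) * (\<integral>\<^sup>+w. g (of_real (shrink x) *s w) \<partial>?\<nu>) \<partial>lborel)
      \<le> ennreal Cd * (\<integral>\<^sup>+v. g v * ennreal ((1 - (norm v)\<^sup>2) ^ ?k) \<partial>?\<nu>)"
    using nn_integral_dilations_le[OF \<alpha>, of j] by blast
  \<comment> \<open>A point of the dividing sphere: its \<open>peak\<close> dominates that of the
    inner ball, and ln (4/3) is the value of ln (1 / (1 - |v|^2)) on it.\<close>
  obtain h :: "complex^'n" where h: "norm h = 1/2" using vector_choose_size[of "1/2"] by auto
  define b1 where "b1 = (\<integral>w. norm (b w) \<partial>?\<nu>)"
  define C1 where "C1 = Cr * b1 * (P * peak \<Phi> \<alpha> h) * (1 + Cl * ln (4/3))"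
  \<comment> \<open>For L >= ln (4/3), 1 + Cl * L is at most (1 / ln (4/3) + Cl) * L, and this L
    cancels the logarithm in the hypothesis.\<close>
  define C2 where "C2 = A * P * (1 / ln (4/3) + Cl)"
  have l43: "ln (4/3 :: real) > 0" by simp
  have b1: "b1 \<ge> 0" by (simp add: b1_def)
  have P: "P \<ge> 1" "P \<ge> Cp" by (auto simp: P_def)
  have ph: "peak \<Phi> \<alpha> h > 0" by (rule peak_pos[OF G]) (use h in simp)
  have C1: "C1 \<ge> 0" using Cr Cl b1 P ph l43 by (simp add: C1_def)
  have C2: "C2 \<ge> 0" using A Cl P l43 by (simp add: C2_def)
  have small: "norm ((radial_deriv ^^ ?k) b v) \<le> Cr * b1 * norm v" if v: "norm v \<le> 1/2" for v
  proof -
    have v1: "norm v < 1" using v by simp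
    have ki: "integrable ?\<nu> (\<lambda>w. b w * rkern ?N ?k (cinner_vec v w))"
      by (rule integrable_kernel[OF holomorphic_on_imp_continuous_on[OF rkern_holomorphic[OF N]] v1 b(2)])
    have "norm ((radial_deriv ^^ ?k) b v) \<le> (\<integral>w. (Cr * norm v) * norm (b w) \<partial>?\<nu>)"
      unfolding iterated_radial_deriv[OF \<alpha> b v1] kern_int_def
    proof (rule Bochner_Integration.integral_norm_bound_integral[OF ki])
      fix w assume "w \<in> space ?\<nu>"
      then have x: "norm (cinner_vec v w) \<le> norm v"
        using norm_cinner_vec_le[of v w] mult_left_le[of "norm w" "norm v"] by simp
      then have "norm (rkern ?N ?k (cinner_vec v w)) \<le> Cr * norm (cinner_vec v w)" using v by (intro Cr) simp
      also have "\<dots> \<le> Cr * norm v" using x Cr by simp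
      finally show "norm (b w * rkern ?N ?k (cinner_vec v w)) \<le> (Cr * norm v) * norm (b w)"
        using mult_left_mono[of "norm (rkern ?N ?k (cinner_vec v w))" "Cr * norm v" "norm (b w)"]
        by (simp add: norm_mult mult.commute)
    qed (use b(2) in simp)
    then show ?thesis by (simp add: b1_def mult_ac)
  qed
  show ?thesis
  proof (rule that[of "norm (b 0) * (P * peak \<Phi> \<alpha> (0 :: complex^'n)) + (C1 * 2 ^ ?k + Cd * C2)"])
    show "norm (b 0) * (P * peak \<Phi> \<alpha> (0 :: complex^'n)) + (C1 * 2 ^ ?k + Cd * C2) \<ge> 0"
      using P peak_pos[OF G, of "0 :: complex^'n" \<alpha>] C1 C2 Cd by simp
    fix f :: "complex^'n \<Rightarrow> complex"
    assume f: "holomorphic_vec f (ball 0 1)" "bounded (f ` ball 0 1)"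
      and I: "(\<integral>\<^sup>+z. ennreal (\<Phi> (norm (f z))) \<partial>?\<nu>) \<le> 1"
    have fP: "norm (f w) \<le> P * peak \<Phi> \<alpha> w" if "norm w < 1" for w
    proof -
      have "Cp * peak \<Phi> \<alpha> w \<le> P * peak \<Phi> \<alpha> w"
        using P peak_pos[OF G that, of \<alpha>] by (intro mult_right_mono) auto
      then show ?thesis using Cp(2)[OF f I that] by linarith
    qed
    define kI where "kI = (\<lambda>v :: complex^'n. \<integral>\<^sup>+z. ennreal (norm (1 - cinner_vec z v) powr (- ?N)) \<partial>?\<nu>)"
    \<comment> \<open>The majorant of the outer part, set to 0 on the inner ball so that the
      dilation lemma applies to it.\<close>
    define g where "g = (\<lambda>v. ennreal (if norm v < 1/2 then 0 else C2 * \<Phi> (norm (f v)) / (1 - (norm v)\<^sup>2) ^ ?k))"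
    have \<Phi>m [measurable]: "(\<lambda>v. \<Phi> (norm (f v))) \<in> borel_measurable ?\<nu>"
      using measurable_growth[OF G, of "\<lambda>v. norm (f v)" ?\<nu>] measurable_holomorphic_vec[OF f(1), of \<alpha>] by simp
    have gm [measurable]: "g \<in> borel_measurable ?\<nu>" unfolding g_def by measurable
    have point: "ennreal (norm ((radial_deriv ^^ ?k) b v) * norm (f v)) * kI v \<le> ennreal (C1 * norm v) + g v"
      if v: "norm v < 1" for v
    proof -
      let ?L = "ln (1 / (1 - (norm v)\<^sup>2))"
      define D where "D = 1 - (norm v)\<^sup>2"
      have D: "D > 0" using one_minus_norm_square_pos[OF v] by (simp add: D_def)
      have le: "ennreal (norm ((radial_deriv ^^ ?k) b v) * norm (f v)) * kI v
        \<le> ennreal (norm ((radial_deriv ^^ ?k) b v) * norm (f v) * (1 + Cl * ?L))"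
        unfolding kI_def using Cl(2)[OF v] by (simp add: ennreal_mult' mult_left_mono del: funpow.simps)
      show ?thesis
      proof (cases "norm v < 1/2")
        case True
        then have "(norm v)\<^sup>2 \<le> (1/2)\<^sup>2" by (intro power_mono) auto
        then have "1 / D \<le> 1 / (3/4)" by (intro divide_left_mono) (auto simp: D_def power2_eq_square intro!: mult_pos_pos D[unfolded D_def power2_eq_square])
        then have "?L \<le> ln (4/3)" using D unfolding D_def[symmetric] by simp
        moreover have "0 \<le> ?L" using D unfolding D_def[symmetric] by (simp add: D_def ln_div)
        ultimately have L: "1 + Cl * ?L \<le> 1 + Cl * ln (4/3)" "0 \<le> 1 + Cl * ?L" using Cl by auto
        have "norm (f v) \<le> P * peak \<Phi> \<alpha> v" by (rule fP[OF v])
        also have "\<dots> \<le> P * peak \<Phi> \<alpha> h"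
          using P True h by (intro mult_left_mono peak_le_peak[OF G \<alpha>]) auto
        finally have "norm ((radial_deriv ^^ ?k) b v) * norm (f v) * (1 + Cl * ?L)
          \<le> (Cr * b1 * norm v) * (P * peak \<Phi> \<alpha> h) * (1 + Cl * ln (4/3))"
          using L small[of v] True Cr b1 P ph by (intro mult_mono) auto
        also have "\<dots> = C1 * norm v" by (simp add: C1_def)
        finally have "ennreal (norm ((radial_deriv ^^ ?k) b v) * norm (f v) * (1 + Cl * ?L)) \<le> ennreal (C1 * norm v)"
          by (rule ennreal_leI)
        also have "\<dots> \<le> ennreal (C1 * norm v) + g v" by simp
        finally show ?thesis using le by (rule order.trans[rotated])
      next
        case False
        then have "(1/2)\<^sup>2 \<le> (norm v)\<^sup>2" by (intro power_mono) auto
        then have "D \<le> 3/4" by (simp add: D_def power2_eq_square)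
        then have "1 / (3/4) \<le> 1 / D" using D by (intro divide_left_mono) auto
        then have L: "ln (4/3) \<le> ?L" unfolding D_def[symmetric] using D by simp
        then have L0: "?L > 0" using l43 by linarith
        have "1 = (1 / ln (4/3)) * ln (4/3 :: real)" using l43 by simp
        also have "\<dots> \<le> (1 / ln (4/3)) * ?L" using L l43 by (intro mult_left_mono) auto
        finally have L1: "1 + Cl * ?L \<le> (1 / ln (4/3) + Cl) * ?L" by (simp add: distrib_right)
        have v0: "v \<noteq> 0" using False by auto
        let ?\<rho> = "D powr (- ?N) / peak \<Phi> \<alpha> v"
        have \<rho>: "?\<rho> \<ge> 0" using peak_pos[OF G v, of \<alpha>] by simp
        have Rb: "norm ((radial_deriv ^^ ?k) b v) \<le> A * inverse (D ^ ?k) * ?\<rho> * inverse ?L"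
          using R[OF v v0] unfolding growth_rho_peak[OF v] D_def .
        have f\<rho>: "norm (f v) * ?\<rho> \<le> P * \<Phi> (norm (f v))"
          using peak_growth_le[OF G v _ fP[OF v] P(1)] unfolding D_def by simp
        have "norm ((radial_deriv ^^ ?k) b v) * norm (f v) * (1 + Cl * ?L)
          \<le> (A * inverse (D ^ ?k) * ?\<rho> * inverse ?L) * norm (f v) * ((1 / ln (4/3) + Cl) * ?L)"
          using Rb L1 L0 Cl A D \<rho> by (intro mult_mono mult_right_mono mult_nonneg_nonneg) auto
        also have "\<dots> = A * inverse (D ^ ?k) * (norm (f v) * ?\<rho>) * (1 / ln (4/3) + Cl) * (inverse ?L * ?L)"
          by (simp only: mult_ac)
        also have "\<dots> = A * inverse (D ^ ?k) * (norm (f v) * ?\<rho>) * (1 / ln (4/3) + Cl)" using L0 by simp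
        also have "\<dots> \<le> A * inverse (D ^ ?k) * (P * \<Phi> (norm (f v))) * (1 / ln (4/3) + Cl)"
          using f\<rho> A D Cl l43 by (intro mult_right_mono mult_left_mono) auto
        also have "\<dots> = C2 * \<Phi> (norm (f v)) / D ^ ?k" by (simp only: C2_def divide_inverse mult_ac)
        finally have "ennreal (norm ((radial_deriv ^^ ?k) b v) * norm (f v) * (1 + Cl * ?L)) \<le> g v"
          using False unfolding g_def D_def by (simp add: ennreal_leI)
        also have "g v \<le> ennreal (C1 * norm v) + g v" by simp
        finally show ?thesis using le by (rule order.trans[rotated])
      qed
    qed
    have gx: "(\<lambda>w. g (of_real (shrink x) *s w)) \<in> borel_measurable ?\<nu>" for x
      using measurable_compose[OF measurable_Pair1'[of x lborel] measurable_compose[OF measurable_shrink_scale gm]] by simp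
    have gxj: "(\<lambda>x. \<integral>\<^sup>+w. g (of_real (shrink x) *s w) \<partial>?\<nu>) \<in> borel_measurable lborel"
    proof -
      interpret finite_measure ?\<nu> by (rule finite_measure_bergman[OF \<alpha>])
      show ?thesis
        using measurable_compose[OF measurable_shrink_scale gm]
        by (intro borel_measurable_nn_integral) (simp add: case_prod_beta')
    qed
    have "L1_norm \<alpha> (small_hankel \<alpha> b f) \<le> ennreal (norm (b 0) * norm (f 0)) +
      (\<integral>\<^sup>+x. ennreal (gamma_weight j x) * (\<integral>\<^sup>+w. ennreal (norm ((radial_deriv ^^ ?k) b (of_real (shrink x) *s w)) * norm (f (of_real (shrink x) *s w))) * kI (of_real (shrink x) *s w) \<partial>?\<nu>) \<partial>lborel)"
      unfolding kI_def by (rule L1_small_hankel_le[OF \<alpha> b f])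
    also have "\<dots> \<le> ennreal (norm (b 0) * norm (f 0)) +
      (\<integral>\<^sup>+x. ennreal (C1 * (exp (- (1/2 * x)) * gamma_weight j x)) + ennreal (gamma_weight j x) * (\<integral>\<^sup>+w. g (of_real (shrink x) *s w) \<partial>?\<nu>) \<partial>lborel)"
    proof (intro add_left_mono nn_integral_mono)
      fix x :: real
      have "(\<integral>\<^sup>+w. ennreal (norm ((radial_deriv ^^ ?k) b (of_real (shrink x) *s w)) * norm (f (of_real (shrink x) *s w))) * kI (of_real (shrink x) *s w) \<partial>?\<nu>)
        \<le> (\<integral>\<^sup>+w. ennreal (C1 * shrink x) + g (of_real (shrink x) *s w) \<partial>?\<nu>)"
      proof (rule nn_integral_mono)
        fix w assume w: "w \<in> space ?\<nu>"
        have s: "norm (complex_of_real (shrink x) *s w) < 1" using norm_shrink_less[of w 1 x] w by simp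
        have "norm (complex_of_real (shrink x) *s w) \<le> shrink x"
          using w shrink(1)[of x] by (simp add: norm_scale_vec mult_left_le)
        then have "ennreal (C1 * norm (complex_of_real (shrink x) *s w)) \<le> ennreal (C1 * shrink x)"
          using C1 by (intro ennreal_leI mult_left_mono)
        then show "ennreal (norm ((radial_deriv ^^ ?k) b (of_real (shrink x) *s w)) * norm (f (of_real (shrink x) *s w))) * kI (of_real (shrink x) *s w)
          \<le> ennreal (C1 * shrink x) + g (of_real (shrink x) *s w)"
          using point[OF s] by (meson add_right_mono order.trans)
      qed
      also have "\<dots> = ennreal (C1 * shrink x) + (\<integral>\<^sup>+w. g (of_real (shrink x) *s w) \<partial>?\<nu>)"
        using gx by (subst nn_integral_add) (simp_all add: emeasure_space_bergman[OF \<alpha>])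
      finally have "ennreal (gamma_weight j x) * (\<integral>\<^sup>+w. ennreal (norm ((radial_deriv ^^ ?k) b (of_real (shrink x) *s w)) * norm (f (of_real (shrink x) *s w))) * kI (of_real (shrink x) *s w) \<partial>?\<nu>)
        \<le> ennreal (gamma_weight j x) * (ennreal (C1 * shrink x) + (\<integral>\<^sup>+w. g (of_real (shrink x) *s w) \<partial>?\<nu>))"
        by (rule mult_left_mono) simp
      also have "\<dots> = ennreal (gamma_weight j x * (C1 * shrink x)) + ennreal (gamma_weight j x) * (\<integral>\<^sup>+w. g (of_real (shrink x) *s w) \<partial>?\<nu>)"
        by (simp add: distrib_left ennreal_mult' gamma_weight_nonneg)
      \<comment> \<open>On the half-line \<open>shrink x\<close> is exp (- x / 2), so the inner part
        is a Gamma integral of rate 1/2; it evaluates to C1 * 2^k.\<close>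
      also have "gamma_weight j x * (C1 * shrink x) = C1 * (exp (- (1/2 * x)) * gamma_weight j x)"
        by (cases "0 \<le> x") (auto simp: shrink_def gamma_weight_def)
      finally show "ennreal (gamma_weight j x) * (\<integral>\<^sup>+w. ennreal (norm ((radial_deriv ^^ ?k) b (of_real (shrink x) *s w)) * norm (f (of_real (shrink x) *s w))) * kI (of_real (shrink x) *s w) \<partial>?\<nu>)
        \<le> ennreal (C1 * (exp (- (1/2 * x)) * gamma_weight j x)) + ennreal (gamma_weight j x) * (\<integral>\<^sup>+w. g (of_real (shrink x) *s w) \<partial>?\<nu>)" .
    qed
    also have "\<dots> = ennreal (norm (b 0) * norm (f 0)) + ((\<integral>\<^sup>+x. ennreal (C1 * (exp (- (1/2 * x)) * gamma_weight j x)) \<partial>lborel)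
      + (\<integral>\<^sup>+x. ennreal (gamma_weight j x) * (\<integral>\<^sup>+w. g (of_real (shrink x) *s w) \<partial>?\<nu>) \<partial>lborel))"
      using gxj by (subst nn_integral_add) auto
    also have "(\<integral>\<^sup>+x. ennreal (C1 * (exp (- (1/2 * x)) * gamma_weight j x)) \<partial>lborel) = ennreal (C1 * 2 ^ ?k)"
    proof -
      have "(\<integral>\<^sup>+x. ennreal (C1 * (exp (- (1/2 * x)) * gamma_weight j x)) \<partial>lborel) = ennreal C1 * (\<integral>\<^sup>+x. ennreal (exp (- (1/2 * x)) * gamma_weight j x) \<partial>lborel)"
        unfolding ennreal_mult'[OF C1] by (rule nn_integral_cmult) measurable
      also have "\<dots> = ennreal C1 * ennreal (1 / (1/2) ^ ?k)" by (subst nn_integral_gamma_weight) auto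
      also have "\<dots> = ennreal (C1 * 2 ^ ?k)" using C1 by (simp add: ennreal_mult'[symmetric] power_one_over del: power_Suc)
      finally show ?thesis .
    qed
    also have "(\<integral>\<^sup>+x. ennreal (gamma_weight j x) * (\<integral>\<^sup>+w. g (of_real (shrink x) *s w) \<partial>?\<nu>) \<partial>lborel) \<le> ennreal (Cd * C2)"
    proof -
      have "(\<integral>\<^sup>+x. ennreal (gamma_weight j x) * (\<integral>\<^sup>+w. g (of_real (shrink x) *s w) \<partial>?\<nu>) \<partial>lborel)
        \<le> ennreal Cd * (\<integral>\<^sup>+v. g v * ennreal ((1 - (norm v)\<^sup>2) ^ ?k) \<partial>?\<nu>)"
        by (rule Cd(2)[OF gm]) (simp add: g_def)
      also have "(\<integral>\<^sup>+v. g v * ennreal ((1 - (norm v)\<^sup>2) ^ ?k) \<partial>?\<nu>) \<le> (\<integral>\<^sup>+v. ennreal C2 * ennreal (\<Phi> (norm (f v))) \<partial>?\<nu>)"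
      proof (rule nn_integral_mono)
        fix v assume "v \<in> space ?\<nu>"
        then have D: "1 - (norm v)\<^sup>2 > 0" by (intro one_minus_norm_square_pos) simp
        then have "(C2 * \<Phi> (norm (f v)) / (1 - (norm v)\<^sup>2) ^ ?k) * (1 - (norm v)\<^sup>2) ^ ?k = C2 * \<Phi> (norm (f v))" by simp
        then show "g v * ennreal ((1 - (norm v)\<^sup>2) ^ ?k) \<le> ennreal C2 * ennreal (\<Phi> (norm (f v)))"
          using D C2 growth_nonneg[OF G, of "norm (f v)"]
          by (auto simp: g_def ennreal_mult'[symmetric] simp del: power_Suc)
      qed
      also have "\<dots> = ennreal C2 * (\<integral>\<^sup>+v. ennreal (\<Phi> (norm (f v))) \<partial>?\<nu>)" by (rule nn_integral_cmult) measurable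
      also have "\<dots> \<le> ennreal C2 * 1" by (intro mult_left_mono I) simp
      finally show ?thesis using Cd C2 by (simp add: ennreal_mult' mult_left_mono)
    qed
    also have "norm (b 0) * norm (f 0) \<le> norm (b 0) * (P * peak \<Phi> \<alpha> (0 :: complex^'n))"
      using fP[of 0] by (intro mult_left_mono) auto
    finally show "L1_norm \<alpha> (small_hankel \<alpha> b f) \<le> ennreal (norm (b 0) * (P * peak \<Phi> \<alpha> (0 :: complex^'n)) + (C1 * 2 ^ ?k + Cd * C2))"
      using P peak_pos[OF G, of "0 :: complex^'n" \<alpha>] C1 C2 Cd
      by (simp add: add_left_mono ennreal_leI del: power_Suc)
  qed
qed

lemma small_hankel_kern_int:
  "small_hankel \<alpha> b f = kern_int \<alpha> (bkern (real CARD('n) + 1 + \<alpha>)) (\<lambda>w :: complex^'n. b w * cnj (f w))"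
  by (simp add: fun_eq_iff small_hankel_eq kern_int_def)

lemma integrable_mult_cnj_bounded:
  fixes b f :: "complex^'n \<Rightarrow> complex"
  assumes "integrable (bergman_measure \<alpha>) b" "holomorphic_vec f (ball 0 1)" "bounded (f ` ball 0 1)"
  shows "integrable (bergman_measure \<alpha>) (\<lambda>w. b w * cnj (f w))"
proof -
  obtain B where B: "\<forall>y\<in>f ` ball 0 1. norm y \<le> B" using assms(3) unfolding bounded_iff by blast
  show ?thesis
    by (rule integrable_bounded_mult[OF assms(1), where B=B])
      (use B measurable_holomorphic_vec[OF assms(2)] in auto)
qed

lemma measurable_small_hankel:
  fixes b f :: "complex^'n \<Rightarrow> complex"
  assumes "integrable (bergman_measure \<alpha>) b" "holomorphic_vec f (ball 0 1)" "bounded (f ` ball 0 1)"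
  shows "small_hankel \<alpha> b f \<in> borel_measurable (bergman_measure \<alpha>)"
  unfolding small_hankel_kern_int
  by (intro measurable_holomorphic_vec holomorphic_vec_kern_int bkern_holomorphic integrable_mult_cnj_bounded assms)

lemma small_hankel_scale:
  "small_hankel \<alpha> b (\<lambda>w. c * f w) z = cnj c * small_hankel \<alpha> b f z"
  unfolding small_hankel_eq by (subst integral_mult_right_zero[symmetric]) (simp add: mult_ac)

text \<open>The normalised bound is rescaled: f / l is admissible for every l in the set whose
  infimum is the Luxemburg norm, and h_b is conjugate-homogeneous in f. The inequality is proved for
  each such l and then passed to the infimum.\<close>

theorem LGamma_imp_bounded:
  fixes b :: "complex^'n \<Rightarrow> complex"
  assumes \<alpha>: "\<alpha> > -1" and p: "0 < p" "p \<le> 1" and G: "\<Phi> \<in> growth_class p"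
    and b: "b \<in> bergman_space \<alpha> 2" and L: "b \<in> LGamma \<alpha> (1 / p - 1) (growth_rho \<Phi>)"
  shows "hankel_extends_bounded \<alpha> \<Phi> b"
proof -
  let ?\<nu> = "bergman_measure \<alpha> :: (complex^'n) measure"
  let ?N = "real CARD('n) + 1 + \<alpha>"
  note b' = bergman_space_2D[OF \<alpha> b]
  obtain k A where k: "real k > (1 / p - 1) * ?N" and A: "A > 0" and
    R: "\<And>z. z \<in> ball 0 1 - {0} \<Longrightarrow> norm ((radial_deriv ^^ k) b z)
      \<le> A * inverse ((1 - (norm z)\<^sup>2) ^ k) * growth_rho \<Phi> ((1 - (norm z)\<^sup>2) powr ?N) * inverse (ln (1 / (1 - (norm z)\<^sup>2)))"
    using L unfolding LGamma_def by blast
  \<comment> \<open>As p is at most 1, the strict lower bound on k forces k > 0, and k can be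
    written as \<open>Suc j\<close>.\<close>
  have "(1 / p - 1) * ?N \<ge> 0" using p \<alpha> by (intro mult_nonneg_nonneg) (auto simp: field_simps)
  then have "k > 0" using k by (cases k) auto
  then obtain j where j: "k = Suc j" by (cases k) auto
  obtain C where C: "C \<ge> 0" "\<And>f. holomorphic_vec f (ball 0 1) \<Longrightarrow> bounded (f ` ball 0 1) \<Longrightarrow>
    (\<integral>\<^sup>+z. ennreal (\<Phi> (norm (f z))) \<partial>?\<nu>) \<le> 1 \<Longrightarrow> L1_norm \<alpha> (small_hankel \<alpha> b f) \<le> ennreal C"
    using hankel_bound_normalized[OF \<alpha> p G b', of j A] R A unfolding j by auto
  have "L1_norm \<alpha> (small_hankel \<alpha> b f) \<le> ennreal (C * lux_norm \<alpha> \<Phi> f)"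
    if f: "holomorphic_vec f (ball 0 1)" "bounded (f ` ball 0 1)" for f
  proof -
    define S where "S = {l. 0 < l \<and> (\<integral>\<^sup>+z. ennreal (\<Phi> (norm (f z) / l)) \<partial>?\<nu>) \<le> 1}"
    have le: "L1_norm \<alpha> (small_hankel \<alpha> b f) \<le> ennreal (C * l)" if l: "l \<in> S" for l
    proof -
      have l0: "l > 0" using l by (simp add: S_def)
      define g where "g = (\<lambda>w. of_real (1 / l) * f w)"
      have g: "holomorphic_vec g (ball 0 1)" unfolding g_def by (intro holomorphic_vec_mult holomorphic_vec_const f)
      have "bounded ((\<lambda>y. of_real (1 / l) * y) ` (f ` ball 0 1))"
        by (intro bounded_linear_image[OF f(2)] bounded_linear_mult_right)
      then have gb: "bounded (g ` ball 0 1)" by (simp add: g_def image_image)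
      have "norm (g z) = norm (f z) / l" for z using l0 by (simp add: g_def norm_mult norm_divide)
      then have "(\<integral>\<^sup>+z. ennreal (\<Phi> (norm (g z))) \<partial>?\<nu>) \<le> 1" using l by (simp add: S_def)
      from C(2)[OF g gb this] have gC: "L1_norm \<alpha> (small_hankel \<alpha> b g) \<le> ennreal C" .
      have "f = (\<lambda>w. of_real l * g w)" using l0 by (simp add: g_def fun_eq_iff)
      then have hf: "small_hankel \<alpha> b f z = of_real l * small_hankel \<alpha> b g z" for z
        using small_hankel_scale[of \<alpha> b "of_real l" g z] by simp
      have "L1_norm \<alpha> (small_hankel \<alpha> b f) = (\<integral>\<^sup>+z. ennreal l * ennreal (norm (small_hankel \<alpha> b g z)) \<partial>?\<nu>)"
        unfolding L1_norm_def hf using l0 by (simp add: norm_mult ennreal_mult')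
      also have "\<dots> = ennreal l * L1_norm \<alpha> (small_hankel \<alpha> b g)"
        unfolding L1_norm_def using measurable_small_hankel[OF b'(2) g gb] by (intro nn_integral_cmult) simp
      also have "\<dots> \<le> ennreal l * ennreal C" by (rule mult_left_mono[OF gC]) simp
      also have "\<dots> = ennreal (C * l)" by (simp only: ennreal_mult'[OF C(1)] mult.commute)
      finally show ?thesis .
    qed
    \<comment> \<open>A large l is admissible because f is bounded; the infimum of the empty set
      would carry no meaning.\<close>
    have "S \<noteq> {}"
    proof -
      obtain B where "\<forall>y\<in>f ` ball 0 1. norm y \<le> B" using f(2) unfolding bounded_iff by blast
      then have B: "norm (f w) \<le> B" if "norm w < 1" for w using that by simp
      define s where "s = ginv \<Phi> 1"
      have s: "s > 0" "\<Phi> s = 1" using ginv_pos[OF G zero_less_one] growth_ginv[OF G zero_less_one] by (auto simp: s_def)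
      define l where "l = (\<bar>B\<bar> + 1) / s"
      have l: "l > 0" using s by (simp add: l_def add_nonneg_pos)
      have "(\<integral>\<^sup>+z. ennreal (\<Phi> (norm (f z) / l)) \<partial>?\<nu>) \<le> (\<integral>\<^sup>+z. 1 \<partial>?\<nu>)"
      proof (rule nn_integral_mono)
        fix z assume "z \<in> space ?\<nu>"
        then have "norm (f z) \<le> \<bar>B\<bar> + 1" using B[of z] by simp
        then have "norm (f z) / l \<le> (\<bar>B\<bar> + 1) / l" using l by (intro divide_right_mono) auto
        also have "(\<bar>B\<bar> + 1) / l = s" using s by (simp add: l_def)
        finally have "\<Phi> (norm (f z) / l) \<le> \<Phi> s" using l by (intro growth_mono[OF G]) auto
        then show "ennreal (\<Phi> (norm (f z) / l)) \<le> 1" using s by simp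
      qed
      also have "\<dots> = 1" by (simp add: emeasure_space_bergman[OF \<alpha>])
      finally show ?thesis using l by (auto simp: S_def)
    qed
    have "ennreal (C * Inf S) \<ge> L1_norm \<alpha> (small_hankel \<alpha> b f)"
    proof -
      obtain l0 where l0: "l0 \<in> S" using \<open>S \<noteq> {}\<close> by blast
      obtain x where x: "L1_norm \<alpha> (small_hankel \<alpha> b f) = ennreal x" "x \<ge> 0"
        using le[OF l0] by (cases "L1_norm \<alpha> (small_hankel \<alpha> b f)" rule: ennreal_cases) (auto simp: top_unique)
      have xl: "x \<le> C * l" if "l \<in> S" for l
      proof -
        have "l > 0" using that by (simp add: S_def)
        then show ?thesis using le[OF that] C(1) unfolding x by (simp add: ennreal_le_iff)
      qed
      have "x \<le> C * Inf S"
      proof (cases "C = 0")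
        case True
        then show ?thesis using xl[OF l0] by simp
      next
        case False
        then have "x / C \<le> Inf S"
          using xl C(1) by (intro cInf_greatest[OF \<open>S \<noteq> {}\<close>]) (simp add: divide_le_eq mult.commute)
        then show ?thesis using False C(1) by (simp add: divide_le_eq mult.commute)
      qed
      then show ?thesis unfolding x by (rule ennreal_leI)
    qed
    then show ?thesis by (simp add: lux_norm_def S_def)
  qed
  then show ?thesis unfolding hankel_extends_bounded_def by blast
qed

section \<open>Necessity\<close>

text \<open>Joint measurability is read off the binomial series, whose terms are powers of the
  product; the branch cut of \<open>powr\<close> does not come up.\<close>

lemma measurable_bkern_cinner:
  "(\<lambda>(z, w). bkern s (cinner_vec z w)) \<in> borel_measurable (bergman_measure \<alpha> \<Otimes>\<^sub>M (bergman_measure \<alpha> :: (complex^'n) measure))"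
proof -
  have "(\<lambda>z. \<Sum>m. of_real (pochhammer s m / fact m) * cinner_vec (fst z) (snd z) ^ m)
    \<in> borel_measurable (bergman_measure \<alpha> \<Otimes>\<^sub>M (bergman_measure \<alpha> :: (complex^'n) measure))"
    by (rule borel_measurable_suminf) measurable
  moreover have "(\<Sum>m. of_real (pochhammer s m / fact m) * cinner_vec (fst z) (snd z) ^ m) = bkern s (cinner_vec (fst z) (snd z))"
    if "z \<in> space (bergman_measure \<alpha> \<Otimes>\<^sub>M (bergman_measure \<alpha> :: (complex^'n) measure))" for z
  proof -
    have "norm (cinner_vec (fst z) (snd z)) < 1"
      using that by (intro norm_cinner_vec_less) (auto simp: space_pair_measure)
    from bkern_sums[OF this] show ?thesis by (simp add: sums_iff)
  qed
  ultimately show ?thesis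
    by (subst measurable_cong[where g="\<lambda>z. \<Sum>m. of_real (pochhammer s m / fact m) * cinner_vec (fst z) (snd z) ^ m"])
      (auto simp: case_prod_beta')
qed

(* Writes P_\<alpha> applied to c (1 - |z|^2) F as an integral against the measure with weight \<alpha> + 1 and moves
   the projection from b cnj f to the bounded function (1 - |z|^2) F. *)
lemma hankel_duality:
  fixes b :: "complex^'n \<Rightarrow> complex"
  assumes \<alpha>: "\<alpha> > -1" and b: "integrable (bergman_measure \<alpha>) b"
  obtains c where "c > 0" "\<And>f F B. holomorphic_vec f (ball 0 1) \<Longrightarrow> bounded (f ` ball 0 1) \<Longrightarrow>
    holomorphic_vec F (ball 0 1) \<Longrightarrow> bounded (F ` ball 0 1) \<Longrightarrow>
    (\<And>w. norm w < 1 \<Longrightarrow> (1 - (norm w)\<^sup>2) * norm (F w) \<le> B) \<Longrightarrow>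
    ennreal (norm (\<integral>w. b w * cnj (f w) * cnj (kern_int (\<alpha> + 1) (bkern (real CARD('n) + 1 + \<alpha>)) F w) \<partial>bergman_measure \<alpha>))
      \<le> ennreal (c * B) * L1_norm \<alpha> (small_hankel \<alpha> b f)"
proof -
  let ?\<nu> = "bergman_measure \<alpha> :: (complex^'n) measure"
  let ?N = "real CARD('n) + 1 + \<alpha>"
  interpret \<nu>: finite_measure ?\<nu> by (rule finite_measure_bergman[OF \<alpha>])
  interpret \<nu>\<nu>: pair_sigma_finite ?\<nu> ?\<nu> ..
  have \<alpha>1: "\<alpha> + 1 > -1" using \<alpha> by simp
  obtain c where c: "c > 0" "(bergman_measure (\<alpha> + 1) :: (complex^'n) measure)
     = density ?\<nu> (\<lambda>w. ennreal (c * (1 - (norm w)\<^sup>2) powr (\<alpha> + 1 - \<alpha>)))"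
    using bergman_measure_reweight[OF \<alpha> \<alpha>1] by blast
  obtain Cf where Cf: "Cf > 0" "\<And>a :: complex^'n. norm a < 1 \<Longrightarrow>
    (\<integral>\<^sup>+w. ennreal ((1 - (norm w)\<^sup>2) * norm (1 - cinner_vec w a) powr (- ?N)) \<partial>?\<nu>) \<le> ennreal Cf"
    using forelli_rudin_bounded[OF \<alpha>] by blast
  show ?thesis
  proof (rule that[OF c(1)])
    fix f F :: "complex^'n \<Rightarrow> complex" and B :: real
    assume f: "holomorphic_vec f (ball 0 1)" "bounded (f ` ball 0 1)"
      and F: "holomorphic_vec F (ball 0 1)" "bounded (F ` ball 0 1)"
      and B: "\<And>w. norm w < 1 \<Longrightarrow> (1 - (norm w)\<^sup>2) * norm (F w) \<le> B"
    define a where "a = (\<lambda>w. b w * cnj (f w))"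
    define \<psi> where "\<psi> = (\<lambda>z. of_real (c * (1 - (norm z)\<^sup>2)) * cnj (F z))"
    have a: "integrable ?\<nu> a" unfolding a_def by (rule integrable_mult_cnj_bounded[OF b f])
    have am [measurable]: "a \<in> borel_measurable ?\<nu>" using a by simp
    have Fm [measurable]: "F \<in> borel_measurable (bergman_measure \<beta>)" for \<beta> by (rule measurable_holomorphic_vec[OF F(1)])
    have \<psi>m [measurable]: "\<psi> \<in> borel_measurable ?\<nu>" unfolding \<psi>_def by measurable
    note measurable_bkern_cinner[of ?N \<alpha>, where 'n='n, measurable]
    \<comment> \<open>K only serves the absolute integrability behind Fubini. The final constant
      contains B alone, which makes the estimate uniform over families of F with a common B.\<close>
    obtain K where "\<forall>y\<in>F ` ball 0 1. norm y \<le> K" using F(2) unfolding bounded_iff by blast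
    then have K: "norm (F w) \<le> K" if "norm w < 1" for w using that by simp
    have K0: "K \<ge> 0" using order.trans[OF norm_ge_zero K[of 0]] by simp
    define H where "H = (\<lambda>z w. a w * bkern ?N (cinner_vec z w) * \<psi> z)"
    have Hm [measurable]: "(\<lambda>(z, w). H z w) \<in> borel_measurable (?\<nu> \<Otimes>\<^sub>M ?\<nu>)"
      unfolding H_def by measurable
    \<comment> \<open>The factor 1 - |z|^2 of \<psi> makes the z-integral of the kernel bounded in
      w, so integrability of a is enough.\<close>
    have Hint: "integrable (?\<nu> \<Otimes>\<^sub>M ?\<nu>) (\<lambda>(z, w). H z w)"
    proof (rule integrableI_bounded[OF Hm])
      have "(\<integral>\<^sup>+x. ennreal (norm (case x of (z, w) \<Rightarrow> H z w)) \<partial>(?\<nu> \<Otimes>\<^sub>M ?\<nu>)) = (\<integral>\<^sup>+w. (\<integral>\<^sup>+z. ennreal (norm (H z w)) \<partial>?\<nu>) \<partial>?\<nu>)"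
        by (subst \<nu>\<nu>.nn_integral_snd[symmetric]) (auto simp: case_prod_beta')
      also have "\<dots> \<le> (\<integral>\<^sup>+w. ennreal (norm (a w)) * ennreal (c * K * Cf) \<partial>?\<nu>)"
      proof (rule nn_integral_mono)
        fix w assume "w \<in> space ?\<nu>"
        then have w: "norm w < 1" by simp
        have "(\<integral>\<^sup>+z. ennreal (norm (H z w)) \<partial>?\<nu>) \<le> (\<integral>\<^sup>+z. ennreal (norm (a w) * (c * K)) * ennreal ((1 - (norm z)\<^sup>2) * norm (1 - cinner_vec z w) powr (- ?N)) \<partial>?\<nu>)"
        proof (rule nn_integral_mono)
          fix z assume "z \<in> space ?\<nu>"
          then have z: "norm z < 1" by simp
          have D: "1 - (norm z)\<^sup>2 > 0" by (rule one_minus_norm_square_pos[OF z])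
          have "norm (\<psi> z) = c * (1 - (norm z)\<^sup>2) * norm (F z)"
            unfolding \<psi>_def norm_mult norm_of_real complex_mod_cnj using c(1) D by (simp add: abs_of_pos)
          also have "\<dots> \<le> c * (1 - (norm z)\<^sup>2) * K" using c(1) D K[OF z] by (intro mult_left_mono) auto
          finally have "norm (H z w) \<le> norm (a w) * norm (1 - cinner_vec z w) powr (- ?N) * (c * (1 - (norm z)\<^sup>2) * K)"
            unfolding H_def norm_mult norm_bkern[OF norm_cinner_vec_less[OF z w]] by (intro mult_left_mono) auto
          also have "\<dots> = (norm (a w) * (c * K)) * ((1 - (norm z)\<^sup>2) * norm (1 - cinner_vec z w) powr (- ?N))"
            by (simp only: mult_ac)
          finally have "ennreal (norm (H z w)) \<le> ennreal ((norm (a w) * (c * K)) * ((1 - (norm z)\<^sup>2) * norm (1 - cinner_vec z w) powr (- ?N)))"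
            by (rule ennreal_leI)
          also have "\<dots> = ennreal (norm (a w) * (c * K)) * ennreal ((1 - (norm z)\<^sup>2) * norm (1 - cinner_vec z w) powr (- ?N))"
            using c(1) K0 by (intro ennreal_mult') simp
          finally show "ennreal (norm (H z w)) \<le> ennreal (norm (a w) * (c * K)) * ennreal ((1 - (norm z)\<^sup>2) * norm (1 - cinner_vec z w) powr (- ?N))" .
        qed
        also have "\<dots> = ennreal (norm (a w) * (c * K)) * (\<integral>\<^sup>+z. ennreal ((1 - (norm z)\<^sup>2) * norm (1 - cinner_vec z w) powr (- ?N)) \<partial>?\<nu>)"
          by (rule nn_integral_cmult) measurable
        also have "\<dots> \<le> ennreal (norm (a w) * (c * K)) * ennreal Cf" by (rule mult_left_mono[OF Cf(2)[OF w]]) simp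
        also have "\<dots> = ennreal (norm (a w)) * ennreal (c * K * Cf)"
          using c(1) K0 Cf(1) by (simp add: ennreal_mult'[symmetric] mult.assoc)
        finally show "(\<integral>\<^sup>+z. ennreal (norm (H z w)) \<partial>?\<nu>) \<le> ennreal (norm (a w)) * ennreal (c * K * Cf)" .
      qed
      also have "\<dots> = (\<integral>\<^sup>+w. ennreal (norm (a w)) \<partial>?\<nu>) * ennreal (c * K * Cf)" by (rule nn_integral_multc) measurable
      also have "\<dots> < \<infinity>" using a by (simp add: integrable_iff_bounded ennreal_mult_less_top)
      finally show "(\<integral>\<^sup>+x. ennreal (norm (case x of (z, w) \<Rightarrow> H z w)) \<partial>(?\<nu> \<Otimes>\<^sub>M ?\<nu>)) < \<infinity>" .
    qed
    have row: "(\<integral>w. H z w \<partial>?\<nu>) = small_hankel \<alpha> b f z * \<psi> z" for z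
      unfolding small_hankel_eq H_def a_def by (rule integral_mult_left_zero)
    have col: "(\<integral>z. H z w \<partial>?\<nu>) = a w * cnj (kern_int (\<alpha> + 1) (bkern ?N) F w)" if "w \<in> space ?\<nu>" for w
    proof -
      have w: "norm w < 1" using that by simp
      have km: "(\<lambda>z. bkern ?N (cinner_vec w z)) \<in> borel_measurable ?\<nu>"
        by (rule continuous_on_measurable_bergman[OF continuous_on_kernel[OF holomorphic_on_imp_continuous_on[OF bkern_holomorphic] w]])
      have "kern_int (\<alpha> + 1) (bkern ?N) F w = (\<integral>z. (c * (1 - (norm z)\<^sup>2) powr (\<alpha> + 1 - \<alpha>)) *\<^sub>R (F z * bkern ?N (cinner_vec w z)) \<partial>?\<nu>)"
        unfolding kern_int_def c(2) using c(1) km by (subst integral_density) auto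
      then have "cnj (kern_int (\<alpha> + 1) (bkern ?N) F w) = (\<integral>z. cnj ((c * (1 - (norm z)\<^sup>2) powr (\<alpha> + 1 - \<alpha>)) *\<^sub>R (F z * bkern ?N (cinner_vec w z))) \<partial>?\<nu>)"
        by (simp only: Bochner_Integration.integral_cnj)
      also have "\<dots> = (\<integral>z. bkern ?N (cinner_vec z w) * \<psi> z \<partial>?\<nu>)"
      proof (rule Bochner_Integration.integral_cong[OF refl])
        fix z assume "z \<in> space ?\<nu>"
        then have z: "norm z < 1" by simp
        have "bkern ?N (cinner_vec z w) = cnj (bkern ?N (cinner_vec w z))"
          unfolding cinner_vec_commute[of z w] by (rule bkern_cnj[OF norm_cinner_vec_less[OF w z]])
        then show "cnj ((c * (1 - (norm z)\<^sup>2) powr (\<alpha> + 1 - \<alpha>)) *\<^sub>R (F z * bkern ?N (cinner_vec w z))) = bkern ?N (cinner_vec z w) * \<psi> z"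
          using one_minus_norm_square_pos[OF z] by (simp add: \<psi>_def scaleR_conv_of_real mult_ac)
      qed
      finally show ?thesis unfolding H_def by (simp add: mult.assoc)
    qed
    have "(\<integral>w. b w * cnj (f w) * cnj (kern_int (\<alpha> + 1) (bkern ?N) F w) \<partial>?\<nu>) = (\<integral>w. (\<integral>z. H z w \<partial>?\<nu>) \<partial>?\<nu>)"
      by (rule Bochner_Integration.integral_cong[OF refl]) (simp only: col a_def)
    also have "\<dots> = (\<integral>z. (\<integral>w. H z w \<partial>?\<nu>) \<partial>?\<nu>)" by (rule \<nu>\<nu>.Fubini_integral[OF Hint])
    also have "\<dots> = (\<integral>z. small_hankel \<alpha> b f z * \<psi> z \<partial>?\<nu>)" unfolding row ..
    finally have eq: "(\<integral>w. b w * cnj (f w) * cnj (kern_int (\<alpha> + 1) (bkern ?N) F w) \<partial>?\<nu>) = (\<integral>z. small_hankel \<alpha> b f z * \<psi> z \<partial>?\<nu>)" .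
    have "integrable ?\<nu> (\<lambda>z. \<integral>w. H z w \<partial>?\<nu>)" using \<nu>\<nu>.integrable_fst[OF Hint] by simp
    then have int: "integrable ?\<nu> (\<lambda>z. small_hankel \<alpha> b f z * \<psi> z)" unfolding row .
    have "ennreal (norm (\<integral>z. small_hankel \<alpha> b f z * \<psi> z \<partial>?\<nu>)) \<le> (\<integral>\<^sup>+z. ennreal (norm (small_hankel \<alpha> b f z * \<psi> z)) \<partial>?\<nu>)"
      by (rule integral_norm_bound_ennreal[OF int])
    also have "\<dots> \<le> (\<integral>\<^sup>+z. ennreal (c * B) * ennreal (norm (small_hankel \<alpha> b f z)) \<partial>?\<nu>)"
    proof (rule nn_integral_mono)
      fix z assume "z \<in> space ?\<nu>"
      then have z: "norm z < 1" by simp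
      have D: "1 - (norm z)\<^sup>2 > 0" by (rule one_minus_norm_square_pos[OF z])
      have "norm (\<psi> z) = c * ((1 - (norm z)\<^sup>2) * norm (F z))"
        unfolding \<psi>_def norm_mult norm_of_real complex_mod_cnj using c(1) D by (simp add: abs_of_pos)
      also have "\<dots> \<le> c * B" using c(1) B[OF z] by (intro mult_left_mono) auto
      finally have "norm (small_hankel \<alpha> b f z * \<psi> z) \<le> (c * B) * norm (small_hankel \<alpha> b f z)" 
        unfolding norm_mult mult.commute[of "norm (small_hankel \<alpha> b f z)"] by (rule mult_right_mono) simp
      moreover have "0 \<le> B" using B[OF z] D by (meson mult_nonneg_nonneg less_imp_le norm_ge_zero order.trans)
      ultimately show "ennreal (norm (small_hankel \<alpha> b f z * \<psi> z)) \<le> ennreal (c * B) * ennreal (norm (small_hankel \<alpha> b f z))"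
        using c(1) by (simp only: ennreal_mult'[symmetric] mult_nonneg_nonneg less_imp_le ennreal_leI)
    qed
    also have "\<dots> = ennreal (c * B) * L1_norm \<alpha> (small_hankel \<alpha> b f)"
      unfolding L1_norm_def using measurable_small_hankel[OF b f] by (intro nn_integral_cmult) simp
    finally show "ennreal (norm (\<integral>w. b w * cnj (f w) * cnj (kern_int (\<alpha> + 1) (bkern ?N) F w) \<partial>?\<nu>)) \<le> ennreal (c * B) * L1_norm \<alpha> (small_hankel \<alpha> b f)"
      unfolding eq .
  qed
qed

text \<open>Integrating with weight \<alpha> + 1 against the kernel of weight \<alpha> is a
  multiplier on Taylor coefficients: (N)_m / (N + 1)_m = N / (N + m).\<close>

lemma kern_int_shifted:
  fixes a z :: "complex^'n"
  assumes \<alpha>: "\<alpha> > -1" and a: "norm a < 1" and z: "norm z < 1"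
    and F: "\<And>x. norm x < 1 \<Longrightarrow> (\<lambda>m. \<gamma> m * x ^ m) sums F x"
    and H: "\<And>x. norm x < 1 \<Longrightarrow> (\<lambda>m. \<gamma> m * of_real ((real CARD('n) + 1 + \<alpha>) / (real CARD('n) + 1 + \<alpha> + m)) * x ^ m) sums H x"
  shows "kern_int (\<alpha> + 1) (bkern (real CARD('n) + 1 + \<alpha>)) (\<lambda>w. F (cinner_vec w a)) z = H (cinner_vec z a)"
proof -
  let ?N = "real CARD('n) + 1 + \<alpha>"
  have N: "?N > 0" using \<alpha> by simp
  have \<alpha>1: "\<alpha> + 1 > -1" using \<alpha> by simp
  interpret finite_measure "bergman_measure (\<alpha> + 1) :: (complex^'n) measure" by (rule finite_measure_bergman[OF \<alpha>1])
  note FH = power_series_continuous_on[OF F]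
  have Fv: "holomorphic_vec (\<lambda>w. F (cinner_vec w a)) (ball 0 1)" by (rule holomorphic_vec_kernel[OF FH(2) a])
  have "continuous_on (ball 0 1) (\<lambda>x. F (cnj x))"
    by (rule continuous_on_compose2[OF FH(1)]) (auto intro!: continuous_intros)
  from kernel_bounded[OF this a] obtain K where K: "\<And>w. norm w < 1 \<Longrightarrow> norm (F (cnj (cinner_vec a w))) \<le> K" by blast
  have int: "integrable (bergman_measure (\<alpha> + 1)) (\<lambda>w. F (cinner_vec w a))"
    by (rule integrable_const_bound[where B=K])
      (use K measurable_holomorphic_vec[OF Fv] in \<open>auto simp: cinner_vec_commute[of _ a]\<close>)
  obtain e where e: "norm e = 1" and ze: "z = of_real (norm z) *s e" by (rule polar_vec)
  have ea: "norm (cinner_vec e a) < 1" using norm_cinner_vec_le[of e a] e a by simp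
  have "(\<lambda>m. (\<gamma> m * cinner_vec e a ^ m) * of_real (norm z) ^ m * of_real (pochhammer ?N m / fact m) * of_real (fact m / pochhammer (real CARD('n) + 1 + (\<alpha> + 1)) m)) sums
    (\<integral>w. F (cinner_vec w a) * bkern ?N (cinner_vec (of_real (norm z) *s e) w) \<partial>bergman_measure (\<alpha> + 1))"
  proof (rule integral_kernel_sums[OF \<alpha>1 Fv int e _ z _ bkern_sums])
    fix \<mu> :: complex assume \<mu>: "norm \<mu> < 1"
    have "norm (\<mu> * cinner_vec e a) < 1"
      using \<mu> ea mult_left_le[of "norm (cinner_vec e a)" "norm \<mu>"] by (simp add: norm_mult)
    from F[OF this] show "(\<lambda>m. (\<gamma> m * cinner_vec e a ^ m) * \<mu> ^ m) sums F (cinner_vec (\<mu> *s e) a)"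
      by (simp add: cinner_vec_scale_left power_mult_distrib mult_ac)
  qed simp_all
  moreover have "(\<gamma> m * cinner_vec e a ^ m) * of_real (norm z) ^ m * of_real (pochhammer ?N m / fact m) * of_real (fact m / pochhammer (real CARD('n) + 1 + (\<alpha> + 1)) m)
    = \<gamma> m * of_real (?N / (?N + m)) * cinner_vec z a ^ m" for m
  proof -
    have p: "pochhammer (?N + 1) m > 0" using N by (intro pochhammer_pos) auto
    have "?N * pochhammer (?N + 1) m = (?N + m) * pochhammer ?N m"
      using pochhammer_rec[of ?N m] pochhammer_rec'[of ?N m] by simp
    then have "pochhammer ?N m / fact m * (fact m / pochhammer (?N + 1) m) = ?N / (?N + m)"
      using N p by (simp add: field_simps)
    moreover have "real CARD('n) + 1 + (\<alpha> + 1) = ?N + 1" by simp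
    ultimately have 1: "complex_of_real (pochhammer ?N m / fact m) * of_real (fact m / pochhammer (real CARD('n) + 1 + (\<alpha> + 1)) m) = of_real (?N / (?N + m))"
      by (simp only: of_real_mult[symmetric])
    have "cinner_vec z a = of_real (norm z) * cinner_vec e a" by (subst ze) (rule cinner_vec_scale_left)
    then have 2: "cinner_vec z a ^ m = of_real (norm z) ^ m * cinner_vec e a ^ m" by (simp only: power_mult_distrib)
    have "(\<gamma> m * cinner_vec e a ^ m) * of_real (norm z) ^ m * of_real (pochhammer ?N m / fact m) * of_real (fact m / pochhammer (real CARD('n) + 1 + (\<alpha> + 1)) m)
      = (\<gamma> m * cinner_vec e a ^ m) * of_real (norm z) ^ m * (of_real (pochhammer ?N m / fact m) * of_real (fact m / pochhammer (real CARD('n) + 1 + (\<alpha> + 1)) m))"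
      by (simp only: mult.assoc)
    then show ?thesis unfolding 1 2 by (simp only: mult_ac)
  qed
  moreover have "(\<lambda>m. \<gamma> m * of_real (?N / (?N + m)) * cinner_vec z a ^ m) sums H (cinner_vec z a)"
    by (rule H[OF norm_cinner_vec_less[OF z a]])
  ultimately show ?thesis unfolding kern_int_def ze[symmetric] by (simp add: sums_unique2)
qed

text \<open>With q = (1 - |a|^2) / |1 - <w,a>|, lower type bounds \<Phi> (peak * q^M) by a multiple
  of q^(p M) (1 - |a|^2)^(-N). By Forelli-Rudin with d = p M - N > 0 this integrates to a bound
  independent of a, and lower type once more turns division by l into the factor l^(-p).\<close>

lemma test_function_bound:
  fixes K M :: real
  assumes \<alpha>: "\<alpha> > -1" and p: "0 < p" and G: "\<Phi> \<in> growth_class p" and M: "p * M > real CARD('n) + 1 + \<alpha>" and K: "K > 0"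
  obtains l where "l > 0" "\<And>(a :: complex^'n) f. norm a < 1 \<Longrightarrow> f \<in> borel_measurable (bergman_measure \<alpha>) \<Longrightarrow>
    (\<And>w. norm w < 1 \<Longrightarrow> norm (f w :: complex) \<le> K * peak \<Phi> \<alpha> a * ((1 - (norm a)\<^sup>2) / norm (1 - cinner_vec w a)) powr M) \<Longrightarrow>
    (\<integral>\<^sup>+w. ennreal (\<Phi> (norm (f w) / l)) \<partial>bergman_measure \<alpha>) \<le> 1"
proof -
  let ?\<nu> = "bergman_measure \<alpha> :: (complex^'n) measure"
  let ?N = "real CARD('n) + 1 + \<alpha>"
  have N: "?N > 0" using \<alpha> by simp
  define d where "d = p * M - ?N"
  have d: "d > 0" using M by (simp add: d_def)
  have M0: "M > 0" using M N p by (metis order.strict_trans zero_less_mult_pos)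
  obtain C where C: "C > 0" "\<And>s t. 0 < s \<Longrightarrow> 0 < t \<Longrightarrow> t \<le> 1 \<Longrightarrow> \<Phi> (s * t) \<le> C * t powr p * \<Phi> s"
    using growth_lower_type[OF G] by blast
  obtain Cf where Cf: "Cf > 0" "\<And>a :: complex^'n. norm a < 1 \<Longrightarrow>
    (\<integral>\<^sup>+w. ennreal (norm (1 - cinner_vec w a) powr (- (?N + d))) \<partial>?\<nu>) \<le> ennreal (Cf * (1 - (norm a)\<^sup>2) powr (- d))"
    using forelli_rudin_power[OF \<alpha> d] by blast
  define K1 where "K1 = max 1 (K * 2 powr M)"
  have K1: "K1 \<ge> 1" by (simp add: K1_def)
  define K2 where "K2 = C * (K1 * C) * Cf"
  have K2: "K2 > 0" using C K1 Cf by (simp add: K2_def)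
  \<comment> \<open>K2 is the bound of the integral before normalisation; this l gives K2 * l^(-p)
    <= 1.\<close>
  define l where "l = max 1 (K2 powr (1 / p))"
  have l: "l \<ge> 1" by (simp add: l_def)
  have lp: "K2 * l powr (- p) \<le> 1"
  proof -
    have "K2 = (K2 powr (1 / p)) powr p" using K2 p by (simp add: powr_powr)
    also have "\<dots> \<le> l powr p" using p by (intro powr_mono2) (auto simp: l_def)
    finally show ?thesis using l by (simp add: powr_minus field_simps)
  qed
  show ?thesis
  proof (rule that[of l])
    show "l > 0" using l by simp
    fix a :: "complex^'n" and f :: "complex^'n \<Rightarrow> complex"
    assume a: "norm a < 1" and fm: "f \<in> borel_measurable ?\<nu>"
      and bd: "\<And>w. norm w < 1 \<Longrightarrow> norm (f w) \<le> K * peak \<Phi> \<alpha> a * ((1 - (norm a)\<^sup>2) / norm (1 - cinner_vec w a)) powr M"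
    define D where "D = 1 - (norm a)\<^sup>2"
    have D: "D > 0" using one_minus_norm_square_pos[OF a] by (simp add: D_def)
    let ?S = "peak \<Phi> \<alpha> a"
    have S: "?S > 0" by (rule peak_pos[OF G a])
    have \<Phi>S: "\<Phi> ?S = D powr (- ?N)" using growth_peak[OF G a] by (simp only: D_def)
    have point: "\<Phi> (norm (f w) / l) \<le> (C * (K1 * C) * l powr (- p)) * D powr d * norm (1 - cinner_vec w a) powr (- (?N + d))"
      if w: "norm w < 1" for w
    proof (cases "f w = 0")
      case False
      let ?y = "norm (1 - cinner_vec w a)"
      have y: "D / 2 \<le> ?y" using one_minus_norm_le(2)[OF w a] by (simp add: D_def)
      have y0: "?y > 0" using y D by linarith
      \<comment> \<open>D / ?y is bounded by 2 only, while lower type asks for a factor at most 1;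
        the missing 2^M has been put into K1.\<close>
      define r where "r = (D / ?y / 2) powr M"
      have Dy: "D / ?y / 2 \<le> 1" "D / ?y / 2 > 0" using y y0 D by (auto simp: field_simps)
      have r: "0 < r" "r \<le> 1" using Dy M0 unfolding r_def by (auto intro: powr_le1)
      have "(D / ?y) powr M = (2 * (D / ?y / 2)) powr M" by simp
      also have "\<dots> = 2 powr M * r" unfolding r_def by (rule powr_mult; use Dy in simp)
      finally have "norm (f w) \<le> (K * 2 powr M) * (?S * r)"
        using bd[OF w] unfolding D_def[symmetric] by (simp add: mult_ac)
      also have "\<dots> \<le> K1 * (?S * r)" using S r by (intro mult_right_mono) (auto simp: K1_def)
      finally have fK: "norm (f w) \<le> K1 * (?S * r)" .
      have "norm (f w) / l = norm (f w) * (1 / l)" by simp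
      also have "\<Phi> \<dots> \<le> C * (1 / l) powr p * \<Phi> (norm (f w))" using False l by (intro C) auto
      also have "(1 / l) powr p = l powr (- p)" using l powr_divide[of 1 l p] by (simp add: powr_minus_divide)
      also have "\<Phi> (norm (f w)) \<le> \<Phi> (K1 * (?S * r))" using fK by (intro growth_mono[OF G]) auto
      also have "\<dots> \<le> K1 * \<Phi> (?S * r)" using K1 S r by (intro growth_scale[OF G]) auto
      also have "\<Phi> (?S * r) \<le> C * r powr p * D powr (- ?N)" using C(2)[OF S r] unfolding \<Phi>S .
      also have "r powr p \<le> (D / ?y) powr (?N + d)"
      proof -
        have "r powr p = (D / ?y / 2) powr (p * M)" unfolding r_def by (simp add: powr_powr mult.commute)
        also have "\<dots> \<le> (D / ?y) powr (p * M)" using Dy p M0 by (intro powr_mono2) auto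
        finally show ?thesis by (simp add: d_def)
      qed
      also have "(D / ?y) powr (?N + d) = D powr (?N + d) * ?y powr (- (?N + d))"
      proof -
        have "(D / ?y) powr s = D powr s * ?y powr (- s)" for s
          using powr_divide[of D ?y s] D y0 by (simp add: powr_minus divide_inverse)
        then show ?thesis .
      qed
      finally have "\<Phi> (norm (f w) / l) \<le> C * l powr (- p) * (K1 * (C * (D powr (?N + d) * ?y powr (- (?N + d))) * D powr (- ?N)))"
        using C(1) K1 D by (auto simp: mult_left_mono mult_right_mono)
      also have "\<dots> = (C * (K1 * C) * l powr (- p)) * (D powr (?N + d) * D powr (- ?N)) * ?y powr (- (?N + d))"
        by (simp only: mult_ac)
      also have "D powr (?N + d) * D powr (- ?N) = D powr d" unfolding powr_add[symmetric] by simp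
      finally show ?thesis .
    next
      case True
      then show ?thesis using C(1) K1 by (simp add: growth_zero[OF G])
    qed
    let ?A = "C * (K1 * C) * l powr (- p) * D powr d"
    have A: "?A \<ge> 0" using C(1) K1 by simp
    have "(\<integral>\<^sup>+w. ennreal (\<Phi> (norm (f w) / l)) \<partial>?\<nu>) \<le> (\<integral>\<^sup>+w. ennreal ?A * ennreal (norm (1 - cinner_vec w a) powr (- (?N + d))) \<partial>?\<nu>)"
      using point by (intro nn_integral_mono) (simp only: ennreal_mult'[OF A, symmetric] ennreal_leI space_bergman mem_ball dist_0_norm)
    also have "\<dots> = ennreal ?A * (\<integral>\<^sup>+w. ennreal (norm (1 - cinner_vec w a) powr (- (?N + d))) \<partial>?\<nu>)"
      by (rule nn_integral_cmult) measurable
    also have "\<dots> \<le> ennreal ?A * ennreal (Cf * D powr (- d))"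
      using Cf(2)[OF a] unfolding D_def[symmetric] by (intro mult_left_mono) auto
    also have "\<dots> = ennreal (?A * (Cf * D powr (- d)))" by (rule ennreal_mult'[OF A, symmetric])
    also have "?A * (Cf * D powr (- d)) = K2 * l powr (- p) * (D powr d * D powr (- d))"
      by (simp only: K2_def mult_ac)
    also have "D powr d * D powr (- d) = 1" using D unfolding powr_add[symmetric] by simp
    also have "ennreal (K2 * l powr (- p) * 1) \<le> 1" using lp by simp
    finally show "(\<integral>\<^sup>+w. ennreal (\<Phi> (norm (f w) / l)) \<partial>?\<nu>) \<le> 1" .
  qed
qed

section \<open>The logarithmic kernel and elementary bounds for logarithms\<close>

lemma bounded_kernel_image:
  fixes a :: "complex^'n"
  assumes \<kappa>: "\<kappa> holomorphic_on ball 0 1" and a: "norm a < 1"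
  shows "bounded ((\<lambda>w. \<kappa> (cinner_vec w a)) ` ball 0 1)"
proof -
  have "continuous_on (ball 0 1) (\<lambda>x. \<kappa> (cnj x))"
    by (rule continuous_on_compose2[OF holomorphic_on_imp_continuous_on[OF \<kappa>]]) (auto intro!: continuous_intros)
  from kernel_bounded[OF this a] obtain K where K: "\<And>w. norm w < 1 \<Longrightarrow> norm (\<kappa> (cnj (cinner_vec a w))) \<le> K" by blast
  have "norm (\<kappa> (cinner_vec w a)) \<le> K" if "w \<in> ball 0 1" for w
    using K[of w] that unfolding cinner_vec_commute[of w a] by simp
  then show ?thesis by (intro boundedI[of _ K]) auto
qed

lemma norm_Ln_le_ln:
  assumes "z \<noteq> 0"
  shows "norm (Ln z) \<le> \<bar>ln (norm z)\<bar> + pi"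
proof -
  have "\<bar>Im (Ln z)\<bar> \<le> pi" using mpi_less_Im_Ln[OF assms] Im_Ln_le_pi[OF assms] by simp
  then show ?thesis using cmod_le[of "Ln z"] assms by simp
qed

text \<open>Its coefficients 1/m + 1/N = (N + m) / (m N) undo the multiplier N / (N + m) of
  \<open>kern_int_shifted\<close>, so that its image is - Ln (1 - x), with coefficients 1/m.\<close>

definition log_kern :: "real \<Rightarrow> complex \<Rightarrow> complex" where
  "log_kern N x = - Ln (1 - x) + of_real (1 / N) * (x / (1 - x))"

lemma minus_Ln_sums:
  assumes "norm x < 1"
  shows "(\<lambda>m. (if m = 0 then 0 else of_real (1 / real m)) * x ^ m) sums (- Ln (1 - x))"
proof -
  have "(\<lambda>m. - ((- (- x)) ^ m) / of_nat m) sums Ln (1 + (- x))"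
    by (rule Ln_series') (use assms in simp)
  from sums_minus[OF this] have "(\<lambda>m. - (- ((- (- x)) ^ m) / of_nat m)) sums (- Ln (1 - x))" by simp
  moreover have "- (- ((- (- x)) ^ m) / of_nat m) = (if m = 0 then 0 else of_real (1 / real m)) * x ^ m" for m
    by simp
  ultimately show ?thesis by simp
qed

lemma log_kern_sums:
  assumes "norm x < 1"
  shows "(\<lambda>m. (if m = 0 then 0 else of_real (1 / real m + 1 / N)) * x ^ m) sums log_kern N x"
proof -
  have "(\<lambda>m. x ^ m - (if m = 0 then 1 else 0)) sums (1 / (1 - x) - 1)"
    using sums_diff[OF geometric_sums[OF assms] sums_single[of 0 "\<lambda>_. 1"]] by (simp add: eq_commute cong: if_cong)
  moreover have "1 / (1 - x) - 1 = x / (1 - x)" using one_minus_nonzero[OF assms] by (simp add: field_simps)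
  ultimately have "(\<lambda>m. of_real (1 / N) * (x ^ m - (if m = 0 then 1 else 0))) sums (of_real (1 / N) * (x / (1 - x)))"
    by (intro sums_mult) simp
  from sums_add[OF minus_Ln_sums[OF assms] this]
  have "(\<lambda>m. (if m = 0 then 0 else of_real (1 / real m)) * x ^ m + of_real (1 / N) * (x ^ m - (if m = 0 then 1 else 0))) sums log_kern N x"
    by (simp only: log_kern_def)
  moreover have "(if m = 0 then 0 else of_real (1 / real m)) * x ^ m + of_real (1 / N) * (x ^ m - (if m = 0 then 1 else 0))
    = (if m = 0 then 0 else of_real (1 / real m + 1 / N)) * x ^ m" for m
    by (simp add: distrib_right)
  ultimately show ?thesis by simp
qed

lemma abs_ln_mult_le:
  assumes "0 < y" "y \<le> (2::real)"
  shows "y * \<bar>ln y\<bar> \<le> 2"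
proof (cases "y \<le> 1")
  case True
  have "ln (1 / y) \<le> 1 / y - 1" using assms by (intro ln_le_minus_one) simp
  then have "- ln y \<le> 1 / y - 1" using assms by (simp add: ln_div)
  then have "y * (- ln y) \<le> y * (1 / y - 1)" using assms by (intro mult_left_mono) auto
  also have "\<dots> \<le> 2" using assms by (simp add: right_diff_distrib)
  finally show ?thesis using True assms by simp
next
  case False
  have "ln y \<le> 1" using ln_le_minus_one[of y] assms by simp
  then have "y * ln y \<le> 2 * 1" using False assms by (intro mult_mono) auto
  then show ?thesis using False by simp
qed

text \<open>The factor |1 - x| compensates the simple pole at 1, and the logarithm is weaker still.
  As 1 - |w|^2 is at most 2 |1 - <w,a>|, the weighted function is bounded uniformly in a.\<close>

lemma log_kern_bound:
  assumes N: "N > 0" and x: "norm x < 1"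
  shows "norm (1 - x) * norm (log_kern N x) \<le> 2 + 2 * pi + 1 / N"
proof -
  let ?y = "norm (1 - x)"
  have x1: "1 - x \<noteq> 0" by (rule one_minus_nonzero[OF x])
  have y: "0 < ?y" "?y \<le> 2" using x1 norm_one_minus_le2[OF x] by auto
  have "norm (log_kern N x) \<le> norm (Ln (1 - x)) + norm (of_real (1 / N) * (x / (1 - x)))"
    unfolding log_kern_def by (metis norm_minus_cancel norm_triangle_ineq)
  also have "norm (of_real (1 / N) * (x / (1 - x))) = 1 / N * (norm x / ?y)"
    using N by (simp add: norm_mult norm_divide)
  also have "norm (Ln (1 - x)) \<le> \<bar>ln ?y\<bar> + pi" by (rule norm_Ln_le_ln[OF x1])
  finally have "?y * norm (log_kern N x) \<le> ?y * (\<bar>ln ?y\<bar> + pi + 1 / N * (norm x / ?y))"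
    using y by (intro mult_left_mono) auto
  also have "\<dots> = ?y * \<bar>ln ?y\<bar> + ?y * pi + 1 / N * norm x" using y by (simp add: distrib_left)
  also have "\<dots> \<le> 2 + 2 * pi + 1 / N * 1"
    using y x N abs_ln_mult_le[OF y] by (intro add_mono mult_left_mono mult_right_mono) auto
  finally show ?thesis by simp
qed

text \<open>A logarithm costs an arbitrarily small power: q^\<epsilon> |ln q| stays bounded as q
  tends to 0. The pi allows for the argument of a complex logarithm.\<close>

lemma powr_abs_ln_le:
  assumes \<epsilon>: "\<epsilon> > 0" and q: "0 < q" "q \<le> 2"
  shows "q powr \<epsilon> * (\<bar>ln q\<bar> + (pi + 1)) \<le> 1 / \<epsilon> + 2 powr \<epsilon> * (pi + 2)"
proof -
  have q2: "q powr \<epsilon> \<le> 2 powr \<epsilon>" using q \<epsilon> by (intro powr_mono2) auto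
  have ln: "q powr \<epsilon> * \<bar>ln q\<bar> \<le> 1 / \<epsilon> + 2 powr \<epsilon>"
  proof (cases "q \<le> 1")
    case True
    have "ln (q powr (- \<epsilon>)) \<le> q powr (- \<epsilon>) - 1" using q by (intro ln_le_minus_one) simp
    then have "\<epsilon> * (- ln q) \<le> q powr (- \<epsilon>)" using q by (simp add: ln_powr)
    then have "- ln q \<le> q powr (- \<epsilon>) / \<epsilon>" using \<epsilon> by (simp add: field_simps)
    then have "q powr \<epsilon> * (- ln q) \<le> q powr \<epsilon> * (q powr (- \<epsilon>) / \<epsilon>)" by (intro mult_left_mono) auto
    also have "\<dots> = (q powr \<epsilon> * q powr (- \<epsilon>)) / \<epsilon>" by simp
    also have "q powr \<epsilon> * q powr (- \<epsilon>) = 1" using q unfolding powr_add[symmetric] by simp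
    finally have "q powr \<epsilon> * \<bar>ln q\<bar> \<le> 1 / \<epsilon>" using True q by simp
    then show ?thesis by (simp add: add_increasing2)
  next
    case False
    have "ln q \<le> 1" using ln_le_minus_one[of q] q by simp
    then have "q powr \<epsilon> * ln q \<le> 2 powr \<epsilon> * 1" using False q2 by (intro mult_mono) auto
    moreover have "1 / \<epsilon> > 0" using \<epsilon> by simp
    moreover have "\<bar>ln q\<bar> = ln q" using False by simp
    ultimately show ?thesis by linarith
  qed
  have "q powr \<epsilon> * (pi + 1) \<le> 2 powr \<epsilon> * (pi + 1)" using q2 by (intro mult_right_mono) auto
  with ln show ?thesis by (simp add: distrib_left)
qed

lemma lux_norm_le:
  assumes "l > 0" "(\<integral>\<^sup>+z. ennreal (\<Phi> (norm (f z) / l)) \<partial>bergman_measure \<alpha>) \<le> 1"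
  shows "0 \<le> lux_norm \<alpha> \<Phi> f" "lux_norm \<alpha> \<Phi> f \<le> l"
proof -
  let ?S = "{l. 0 < l \<and> (\<integral>\<^sup>+z. ennreal (\<Phi> (norm (f z) / l)) \<partial>bergman_measure \<alpha>) \<le> 1}"
  have l: "l \<in> ?S" using assms by simp
  show "0 \<le> lux_norm \<alpha> \<Phi> f" unfolding lux_norm_def using l by (intro cInf_greatest) auto
  have "bdd_below ?S" by (rule bdd_belowI[of _ 0]) auto
  then show "lux_norm \<alpha> \<Phi> f \<le> l" unfolding lux_norm_def using l by (intro cInf_lower)
qed

(* Testing on f_a = peak a * (1 - |a|^2)^(N+k) * R^k K_a, whose pairing with b is a multiple of R^k b a.
   The pairing with f_a * log (1 / (1 - <w,a>)) gains the factor log (1 / (1 - |a|^2)), because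
   f_a * log ((1 - |a|^2) / (1 - <w,a>)) is again an admissible test function. *)
theorem bounded_imp_LGamma:
  fixes b :: "complex^'n \<Rightarrow> complex"
  assumes \<alpha>: "\<alpha> > -1" and p: "0 < p" "p \<le> 1" and G: "\<Phi> \<in> growth_class p"
    and b: "b \<in> bergman_space \<alpha> 2" and H: "hankel_extends_bounded \<alpha> \<Phi> b"
  shows "b \<in> LGamma \<alpha> (1 / p - 1) (growth_rho \<Phi>)"
proof -
  let ?\<nu> = "bergman_measure \<alpha> :: (complex^'n) measure"
  let ?N = "real CARD('n) + 1 + \<alpha>"
  note b' = bergman_space_2D[OF \<alpha> b]
  have N: "?N > 0" using \<alpha> by simp
  obtain k :: nat where k: "real k > (1 / p - 1) * ?N" using reals_Archimedean2 by blast
  define M where "M = ?N + real k"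
  define X where "X = ?N / p"
  \<comment> \<open>The choice of k means M > N / p = X. The midpoint still satisfies p * M' > N, as
    \<open>test_function_bound\<close> demands, and \<epsilon> = M - M' is the power spent on the
    logarithm.\<close>
  define M' where "M' = (M + X) / 2"
  define \<epsilon> where "\<epsilon> = M - M'"
  have "(1 / p - 1) * ?N = ?N / p - ?N" by (simp add: left_diff_distrib)
  then have MN: "M > X" using k by (simp add: M_def X_def)
  then have \<epsilon>: "\<epsilon> > 0" by (simp add: \<epsilon>_def M'_def field_simps)
  have "M' > X" using MN by (simp add: M'_def field_simps)
  then have "p * M' > p * X" using p by simp
  then have pM': "p * M' > ?N" using p by (simp add: X_def)
  obtain Ck where Ck: "Ck > 0" "\<And>x. norm x < 1 \<Longrightarrow> norm (rkern ?N k x) \<le> Ck * norm (1 - x) powr (- M)"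
    using rkern_sums_bound(2)[OF N, of k] unfolding M_def by blast
  define K where "K = Ck * (1 / \<epsilon> + 2 powr \<epsilon> * (pi + 2))"
  have K: "K > 0" using Ck \<epsilon> by (simp add: K_def add_pos_pos add_nonneg_pos)
  obtain l where l: "l > 0" "\<And>(a :: complex^'n) f. norm a < 1 \<Longrightarrow> f \<in> borel_measurable ?\<nu> \<Longrightarrow>
    (\<And>w. norm w < 1 \<Longrightarrow> norm (f w :: complex) \<le> K * peak \<Phi> \<alpha> a * ((1 - (norm a)\<^sup>2) / norm (1 - cinner_vec w a)) powr M') \<Longrightarrow>
    (\<integral>\<^sup>+w. ennreal (\<Phi> (norm (f w) / l)) \<partial>?\<nu>) \<le> 1"
    using test_function_bound[OF \<alpha> p(1) G pM' K] by blast
  obtain C0 where C0: "\<And>f. holomorphic_vec f (ball 0 1) \<Longrightarrow> bounded (f ` ball 0 1) \<Longrightarrow>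
      L1_norm \<alpha> (small_hankel \<alpha> b f) \<le> ennreal (C0 * lux_norm \<alpha> \<Phi> f)"
    using H unfolding hankel_extends_bounded_def by blast
  obtain c where c: "c > 0" "\<And>f F B. holomorphic_vec f (ball 0 1) \<Longrightarrow> bounded (f ` ball 0 1) \<Longrightarrow>
    holomorphic_vec F (ball 0 1) \<Longrightarrow> bounded (F ` ball 0 1) \<Longrightarrow>
    (\<And>w. norm w < 1 \<Longrightarrow> (1 - (norm w)\<^sup>2) * norm (F w) \<le> B) \<Longrightarrow>
    ennreal (norm (\<integral>w. b w * cnj (f w) * cnj (kern_int (\<alpha> + 1) (bkern ?N) F w) \<partial>?\<nu>))
      \<le> ennreal (c * B) * L1_norm \<alpha> (small_hankel \<alpha> b f)"
    using hankel_duality[OF \<alpha> b'(2)] by blast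
  define B where "B = 2 * (2 + 2 * pi + 1 / ?N)"
  have B: "B > 0" using N pi_gt_zero by (simp add: B_def add_pos_pos)
  \<comment> \<open>The bounds of the two pairings, with the logarithm (constant B) and with the
    constant function (constant 1); the final 1 ensures positivity.\<close>
  define A where "A = c * B * (\<bar>C0\<bar> * l) + c * (\<bar>C0\<bar> * l) + 1"
  have A: "A > 0" using c(1) B l(1) by (simp add: A_def add_nonneg_pos)
  have pair: "norm (\<integral>w. b w * cnj (f w) * cnj (kern_int (\<alpha> + 1) (bkern ?N) F w) \<partial>?\<nu>) \<le> c * E * (\<bar>C0\<bar> * l)"
    if "holomorphic_vec f (ball 0 1)" "bounded (f ` ball 0 1)" "holomorphic_vec F (ball 0 1)" "bounded (F ` ball 0 1)"
      and E: "\<And>w. norm w < 1 \<Longrightarrow> (1 - (norm w)\<^sup>2) * norm (F w) \<le> E" "E \<ge> 0"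
      and I: "(\<integral>\<^sup>+w. ennreal (\<Phi> (norm (f w) / l)) \<partial>?\<nu>) \<le> 1" for f F E
  proof -
    have "C0 * lux_norm \<alpha> \<Phi> f \<le> \<bar>C0\<bar> * lux_norm \<alpha> \<Phi> f"
      using lux_norm_le(1)[OF l(1) I] by (intro mult_right_mono) auto
    also have "\<dots> \<le> \<bar>C0\<bar> * l" using lux_norm_le(2)[OF l(1) I] by (intro mult_left_mono) auto
    finally have "L1_norm \<alpha> (small_hankel \<alpha> b f) \<le> ennreal (\<bar>C0\<bar> * l)"
      using C0[OF that(1,2)] by (meson ennreal_leI order.trans)
    then have "ennreal (c * E) * L1_norm \<alpha> (small_hankel \<alpha> b f) \<le> ennreal (c * E) * ennreal (\<bar>C0\<bar> * l)"
      by (rule mult_left_mono) simp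
    also have "\<dots> = ennreal (c * E * (\<bar>C0\<bar> * l))" using c(1) E(2) by (intro ennreal_mult'[symmetric]) simp
    finally have "ennreal (norm (\<integral>w. b w * cnj (f w) * cnj (kern_int (\<alpha> + 1) (bkern ?N) F w) \<partial>?\<nu>)) \<le> ennreal (c * E * (\<bar>C0\<bar> * l))"
      using c(2)[OF that(1-4) E(1)] by (rule order.trans[rotated])
    then show ?thesis using c(1) E(2) l(1) by (subst (asm) ennreal_le_iff) auto
  qed
  have main: "norm ((radial_deriv ^^ k) b a) * (peak \<Phi> \<alpha> a * (1 - (norm a)\<^sup>2) powr M * ln (1 / (1 - (norm a)\<^sup>2))) \<le> A"
    if a: "norm a < 1" for a :: "complex^'n"
  proof -
    define D where "D = 1 - (norm a)\<^sup>2"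
    define L where "L = ln (1 / D)"
    \<comment> \<open>With this factor the size |1 - <w,a>|^(-M) of R^k of the kernel becomes peak *
      q^M, where q = (1 - |a|^2) / |1 - <w,a>|.\<close>
    define \<sigma> where "\<sigma> = peak \<Phi> \<alpha> a * D powr M"
    have D: "0 < D" "D \<le> 1" using one_minus_norm_square_pos[OF a] by (auto simp: D_def)
    have L: "L \<ge> 0" "L = - ln D" using D by (auto simp: L_def ln_div)
    have \<sigma>: "\<sigma> > 0" using peak_pos[OF G a] D by (simp add: \<sigma>_def)
    define \<kappa>1 where "\<kappa>1 = (\<lambda>x. of_real \<sigma> * rkern ?N k x)"
    define \<kappa>2 where "\<kappa>2 = (\<lambda>x. \<kappa>1 x * (- Ln (1 - x) - of_real L))"
    have Lnhol: "(\<lambda>x. - Ln (1 - x)) holomorphic_on ball 0 1"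
      by (rule power_series_continuous_on(2)[OF minus_Ln_sums])
    have \<kappa>1: "\<kappa>1 holomorphic_on ball 0 1" unfolding \<kappa>1_def by (intro holomorphic_intros rkern_holomorphic N)
    have \<kappa>2: "\<kappa>2 holomorphic_on ball 0 1" unfolding \<kappa>2_def by (intro holomorphic_on_mult holomorphic_on_diff \<kappa>1 Lnhol holomorphic_on_const)
    define f1 where "f1 = (\<lambda>w. \<kappa>1 (cinner_vec w a))"
    define f2 where "f2 = (\<lambda>w. \<kappa>2 (cinner_vec w a))"
    have f1: "holomorphic_vec f1 (ball 0 1)" "bounded (f1 ` ball 0 1)"
      unfolding f1_def by (rule holomorphic_vec_kernel[OF \<kappa>1 a], rule bounded_kernel_image[OF \<kappa>1 a])
    have f2: "holomorphic_vec f2 (ball 0 1)" "bounded (f2 ` ball 0 1)"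
      unfolding f2_def by (rule holomorphic_vec_kernel[OF \<kappa>2 a], rule bounded_kernel_image[OF \<kappa>2 a])
    have bound: "norm (f1 w) \<le> K * peak \<Phi> \<alpha> a * (D / norm (1 - cinner_vec w a)) powr M' \<and>
        norm (f2 w) \<le> K * peak \<Phi> \<alpha> a * (D / norm (1 - cinner_vec w a)) powr M'" if w: "norm w < 1" for w
    proof -
      let ?x = "cinner_vec w a"
      define q where "q = D / norm (1 - ?x)"
      have x: "norm ?x < 1" by (rule norm_cinner_vec_less[OF w a])
      have x1: "1 - ?x \<noteq> 0" by (rule one_minus_nonzero[OF x])
      have y: "D / 2 \<le> norm (1 - ?x)" using one_minus_norm_le(2)[OF w a] by (simp add: D_def)
      have q: "0 < q" "q \<le> 2" using D x1 y by (auto simp: q_def field_simps)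
      have qM: "q powr M = D powr M * norm (1 - ?x) powr (- M)"
        unfolding q_def using powr_divide[of D "norm (1 - ?x)" M] D by (simp add: powr_minus divide_inverse)
      have "norm (f1 w) = \<sigma> * norm (rkern ?N k ?x)" using \<sigma> by (simp add: f1_def \<kappa>1_def norm_mult)
      also have "\<dots> \<le> \<sigma> * (Ck * norm (1 - ?x) powr (- M))" using \<sigma> Ck(2)[OF x] by (intro mult_left_mono) auto
      also have "\<dots> = Ck * peak \<Phi> \<alpha> a * q powr M" unfolding qM \<sigma>_def by (simp only: mult_ac)
      finally have n1: "norm (f1 w) \<le> Ck * peak \<Phi> \<alpha> a * q powr M" .
      have "norm (- Ln (1 - ?x) - of_real L) \<le> \<bar>ln q\<bar> + pi"
      proof -
        \<comment> \<open>Subtracting L = - ln D turns the real part of the logarithm into exactly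
          ln q; the imaginary part is an argument and at most pi in modulus.\<close>
        have "Re (- Ln (1 - ?x) - of_real L) = ln q"
          using x1 D L unfolding q_def by (simp add: ln_div)
        moreover have "\<bar>Im (- Ln (1 - ?x) - of_real L)\<bar> \<le> pi"
          using mpi_less_Im_Ln[OF x1] Im_Ln_le_pi[OF x1] by simp
        ultimately show ?thesis using cmod_le[of "- Ln (1 - ?x) - of_real L"] by linarith
      qed
      then have n2: "norm (f2 w) \<le> (Ck * peak \<Phi> \<alpha> a * q powr M) * (\<bar>ln q\<bar> + pi)"
        using n1 unfolding f2_def \<kappa>2_def f1_def norm_mult
        by (intro mult_mono) (auto intro: order.trans[OF norm_ge_zero])
      have pos: "Ck * peak \<Phi> \<alpha> a * q powr M \<ge> 0" using Ck(1) peak_pos[OF G a, of \<alpha>] by simp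
      \<comment> \<open>The 1 added to pi makes the bracket at least 1, so one inequality covers f1
        and f2 alike.\<close>
      have "(Ck * peak \<Phi> \<alpha> a * q powr M) * (\<bar>ln q\<bar> + (pi + 1)) = Ck * peak \<Phi> \<alpha> a * q powr M' * (q powr \<epsilon> * (\<bar>ln q\<bar> + (pi + 1)))"
      proof -
        have "q powr M = q powr M' * q powr \<epsilon>" unfolding powr_add[symmetric] by (simp add: \<epsilon>_def)
        then show ?thesis by (simp only: mult_ac)
      qed
      also have "\<dots> \<le> Ck * peak \<Phi> \<alpha> a * q powr M' * (1 / \<epsilon> + 2 powr \<epsilon> * (pi + 2))"
        using Ck(1) peak_pos[OF G a, of \<alpha>] by (intro mult_left_mono powr_abs_ln_le[OF \<epsilon> q]) auto
      also have "\<dots> = K * peak \<Phi> \<alpha> a * q powr M'" by (simp only: K_def mult_ac)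
      finally have top: "(Ck * peak \<Phi> \<alpha> a * q powr M) * (\<bar>ln q\<bar> + (pi + 1)) \<le> K * peak \<Phi> \<alpha> a * q powr M'" .
      have "(Ck * peak \<Phi> \<alpha> a * q powr M) * 1 \<le> (Ck * peak \<Phi> \<alpha> a * q powr M) * (\<bar>ln q\<bar> + (pi + 1))"
        using pos pi_gt_zero by (intro mult_left_mono) auto
      moreover have "(Ck * peak \<Phi> \<alpha> a * q powr M) * (\<bar>ln q\<bar> + pi) \<le> (Ck * peak \<Phi> \<alpha> a * q powr M) * (\<bar>ln q\<bar> + (pi + 1))"
        using pos by (intro mult_left_mono) auto
      ultimately show ?thesis using n1 n2 top unfolding q_def by linarith
    qed
    have I1: "(\<integral>\<^sup>+w. ennreal (\<Phi> (norm (f1 w) / l)) \<partial>?\<nu>) \<le> 1"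
      by (rule l(2)[OF a measurable_holomorphic_vec[OF f1(1)]]) (use bound in \<open>simp add: D_def\<close>)
    have I2: "(\<integral>\<^sup>+w. ennreal (\<Phi> (norm (f2 w) / l)) \<partial>?\<nu>) \<le> 1"
      by (rule l(2)[OF a measurable_holomorphic_vec[OF f2(1)]]) (use bound in \<open>simp add: D_def\<close>)
    have lkh: "log_kern ?N holomorphic_on ball 0 1" by (rule power_series_continuous_on(2)[OF log_kern_sums])
    define F where "F = (\<lambda>w. log_kern ?N (cinner_vec w a))"
    have F: "holomorphic_vec F (ball 0 1)" "bounded (F ` ball 0 1)"
      unfolding F_def by (rule holomorphic_vec_kernel[OF lkh a], rule bounded_kernel_image[OF lkh a])
    have FB: "(1 - (norm w)\<^sup>2) * norm (F w) \<le> B" if w: "norm w < 1" for w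
    proof -
      have x: "norm (cinner_vec w a) < 1" by (rule norm_cinner_vec_less[OF w a])
      have "(1 - (norm w)\<^sup>2) * norm (F w) \<le> (2 * norm (1 - cinner_vec w a)) * norm (F w)"
        using one_minus_norm_le(1)[OF w a] by (intro mult_right_mono) auto
      also have "\<dots> \<le> B" using log_kern_bound[OF N x] by (simp add: B_def F_def mult.assoc)
      finally show ?thesis .
    qed
    have GF: "kern_int (\<alpha> + 1) (bkern ?N) F w = - Ln (1 - cinner_vec w a)" if w: "norm w < 1" for w
      unfolding F_def
    proof (rule kern_int_shifted[OF \<alpha> a w log_kern_sums])
      fix x :: complex assume x: "norm x < 1"
      have "(if m = 0 then 0 else of_real (1 / real m + 1 / ?N)) * of_real (?N / (?N + m)) = (if m = 0 then 0 else complex_of_real (1 / real m))" for m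
      proof (cases "m = 0")
        case False
        have "(1 / real m + 1 / s) * (s / (s + real m)) = 1 / real m" if "s > 0" for s
        proof -
          have "1 / real m + 1 / s = (s + real m) / (real m * s)" using False that by (simp add: field_simps)
          moreover have "s + real m > 0" using that by simp
          ultimately show ?thesis using that by simp
        qed
        from this[OF N] have "(1 / real m + 1 / ?N) * (?N / (?N + m)) = 1 / m" .
        then have "complex_of_real (1 / real m + 1 / ?N) * of_real (?N / (?N + m)) = of_real (1 / m)" by (simp only: of_real_mult[symmetric])
        then show ?thesis using False by simp
      qed simp
      then show "(\<lambda>m. (if m = 0 then 0 else of_real (1 / real m + 1 / ?N)) * of_real (?N / (?N + m)) * x ^ m) sums - Ln (1 - x)"
        using minus_Ln_sums[OF x] by (simp only:)
    qed
    \<comment> \<open>The constant function is reproduced, so \<open>pair\<close> applied to f2 and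
      the constant bounds T2 by itself.\<close>
    have G1: "kern_int (\<alpha> + 1) (bkern ?N) (\<lambda>w. 1) w = 1" if w: "norm w < 1" for w :: "complex^'n"
    proof (rule kern_int_shifted[OF \<alpha> a w, where F="\<lambda>_. 1" and H="\<lambda>_. 1" and \<gamma>="\<lambda>m. if m = 0 then 1 else 0"])
      fix x :: complex
      have one: "(\<lambda>m. if m = 0 then 1 else 0) sums (1::complex)"
        using sums_single[of 0 "\<lambda>_. 1::complex"] by (simp add: eq_commute cong: if_cong)
      have "(\<lambda>m. (if m = 0 then 1 else 0) * x ^ m) = (\<lambda>m. if m = 0 then 1 else 0)" by auto
      with one show "(\<lambda>m. (if m = 0 then 1 else 0) * x ^ m) sums 1" by simp
      have "(if m = 0 then 1 else 0) * of_real (?N / (?N + m)) * x ^ m = (if m = 0 then 1 else 0)" for m :: nat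
      proof (cases "m = 0")
        case True
        have "?N / (?N + m) = 1" using True N by simp
        then have "complex_of_real (?N / (?N + m)) = 1" by (simp only: of_real_1)
        then show ?thesis unfolding \<open>complex_of_real (?N / (?N + m)) = 1\<close> using True by simp
      qed simp
      with one show "(\<lambda>m. (if m = 0 then 1 else 0) * of_real (?N / (?N + m)) * x ^ m) sums 1" by (simp only:)
    qed
    define T1 where "T1 = (\<integral>w. b w * cnj (f1 w) \<partial>?\<nu>)"
    define T2 where "T2 = (\<integral>w. b w * cnj (f2 w) \<partial>?\<nu>)"
    have i1: "integrable ?\<nu> (\<lambda>w. b w * cnj (f1 w))" and i2: "integrable ?\<nu> (\<lambda>w. b w * cnj (f2 w))"
      by (rule integrable_mult_cnj_bounded[OF b'(2) f1], rule integrable_mult_cnj_bounded[OF b'(2) f2])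
    have T1: "T1 = of_real \<sigma> * (radial_deriv ^^ k) b a"
    proof -
      have "T1 = (\<integral>w. of_real \<sigma> * (b w * rkern ?N k (cinner_vec a w)) \<partial>?\<nu>)"
        unfolding T1_def
      proof (rule Bochner_Integration.integral_cong[OF refl])
        fix w assume "w \<in> space ?\<nu>"
        then have "norm (cinner_vec w a) < 1" using a by (intro norm_cinner_vec_less) auto
        from rkern_cnj[OF this N, of k]
        show "b w * cnj (f1 w) = of_real \<sigma> * (b w * rkern ?N k (cinner_vec a w))"
          by (simp add: f1_def \<kappa>1_def cinner_vec_commute[of a w])
      qed
      also have "\<dots> = of_real \<sigma> * (radial_deriv ^^ k) b a"
        unfolding iterated_radial_deriv[OF \<alpha> b' a] kern_int_def by (rule integral_mult_right_zero)
      finally show ?thesis .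
    qed
    \<comment> \<open>Here f1 * (- Ln (1 - <w,a>)) = f2 + L * f1, so the pairing equals T2 + L * T1;
      with T2 bounded separately, L * T1 is bounded, and T1 is a multiple of R^k b at a.\<close>
    have "(\<integral>w. b w * cnj (f1 w) * cnj (kern_int (\<alpha> + 1) (bkern ?N) F w) \<partial>?\<nu>) = (\<integral>w. b w * cnj (f2 w) + of_real L * (b w * cnj (f1 w)) \<partial>?\<nu>)"
    proof (rule Bochner_Integration.integral_cong[OF refl])
      fix w assume "w \<in> space ?\<nu>"
      then have w: "norm w < 1" by simp
      have "f1 w * (- Ln (1 - cinner_vec w a)) = f2 w + of_real L * f1 w"
        by (simp add: f1_def f2_def \<kappa>2_def algebra_simps)
      then have "cnj (f1 w * (- Ln (1 - cinner_vec w a))) = cnj (f2 w) + of_real L * cnj (f1 w)" by simp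
      then have "b w * (cnj (f1 w) * cnj (- Ln (1 - cinner_vec w a))) = b w * (cnj (f2 w) + of_real L * cnj (f1 w))"
        by (simp only: complex_cnj_mult)
      then show "b w * cnj (f1 w) * cnj (kern_int (\<alpha> + 1) (bkern ?N) F w) = b w * cnj (f2 w) + of_real L * (b w * cnj (f1 w))"
        unfolding GF[OF w] by (simp only: mult.assoc distrib_left mult.left_commute)
    qed
    also have "\<dots> = T2 + of_real L * T1"
      unfolding T1_def T2_def using i1 i2 by simp
    finally have eq: "(\<integral>w. b w * cnj (f1 w) * cnj (kern_int (\<alpha> + 1) (bkern ?N) F w) \<partial>?\<nu>) = T2 + of_real L * T1" .
    have 1: "norm (T2 + of_real L * T1) \<le> c * B * (\<bar>C0\<bar> * l)"
      unfolding eq[symmetric] by (rule pair[OF f1 F FB _ I1]) (use B in auto)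
    have "(\<integral>w. b w * cnj (f2 w) * cnj (kern_int (\<alpha> + 1) (bkern ?N) (\<lambda>w. 1) w) \<partial>?\<nu>) = T2"
      unfolding T2_def by (rule Bochner_Integration.integral_cong) (simp_all add: G1)
    moreover have "norm (\<integral>w. b w * cnj (f2 w) * cnj (kern_int (\<alpha> + 1) (bkern ?N) (\<lambda>w. 1) w) \<partial>?\<nu>) \<le> c * 1 * (\<bar>C0\<bar> * l)"
    proof (rule pair[OF f2 holomorphic_vec_const _ _ _ I2])
      show "bounded ((\<lambda>w::complex^'n. 1::complex) ` ball 0 1)" by (rule bounded_subset[of "{1}"]) auto
    qed auto
    ultimately have 2: "norm T2 \<le> c * (\<bar>C0\<bar> * l)" by simp
    have "norm (of_real L * T1) \<le> norm (T2 + of_real L * T1) + norm T2"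
      using norm_triangle_ineq4[of "T2 + of_real L * T1" T2] by simp
    also have "\<dots> \<le> A" using 1 2 by (simp add: A_def)
    finally have "L * (\<sigma> * norm ((radial_deriv ^^ k) b a)) \<le> A"
      unfolding T1 using L(1) \<sigma> by (simp add: norm_mult)
    then show ?thesis by (simp add: \<sigma>_def L_def D_def mult_ac)
  qed
  \<comment> \<open>Away from 0 the logarithm is positive, so \<open>main\<close> can be divided by
    it; at 0 it is 0 and the division is impossible.\<close>
  have "norm ((radial_deriv ^^ k) b z) \<le> A * inverse ((1 - (norm z)\<^sup>2) ^ k) * growth_rho \<Phi> ((1 - (norm z)\<^sup>2) powr ?N) * inverse (ln (1 / (1 - (norm z)\<^sup>2)))"
    if z: "z \<in> ball 0 1 - {0}" for z
  proof -
    have z1: "norm z < 1" and z0: "norm z > 0" using z by auto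
    define D where "D = 1 - (norm z)\<^sup>2"
    have D: "0 < D" "D < 1" using one_minus_norm_square_pos[OF z1] z0 by (auto simp: D_def)
    have L: "ln (1 / D) > 0" using D by (simp add: ln_div)
    define Y where "Y = peak \<Phi> \<alpha> z * D powr M * ln (1 / D)"
    have Y: "Y > 0" using peak_pos[OF G z1] D L by (simp add: Y_def)
    have "norm ((radial_deriv ^^ k) b z) * Y \<le> A" using main[OF z1] by (simp only: Y_def D_def)
    then have "norm ((radial_deriv ^^ k) b z) \<le> A / Y" using Y by (simp add: field_simps)
    also have "A / Y = A * inverse (D ^ k) * (D powr (- ?N) / peak \<Phi> \<alpha> z) * inverse (ln (1 / D))"
    proof -
      have "D powr M = D powr ?N * D ^ k" unfolding M_def powr_add using D by (simp add: powr_realpow)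
      then show ?thesis unfolding Y_def powr_minus divide_inverse by (simp add: mult_ac)
    qed
    finally show ?thesis unfolding growth_rho_peak[OF z1] D_def .
  qed
  then show ?thesis unfolding LGamma_def using b'(1) k A by blast
qed

theorem theorem4p8:
  fixes \<alpha> p :: real and \<Phi> :: "real \<Rightarrow> real" and b :: "complex ^ 'n \<Rightarrow> complex"
  assumes "\<alpha> > -1" and "0 < p" and "p \<le> 1" and "\<Phi> \<in> growth_class p"
    and "b \<in> bergman_space \<alpha> 2"
  shows "hankel_extends_bounded \<alpha> \<Phi> b \<longleftrightarrow> b \<in> LGamma \<alpha> (1 / p - 1) (growth_rho \<Phi>)"
  using bounded_imp_LGamma[OF assms] LGamma_imp_bounded[OF assms] by blast

end
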